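(* Suppose that $(\Sigma_1,\mu_1),\ldots,(\Sigma_m,\mu_m)$ are measure spaces, and $\mathscr{S}_j$ is the collection of all simple functions on $\Sigma_j$, $j=1,\ldots,m$. Denote by $\mathfrak{M}(\mathbb{R}^n)$ the set of all measurable functions on $\mathbb{R}^n$. Let $T:\mathscr{S}=\mathscr{S}_1\times\cdots\times\mathscr{S}_m\to\mathfrak{M}(\mathbb{R}^n)$ be an $m$-linear operator. Let $0<p_0,q_0<\infty$, $1\le p_j,q_j\le\infty$, $j=1,\ldots,m$, let $w_0^{p_0},v_0^{q_0}\in A_\infty(\mathbb{R}^n)$ and let $w_j,v_j$ be weights on $\Sigma_j$, $j=1,\ldots,m$. Assume that $T$ is bounded from $L^{p_1}(\Sigma_1,w_1^{p_1})\times\cdots\times L^{p_m}(\Sigma_m,w_m^{p_m})$ to $L^{p_0}(\mathbb{R}^n,w_0^{p_0})$, and that $T$ is compact from $L^{q_1}(\Sigma_1,v_1^{q_1})\times\cdots\times L^{q_m}(\Sigma_m,v_m^{q_m})$ to $L^{q_0}(\mathbb{R}^n,v_0^{q_0})$. Then $T$ can be extended as a compact operator from $L^{r_1}(\Sigma_1,u_1^{r_1})\times\cdots\times L^{r_m}(\Sigma_m,u_m^{r_m})$ to $L^{r_0}(\mathbb{R}^n,u_0^{r_0})$ for all exponents and weights satisfying $$0<\theta<1,\quad \frac1{r_j}=\frac{1-\theta}{p_j}+\frac{\theta}{q_j}\quad\text{and}\quad u_j=w_j^{1-\theta}v_j^\theta,\quad j=0,\ldots,m.$$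
   Context: A weight on a measure space $(\Sigma,\mu)$ is a measurable function $w$ with $0<w<\infty$ $\mu$-a.e. A simple function is a finite linear combination of indicator functions of measurable sets of finite measure. $\|f\|_{L^p(\Sigma,w^p)}=\|fw\|_{L^p(\Sigma,\mu)}$ (also used as the definition when $p=\infty$). Muckenhoupt classes on $\mathbb{R}^n$: for $1<p<\infty$, $w\in A_p$ iff $\sup_Q\big(\frac1{|Q|}\int_Qw\big)\big(\frac1{|Q|}\int_Qw^{1-p'}\big)^{p-1}<\infty$; $w\in A_1$ iff $\sup_Q\big(\frac1{|Q|}\int_Qw\big)\operatorname{ess\,sup}_Qw^{-1}<\infty$ (suprema over cubes); $A_\infty=\bigcup_{p\ge1}A_p$. Compactness: an $m$-linear operator $T:X_1\times\cdots\times X_m\to Y$ ($X_i$ normed, $Y$ quasi-normed) is compact if $\{T(x_1,\ldots,x_m):\|x_i\|\le1\}$ is relatively compact in $Y$. Since $T$ is given on simple functions, boundedness and compactness in the hypotheses refer to $T$ acting on tuples of simple functions with finite norms in the indicated domain spaces, and the extension in the conclusion is of $T$ restricted to tuples of simple functions with $\|f_jw_j\|_{L^{p_j}}<\infty$ and $\|f_jv_j\|_{L^{q_j}}<\infty$, $j=1,\ldots,m$. *)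

theory Defs
  imports "HOL-Analysis.Analysis" "HOL-Probability.Essential_Supremum"
begin

section \<open>Weighted Lebesgue spaces\<close>

text \<open>Weights are real-valued functions, so finiteness is built in.\<close>

definition weight :: "'a measure \<Rightarrow> ('a \<Rightarrow> real) \<Rightarrow> bool" where
  "weight M w \<longleftrightarrow> w \<in> borel_measurable M \<and> (AE x in M. 0 < w x)"

text \<open>Power of an extended nonnegative number; only used with exponents \<open>a > 0\<close>.\<close>

definition ennpowr :: "ennreal \<Rightarrow> real \<Rightarrow> ennreal" where
  "ennpowr x a = (if x = \<infinity> then \<infinity> else ennreal (enn2real x powr a))"

definition Lnorm :: "'a measure \<Rightarrow> ennreal \<Rightarrow> ('a \<Rightarrow> complex) \<Rightarrow> ennreal" where
  "Lnorm M p f =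
     (if p = \<infinity> then esssup M (\<lambda>x. ennreal (norm (f x)))
      else ennpowr (\<integral>\<^sup>+x. ennreal (norm (f x) powr enn2real p) \<partial>M) (1 / enn2real p))"

text \<open>\<open>wLnorm M p w\<close> is the norm of $L^p(\Sigma, w^p)$, that is, $\|fw\|_{L^p(\Sigma,\mu)}$.\<close>

definition wLnorm :: "'a measure \<Rightarrow> ennreal \<Rightarrow> ('a \<Rightarrow> real) \<Rightarrow> ('a \<Rightarrow> complex) \<Rightarrow> ennreal" where
  "wLnorm M p w f = Lnorm M p (\<lambda>x. f x * of_real (w x))"

text \<open>Elements of $L^p(\Sigma,w^p)$ are represented by functions; functions that agree almost
  everywhere have distance 0 and represent the same element.\<close>

definition wLspace :: "'a measure \<Rightarrow> ennreal \<Rightarrow> ('a \<Rightarrow> real) \<Rightarrow> ('a \<Rightarrow> complex) set" where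
  "wLspace M p w = {f \<in> borel_measurable M. wLnorm M p w f < \<infinity>}"

definition wLopen :: "'a measure \<Rightarrow> ennreal \<Rightarrow> ('a \<Rightarrow> real) \<Rightarrow> ('a \<Rightarrow> complex) set \<Rightarrow> bool" where
  "wLopen M p w U \<longleftrightarrow> U \<subseteq> wLspace M p w \<and>
     (\<forall>f\<in>U. \<exists>\<epsilon>>0. \<forall>g\<in>wLspace M p w. wLnorm M p w (\<lambda>x. g x - f x) < ennreal \<epsilon> \<longrightarrow> g \<in> U)"

lemma istopology_wLopen: "istopology (wLopen M p w)"
  unfolding istopology_def
proof (intro conjI allI impI)
  fix S T assume S: "wLopen M p w S" and T: "wLopen M p w T"
  show "wLopen M p w (S \<inter> T)"
    unfolding wLopen_def
  proof (intro conjI ballI)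
    show "S \<inter> T \<subseteq> wLspace M p w" using S by (auto simp: wLopen_def)
    fix f assume f: "f \<in> S \<inter> T"
    obtain d where d: "d > 0"
      "\<forall>g\<in>wLspace M p w. wLnorm M p w (\<lambda>x. g x - f x) < ennreal d \<longrightarrow> g \<in> S"
      using S f by (auto simp: wLopen_def)
    obtain e where e: "e > 0"
      "\<forall>g\<in>wLspace M p w. wLnorm M p w (\<lambda>x. g x - f x) < ennreal e \<longrightarrow> g \<in> T"
      using T f by (auto simp: wLopen_def)
    define c where "c = min d e"
    have c: "ennreal c \<le> ennreal d" "ennreal c \<le> ennreal e"
      by (auto simp: c_def intro: ennreal_leI)
    have "g \<in> S \<inter> T" if "g \<in> wLspace M p w" "wLnorm M p w (\<lambda>x. g x - f x) < ennreal c" for g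
      using d(2) e(2) that less_le_trans[OF that(2) c(1)] less_le_trans[OF that(2) c(2)] by blast
    moreover have "c > 0" using d(1) e(1) by (simp add: c_def)
    ultimately show "\<exists>\<epsilon>>0. \<forall>g\<in>wLspace M p w.
        wLnorm M p w (\<lambda>x. g x - f x) < ennreal \<epsilon> \<longrightarrow> g \<in> S \<inter> T"
      by blast
  qed
next
  fix \<K> assume "\<forall>K\<in>\<K>. wLopen M p w K"
  then show "wLopen M p w (\<Union>\<K>)"
    unfolding wLopen_def by (simp add: Sup_le_iff) (meson UnionI)
qed

definition wLtopology :: "'a measure \<Rightarrow> ennreal \<Rightarrow> ('a \<Rightarrow> real) \<Rightarrow> ('a \<Rightarrow> complex) topology" where
  "wLtopology M p w = topology (wLopen M p w)"

lemma openin_wLtopology: "openin (wLtopology M p w) = wLopen M p w"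
  by (simp add: wLtopology_def istopology_wLopen)

lemma topspace_wLtopology: "topspace (wLtopology M p w) = wLspace M p w"
proof -
  have "wLopen M p w (wLspace M p w)"
    by (auto simp: wLopen_def intro: exI[of _ 1])
  moreover have "U \<subseteq> wLspace M p w" if "wLopen M p w U" for U
    using that by (simp add: wLopen_def)
  ultimately show ?thesis
    unfolding topspace_def openin_wLtopology by blast
qed

definition relatively_compact_in :: "'a topology \<Rightarrow> 'a set \<Rightarrow> bool" where
  "relatively_compact_in X S \<longleftrightarrow> S \<subseteq> topspace X \<and> compactin X (X closure_of S)"


section \<open>Muckenhoupt classes\<close>

definition cubes :: "(real ^ 'n) set set" where
  "cubes = {cbox a (a + (\<chi> i. l)) | a l. 0 < l}"

definition avg :: "(real ^ 'n) set \<Rightarrow> (real ^ 'n \<Rightarrow> real) \<Rightarrow> ennreal" where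
  "avg Q w = (\<integral>\<^sup>+x\<in>Q. ennreal (w x) \<partial>lebesgue) / emeasure lebesgue Q"

text \<open>In the case \<open>p > 1\<close> the exponent \<open>1 - p / (p - 1)\<close> is $1-p'$.\<close>

definition Muckenhoupt :: "real \<Rightarrow> (real ^ 'n \<Rightarrow> real) set" where
  "Muckenhoupt p = {w. weight lebesgue w \<and>
     (if p = 1
      then (SUP Q\<in>cubes. avg Q w * esssup (restrict_space lebesgue Q) (\<lambda>x. ennreal (inverse (w x)))) < \<infinity>
      else (SUP Q\<in>cubes. avg Q w * ennpowr (avg Q (\<lambda>x. w x powr (1 - p / (p - 1)))) (p - 1)) < \<infinity>)}"

definition Muckenhoupt_infinity :: "(real ^ 'n \<Rightarrow> real) set" where
  "Muckenhoupt_infinity = (\<Union>p\<in>{1..}. Muckenhoupt p)"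


section \<open>Multilinear operators\<close>

text \<open>The variables of an \<open>m\<close>-linear operator are indexed by a finite type \<open>'m\<close> with \<open>m\<close> elements, so
  a tuple is a function on \<open>'m\<close>. The measure spaces \<open>M j\<close> have carriers in a common type but are
  otherwise unrelated.\<close>

definition simple_functions :: "'a measure \<Rightarrow> ('a \<Rightarrow> complex) set" where
  "simple_functions M = {f. \<exists>(k::nat) c A. (\<forall>i<k. A i \<in> fmeasurable M) \<and>
     f = (\<lambda>x. \<Sum>i<k. c i * indicator (A i) x)}"

text \<open>Values of the operator are identified when they agree almost everywhere, so linearity in each
  variable is required only almost everywhere.\<close>

definition multilinear_op ::
  "('m \<Rightarrow> ('a \<Rightarrow> complex) set) \<Rightarrow> 'b measure \<Rightarrow> ('b \<Rightarrow> complex) set \<Rightarrow>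
   (('m \<Rightarrow> 'a \<Rightarrow> complex) \<Rightarrow> 'b \<Rightarrow> complex) \<Rightarrow> bool" where
  "multilinear_op X N Y T \<longleftrightarrow>
     (\<forall>f. (\<forall>j. f j \<in> X j) \<longrightarrow> T f \<in> Y) \<and>
     (\<forall>f j g h a b. (\<forall>i. f i \<in> X i) \<and> g \<in> X j \<and> h \<in> X j \<longrightarrow>
        (AE x in N. T (f(j := (\<lambda>y. a * g y + b * h y))) x
                    = a * T (f(j := g)) x + b * T (f(j := h)) x))"

definition respects_AE ::
  "('m \<Rightarrow> 'a measure) \<Rightarrow> ('m \<Rightarrow> ('a \<Rightarrow> complex) set) \<Rightarrow> 'b measure \<Rightarrow>
   (('m \<Rightarrow> 'a \<Rightarrow> complex) \<Rightarrow> 'b \<Rightarrow> complex) \<Rightarrow> bool" where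
  "respects_AE M X N T \<longleftrightarrow>
     (\<forall>f g. (\<forall>j. f j \<in> X j \<and> g j \<in> X j \<and> (AE x in M j. f j x = g j x)) \<longrightarrow>
        (AE x in N. T f x = T g x))"

text \<open>Boundedness and compactness refer to the action of \<open>T\<close> on those tuples from the domain \<open>X\<close>
  that have finite norms in the spaces $L^{p_j}(\Sigma_j,w_j^{p_j})$. The domain \<open>X\<close> may be a
  proper subset of these spaces, for instance the simple functions.\<close>

definition bounded_op ::
  "('m::finite \<Rightarrow> ('a \<Rightarrow> complex) set) \<Rightarrow>
   ('m \<Rightarrow> 'a measure) \<Rightarrow> ('m \<Rightarrow> ennreal) \<Rightarrow> ('m \<Rightarrow> 'a \<Rightarrow> real) \<Rightarrow>
   'b measure \<Rightarrow> ennreal \<Rightarrow> ('b \<Rightarrow> real) \<Rightarrow>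
   (('m \<Rightarrow> 'a \<Rightarrow> complex) \<Rightarrow> 'b \<Rightarrow> complex) \<Rightarrow> bool" where
  "bounded_op X M p w N p0 w0 T \<longleftrightarrow>
     (\<exists>C::real. \<forall>f. (\<forall>j. f j \<in> X j \<and> wLnorm (M j) (p j) (w j) (f j) < \<infinity>) \<longrightarrow>
        T f \<in> wLspace N p0 w0 \<and>
        wLnorm N p0 w0 (T f) \<le> ennreal C * (\<Prod>j\<in>UNIV. wLnorm (M j) (p j) (w j) (f j)))"

definition compact_op ::
  "('m \<Rightarrow> ('a \<Rightarrow> complex) set) \<Rightarrow>
   ('m \<Rightarrow> 'a measure) \<Rightarrow> ('m \<Rightarrow> ennreal) \<Rightarrow> ('m \<Rightarrow> 'a \<Rightarrow> real) \<Rightarrow>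
   'b measure \<Rightarrow> ennreal \<Rightarrow> ('b \<Rightarrow> real) \<Rightarrow>
   (('m \<Rightarrow> 'a \<Rightarrow> complex) \<Rightarrow> 'b \<Rightarrow> complex) \<Rightarrow> bool" where
  "compact_op X M p w N p0 w0 T \<longleftrightarrow>
     relatively_compact_in (wLtopology N p0 w0)
       {T f | f. \<forall>j. f j \<in> X j \<and> wLnorm (M j) (p j) (w j) (f j) \<le> 1}"

end

theory Submission
  imports Defs "HOL-Complex_Analysis.Complex_Analysis" "HOL-Probability.Probability_Measure"
begin

text \<open>
  The proof has three parts: interpolation of bounds, interpolation of compactness, and the
  extension from simple functions to the whole domain space. Throughout, the size of a function in
  the target space is measured by the \<open>s\<close>-th power of its norm (\<open>Lpow\<close>), which is an integral for
  every \<open>s > 0\<close> and satisfies a relaxed triangle inequality.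

  To interpolate bounds, simple functions \<open>f\<^sub>j\<close> are put into analytic families
  \<open>F\<^sub>j(z) = f\<^sub>j exp (b\<^sub>j (z - \<theta>))\<close> whose norms at both edges \<open>Re z = 0\<close> and \<open>Re z = 1\<close> of the strip are
  controlled by the norm of \<open>f\<^sub>j\<close> at \<open>\<theta>\<close>. If \<open>b\<^sub>j\<close> has finitely many values, then multilinearity turns
  \<open>T(F(z))(x)\<close> into a finite sum of exponentials in \<open>z\<close>, for a.e. \<open>x\<close>. For holomorphic \<open>g\<close>, the
  function \<open>ln \<bar>g\<bar>\<close> satisfies the sub-mean-value inequality on the disc (\<open>log_subharmonic_mean\<close>), and a
  conformal map carries it to the strip. Jensen's inequality on the two arcs of the circle that
  correspond to the two edges then gives a pointwise estimate of \<open>\<bar>T f(x)\<bar>\<^sup>r\<close> by integral means of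
  \<open>\<bar>T(F(z))(x)\<bar>\<^sup>p\<close> and \<open>\<bar>T(F(z))(x)\<bar>\<^sup>q\<close>, which can be integrated in \<open>x\<close>
  (\<open>strip_function_bound\<close>, \<open>strip_interpolation\<close>). Working with powers and logarithms of moduli, and
  not with pairings, is what makes this possible for target exponents below 1. Since \<open>b\<^sub>j\<close> is made
  from the logarithms of the weights, rounded to integers, the argument applies to functions that
  live where the weights are bounded above and below; a limit in one coordinate at a time removes
  this restriction (\<open>admissible_interpolation\<close>).

  To interpolate compactness, note that a totally bounded set in the target space at the \<open>q\<close>-endpoint is uniformly close to
  step functions on finitely many cells \<open>Q\<^sub>i\<close>, and the cells can be chosen such that both weights
  vary by at most a factor 2 on each of them (\<open>cells_exist\<close>). Closeness to step functions is measured
  by two operators that are again multilinear: \<open>T f\<close> restricted to the complement of the cells, and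
  \<open>(x, y) \<mapsto> T f(x) - T f(y)\<close> on pairs of points in a common cell. Both are bounded at the
  \<open>p\<close>-endpoint and have small norm at the \<open>q\<close>-endpoint, so by the first part they have small norm in
  between. Conversely, if both quantities are small then \<open>T f\<close> is close to a step function on the
  cells (\<open>step_approx\<close>), and bounded sets of such step functions are totally bounded. Hence \<open>T\<close> maps
  balls to totally bounded sets at the intermediate exponents (\<open>compact_interpolation\<close>).

  As for the extension, if \<open>r\<^sub>j = \<infinity>\<close> then simple functions of finite measure support are not dense, so \<open>T\<close>
  cannot be extended by continuity alone. Compactness replaces density: for \<open>f\<close> in the domain space,
  \<open>T' f\<close> is the limit, along one fixed ultrafilter, of \<open>T\<close> applied to approximations of \<open>f\<^sub>j 1\<^bsub>A\<^sub>j\<^esub>\<close>,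
  where the \<open>A\<^sub>j\<close> increase through sets of finite measure on which the weights are bounded above and
  below. The limit exists because the values stay in a totally bounded set of a complete space; it is
  multilinear because limits are linear; and it agrees with \<open>T\<close> on the simple functions in question,
  since for those \<open>f\<^sub>j 1\<^bsub>A\<^sub>j\<^esub>\<close> does converge to \<open>f\<^sub>j\<close> in norm (\<open>compact_extension\<close>).
\<close>

section \<open>Ultrafilters and total boundedness\<close>

text \<open>Zorn's lemma, applied to families of sets with the finite intersection property: a maximal such
  family generates an ultrafilter.\<close>

lemma ultrafilter_extension:
  fixes F :: "'i filter"
  assumes "F \<noteq> bot"
  obtains U where "U \<le> F" "U \<noteq> bot" "\<And>P. eventually P U \<or> eventually (\<lambda>i. \<not> P i) U"
proof -
  define fip where "fip S \<longleftrightarrow> (\<forall>Y. finite Y \<and> Y \<subseteq> S \<longrightarrow> \<Inter>Y \<noteq> {})" for S :: "'i set set"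
  define S0 where "S0 = {X. eventually (\<lambda>i. i \<in> X) F}"
  define \<A> where "\<A> = {S. S0 \<subseteq> S \<and> fip S}"
  have "fip S0"
    unfolding fip_def
  proof (intro allI impI)
    fix Y assume "finite Y \<and> Y \<subseteq> S0"
    then have "eventually (\<lambda>i. \<forall>X\<in>Y. i \<in> X) F"
      by (intro eventually_ball_finite) (auto simp: S0_def)
    then show "\<Inter>Y \<noteq> {}"
      using eventually_happens'[OF assms, of "\<lambda>i. \<forall>X\<in>Y. i \<in> X"] by auto
  qed
  then have "\<A> \<noteq> {}" by (auto simp: \<A>_def)
  moreover have "\<Union>C \<in> \<A>" if C: "C \<noteq> {}" "subset.chain \<A> C" for C
  proof -
    have "fip (\<Union>C)"
      unfolding fip_def
    proof (intro allI impI)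
      fix Y assume Y: "finite Y \<and> Y \<subseteq> \<Union>C"
      then obtain S where "S \<in> C" "Y \<subseteq> S"
        using finite_subset_Union_chain[of Y C \<A>] C by blast
      then show "\<Inter>Y \<noteq> {}"
        using C Y by (auto simp: subset.chain_def \<A>_def fip_def)
    qed
    then show ?thesis using C by (fastforce simp: subset.chain_def \<A>_def)
  qed
  ultimately obtain S where S: "S \<in> \<A>" and max: "\<And>X. X \<in> \<A> \<Longrightarrow> S \<subseteq> X \<Longrightarrow> X = S"
    using subset_Zorn_nonempty[of \<A>] by metis
  define U where "U = (INF X\<in>S. principal X)"
  have mem: "eventually (\<lambda>i. i \<in> X) U" if "X \<in> S" for X
  proof -
    have "U \<le> principal X" unfolding U_def using that by (rule INF_lower)
    then show ?thesis by (simp add: le_principal)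
  qed
  show thesis
  proof (rule that[of U])
    show "U \<le> F"
    proof (rule filter_leI)
      fix P assume "eventually P F"
      then have "{i. P i} \<in> S" using S by (auto simp: \<A>_def S0_def)
      from mem[OF this] show "eventually P U" by simp
    qed
    have "(INF X\<in>Y. principal X) \<noteq> bot" if "finite Y" "Y \<subseteq> S" for Y
    proof -
      have "(INF X\<in>Y. principal X) = principal (\<Inter>X\<in>Y. X)"
        using that(1) by (rule INF_principal_finite)
      moreover have "(\<Inter>X\<in>Y. X) \<noteq> {}" using S that by (auto simp: \<A>_def fip_def)
      ultimately show ?thesis by (metis principal_eq_bot_iff)
    qed
    then show "U \<noteq> bot" unfolding U_def by (rule INF_filter_not_bot) auto
    show "eventually P U \<or> eventually (\<lambda>i. \<not> P i) U" for P
    proof (rule ccontr)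
      assume n: "\<not> (eventually P U \<or> eventually (\<lambda>i. \<not> P i) U)"
      \<comment> \<open>By maximality, adding a set outside \<open>S\<close> destroys the finite intersection property.\<close>
      have ins: "\<exists>Y. finite Y \<and> Y \<subseteq> S \<and> \<Inter>Y \<inter> X = {}" if "X \<notin> S" for X
      proof -
        have "insert X S \<notin> \<A>" using max[of "insert X S"] that by blast
        then have "\<not> fip (insert X S)" using S by (auto simp: \<A>_def)
        then obtain Y where "finite Y" "Y \<subseteq> insert X S" "\<Inter>Y = {}" by (auto simp: fip_def)
        then show ?thesis by (intro exI[of _ "Y - {X}"]) auto
      qed
      have "{i. P i} \<notin> S" "{i. \<not> P i} \<notin> S" using n mem[of "{i. P i}"] mem[of "{i. \<not> P i}"] by auto
      from this[THEN ins] obtain Y Y' where Y: "finite Y" "Y \<subseteq> S" "\<Inter>Y \<inter> {i. P i} = {}"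
        and Y': "finite Y'" "Y' \<subseteq> S" "\<Inter>Y' \<inter> {i. \<not> P i} = {}" by blast
      then have "\<Inter>(Y \<union> Y') = {}" by blast
      then show False using S Y Y' by (auto simp: \<A>_def fip_def)
    qed
  qed
qed

text \<open>The \<open>s\<close>-th power of the \<open>L\<^sup>s\<close> distance satisfies the triangle inequality up to a constant factor and
  vanishes for functions that agree almost everywhere; these axioms allow for both.\<close>

locale quasi_metric =
  fixes X :: "'a set" and d :: "'a \<Rightarrow> 'a \<Rightarrow> real" and K :: real
  assumes d_nonneg: "x \<in> X \<Longrightarrow> y \<in> X \<Longrightarrow> 0 \<le> d x y"
    and d_refl: "x \<in> X \<Longrightarrow> d x x = 0"
    and d_sym: "x \<in> X \<Longrightarrow> y \<in> X \<Longrightarrow> d x y = d y x"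
    and d_tri: "x \<in> X \<Longrightarrow> y \<in> X \<Longrightarrow> z \<in> X \<Longrightarrow> d x z \<le> K * (d x y + d y z)"
    and K: "1 \<le> K"
begin

definition totbdd :: "'a set \<Rightarrow> bool" where
  "totbdd S \<longleftrightarrow> S \<subseteq> X \<and> (\<forall>\<epsilon>>0. \<exists>F. finite F \<and> F \<subseteq> X \<and> (\<forall>x\<in>S. \<exists>y\<in>F. d x y < \<epsilon>))"

definition complete :: bool where
  "complete \<longleftrightarrow> (\<forall>\<xi>. range \<xi> \<subseteq> X \<and> (\<forall>\<epsilon>>0. \<exists>n0::nat. \<forall>m\<ge>n0. \<forall>n\<ge>n0. d (\<xi> m) (\<xi> n) < \<epsilon>)
     \<longrightarrow> (\<exists>x\<in>X. \<forall>\<epsilon>>0. \<exists>n0. \<forall>n\<ge>n0. d (\<xi> n) x < \<epsilon>))"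

definition open_set :: "'a set \<Rightarrow> bool" where
  "open_set U \<longleftrightarrow> U \<subseteq> X \<and> (\<forall>x\<in>U. \<exists>\<epsilon>>0. \<forall>y\<in>X. d y x < \<epsilon> \<longrightarrow> y \<in> U)"

lemma d_half:
  assumes "x \<in> X" "y \<in> X" "z \<in> X" "d x y < \<epsilon> / (2 * K)" "d y z < \<epsilon> / (2 * K)"
  shows "d x z < \<epsilon>"
proof -
  have "d x z \<le> K * (d x y + d y z)" using assms by (intro d_tri)
  also have "\<dots> < K * (\<epsilon> / (2 * K) + \<epsilon> / (2 * K))"
    using assms K by (intro mult_strict_left_mono) auto
  also have "\<dots> = \<epsilon>" using K by (simp add: field_simps)
  finally show ?thesis .
qed

text \<open>A ball of a quasi-metric need not be open. By the relaxed triangle inequality, the points that have a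
  whole ball around them inside the given one do form an open set.\<close>

lemma ball_nbhd:
  assumes "x \<in> X" "0 < \<epsilon>"
  obtains U where "open_set U" "x \<in> U" "\<And>y. y \<in> U \<Longrightarrow> d y x < \<epsilon>"
proof
  define U where "U = {y\<in>X. \<exists>\<delta>>0. \<forall>z\<in>X. d z y < \<delta> \<longrightarrow> d z x < \<epsilon>}"
  show "x \<in> U" using assms by (auto simp: U_def)
  show "d y x < \<epsilon>" if "y \<in> U" for y
    using that d_refl by (auto simp: U_def)
  show "open_set U"
    unfolding open_set_def
  proof (intro conjI ballI)
    fix y assume "y \<in> U"
    then obtain \<delta> where y: "y \<in> X" and \<delta>: "\<delta> > 0" "\<And>z. z \<in> X \<Longrightarrow> d z y < \<delta> \<Longrightarrow> d z x < \<epsilon>"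
      by (auto simp: U_def)
    have "z \<in> U" if z: "z \<in> X" "d z y < \<delta> / (2 * K)" for z
    proof -
      have "d t x < \<epsilon>" if t: "t \<in> X" "d t z < \<delta> / (2 * K)" for t
      proof (rule \<delta>(2)[OF t(1)])
        show "d t y < \<delta>" using d_half t z y by blast
      qed
      moreover have "0 < \<delta> / (2 * K)" using \<delta> K by simp
      ultimately show ?thesis using z unfolding U_def by blast
    qed
    moreover have "0 < \<delta> / (2 * K)" using \<delta> K by simp
    ultimately show "\<exists>\<epsilon>>0. \<forall>z\<in>X. d z y < \<epsilon> \<longrightarrow> z \<in> U" by blast
  qed (auto simp: U_def)
qed

lemma totbdd_if_compact_closure:
  assumes T: "\<And>U. openin \<T> U \<longleftrightarrow> open_set U" "topspace \<T> = X"
    and S: "S \<subseteq> X" "compactin \<T> (\<T> closure_of S)"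
  shows "totbdd S"
  unfolding totbdd_def
proof (intro conjI allI impI S)
  fix \<epsilon> :: real assume "\<epsilon> > 0"
  then have "\<forall>x\<in>X. \<exists>U. open_set U \<and> x \<in> U \<and> (\<forall>y\<in>U. d y x < \<epsilon>)" by (metis ball_nbhd)
  then obtain U where U: "\<And>x. x \<in> X \<Longrightarrow> open_set (U x) \<and> x \<in> U x \<and> (\<forall>y\<in>U x. d y x < \<epsilon>)" by metis
  have "(\<forall>V\<in>U ` X. openin \<T> V) \<and> \<T> closure_of S \<subseteq> \<Union>(U ` X)"
    using U T closure_of_subset_topspace[of \<T> S] by blast
  then obtain \<F> where F: "finite \<F>" "\<F> \<subseteq> U ` X" "\<T> closure_of S \<subseteq> \<Union>\<F>"
    using S(2) unfolding compactin_def by meson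
  then obtain F where "finite F" "F \<subseteq> X" "\<F> = U ` F" by (metis finite_subset_image)
  moreover have "S \<subseteq> \<T> closure_of S" using S T closure_of_subset by blast
  moreover have "\<exists>y\<in>F. d x y < \<epsilon>" if xS: "x \<in> S" for x
  proof -
    obtain y where "y \<in> F" "x \<in> U y" using calculation F(3) xS by blast
    with U[of y] calculation(2) show ?thesis by blast
  qed
  ultimately show "\<exists>F. finite F \<and> F \<subseteq> X \<and> (\<forall>x\<in>S. \<exists>y\<in>F. d x y < \<epsilon>)" by blast
qed

text \<open>For every radius, one of finitely many balls that cover \<open>S\<close> belongs to the image of the
  ultrafilter; the centres of these balls form a Cauchy sequence, whose limit is the required point.\<close>

lemma ultrafilter_limit:
  assumes complete and S: "totbdd S"
    and U: "U \<noteq> bot" "\<And>P. eventually P U \<or> eventually (\<lambda>i. \<not> P i) U"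
    and h: "eventually (\<lambda>i. h i \<in> S) U"
  obtains x where "x \<in> X" "\<And>\<epsilon>. 0 < \<epsilon> \<Longrightarrow> eventually (\<lambda>i. d (h i) x < \<epsilon>) U"
proof -
  have SX: "S \<subseteq> X" using S by (simp add: totbdd_def)
  \<comment> \<open>Otherwise the complements of finitely many balls that cover \<open>S\<close> would all belong to the ultrafilter.\<close>
  have "\<exists>c\<in>X. eventually (\<lambda>i. d (h i) c < \<epsilon>) U" if "\<epsilon> > 0" for \<epsilon>
  proof (rule ccontr)
    assume n: "\<not> ?thesis"
    obtain F where F: "finite F" "F \<subseteq> X" "\<And>x. x \<in> S \<Longrightarrow> \<exists>y\<in>F. d x y < \<epsilon>"
      using S \<open>\<epsilon> > 0\<close> unfolding totbdd_def by metis
    have "eventually (\<lambda>i. \<forall>c\<in>F. \<not> d (h i) c < \<epsilon>) U"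
      using F n U(2) by (intro eventually_ball_finite) blast+
    with h have "eventually (\<lambda>i. False) U"
      by eventually_elim (use F(3) in blast)
    then show False using U(1) by (simp add: trivial_limit_def)
  qed
  then have "\<forall>n. \<exists>c\<in>X. eventually (\<lambda>i. d (h i) c < 1 / real (Suc n)) U" by simp
  then obtain c where c: "\<And>n. c n \<in> X" "\<And>n. eventually (\<lambda>i. d (h i) (c n) < 1 / real (Suc n)) U" by metis
  have cc: "d (c m) (c n) < K * (1 / real (Suc m) + 1 / real (Suc n))" for m n
  proof -
    have e: "eventually (\<lambda>i. h i \<in> S \<and> d (h i) (c n) < 1 / real (Suc n) \<and> d (h i) (c m) < 1 / real (Suc m)) U"
      using h c(2)[of n] c(2)[of m] by (intro eventually_conj)
    then obtain i where i: "h i \<in> X" "d (h i) (c n) < 1 / real (Suc n)" "d (h i) (c m) < 1 / real (Suc m)"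
      using eventually_happens'[OF U(1) e] SX by blast
    have "d (c m) (c n) \<le> K * (d (c m) (h i) + d (h i) (c n))" using c i d_tri by blast
    also have "\<dots> < K * (1 / real (Suc m) + 1 / real (Suc n))"
      using i K d_sym[OF i(1) c(1)] by (intro mult_strict_left_mono) auto
    finally show ?thesis .
  qed
  have small: "\<exists>n0. \<forall>n\<ge>n0. 1 / real (Suc n) < \<epsilon>" if "\<epsilon> > 0" for \<epsilon>
  proof -
    obtain n0 where n0: "1 / real (Suc n0) < \<epsilon>" using reals_Archimedean[OF \<open>\<epsilon> > 0\<close>] by (auto simp: inverse_eq_divide)
    have "1 / real (Suc n) \<le> 1 / real (Suc n0)" if "n \<ge> n0" for n using that by (simp add: frac_le)
    with n0 show ?thesis by (meson le_less_trans)
  qed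
  have "\<exists>n0. \<forall>m\<ge>n0. \<forall>n\<ge>n0. d (c m) (c n) < \<epsilon>" if "\<epsilon> > 0" for \<epsilon>
  proof -
    obtain n0 where n0: "\<And>n. n \<ge> n0 \<Longrightarrow> 1 / real (Suc n) < \<epsilon> / (2 * K)"
      using small[of "\<epsilon> / (2 * K)"] \<open>\<epsilon> > 0\<close> K by (auto simp del: of_nat_Suc)
    have "d (c m) (c n) < \<epsilon>" if mn: "m \<ge> n0" "n \<ge> n0" for m n
    proof -
      have "d (c m) (c n) < K * (\<epsilon> / (2*K) + \<epsilon> / (2*K))"
        by (rule less_trans[OF cc[of m n]], rule mult_strict_left_mono)
          (use n0[OF mn(1)] n0[OF mn(2)] K in linarith)+
      also have "\<dots> = \<epsilon>" using K by (simp add: field_simps)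
      finally show ?thesis .
    qed
    then show ?thesis by blast
  qed
  with \<open>complete\<close> c(1) obtain x where x: "x \<in> X" "\<And>\<epsilon>. \<epsilon> > 0 \<Longrightarrow> \<exists>n0. \<forall>n\<ge>n0. d (c n) x < \<epsilon>"
    unfolding complete_def by blast
  show thesis
  proof (rule that[OF x(1)])
    fix \<epsilon> :: real assume "\<epsilon> > 0"
    then have e: "0 < \<epsilon> / (2 * K)" using K by simp
    obtain n1 where n1: "\<And>n. n \<ge> n1 \<Longrightarrow> d (c n) x < \<epsilon> / (2 * K)" using x(2)[OF e] by blast
    obtain n2 where n2: "\<And>n. n \<ge> n2 \<Longrightarrow> 1 / real (Suc n) < \<epsilon> / (2 * K)" using small[OF e] by blast
    define n where "n = max n1 n2"
    show "eventually (\<lambda>i. d (h i) x < \<epsilon>) U"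
      using h c(2)[of n]
    proof eventually_elim
      case (elim i)
      have hX: "h i \<in> X" using elim SX by blast
      show ?case
        using elim n1[of n] n2[of n] by (intro d_half[OF hX c(1)[of n] x(1)]) (auto simp: n_def)
    qed
  qed
qed

lemma totbdd_thicken:
  assumes S: "totbdd S" and S': "S' \<subseteq> X"
    and near: "\<And>x \<epsilon>. x \<in> S' \<Longrightarrow> \<epsilon> > 0 \<Longrightarrow> \<exists>y\<in>S. d x y < \<epsilon>"
  shows "totbdd S'"
  unfolding totbdd_def
proof (intro conjI allI impI S')
  fix \<epsilon> :: real assume "\<epsilon> > 0"
  then have e: "0 < \<epsilon> / (2 * K)" using K by simp
  obtain F where F: "finite F" "F \<subseteq> X" "\<And>x. x \<in> S \<Longrightarrow> \<exists>y\<in>F. d x y < \<epsilon> / (2 * K)"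
    using S e unfolding totbdd_def by metis
  have "\<exists>z\<in>F. d x z < \<epsilon>" if x: "x \<in> S'" for x
  proof -
    obtain y where y: "y \<in> S" "d x y < \<epsilon> / (2 * K)" using near[OF x e] by blast
    obtain z where z: "z \<in> F" "d y z < \<epsilon> / (2 * K)" using F(3)[OF y(1)] by blast
    have "x \<in> X" "y \<in> X" "z \<in> X" using x y z S S' F by (auto simp: totbdd_def)
    with y z show ?thesis using d_half by blast
  qed
  then show "\<exists>F. finite F \<and> F \<subseteq> X \<and> (\<forall>x\<in>S'. \<exists>y\<in>F. d x y < \<epsilon>)" using F by blast
qed

text \<open>If no finite part of an open cover sufficed, the complements of the covering sets would be
  contained in an ultrafilter; its limit point lies in the closure but in no covering set.\<close>

lemma compact_closure_if_totbdd:
  assumes T: "\<And>U. openin \<T> U \<longleftrightarrow> open_set U" "topspace \<T> = X"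
    and "complete" and S: "totbdd S"
  shows "compactin \<T> (\<T> closure_of S)"
proof -
  define C where "C = \<T> closure_of S"
  have CX: "C \<subseteq> X" using closure_of_subset_topspace[of \<T> S] T by (simp add: C_def)
  have "totbdd C"
  proof (rule totbdd_thicken[OF S CX])
    fix x and \<epsilon> :: real assume x: "x \<in> C" and "\<epsilon> > 0"
    with CX obtain U where U: "open_set U" "x \<in> U" "\<And>y. y \<in> U \<Longrightarrow> d y x < \<epsilon>" using ball_nbhd by blast
    then obtain y where "y \<in> S" "y \<in> U" using x T unfolding C_def in_closure_of by blast
    then show "\<exists>y\<in>S. d x y < \<epsilon>" using U d_sym x CX S unfolding totbdd_def
      by (metis subsetD)
  qed
  have "\<exists>\<F>. finite \<F> \<and> \<F> \<subseteq> \<U> \<and> C \<subseteq> \<Union>\<F>" if op: "\<forall>V\<in>\<U>. openin \<T> V" and cov: "C \<subseteq> \<Union>\<U>" for \<U>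
  proof (rule ccontr)
    assume n: "\<nexists>\<F>. finite \<F> \<and> \<F> \<subseteq> \<U> \<and> C \<subseteq> \<Union>\<F>"
    define F where "F = (INF V\<in>\<U>. principal (C - V))"
    have "(INF V\<in>\<F>. principal (C - V)) \<noteq> bot" if "finite \<F>" "\<F> \<subseteq> \<U>" for \<F>
    proof (cases "\<F> = {}")
      case False
      have "(INF V\<in>\<F>. principal (C - V)) = principal (\<Inter>V\<in>\<F>. C - V)"
        using that(1) by (rule INF_principal_finite)
      moreover have "(\<Inter>V\<in>\<F>. C - V) \<noteq> {}" using n that False by auto
      ultimately show ?thesis by (metis principal_eq_bot_iff)
    qed (simp add: trivial_limit_def)
    then have "F \<noteq> bot" unfolding F_def by (rule INF_filter_not_bot) auto
    then obtain U where U: "U \<le> F" "U \<noteq> bot" "\<And>P. eventually P U \<or> eventually (\<lambda>i. \<not> P i) U"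
      by (rule ultrafilter_extension) blast
    have ev: "eventually (\<lambda>x. x \<in> C - V) U" if "V \<in> \<U>" for V
    proof -
      have "F \<le> principal (C - V)" unfolding F_def using that by (rule INF_lower)
      then show ?thesis using U(1) by (metis le_principal order_trans)
    qed
    have "C \<noteq> {}" using n by auto
    then obtain V0 where "V0 \<in> \<U>" using cov by blast
    from ev[OF this] have evC: "eventually (\<lambda>x. x \<in> C) U" by (rule eventually_mono) auto
    then obtain x where x: "x \<in> X" "\<And>\<epsilon>. 0 < \<epsilon> \<Longrightarrow> eventually (\<lambda>y. d y x < \<epsilon>) U"
      using ultrafilter_limit[OF \<open>complete\<close> \<open>totbdd C\<close> U(2,3), of "\<lambda>x. x"] by blast
    have hit: "\<exists>y\<in>C - V. y \<in> W" if "open_set W" "x \<in> W" "V \<in> \<U>" for W V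
    proof -
      obtain \<epsilon> where "\<epsilon> > 0" and \<epsilon>: "\<And>y. y \<in> X \<Longrightarrow> d y x < \<epsilon> \<Longrightarrow> y \<in> W"
        using \<open>open_set W\<close> \<open>x \<in> W\<close> unfolding open_set_def by blast
      have e: "eventually (\<lambda>y. y \<in> C - V \<and> d y x < \<epsilon>) U"
        using x(2)[OF \<open>\<epsilon> > 0\<close>] ev[OF that(3)] by (rule eventually_conj[rotated])
      then obtain y where "y \<in> C - V" "d y x < \<epsilon>" using eventually_happens'[OF U(2) e] by blast
      then show ?thesis using \<epsilon> CX by blast
    qed
    have "x \<in> \<T> closure_of C"
      unfolding in_closure_of using x(1) T hit \<open>V0 \<in> \<U>\<close> by blast
    then have "x \<in> C" by (simp add: C_def)
    then obtain V where V: "V \<in> \<U>" "x \<in> V" using cov by blast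
    then show False using hit[of V V] op T by blast
  qed
  then show ?thesis unfolding compactin_def C_def[symmetric] using CX T by auto
qed

end

section \<open>Powers of weighted norms\<close>

text \<open>For finite exponents this is the \<open>s\<close>-th power of the weighted norm. Unlike the norm it is additive
  over disjoint sets, and its quasi-triangle inequality has the same form for \<open>s < 1\<close> and \<open>s \<ge> 1\<close>.\<close>

definition Lpow :: "'a measure \<Rightarrow> real \<Rightarrow> ('a \<Rightarrow> real) \<Rightarrow> ('a \<Rightarrow> complex) \<Rightarrow> ennreal" where
  "Lpow N s w f = (\<integral>\<^sup>+x. ennreal (norm (f x * of_real (w x)) powr s) \<partial>N)"

lemma ennpowr_le_iff:
  assumes "0 < s" "0 \<le> c"
  shows "ennpowr X (1 / s) \<le> ennreal c \<longleftrightarrow> X \<le> ennreal (c powr s)"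
proof (cases X)
  case (real x)
  have "x powr (1 / s) \<le> c \<longleftrightarrow> x \<le> c powr s"
  proof
    assume "x powr (1 / s) \<le> c"
    then have "(x powr (1 / s)) powr s \<le> c powr s" using assms by (intro powr_mono2) auto
    then show "x \<le> c powr s" using real assms by (simp add: powr_powr)
  next
    assume "x \<le> c powr s"
    then have "x powr (1 / s) \<le> (c powr s) powr (1 / s)" using assms real by (intro powr_mono2) auto
    then show "x powr (1 / s) \<le> c" using assms by (simp add: powr_powr)
  qed
  then show ?thesis using real assms by (simp add: ennpowr_def)
qed (simp add: ennpowr_def top_unique)

lemma ennpowr_less_iff:
  assumes "0 < s" "0 < c"
  shows "ennpowr X (1 / s) < ennreal c \<longleftrightarrow> X < ennreal (c powr s)"
proof (cases X)
  case (real x)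
  have "x powr (1 / s) < c \<longleftrightarrow> x < c powr s"
  proof
    assume "x powr (1 / s) < c"
    then have "(x powr (1 / s)) powr s < c powr s" using assms by (intro powr_less_mono2) auto
    then show "x < c powr s" using real assms by (simp add: powr_powr)
  next
    assume "x < c powr s"
    then have "x powr (1 / s) < (c powr s) powr (1 / s)" using assms real by (intro powr_less_mono2) auto
    then show "x powr (1 / s) < c" using assms by (simp add: powr_powr)
  qed
  then show ?thesis using real assms by (simp add: ennpowr_def ennreal_less_iff)
qed (simp add: ennpowr_def top_unique)

lemma ennpowr_finite_iff: "ennpowr X a < \<infinity> \<longleftrightarrow> X < \<infinity>"
  by (cases X) (auto simp: ennpowr_def)

lemma wLnorm_eq_Lpow:
  assumes "0 < s"
  shows "wLnorm N (ennreal s) w f = ennpowr (Lpow N s w f) (1 / s)"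
  using assms by (simp add: wLnorm_def Lnorm_def Lpow_def)

lemma wLnorm_le_iff_Lpow:
  assumes "0 < s" "0 \<le> c"
  shows "wLnorm N (ennreal s) w f \<le> ennreal c \<longleftrightarrow> Lpow N s w f \<le> ennreal (c powr s)"
  using assms by (simp add: wLnorm_eq_Lpow ennpowr_le_iff)

lemma wLnorm_less_iff_Lpow:
  assumes "0 < s" "0 < c"
  shows "wLnorm N (ennreal s) w f < ennreal c \<longleftrightarrow> Lpow N s w f < ennreal (c powr s)"
  using assms by (simp add: wLnorm_eq_Lpow ennpowr_less_iff)

lemma wLspace_eq_Lpow:
  assumes "0 < s"
  shows "wLspace N (ennreal s) w = {f \<in> borel_measurable N. Lpow N s w f < \<infinity>}"
  using assms by (simp add: wLspace_def wLnorm_eq_Lpow ennpowr_finite_iff[unfolded infinity_ennreal_def])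

lemma wLnorm_top_le_iff:
  assumes "f \<in> borel_measurable N" "w \<in> borel_measurable N" "0 \<le> c"
  shows "wLnorm N \<infinity> w f \<le> ennreal c \<longleftrightarrow> (AE x in N. norm (f x * of_real (w x)) \<le> c)"
proof
  have m: "(\<lambda>x. ennreal (norm (f x * of_real (w x)))) \<in> borel_measurable N"
    using assms by measurable
  show "AE x in N. norm (f x * of_real (w x)) \<le> c" if "wLnorm N \<infinity> w f \<le> ennreal c"
  proof -
    have "AE x in N. ennreal (norm (f x * of_real (w x))) \<le> wLnorm N \<infinity> w f"
      using esssup_AE[of "\<lambda>x. ennreal (norm (f x * of_real (w x)))" N] by (simp add: wLnorm_def Lnorm_def)
    then show ?thesis
    proof eventually_elim
      case (elim x)
      with that have "ennreal (norm (f x * of_real (w x))) \<le> ennreal c" by (rule order_trans[rotated])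
      with assms(3) show ?case by (simp add: ennreal_le_iff)
    qed
  qed
  show "wLnorm N \<infinity> w f \<le> ennreal c" if "AE x in N. norm (f x * of_real (w x)) \<le> c"
    unfolding wLnorm_def Lnorm_def
    using that m by (auto intro!: esssup_I elim!: eventually_mono simp: assms(3) ennreal_leI)
qed

text \<open>The sum is at most twice the larger term, so the constant \<open>2\<^sup>s\<close> serves all exponents \<open>s > 0\<close>.\<close>

lemma norm_mult_weight_powr_add:
  fixes a b :: complex and u s :: real
  assumes "0 < s"
  shows "norm ((a + b) * of_real u) powr s \<le>
    2 powr s * (norm (a * of_real u) powr s + norm (b * of_real u) powr s)"
proof -
  define M where "M = max (norm (a * of_real u)) (norm (b * of_real u))"
  have "norm ((a + b) * of_real u) \<le> 2 * M"
    unfolding M_def distrib_right by (rule order_trans[OF norm_triangle_ineq]) auto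
  then have "norm ((a + b) * of_real u) powr s \<le> (2 * M) powr s"
    using assms by (intro powr_mono2) auto
  also have "\<dots> = 2 powr s * M powr s" by (rule powr_mult)
  also have "M powr s \<le> norm (a * of_real u) powr s + norm (b * of_real u) powr s"
    by (auto simp: M_def max_def)
  finally show ?thesis by simp
qed

context
  fixes N :: "'a measure" and w :: "'a \<Rightarrow> real" and s :: real
  assumes w[measurable]: "w \<in> borel_measurable N" and s: "0 < s"
begin

lemma Lpow_cong_AE:
  assumes "AE x in N. f x = g x"
  shows "Lpow N s w f = Lpow N s w g"
  unfolding Lpow_def using assms by (intro nn_integral_cong_AE) (auto elim!: eventually_mono)

lemma Lpow_mono_AE:
  assumes "AE x in N. norm (f x * of_real (w x)) \<le> norm (g x * of_real (w x))"
  shows "Lpow N s w f \<le> Lpow N s w g"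
  unfolding Lpow_def using assms s
  by (intro nn_integral_mono_AE) (auto elim!: eventually_mono intro!: ennreal_leI powr_mono2)

lemma Lpow_add:
  assumes [measurable]: "f \<in> borel_measurable N" "g \<in> borel_measurable N"
  shows "Lpow N s w (\<lambda>x. f x + g x) \<le> ennreal (2 powr s) * (Lpow N s w f + Lpow N s w g)"
proof -
  have "Lpow N s w (\<lambda>x. f x + g x) \<le> (\<integral>\<^sup>+x. ennreal (2 powr s) * (ennreal (norm (f x * of_real (w x)) powr s)
     + ennreal (norm (g x * of_real (w x)) powr s)) \<partial>N)"
    unfolding Lpow_def
    using norm_mult_weight_powr_add[OF s]
    by (intro nn_integral_mono) (simp flip: ennreal_plus ennreal_mult add: ennreal_leI)
  also have "\<dots> = ennreal (2 powr s) * (Lpow N s w f + Lpow N s w g)"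
    unfolding Lpow_def by (simp add: nn_integral_cmult nn_integral_add)
  finally show ?thesis .
qed

lemma Lpow_scale:
  assumes [measurable]: "f \<in> borel_measurable N"
  shows "Lpow N s w (\<lambda>x. c * f x) = ennreal (norm c powr s) * Lpow N s w f"
proof -
  have "Lpow N s w (\<lambda>x. c * f x) = (\<integral>\<^sup>+x. ennreal (norm c powr s) * ennreal (norm (f x * of_real (w x)) powr s) \<partial>N)"
    unfolding Lpow_def by (intro nn_integral_cong) (simp add: norm_mult powr_mult mult.assoc flip: ennreal_mult)
  then show ?thesis unfolding Lpow_def by (simp add: nn_integral_cmult)
qed

lemma Lpow_minus_commute: "Lpow N s w (\<lambda>x. f x - g x) = Lpow N s w (\<lambda>x. g x - f x)"
  unfolding Lpow_def by (simp add: norm_mult norm_minus_commute)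

lemma Lpow_eq_0_iff:
  assumes [measurable]: "f \<in> borel_measurable N"
  shows "Lpow N s w f = 0 \<longleftrightarrow> (AE x in N. f x * of_real (w x) = 0)"
  unfolding Lpow_def by (subst nn_integral_0_iff_AE) (auto simp: ennreal_eq_0_iff)

lemma Lpow_Fatou:
  assumes [measurable]: "\<And>n. g n \<in> borel_measurable N"
    and lim: "AE x in N. (\<lambda>n. g n x) \<longlonglongrightarrow> f x"
    and le: "eventually (\<lambda>n. Lpow N s w (g n) \<le> C) sequentially"
  shows "Lpow N s w f \<le> C"
proof -
  have "Lpow N s w f \<le> (\<integral>\<^sup>+x. liminf (\<lambda>n. ennreal (norm (g n x * of_real (w x)) powr s)) \<partial>N)"
    unfolding Lpow_def
  proof (rule nn_integral_mono_AE, use lim in eventually_elim)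
    case (elim x)
    have "(\<lambda>n. ennreal (norm (g n x * of_real (w x)) powr s)) \<longlonglongrightarrow> ennreal (norm (f x * of_real (w x)) powr s)"
      using elim s by (intro tendsto_ennrealI tendsto_powr2 tendsto_intros) auto
    then show ?case by (subst lim_imp_Liminf) auto
  qed
  also have "\<dots> \<le> liminf (\<lambda>n. Lpow N s w (g n))"
    unfolding Lpow_def by (intro nn_integral_liminf) measurable
  also have "\<dots> \<le> C"
  proof -
    have "liminf (\<lambda>n. Lpow N s w (g n)) \<le> limsup (\<lambda>n. Lpow N s w (g n))"
      by (rule Liminf_le_Limsup) simp
    also have "\<dots> \<le> C" using le by (rule Limsup_bounded)
    finally show ?thesis .
  qed
  finally show ?thesis .
qed

text \<open>By monotone convergence the series of \<open>s\<close>-th powers converges a.e., so its terms tend to 0.\<close>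

lemma Lpow_suminf_AE_null:
  assumes [measurable]: "\<And>n. h n \<in> borel_measurable N"
    and fin: "(\<Sum>n. Lpow N s w (h n)) < \<infinity>"
  shows "AE x in N. (\<lambda>n. h n x * of_real (w x)) \<longlonglongrightarrow> 0"
proof -
  have "(\<integral>\<^sup>+x. (\<Sum>n. ennreal (norm (h n x * of_real (w x)) powr s)) \<partial>N) < \<infinity>"
    using fin unfolding Lpow_def by (subst nn_integral_suminf) auto
  then have "AE x in N. (\<Sum>n. ennreal (norm (h n x * of_real (w x)) powr s)) \<noteq> \<infinity>"
    by (intro nn_integral_noteq_infinite) auto
  then show ?thesis
  proof eventually_elim
    case (elim x)
    then have "summable (\<lambda>n. norm (h n x * of_real (w x)) powr s)"
      by (intro summable_suminf_not_top) (auto simp: infinity_ennreal_def)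
    then have "(\<lambda>n. norm (h n x * of_real (w x)) powr s) \<longlonglongrightarrow> 0" by (rule summable_LIMSEQ_zero)
    then have "(\<lambda>n. (norm (h n x * of_real (w x)) powr s) powr (1 / s)) \<longlonglongrightarrow> 0 powr (1 / s)"
      using s by (intro tendsto_powr2 tendsto_intros) auto
    then show ?case using s by (simp add: powr_powr tendsto_norm_zero_iff del: norm_mult)
  qed
qed

text \<open>The Riesz--Fischer argument, arranged so that \<open>s < 1\<close> needs no separate treatment: along a fast
  subsequence even \<open>2\<^sup>n\<close> times the consecutive differences tends to 0 a.e., so the subsequence
  converges a.e. by comparison with a geometric series.\<close>

lemma Lpow_complete:
  assumes pos: "AE x in N. 0 < w x"
    and \<xi>[measurable]: "\<And>n. \<xi> n \<in> borel_measurable N"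
    and cau: "\<And>\<epsilon>::real. 0 < \<epsilon> \<Longrightarrow> \<exists>n0::nat. \<forall>m\<ge>n0. \<forall>n\<ge>n0. Lpow N s w (\<lambda>x. \<xi> m x - \<xi> n x) \<le> ennreal \<epsilon>"
  obtains f where "f \<in> borel_measurable N"
    "\<And>\<epsilon>::real. 0 < \<epsilon> \<Longrightarrow> \<exists>n0::nat. \<forall>m\<ge>n0. Lpow N s w (\<lambda>x. \<xi> m x - f x) \<le> ennreal \<epsilon>"
proof -
  \<comment> \<open>The divisor makes up for the factor \<open>2 ^ n\<close> in \<open>h n\<close> below.\<close>
  define \<epsilon> where "\<epsilon> n = (1/2)^n / 2 powr (real n * s)" for n :: nat
  have \<epsilon>: "\<epsilon> n > 0" for n by (simp add: \<epsilon>_def)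
  have "\<forall>n. \<exists>a. \<forall>m\<ge>a. \<forall>l\<ge>a. Lpow N s w (\<lambda>x. \<xi> m x - \<xi> l x) \<le> ennreal (\<epsilon> n)"
    using cau \<epsilon> by blast
  then obtain a where a: "\<And>n m l. m \<ge> a n \<Longrightarrow> l \<ge> a n \<Longrightarrow> Lpow N s w (\<lambda>x. \<xi> m x - \<xi> l x) \<le> ennreal (\<epsilon> n)" by metis
  define k where "k n = n + (\<Sum>i\<le>n. a i)" for n
  have ka: "k n \<ge> a n" for n
    using member_le_sum[of n "{..n}" a] by (simp add: k_def)
  have kSuc: "k (Suc n) \<ge> a n" for n using ka[of n] by (simp add: k_def)
  have kn: "k n \<ge> n" for n by (simp add: k_def)
  define h where "h n x = 2 ^ n * (\<xi> (k (Suc n)) x - \<xi> (k n) x)" for n x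
  have [measurable]: "h n \<in> borel_measurable N" for n unfolding h_def by measurable
  have hle: "Lpow N s w (h n) \<le> ennreal ((1/2)^n)" for n
  proof -
    have "Lpow N s w (h n) = ennreal (norm (2 ^ n :: complex) powr s) * Lpow N s w (\<lambda>x. \<xi> (k (Suc n)) x - \<xi> (k n) x)"
      unfolding h_def by (rule Lpow_scale) measurable
    also have "\<dots> \<le> ennreal (2 powr (real n * s)) * ennreal (\<epsilon> n)"
      using a[OF kSuc[of n] ka[of n]]
      by (intro mult_mono) (auto simp: norm_power powr_powr simp flip: powr_realpow)
    also have "\<dots> = ennreal ((1/2)^n)" by (simp add: \<epsilon>_def flip: ennreal_mult)
    finally show ?thesis .
  qed
  have "(\<Sum>n. Lpow N s w (h n)) \<le> (\<Sum>n. ennreal ((1/2)^n))" using hle by (intro suminf_le) auto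
  also have "\<dots> < \<infinity>" by (subst suminf_ennreal2) (auto simp: summable_geometric)
  finally have "AE x in N. (\<lambda>n. h n x * of_real (w x)) \<longlonglongrightarrow> 0"
    by (intro Lpow_suminf_AE_null) auto
  with pos have conv: "AE x in N. convergent (\<lambda>n. \<xi> (k n) x)"
  proof eventually_elim
    case (elim x)
    then have "(\<lambda>n. h n x * of_real (w x) * of_real (1 / w x)) \<longlonglongrightarrow> 0 * of_real (1 / w x)"
      by (intro tendsto_intros)
    moreover have "h n x * of_real (w x) * of_real (1 / w x) = h n x" for n
      using elim by (simp add: field_simps)
    ultimately have "(\<lambda>n. h n x) \<longlonglongrightarrow> 0" by simp
    then have "Bseq (\<lambda>n. h n x)" by (intro convergent_imp_Bseq convergentI)
    then obtain C where C: "\<And>n. norm (h n x) \<le> C" by (auto simp: Bseq_def)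
    have "summable (\<lambda>n. C * (1/2::real) ^ n)" by (intro summable_mult summable_geometric) auto
    then have "summable (\<lambda>n. \<xi> (k (Suc n)) x - \<xi> (k n) x)"
    proof (rule summable_comparison_test'[of _ 0])
      fix n
      have "norm (\<xi> (k (Suc n)) x - \<xi> (k n) x) = norm (h n x) * (1/2)^n"
        by (simp add: h_def norm_mult norm_power power_one_over)
      also have "\<dots> \<le> C * (1/2)^n" using C by (intro mult_right_mono) auto
      finally show "norm (\<xi> (k (Suc n)) x - \<xi> (k n) x) \<le> C * (1/2)^n" .
    qed
    then have "convergent (\<lambda>n. \<Sum>i<n. \<xi> (k (Suc i)) x - \<xi> (k i) x)" by (simp add: summable_iff_convergent)
    then have "convergent (\<lambda>n. \<xi> (k n) x - \<xi> (k 0) x)" by (simp only: sum_lessThan_telescope[of "\<lambda>i. \<xi> (k i) x"])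
    then have "convergent (\<lambda>n. \<xi> (k n) x - \<xi> (k 0) x + \<xi> (k 0) x)"
      by (intro convergent_add convergent_const)
    then show ?case by simp
  qed
  define f where "f x = lim (\<lambda>n. \<xi> (k n) x)" for x
  have [measurable]: "f \<in> borel_measurable N"
    unfolding f_def by (rule borel_measurable_lim_metric) measurable
  show thesis
  proof (rule that[of f])
    fix e :: real assume "0 < e"
    then obtain n0 where n0: "\<And>m n. m \<ge> n0 \<Longrightarrow> n \<ge> n0 \<Longrightarrow> Lpow N s w (\<lambda>x. \<xi> m x - \<xi> n x) \<le> ennreal e"
      using cau by blast
    have "Lpow N s w (\<lambda>x. \<xi> m x - f x) \<le> ennreal e" if m: "m \<ge> n0" for m
    proof (rule Lpow_Fatou)
      show "(\<lambda>x. \<xi> m x - \<xi> (k n) x) \<in> borel_measurable N" for n by measurable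
      show "AE x in N. (\<lambda>n. \<xi> m x - \<xi> (k n) x) \<longlonglongrightarrow> \<xi> m x - f x"
        using conv by eventually_elim (auto intro!: tendsto_intros simp: f_def convergent_LIMSEQ_iff)
      show "eventually (\<lambda>n. Lpow N s w (\<lambda>x. \<xi> m x - \<xi> (k n) x) \<le> ennreal e) sequentially"
        using n0[OF m] kn by (intro eventually_sequentiallyI[of n0]) (meson order_trans)
    qed
    then show "\<exists>n0. \<forall>m\<ge>n0. Lpow N s w (\<lambda>x. \<xi> m x - f x) \<le> ennreal e" by blast
  qed measurable
qed

end

definition Ldist :: "'a measure \<Rightarrow> real \<Rightarrow> ('a \<Rightarrow> real) \<Rightarrow> ('a \<Rightarrow> complex) \<Rightarrow> ('a \<Rightarrow> complex) \<Rightarrow> real" where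
  "Ldist N s w f g = enn2real (Lpow N s w (\<lambda>x. f x - g x))"

locale weighted_Lspace =
  fixes N :: "'a measure" and s :: real and w :: "'a \<Rightarrow> real"
  assumes weight: "weight N w" and s: "0 < s"
begin

lemma w_meas [measurable]: "w \<in> borel_measurable N"
  using weight by (simp add: weight_def)

lemma w_pos: "AE x in N. 0 < w x"
  using weight by (simp add: weight_def)

abbreviation "L \<equiv> wLspace N (ennreal s) w"

lemma L_iff: "f \<in> L \<longleftrightarrow> f \<in> borel_measurable N \<and> Lpow N s w f < \<infinity>"
  by (simp add: wLspace_eq_Lpow s)

lemma L_meas: "f \<in> L \<Longrightarrow> f \<in> borel_measurable N"
  by (simp add: L_iff)

lemma L_add: "f \<in> L \<Longrightarrow> g \<in> L \<Longrightarrow> (\<lambda>x. f x + g x) \<in> L"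
  using Lpow_add[OF w_meas s, of f g]
  by (auto simp: L_iff ennreal_mult_less_top elim!: le_less_trans)

lemma L_scale: "f \<in> L \<Longrightarrow> (\<lambda>x. c * f x) \<in> L"
  using Lpow_scale[OF w_meas s, of f c] by (auto simp: L_iff ennreal_mult_less_top)

lemma L_diff: "f \<in> L \<Longrightarrow> g \<in> L \<Longrightarrow> (\<lambda>x. f x - g x) \<in> L"
  using L_add[of f "\<lambda>x. - 1 * g x"] L_scale[of g "-1"] by simp

lemma Lpow_Ldist: "f \<in> L \<Longrightarrow> g \<in> L \<Longrightarrow> Lpow N s w (\<lambda>x. f x - g x) = ennreal (Ldist N s w f g)"
  using L_diff[of f g] by (simp add: Ldist_def L_iff)

lemma Ldist_nonneg: "0 \<le> Ldist N s w f g"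
  by (simp add: Ldist_def)

lemma Lpow_less_iff_Ldist:
  "f \<in> L \<Longrightarrow> g \<in> L \<Longrightarrow> Lpow N s w (\<lambda>x. f x - g x) < ennreal e \<longleftrightarrow> Ldist N s w f g < e"
  by (simp add: Lpow_Ldist ennreal_less_iff Ldist_nonneg)

lemma Lpow_le_iff_Ldist:
  "0 \<le> e \<Longrightarrow> f \<in> L \<Longrightarrow> g \<in> L \<Longrightarrow> Lpow N s w (\<lambda>x. f x - g x) \<le> ennreal e \<longleftrightarrow> Ldist N s w f g \<le> e"
  by (simp add: Lpow_Ldist ennreal_le_iff)

sublocale quasi_metric L "Ldist N s w" "2 powr s"
proof
  fix f g h assume f: "f \<in> L" and g: "g \<in> L"
  show "0 \<le> Ldist N s w f g" by (simp add: Ldist_def)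
  show "Ldist N s w f f = 0" by (simp add: Ldist_def Lpow_def s)
  show "Ldist N s w f g = Ldist N s w g f" by (simp add: Ldist_def Lpow_minus_commute[OF w_meas s, of f g])
  assume h: "h \<in> L"
  have "Lpow N s w (\<lambda>x. (f x - g x) + (g x - h x)) \<le>
      ennreal (2 powr s) * (Lpow N s w (\<lambda>x. f x - g x) + Lpow N s w (\<lambda>x. g x - h x))"
    using f g h by (intro Lpow_add w_meas s borel_measurable_diff L_meas)
  then have "ennreal (Ldist N s w f h) \<le> ennreal (2 powr s * (Ldist N s w f g + Ldist N s w g h))"
    using f g h by (simp add: Lpow_Ldist Ldist_nonneg flip: ennreal_plus ennreal_mult)
  then show "Ldist N s w f h \<le> 2 powr s * (Ldist N s w f g + Ldist N s w g h)"
    by (subst (asm) ennreal_le_iff) (auto simp: Ldist_nonneg)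
qed (use s in \<open>auto simp: ge_one_powr_ge_zero\<close>)

text \<open>The distance is the \<open>s\<close>-th power of the norm of the difference, so both have the same
  neighbourhoods.\<close>

lemma open_set_iff: "open_set U \<longleftrightarrow> wLopen N (ennreal s) w U"
proof -
  have *: "(\<exists>\<epsilon>>0. \<forall>y\<in>L. Ldist N s w y x < \<epsilon> \<longrightarrow> y \<in> U) \<longleftrightarrow>
        (\<exists>\<epsilon>>0. \<forall>g\<in>L. wLnorm N (ennreal s) w (\<lambda>y. g y - x y) < ennreal \<epsilon> \<longrightarrow> g \<in> U)" (is "?A \<longleftrightarrow> ?B")
    if x: "x \<in> L" for x
  proof
    assume ?A
    then obtain e where e: "e > 0" "\<And>y. y \<in> L \<Longrightarrow> Ldist N s w y x < e \<Longrightarrow> y \<in> U" by blast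
    have "g \<in> U" if "g \<in> L" "wLnorm N (ennreal s) w (\<lambda>y. g y - x y) < ennreal (e powr (1 / s))" for g
    proof -
      have "Lpow N s w (\<lambda>y. g y - x y) < ennreal e"
        using that(2) e(1) s by (subst (asm) wLnorm_less_iff_Lpow) (auto simp: powr_powr)
      then have "Ldist N s w g x < e" using that x by (simp add: Lpow_less_iff_Ldist)
      then show ?thesis using that e(2) by blast
    qed
    moreover have "e powr (1 / s) > 0" using e by simp
    ultimately show ?B by blast
  next
    assume ?B
    then obtain e where e: "e > 0" "\<And>g. g \<in> L \<Longrightarrow> wLnorm N (ennreal s) w (\<lambda>y. g y - x y) < ennreal e \<Longrightarrow> g \<in> U" by blast
    have "g \<in> U" if "g \<in> L" "Ldist N s w g x < e powr s" for g
    proof (rule e(2)[OF that(1)])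
      have "Lpow N s w (\<lambda>y. g y - x y) < ennreal (e powr s)"
        using that x by (simp add: Lpow_less_iff_Ldist)
      then show "wLnorm N (ennreal s) w (\<lambda>y. g y - x y) < ennreal e"
        using e(1) s by (simp add: wLnorm_less_iff_Lpow)
    qed
    moreover have "e powr s > 0" using e by simp
    ultimately show ?A by blast
  qed
  then show ?thesis unfolding open_set_def wLopen_def by blast
qed

lemma complete_L: complete
  unfolding complete_def
proof (intro allI impI, elim conjE)
  fix \<xi> :: "nat \<Rightarrow> _" assume r: "range \<xi> \<subseteq> L"
    and c: "\<forall>\<epsilon>>0. \<exists>n0. \<forall>m\<ge>n0. \<forall>n\<ge>n0. Ldist N s w (\<xi> m) (\<xi> n) < \<epsilon>"
  have L: "\<xi> n \<in> L" for n using r by blast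
  have cau: "\<exists>n0. \<forall>m\<ge>n0. \<forall>n\<ge>n0. Lpow N s w (\<lambda>x. \<xi> m x - \<xi> n x) \<le> ennreal \<epsilon>" if "\<epsilon> > 0" for \<epsilon>
    using c that by (metis Lpow_less_iff_Ldist[OF L L] less_imp_le)
  obtain f where f[measurable]: "f \<in> borel_measurable N"
    and lim: "\<And>\<epsilon>::real. 0 < \<epsilon> \<Longrightarrow> \<exists>n0::nat. \<forall>m\<ge>n0. Lpow N s w (\<lambda>x. \<xi> m x - f x) \<le> ennreal \<epsilon>"
    by (rule Lpow_complete[OF w_meas s w_pos L_meas[OF L] cau]) blast+
  obtain n0 where n0: "Lpow N s w (\<lambda>x. \<xi> n0 x - f x) \<le> ennreal 1" using lim[of 1] by auto
  then have "(\<lambda>x. \<xi> n0 x - f x) \<in> L" using L_meas[OF L, of n0] by (auto simp: L_iff intro: le_less_trans)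
  from L_diff[OF L[of n0] this] have fL: "f \<in> L" by simp
  show "\<exists>f\<in>L. \<forall>\<epsilon>>0. \<exists>n0. \<forall>n\<ge>n0. Ldist N s w (\<xi> n) f < \<epsilon>"
  proof (intro bexI[OF _ fL] allI impI)
    fix \<epsilon> :: real assume "\<epsilon> > 0"
    then obtain n0 where n0: "\<And>m. m \<ge> n0 \<Longrightarrow> Lpow N s w (\<lambda>x. \<xi> m x - f x) \<le> ennreal (\<epsilon> / 2)"
      using lim[of "\<epsilon> / 2"] by auto
    have "Ldist N s w (\<xi> n) f < \<epsilon>" if "n \<ge> n0" for n
      using n0[OF that] \<open>\<epsilon> > 0\<close> by (simp add: Lpow_le_iff_Ldist L fL)
    then show "\<exists>n0. \<forall>n\<ge>n0. Ldist N s w (\<xi> n) f < \<epsilon>" by blast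
  qed
qed

lemma relatively_compact_iff_totbdd:
  "relatively_compact_in (wLtopology N (ennreal s) w) S \<longleftrightarrow> totbdd S"
proof
  assume "totbdd S"
  then show "relatively_compact_in (wLtopology N (ennreal s) w) S"
    using compact_closure_if_totbdd[of "wLtopology N (ennreal s) w" S] complete_L
    by (simp add: relatively_compact_in_def openin_wLtopology topspace_wLtopology open_set_iff totbdd_def)
next
  assume "relatively_compact_in (wLtopology N (ennreal s) w) S"
  then show "totbdd S"
    using totbdd_if_compact_closure[of "wLtopology N (ennreal s) w" S]
    by (simp add: relatively_compact_in_def openin_wLtopology topspace_wLtopology open_set_iff)
qed

end

section \<open>Log-subharmonicity on the unit disc\<close>

text \<open>On the unit circle the conjugate of \<open>z\<close> is \<open>1 / z\<close>, and a negative power may be replaced by the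
  conjugate positive power under the real part. Hence the real parts of polynomials are closed under
  multiplication on the circle.\<close>

lemma circle_cos_product:
  fixes P Q :: "complex poly"
  shows "\<exists>R. \<forall>z. norm z = 1 \<longrightarrow> Re (poly P z * cnj (poly Q z)) = Re (poly R z)"
proof -
  have mono: "\<exists>R. \<forall>z. norm z = 1 \<longrightarrow> Re (a * z ^ i * cnj (b * z ^ j)) = Re (poly R z)" for a b i j
  proof (cases "j \<le> i")
    case True
    show ?thesis
    proof (intro exI[of _ "monom (a * cnj b) (i - j)"] allI impI)
      fix z :: complex assume "norm z = 1"
      then have "z * cnj z = 1" by (simp add: complex_mult_cnj cmod_def)
      then have one: "z ^ j * cnj z ^ j = 1" by (metis power_mult_distrib power_one)
      have "z ^ i = z ^ (i - j) * z ^ j" using True by (simp flip: power_add)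
      then have "a * z ^ i * cnj (b * z ^ j) = a * cnj b * z ^ (i - j) * (z ^ j * cnj z ^ j)"
        by (simp only: complex_cnj_mult complex_cnj_power mult_ac)
      then have "a * z ^ i * cnj (b * z ^ j) = a * cnj b * z ^ (i - j)" by (simp only: one mult_1_right)
      then show "Re (a * z ^ i * cnj (b * z ^ j)) = Re (poly (monom (a * cnj b) (i - j)) z)"
        by (simp only: poly_monom)
    qed
  next
    case False
    show ?thesis
    proof (intro exI[of _ "monom (cnj a * b) (j - i)"] allI impI)
      fix z :: complex assume "norm z = 1"
      then have "z * cnj z = 1" by (simp add: complex_mult_cnj cmod_def)
      then have one: "z ^ i * cnj z ^ i = 1" by (metis power_mult_distrib power_one)
      have "z ^ j = z ^ (j - i) * z ^ i" using False by (simp flip: power_add)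
      then have "cnj (a * z ^ i * cnj (b * z ^ j)) = cnj a * b * z ^ (j - i) * (z ^ i * cnj z ^ i)"
        by (simp only: complex_cnj_mult complex_cnj_power complex_cnj_cnj mult_ac)
      then have "cnj (a * z ^ i * cnj (b * z ^ j)) = cnj a * b * z ^ (j - i)" by (simp only: one mult_1_right)
      moreover have "Re (a * z ^ i * cnj (b * z ^ j)) = Re (cnj (a * z ^ i * cnj (b * z ^ j)))"
        by (simp only: cnj.simps)
      ultimately show "Re (a * z ^ i * cnj (b * z ^ j)) = Re (poly (monom (cnj a * b) (j - i)) z)"
        by (simp only: poly_monom)
    qed
  qed
  then have "\<forall>i j. \<exists>R. \<forall>z. norm z = 1 \<longrightarrow>
      Re (coeff P i * z ^ i * cnj (coeff Q j * z ^ j)) = Re (poly R z)" by blast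
  then obtain R where R: "\<And>i j z. norm z = 1 \<Longrightarrow>
      Re (coeff P i * z ^ i * cnj (coeff Q j * z ^ j)) = Re (poly (R i j) z)" by metis
  show ?thesis
  proof (intro exI[of _ "\<Sum>i\<le>degree P. \<Sum>j\<le>degree Q. R i j"] allI impI)
    fix z :: complex assume z: "norm z = 1"
    have "Re (poly P z * cnj (poly Q z)) =
        (\<Sum>i\<le>degree P. \<Sum>j\<le>degree Q. Re (coeff P i * z ^ i * cnj (coeff Q j * z ^ j)))"
      by (simp only: poly_altdef cnj_sum sum_product Re_sum)
    also have "\<dots> = Re (poly (\<Sum>i\<le>degree P. \<Sum>j\<le>degree Q. R i j) z)"
      using R[OF z] by (simp add: poly_sum)
    finally show "Re (poly P z * cnj (poly Q z)) = Re (poly (\<Sum>i\<le>degree P. \<Sum>j\<le>degree Q. R i j) z)" .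
  qed
qed

lemma real_polynomial_on_circle:
  fixes f :: "complex \<Rightarrow> real"
  assumes "real_polynomial_function f"
  shows "\<exists>P. \<forall>z. norm z = 1 \<longrightarrow> f z = Re (poly P z)"
  using assms
proof induction
  case (linear f)
  interpret bounded_linear f by fact
  show ?case
  proof (intro exI[of _ "[:0, Complex (f 1) (- f \<i>):]"] allI impI)
    fix z :: complex
    have "f z = f (Re z *\<^sub>R 1 + Im z *\<^sub>R \<i>)" by (rule arg_cong[where f = f]) (simp add: complex_eq_iff)
    also have "\<dots> = Re z * f 1 + Im z * f \<i>" by (simp only: add scaleR real_scaleR_def)
    finally show "f z = Re (poly [:0, Complex (f 1) (- f \<i>):] z)" by simp
  qed
next
  case (const c)
  show ?case by (rule exI[of _ "[:of_real c:]"]) simp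
next
  case (add f g)
  then obtain P Q where "\<And>z. norm z = 1 \<Longrightarrow> f z = Re (poly P z)" "\<And>z. norm z = 1 \<Longrightarrow> g z = Re (poly Q z)" by blast
  then show ?case by (intro exI[of _ "P + Q"]) simp
next
  case (mult f g)
  then obtain P Q where PQ: "\<And>z. norm z = 1 \<Longrightarrow> f z = Re (poly P z)" "\<And>z. norm z = 1 \<Longrightarrow> g z = Re (poly Q z)" by blast
  obtain R where R: "\<And>z. norm z = 1 \<Longrightarrow> Re (poly P z * cnj (poly Q z)) = Re (poly R z)"
    using circle_cos_product by blast
  show ?case
  proof (intro exI[of _ "smult (1/2) (P * Q + R)"] allI impI)
    fix z :: complex assume z: "norm z = 1"
    have "Re (poly (smult (1/2) (P * Q + R)) z) = (Re (poly P z * poly Q z) + Re (poly R z)) / 2"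
      by simp
    then show "f z * g z = Re (poly (smult (1/2) (P * Q + R)) z)"
      using PQ[OF z] R[OF z] by simp
  qed
qed

text \<open>Stone--Weierstrass, in a form that hands out boundary values of harmonic functions.\<close>

lemma circle_approx_Re_poly:
  fixes h :: "complex \<Rightarrow> real"
  assumes "continuous_on (sphere 0 1) h" "0 < \<epsilon>"
  obtains P :: "complex poly" where "\<And>z. norm z = 1 \<Longrightarrow> \<bar>h z - Re (poly P z)\<bar> < \<epsilon>"
proof -
  obtain g where g: "real_polynomial_function g" "\<And>z. z \<in> sphere 0 1 \<Longrightarrow> \<bar>h z - g z\<bar> < \<epsilon>"
    using Stone_Weierstrass_real_polynomial_function[OF compact_sphere assms] by blast
  obtain P where "\<And>z. norm z = 1 \<Longrightarrow> g z = Re (poly P z)" using real_polynomial_on_circle[OF g(1)] by blast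
  with g(2) show thesis by (intro that[of P]) auto
qed

definition unit_interval :: "real measure" where
  "unit_interval = restrict_space lborel {0..1}"

lemma space_unit_interval [simp]: "space unit_interval = {0..1}"
  by (simp add: unit_interval_def space_restrict_space)

lemma sets_unit_interval [measurable_cong]: "sets unit_interval = sets (restrict_space borel {0..1})"
  unfolding unit_interval_def by (intro sets_restrict_space_cong) simp

lemma prob_space_unit_interval: "prob_space unit_interval"
  unfolding unit_interval_def by (intro prob_spaceI) (simp add: space_restrict_space emeasure_restrict_space)

lemma measurable_unit_interval: "f \<in> borel_measurable borel \<Longrightarrow> f \<in> borel_measurable unit_interval"
  unfolding unit_interval_def by (intro measurable_restrict_space1) simp

lemma has_integral_unit_interval:
  fixes f :: "real \<Rightarrow> real"
  assumes "(f has_integral I) {0..1}" and cont: "continuous_on {0..1} f"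
  shows "integrable unit_interval f" "(\<integral>t. f t \<partial>unit_interval) = I"
proof -
  have "set_integrable lborel {0..1} f"
    using cont by (intro borel_integrable_compact[unfolded set_integrable_def[symmetric]]) (auto simp: set_integrable_def)
  then show "integrable unit_interval f"
    by (simp add: unit_interval_def integrable_restrict_space set_integrable_def)
  show "(\<integral>t. f t \<partial>unit_interval) = I"
    using set_borel_integral_eq_integral(2)[OF \<open>set_integrable lborel {0..1} f\<close>] assms(1)
    by (simp add: unit_interval_def integral_restrict_space set_lebesgue_integral_def integral_unique)
qed

lemma mean_value_Re_poly:
  fixes P :: "complex poly"
  shows "(\<integral>t. Re (poly P (cis (2 * pi * t))) \<partial>unit_interval) = Re (poly P 0)"
    and "integrable unit_interval (\<lambda>t. Re (poly P (cis (2 * pi * t))))"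
proof -
  have "((\<lambda>u. poly P u / (u - 0)) has_contour_integral (2 * of_real pi * \<i> * poly P 0)) (circlepath 0 1)"
    by (rule Cauchy_integral_circlepath_simple) (auto intro!: holomorphic_intros)
  then have "((\<lambda>t. (poly P (circlepath 0 1 t) / circlepath 0 1 t) * (2 * pi * \<i> * exp (2 * of_real pi * \<i> * t)))
      has_integral (2 * of_real pi * \<i> * poly P 0)) {0..1}"
    unfolding has_contour_integral_def
    by (rule has_integral_eq[rotated]) (simp add: vector_derivative_circlepath01)
  then have "((\<lambda>t. (1 / (2 * of_real pi * \<i>)) * ((poly P (circlepath 0 1 t) / circlepath 0 1 t) * (2 * pi * \<i> * exp (2 * of_real pi * \<i> * t))))
      has_integral (1 / (2 * of_real pi * \<i>)) * (2 * of_real pi * \<i> * poly P 0)) {0..1}"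
    by (rule has_integral_mult_right)
  moreover have "(1 / (2 * of_real pi * \<i>)) * ((poly P (circlepath 0 1 t) / circlepath 0 1 t) * (2 * pi * \<i> * exp (2 * of_real pi * \<i> * t)))
     = poly P (cis (2 * pi * t))" for t
  proof -
    have "circlepath 0 1 t = cis (2 * pi * t)" "exp (2 * of_real pi * \<i> * t) = cis (2 * pi * t)"
      by (simp_all add: circlepath cis_conv_exp mult_ac)
    then show ?thesis by (simp add: field_simps)
  qed
  ultimately have "((\<lambda>t. poly P (cis (2 * pi * t))) has_integral poly P 0) {0..1}" by simp
  then have "((\<lambda>t. Re (poly P (cis (2 * pi * t)))) has_integral Re (poly P 0)) {0..1}"
    by (rule has_integral_Re)
  moreover have "continuous_on {0..1} (\<lambda>t. Re (poly P (cis (2 * pi * t))))" by (auto intro!: continuous_intros)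
  ultimately show "(\<integral>t. Re (poly P (cis (2 * pi * t))) \<partial>unit_interval) = Re (poly P 0)"
    "integrable unit_interval (\<lambda>t. Re (poly P (cis (2 * pi * t))))"
    by (fact has_integral_unit_interval(2), fact has_integral_unit_interval(1))
qed

text \<open>Approximate \<open>ln \<bar>g\<bar>\<close>, truncated below to keep it continuous, on the circle of radius \<open>\<rho>\<close> by
  \<open>Re P\<close>. The maximum principle for \<open>g exp (- P)\<close> bounds \<open>ln \<bar>g 0\<bar>\<close> by \<open>Re (P 0)\<close> up to the error,
  and the latter is the mean of \<open>Re P\<close> over the circle.\<close>

lemma log_subharmonic_mean:
  fixes g :: "complex \<Rightarrow> complex" and \<rho> \<delta> :: real
  assumes hol: "g holomorphic_on ball 0 1" and \<rho>: "0 < \<rho>" "\<rho> < 1" and \<delta>: "0 < \<delta>" and nz: "g 0 \<noteq> 0"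
  shows "ln (norm (g 0)) \<le> (\<integral>t. ln (max (norm (g (\<rho> * cis (2 * pi * t)))) \<delta>) \<partial>unit_interval)"
proof (rule field_le_epsilon)
  fix e :: real assume "0 < e"
  define h where "h z = ln (max (norm (g (\<rho> * z))) \<delta>)" for z :: complex
  have sub: "of_real \<rho> * z \<in> ball 0 1" if "z \<in> cball 0 1" for z :: complex
  proof -
    have "norm (of_real \<rho> * z) \<le> \<rho> * 1" using that \<rho> by (simp add: norm_mult del: mult_1_right)
    then show ?thesis using \<rho> by simp
  qed
  have gc: "continuous_on (cball 0 1) (\<lambda>z. g (of_real \<rho> * z))"
    by (rule continuous_on_compose2[OF holomorphic_on_imp_continuous_on[OF hol]])
      (use sub in \<open>auto intro!: continuous_intros\<close>)
  have hc: "continuous_on (cball 0 1) h"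
    unfolding h_def using \<delta> by (intro continuous_intros gc) auto
  have "continuous_on (sphere 0 1) h" using hc by (rule continuous_on_subset) auto
  then obtain P where P: "\<And>z. norm z = 1 \<Longrightarrow> \<bar>h z - Re (poly P z)\<bar> < e / 2"
    using circle_approx_Re_poly[of h "e / 2"] \<open>0 < e\<close> by auto
  have "norm (g (of_real \<rho> * 0) * exp (- poly P 0)) \<le> exp (e / 2)"
  proof (rule maximum_modulus_frontier[where f = "\<lambda>z. g (of_real \<rho> * z) * exp (- poly P z)" and S = "ball 0 1"])
    have "(\<lambda>z. g (of_real \<rho> * z)) holomorphic_on ball 0 1"
      by (rule holomorphic_on_compose_gen[OF _ hol, unfolded o_def]) (use sub in \<open>auto intro!: holomorphic_intros\<close>)
    then show "(\<lambda>z. g (of_real \<rho> * z) * exp (- poly P z)) holomorphic_on interior (ball 0 1)"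
      by (auto intro!: holomorphic_intros)
    show "continuous_on (closure (ball 0 1)) (\<lambda>z. g (of_real \<rho> * z) * exp (- poly P z))"
      using gc by (auto intro!: continuous_intros)
    fix z :: complex assume "z \<in> frontier (ball 0 1)"
    then have z: "norm z = 1" by simp
    have "norm (g (of_real \<rho> * z)) \<le> exp (h z)" using \<delta> by (simp add: h_def)
    then have "norm (g (of_real \<rho> * z) * exp (- poly P z)) \<le> exp (h z) * exp (- Re (poly P z))"
      by (simp add: norm_mult)
    also have "\<dots> \<le> exp (e / 2)" using abs_le_D1[OF less_imp_le[OF P[OF z]]] by (simp flip: exp_add)
    finally show "norm (g (of_real \<rho> * z) * exp (- poly P z)) \<le> exp (e / 2)" .
  qed auto
  then have "norm (g 0) * exp (- Re (poly P 0)) \<le> exp (e / 2)" by (simp add: norm_mult)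
  then have "norm (g 0) \<le> exp (e / 2) * exp (Re (poly P 0))" by (simp add: exp_minus field_simps)
  then have "norm (g 0) \<le> exp (e / 2 + Re (poly P 0))" by (simp only: exp_add)
  then have "ln (norm (g 0)) \<le> ln (exp (e / 2 + Re (poly P 0)))" using nz by (subst ln_le_cancel_iff) auto
  then have 1: "ln (norm (g 0)) \<le> e / 2 + Re (poly P 0)" by simp
  have hcis: "continuous_on {0..1} (\<lambda>t. h (cis (2 * pi * t)))"
    by (rule continuous_on_compose2[OF hc]) (auto intro!: continuous_intros)
  then have hI: "integrable unit_interval (\<lambda>t. h (cis (2 * pi * t)))"
    using has_integral_unit_interval(1)[OF integrable_integral[OF integrable_continuous_real]] by blast
  interpret D: prob_space unit_interval by (rule prob_space_unit_interval)
  have "Re (poly P 0) = (\<integral>t. Re (poly P (cis (2 * pi * t))) \<partial>unit_interval)"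
    by (simp add: mean_value_Re_poly)
  also have "\<dots> \<le> (\<integral>t. h (cis (2 * pi * t)) + e / 2 \<partial>unit_interval)"
  proof (rule integral_mono)
    show "Re (poly P (cis (2 * pi * t))) \<le> h (cis (2 * pi * t)) + e / 2" for t
      using P[of "cis (2 * pi * t)", OF norm_cis] unfolding abs_less_iff by linarith
  qed (use hI mean_value_Re_poly in auto)
  also have "\<dots> = (\<integral>t. h (cis (2 * pi * t)) \<partial>unit_interval) + e / 2"
    using hI D.prob_space by (simp add: Bochner_Integration.integral_add)
  finally show "ln (norm (g 0)) \<le> (\<integral>t. ln (max (norm (g (\<rho> * cis (2 * pi * t)))) \<delta>) \<partial>unit_interval) + e"
    using 1 by (simp add: h_def)
qed

section \<open>A three lines estimate with integral means\<close>

lemma measurable_ident_unit_interval: "(\<lambda>t. t) \<in> borel_measurable unit_interval"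
  by (rule measurable_unit_interval) simp

lemma AE_unit_interval_interior: "AE t in unit_interval. 0 < t \<and> t < 1 \<and> t \<noteq> \<theta>"
proof -
  have "AE t in lborel. t \<noteq> 0 \<and> t \<noteq> \<theta> \<and> t \<noteq> (1::real)"
    by (intro AE_conjI AE_lborel_singleton)
  then have "AE t in lborel. t \<in> {0..1} \<longrightarrow> 0 < t \<and> t < 1 \<and> t \<noteq> \<theta>"
    by eventually_elim auto
  then show ?thesis unfolding unit_interval_def by (subst AE_restrict_space_iff) auto
qed

lemma integral_unit_interval_split:
  assumes "0 < \<theta>" "\<theta> < 1"
  shows "(\<integral>t. (if t < \<theta> then A else B) \<partial>unit_interval) = \<theta> * A + (1 - \<theta>) * (B::real)"
    and "integrable unit_interval (\<lambda>t. if t < \<theta> then A else B)"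
proof -
  interpret D: prob_space unit_interval by (rule prob_space_unit_interval)
  have [simp]: "measure unit_interval {0..<\<theta>} = \<theta>" "measure unit_interval {\<theta>..1} = 1 - \<theta>"
    using assms by (auto simp: unit_interval_def measure_restrict_space subset_iff)
  have [simp]: "{0..<\<theta>} \<inter> {0..1} = {0..<\<theta>}" "max \<theta> 0 = \<theta>" using assms by auto
  have [measurable]: "{0..<\<theta>} \<in> sets unit_interval" "{\<theta>..1} \<in> sets unit_interval"
    using assms by (auto simp: sets_unit_interval sets_restrict_space image_iff intro!: exI[of _ "{0..<\<theta>}"] exI[of _ "{\<theta>..1}"])
  have [simp]: "integrable unit_interval (indicat_real {0..<\<theta>})" "integrable unit_interval (indicat_real {\<theta>..1})"
    by (auto intro!: integrable_real_indicator simp: D.emeasure_eq_measure)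
  have eq: "(if t < \<theta> then A else B) = A * indicator {0..<\<theta>} t + B * indicator {\<theta>..1} t"
    if "t \<in> space unit_interval" for t using that by (auto simp: indicator_def)
  have "(\<integral>t. (if t < \<theta> then A else B) \<partial>unit_interval) = (\<integral>t. A * indicator {0..<\<theta>} t + B * indicator {\<theta>..1} t \<partial>unit_interval)"
    by (rule Bochner_Integration.integral_cong[OF refl eq])
  also have "\<dots> = A * \<theta> + B * (1 - \<theta>)"
    by (subst Bochner_Integration.integral_add) (auto simp: D.emeasure_eq_measure intro!: integrable_mult_right)
  finally show "(\<integral>t. (if t < \<theta> then A else B) \<partial>unit_interval) = \<theta> * A + (1 - \<theta>) * B"
    by (simp add: mult.commute)
  show "integrable unit_interval (\<lambda>t. if t < \<theta> then A else B)"
    by (subst Bochner_Integration.integrable_cong[OF refl eq])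
      (auto intro!: Bochner_Integration.integrable_add integrable_mult_right)
qed

text \<open>Jensen's inequality for the logarithm, with the probability density that is \<open>r / q\<close> on \<open>[0, \<theta>)\<close>
  and \<open>r / p\<close> on the rest; the relation between the exponents says exactly that its integral is 1.
  The constants \<open>a\<close> and \<open>b\<close> are free: a suitable choice yields a multiplicative estimate in the end.\<close>

lemma two_arc_Jensen:
  fixes k :: "real \<Rightarrow> real"
  assumes \<theta>: "0 < \<theta>" "\<theta> < 1" and pos: "0 < p" "0 < q" "0 < r" "0 < a" "0 < b"
    and r: "1 / r = (1 - \<theta>) / p + \<theta> / q"
    and [measurable]: "k \<in> borel_measurable unit_interval"
    and k: "\<And>t. t \<in> {0..1} \<Longrightarrow> \<delta> \<le> k t" "\<And>t. t \<in> {0..1} \<Longrightarrow> k t \<le> C" and \<delta>: "0 < \<delta>"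
    and g: "0 < g" "ln g \<le> (\<integral>t. ln (k t) \<partial>unit_interval)"
  shows "g powr r \<le> a powr ((1 - \<theta>) * r / p) * b powr (\<theta> * r / q) *
    (\<integral>t. (if t < \<theta> then r / q * (k t powr q / b) else r / p * (k t powr p / a)) \<partial>unit_interval)"
proof -
  interpret D: prob_space unit_interval by (rule prob_space_unit_interval)
  note measurable_ident_unit_interval [measurable]
  define c where "c t = (if t < \<theta> then r / q else r / p)" for t
  define y where "y t = (if t < \<theta> then k t powr q / b else k t powr p / a)" for t
  define l where "l t = (if t < \<theta> then r / q * ln b else r / p * ln a)" for t
  have C: "\<delta> \<le> C" using k[of 0] by simp
  have sum1: "(1 - \<theta>) * r / p + \<theta> * r / q = 1"
    using r pos by (simp add: field_simps)
  have [measurable]: "c \<in> borel_measurable unit_interval" "y \<in> borel_measurable unit_interval"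
    unfolding c_def y_def by measurable
  have cy: "(if t < \<theta> then r / q * (k t powr q / b) else r / p * (k t powr p / a)) = c t * y t" for t
    by (simp add: c_def y_def)
  have ypos: "0 < y t" if "t \<in> {0..1}" for t
    using k(1)[OF that] \<delta> pos by (auto simp: y_def)
  have cpos: "0 < c t" for t using pos by (auto simp: c_def)
  have cyI: "integrable unit_interval (\<lambda>t. c t * y t)"
  proof (rule D.integrable_const_bound[where B = "max (r/q * (C powr q / b)) (r/p * (C powr p / a))"])
    show "AE t in unit_interval. norm (c t * y t) \<le> max (r/q * (C powr q / b)) (r/p * (C powr p / a))"
    proof (rule AE_I2)
      fix t assume t: "t \<in> space unit_interval"
      have "k t powr q \<le> C powr q" "k t powr p \<le> C powr p"
        using k[of t] t \<delta> pos by (auto intro!: powr_mono2)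
      then have "c t * y t \<le> max (r/q * (C powr q / b)) (r/p * (C powr p / a))"
        using pos by (auto simp: c_def y_def le_max_iff_disj divide_right_mono mult_left_mono)
      moreover have "0 \<le> c t * y t" using ypos[of t] t cpos[of t] by (simp add: less_imp_le)
      ultimately show "norm (c t * y t) \<le> max (r/q * (C powr q / b)) (r/p * (C powr p / a))" by simp
    qed
  qed measurable
  have lnI: "integrable unit_interval (\<lambda>t. ln (k t))"
  proof (rule D.integrable_const_bound[where B = "max \<bar>ln \<delta>\<bar> \<bar>ln C\<bar>"])
    show "AE t in unit_interval. norm (ln (k t)) \<le> max \<bar>ln \<delta>\<bar> \<bar>ln C\<bar>"
    proof (rule AE_I2)
      fix t assume t: "t \<in> space unit_interval"
      then have "ln \<delta> \<le> ln (k t)" "ln (k t) \<le> ln C" using k[of t] \<delta> by auto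
      then show "norm (ln (k t)) \<le> max \<bar>ln \<delta>\<bar> \<bar>ln C\<bar>" by auto
    qed
  qed measurable
  define Y where "Y = (\<integral>t. c t * y t \<partial>unit_interval)"
  have Y: "0 < Y"
  proof -
    have "Y > 0 \<longleftrightarrow> Y \<noteq> 0"
      unfolding Y_def using ypos cpos by (metis (no_types, lifting) integral_nonneg_AE AE_I2 less_imp_le mult_pos_pos order_less_le space_unit_interval)
    moreover have "Y \<noteq> 0"
    proof
      assume "Y = 0"
      then have "AE t in unit_interval. c t * y t = 0"
        unfolding Y_def using cyI ypos cpos
        by (subst (asm) integral_nonneg_eq_0_iff_AE) (auto simp: less_imp_le)
      then have "AE t in unit_interval. False"
        using AE_space
      proof eventually_elim
        case (elim t)
        then show ?case using ypos[of t] cpos[of t] by auto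
      qed
      then show False using D.AE_False by blast
    qed
    ultimately show ?thesis by blast
  qed
  have cI: "integrable unit_interval c" "(\<integral>t. c t \<partial>unit_interval) = 1"
    using integral_unit_interval_split[OF \<theta>, of "r / q" "r / p"] sum1
    unfolding c_def by (auto simp: mult.commute)
  have lI: "integrable unit_interval l" "(\<integral>t. l t \<partial>unit_interval) = \<theta> * r / q * ln b + (1 - \<theta>) * r / p * ln a"
    using integral_unit_interval_split[OF \<theta>, of "r / q * ln b" "r / p * ln a"]
    unfolding l_def by auto
  \<comment> \<open>The tangent of the logarithm at \<open>Y\<close> lies above it; against \<open>c\<close>, its linear part \<open>y / Y - 1\<close> integrates to 0.\<close>
  have pw: "r * ln (k t) \<le> c t * (ln Y - 1) + c t * y t / Y + l t" if t: "t \<in> {0..1}" for t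
  proof -
    have kt: "0 < k t" using k(1)[OF t] \<delta> by simp
    have "ln (y t / Y) \<le> y t / Y - 1" using ypos[OF t] Y by (intro ln_le_minus_one) simp
    then have "ln (y t) \<le> ln Y + y t / Y - 1" using ypos[OF t] Y by (simp add: ln_div)
    then have "c t * ln (y t) \<le> c t * (ln Y + y t / Y - 1)" using cpos[of t] by (intro mult_left_mono) auto
    moreover have "r * ln (k t) = c t * ln (y t) + l t"
      using kt pos by (auto simp: c_def y_def l_def ln_div ln_powr field_simps)
    ultimately show ?thesis by (simp add: algebra_simps)
  qed
  have "r * ln g \<le> (\<integral>t. r * ln (k t) \<partial>unit_interval)" using g(2) pos by simp
  also have "\<dots> \<le> (\<integral>t. c t * (ln Y - 1) + c t * y t / Y + l t \<partial>unit_interval)"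
    using lnI cI cyI lI pw by (intro integral_mono) auto
  also have "\<dots> = (ln Y - 1) + Y / Y + (\<theta> * r / q * ln b + (1 - \<theta>) * r / p * ln a)"
    using cI cyI lI by (simp add: Y_def Bochner_Integration.integral_add)
  also have "\<dots> = ln (a powr ((1 - \<theta>) * r / p) * b powr (\<theta> * r / q) * Y)"
    using Y pos by (simp add: ln_mult ln_powr)
  finally have "ln (g powr r) \<le> ln (a powr ((1 - \<theta>) * r / p) * b powr (\<theta> * r / q) * Y)"
    using g by (simp add: ln_powr)
  then show ?thesis
    unfolding cy Y_def[symmetric] using g Y pos by (subst (asm) ln_le_cancel_iff) auto
qed

text \<open>The conformal map of the unit disc onto the strip \<open>0 < Re z < 1\<close> that sends 0 to \<open>\<theta>\<close>. The arc
  from 1 to \<open>cis (2 * pi * \<theta>)\<close>, of normalized length \<open>\<theta>\<close>, corresponds to the edge \<open>Re z = 1\<close>, and the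
  complementary arc to the edge \<open>Re z = 0\<close>. The formula needs only logarithms on the right half-plane.\<close>

definition strip_map :: "real \<Rightarrow> complex \<Rightarrow> complex" where
  "strip_map \<theta> z = of_real \<theta> + (Ln (1 - z * cis (- 2 * pi * \<theta>)) - Ln (1 - z)) / (pi * \<i>)"

lemma strip_map_0: "strip_map \<theta> 0 = of_real \<theta>"
  by (simp add: strip_map_def)

lemma Re_strip_map:
  "Re (strip_map \<theta> z) = \<theta> + (Im (Ln (1 - z * cis (- 2 * pi * \<theta>))) - Im (Ln (1 - z))) / pi"
  by (simp add: strip_map_def Re_divide)
     (simp add: power2_eq_square field_simps)

lemma Re_one_minus_pos:
  assumes "norm z < 1"
  shows "0 < Re (1 - z)"
  using complex_Re_le_cmod[of z] assms by simp

lemma strip_map_holomorphic: "strip_map \<theta> holomorphic_on ball 0 1"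
proof -
  have "1 - z \<notin> \<real>\<^sub>\<le>\<^sub>0" "1 - z * cis (- 2 * pi * \<theta>) \<notin> \<real>\<^sub>\<le>\<^sub>0" if "z \<in> ball 0 1" for z
    using Re_one_minus_pos[of z] Re_one_minus_pos[of "z * cis (- 2 * pi * \<theta>)"] that
    by (auto simp: complex_nonpos_Reals_iff norm_mult)
  then show ?thesis unfolding strip_map_def by (auto intro!: holomorphic_intros)
qed

text \<open>Each of the two logarithms has an imaginary part of modulus less than \<open>pi / 2\<close>. This bound suffices
  for dominated convergence.\<close>

lemma Re_strip_map_bound:
  assumes "norm z < 1"
  shows "\<bar>Re (strip_map \<theta> z) - \<theta>\<bar> \<le> 1"
proof -
  have "0 < Re (1 - z * cis (- 2 * pi * \<theta>))" "0 < Re (1 - z)"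
    using assms by (intro Re_one_minus_pos; simp add: norm_mult)+
  then have "\<bar>Im (Ln (1 - z * cis (- 2 * pi * \<theta>)))\<bar> < pi / 2"  "\<bar>Im (Ln (1 - z))\<bar> < pi / 2"
    using Re_Ln_pos_lt_imp by blast+
  then have "\<bar>Im (Ln (1 - z * cis (- 2 * pi * \<theta>))) - Im (Ln (1 - z))\<bar> \<le> pi" by linarith
  then show ?thesis unfolding Re_strip_map by (simp add: abs_divide)
qed

text \<open>Because \<open>1 - cis s = 2 sin (s / 2) cis ((s - pi) / 2)\<close> with a positive first factor.\<close>

lemma Im_Ln_one_minus_cis:
  assumes "0 < s" "s < 2 * pi"
  shows "Im (Ln (1 - cis s)) = (s - pi) / 2"
proof -
  have sp: "0 < sin (s / 2)" using assms by (intro sin_gt_zero) auto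
  have "1 - cis s = of_real (2 * sin (s / 2)) * cis ((s - pi) / 2)"
  proof -
    have "cis ((s - pi) / 2) = Complex (sin (s / 2)) (- cos (s / 2))"
      by (simp add: diff_divide_distrib cis.ctr cos_diff sin_diff)
    moreover have "cos s = 1 - 2 * (sin (s / 2))\<^sup>2" "sin s = 2 * sin (s / 2) * cos (s / 2)"
      using cos_double_sin[of "s/2"] sin_double[of "s/2"] by auto
    ultimately show ?thesis by (simp add: complex_eq_iff power2_eq_square)
  qed
  then have "Ln (1 - cis s) = Ln (of_real (2 * sin (s / 2)) * exp (\<i> * ((s - pi) / 2)))"
    by (simp add: cis_conv_exp)
  also have "\<dots> = Ln (exp (of_real (ln (2 * sin (s / 2))) + \<i> * ((s - pi) / 2)))"
    using sp by (subst exp_add, subst exp_of_real) simp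
  also have "\<dots> = of_real (ln (2 * sin (s / 2))) + \<i> * ((s - pi) / 2)"
    using assms by (intro Ln_exp) auto
  finally show ?thesis by simp
qed

lemma Re_strip_map_boundary:
  assumes \<theta>: "0 < \<theta>" "\<theta> < 1"
  shows "0 < t \<Longrightarrow> t < \<theta> \<Longrightarrow> Re (strip_map \<theta> (cis (2 * pi * t))) = 1"
    and "\<theta> < t \<Longrightarrow> t < 1 \<Longrightarrow> Re (strip_map \<theta> (cis (2 * pi * t))) = 0"
proof -
  have c: "cis (2 * pi * t) * cis (- 2 * pi * \<theta>) = cis (2 * pi * (t - \<theta>))"
    by (simp add: cis_mult algebra_simps)
  have c': "cis (2 * pi * (t - \<theta>)) = cis (2 * pi * (t - \<theta> + 1))"
    by (simp add: distrib_left flip: cis_mult)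
  show "Re (strip_map \<theta> (cis (2 * pi * t))) = 1" if t: "0 < t" "t < \<theta>"
  proof -
    have "Im (Ln (1 - cis (2 * pi * (t - \<theta> + 1)))) = (2 * pi * (t - \<theta> + 1) - pi) / 2"
      using t \<theta> by (intro Im_Ln_one_minus_cis) auto
    moreover have "Im (Ln (1 - cis (2 * pi * t))) = (2 * pi * t - pi) / 2"
      using t \<theta> by (intro Im_Ln_one_minus_cis) auto
    ultimately show ?thesis unfolding Re_strip_map c c' by (simp add: field_simps)
  qed
  show "Re (strip_map \<theta> (cis (2 * pi * t))) = 0" if t: "\<theta> < t" "t < 1"
  proof -
    have "Im (Ln (1 - cis (2 * pi * (t - \<theta>)))) = (2 * pi * (t - \<theta>) - pi) / 2"
      using t \<theta> by (intro Im_Ln_one_minus_cis) auto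
    moreover have "Im (Ln (1 - cis (2 * pi * t))) = (2 * pi * t - pi) / 2"
      using t \<theta> by (intro Im_Ln_one_minus_cis) auto
    ultimately show ?thesis unfolding Re_strip_map c by (simp add: field_simps)
  qed
qed

lemma isCont_strip_map_boundary:
  assumes "0 < \<theta>" "\<theta> < 1" "0 < t" "t < 1" "t \<noteq> \<theta>"
  shows "isCont (strip_map \<theta>) (cis (2 * pi * t))"
proof -
  have *: "1 - cis (2 * pi * x) \<notin> \<real>\<^sub>\<le>\<^sub>0" if "x \<in> {-1<..<1}" "x \<noteq> 0" for x
  proof -
    have "cos (2 * pi * x) < 1"
    proof (rule ccontr)
      assume "\<not> cos (2 * pi * x) < 1"
      then have "cos (2 * pi * x) = 1" using cos_le_one[of "2 * pi * x"] by linarith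
      then obtain n :: int where "2 * pi * x = of_int n * 2 * pi" using cos_one_2pi_int by blast
      then have "x = of_int n" by (simp add: field_simps)
      then show False using that by auto
    qed
    then show ?thesis by (simp add: complex_nonpos_Reals_iff)
  qed
  have c: "cis (2 * pi * t) * cis (- 2 * pi * \<theta>) = cis (2 * pi * (t - \<theta>))"
    by (simp add: cis_mult algebra_simps)
  have "1 - cis (2 * pi * t) \<notin> \<real>\<^sub>\<le>\<^sub>0" "1 - cis (2 * pi * t) * cis (- 2 * pi * \<theta>) \<notin> \<real>\<^sub>\<le>\<^sub>0"
    unfolding c using assms by (intro *[of t] *[of "t - \<theta>"]; simp)+
  then show ?thesis unfolding strip_map_def by (auto intro!: continuous_intros)
qed

lemma borel_measurable_strip_map_cis [measurable]:
  "(\<lambda>t. strip_map \<theta> (cis (2 * pi * t))) \<in> borel_measurable borel"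
proof -
  have [measurable]: "(\<lambda>t. cis (2 * pi * t)) \<in> borel_measurable borel"
    by (intro borel_measurable_continuous_onI continuous_intros)
  show ?thesis unfolding strip_map_def by measurable
qed

text \<open>The function \<open>G\<close> on the disc has value \<open>\<Sum>k\<in>I. Cc k\<close> at 0. Its log-subharmonicity on circles of
  radius less than 1 and Jensen's inequality give the estimate with \<open>G\<close> truncated from below; radius
  1 and truncation 0 are reached by dominated convergence.\<close>

lemma strip_function_bound:
  fixes Cc :: "'k \<Rightarrow> complex" and B :: "'k \<Rightarrow> real"
  assumes \<theta>: "0 < \<theta>" "\<theta> < 1" and pos: "0 < p" "0 < q" "0 < r" "0 < a" "0 < b"
    and r: "1 / r = (1 - \<theta>) / p + \<theta> / q" and I: "finite I"
  defines "G \<equiv> \<lambda>z. \<Sum>k\<in>I. Cc k * exp (of_real (B k) * (strip_map \<theta> z - of_real \<theta>))"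
  shows "norm (\<Sum>k\<in>I. Cc k) powr r \<le> a powr ((1 - \<theta>) * r / p) * b powr (\<theta> * r / q) *
    (\<integral>t. (if t < \<theta> then r / q * (norm (G (cis (2 * pi * t))) powr q / b)
          else r / p * (norm (G (cis (2 * pi * t))) powr p / a)) \<partial>unit_interval)"
proof (cases "(\<Sum>k\<in>I. Cc k) = 0")
  case True
  then have "norm (\<Sum>k\<in>I. Cc k) powr r = 0" by simp
  also have "0 \<le> a powr ((1 - \<theta>) * r / p) * b powr (\<theta> * r / q) *
    (\<integral>t. (if t < \<theta> then r / q * (norm (G (cis (2 * pi * t))) powr q / b)
          else r / p * (norm (G (cis (2 * pi * t))) powr p / a)) \<partial>unit_interval)"
    using pos by (intro mult_nonneg_nonneg integral_nonneg_AE AE_I2) auto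
  finally show ?thesis .
next
  case False
  interpret D: prob_space unit_interval by (rule prob_space_unit_interval)
  note measurable_ident_unit_interval [measurable]
  have G0: "G 0 = (\<Sum>k\<in>I. Cc k)" by (simp add: G_def strip_map_0)
  have hol: "G holomorphic_on ball 0 1"
    unfolding G_def by (intro holomorphic_intros strip_map_holomorphic)
  define M where "M = max 1 (\<Sum>k\<in>I. norm (Cc k) * exp \<bar>B k\<bar>)"
  have M1: "1 \<le> M" by (simp add: M_def)
  have GM: "norm (G z) \<le> M" if "norm z < 1" for z
  proof -
    have "norm (G z) \<le> (\<Sum>k\<in>I. norm (Cc k) * exp \<bar>B k\<bar>)"
      unfolding G_def
    proof (rule sum_norm_le)
      fix k assume "k \<in> I"
      have "B k * (Re (strip_map \<theta> z) - \<theta>) \<le> \<bar>B k\<bar> * \<bar>Re (strip_map \<theta> z) - \<theta>\<bar>"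
        by (metis abs_ge_self abs_mult)
      also have "\<dots> \<le> \<bar>B k\<bar> * 1" using Re_strip_map_bound[OF that] by (intro mult_left_mono) auto
      finally show "norm (Cc k * exp (of_real (B k) * (strip_map \<theta> z - of_real \<theta>))) \<le> norm (Cc k) * exp \<bar>B k\<bar>"
        by (simp add: norm_mult mult_left_mono)
    qed
    then show ?thesis by (simp add: M_def)
  qed
  define \<rho> where "\<rho> n = 1 - 1 / (real n + 2)" for n :: nat
  define \<delta> where "\<delta> n = 1 / (real n + 2)" for n :: nat
  have \<rho>: "0 < \<rho> n" "\<rho> n < 1" for n by (auto simp: \<rho>_def field_simps)
  have \<delta>: "0 < \<delta> n" "\<delta> n \<le> 1" for n by (auto simp: \<delta>_def field_simps)
  define k where "k n t = max (norm (G (\<rho> n * cis (2 * pi * t)))) (\<delta> n)" for n t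
  have \<rho>c: "norm (\<rho> n * cis x) < 1" for n x using \<rho>[of n] by (simp add: norm_mult)
  have kle: "k n t \<le> M" for n t
    using GM[OF \<rho>c, of n "2 * pi * t"] order_trans[OF \<delta>(2)[of n] M1] by (simp add: k_def)
  have [measurable]: "(\<lambda>t. k n t) \<in> borel_measurable unit_interval" for n
  proof (rule measurable_unit_interval, rule borel_measurable_continuous_onI)
    have "continuous_on UNIV (\<lambda>t. G (\<rho> n * cis (2 * pi * t)))"
      by (rule continuous_on_compose2[OF holomorphic_on_imp_continuous_on[OF hol]])
        (use \<rho>c in \<open>auto intro!: continuous_intros simp: norm_mult\<close>)
    then show "continuous_on UNIV (k n)" unfolding k_def by (intro continuous_intros)
  qed
  define J where "J f t = (if t < \<theta> then r / q * (f t powr q / b) else r / p * (f t powr p / a))" for f :: "real \<Rightarrow> real" and t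
  have main: "norm (\<Sum>k\<in>I. Cc k) powr r \<le> a powr ((1 - \<theta>) * r / p) * b powr (\<theta> * r / q) *
      (\<integral>t. J (k n) t \<partial>unit_interval)" for n
    unfolding J_def
  proof (rule two_arc_Jensen[OF \<theta> pos r])
    show "ln (norm (\<Sum>k\<in>I. Cc k)) \<le> (\<integral>t. ln (k n t) \<partial>unit_interval)"
      using log_subharmonic_mean[OF hol \<rho>[of n] \<delta>(1)[of n]] False by (simp add: G0 k_def)
    show "\<delta> n \<le> k n t" for t by (simp add: k_def)
  qed (use False kle \<delta> in auto)
  have "(\<lambda>n. \<integral>t. J (k n) t \<partial>unit_interval) \<longlonglongrightarrow> (\<integral>t. J (\<lambda>t. norm (G (cis (2 * pi * t)))) t \<partial>unit_interval)"
  proof (rule integral_dominated_convergence)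
    show "integrable unit_interval (\<lambda>t. r / q * (M powr q / b) + r / p * (M powr p / a))" by simp
    have [measurable]: "(\<lambda>t. G (cis (2 * pi * t))) \<in> borel_measurable unit_interval"
      by (rule measurable_unit_interval) (unfold G_def, measurable)
    show "J (\<lambda>t. norm (G (cis (2 * pi * t)))) \<in> borel_measurable unit_interval"
      unfolding J_def by measurable
    show "J (k n) \<in> borel_measurable unit_interval" for n unfolding J_def by measurable
    show "AE t in unit_interval. norm (J (k n) t) \<le> r / q * (M powr q / b) + r / p * (M powr p / a)" for n
    proof (rule AE_I2)
      fix t
      have "k n t powr q \<le> M powr q" "k n t powr p \<le> M powr p"
        using kle[of n t] pos by (auto intro!: powr_mono2 simp: k_def le_max_iff_disj)
      then have "r / q * (k n t powr q / b) \<le> r / q * (M powr q / b)" "r / p * (k n t powr p / a) \<le> r / p * (M powr p / a)"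
        using pos by (auto intro!: mult_left_mono divide_right_mono)
      moreover have "0 \<le> r / q * (k n t powr q / b)" "0 \<le> r / p * (k n t powr p / a)"
        using pos by auto
      ultimately show "norm (J (k n) t) \<le> r / q * (M powr q / b) + r / p * (M powr p / a)"
        by (auto simp: J_def)
    qed
    show "AE t in unit_interval. (\<lambda>n. J (k n) t) \<longlonglongrightarrow> J (\<lambda>t. norm (G (cis (2 * pi * t)))) t"
      using AE_unit_interval_interior[of \<theta>]
    proof eventually_elim
      case (elim t)
      then have t: "0 < t" "t < 1" "t \<noteq> \<theta>" by auto
      have "isCont G (cis (2 * pi * t))"
        unfolding G_def using isCont_strip_map_boundary[OF \<theta> t] by (intro continuous_intros)
      moreover have "(\<lambda>n. \<rho> n * cis (2 * pi * t)) \<longlonglongrightarrow> of_real 1 * cis (2 * pi * t)"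
        unfolding \<rho>_def by (intro tendsto_intros) real_asymp
      ultimately have "(\<lambda>n. G (\<rho> n * cis (2 * pi * t))) \<longlonglongrightarrow> G (cis (2 * pi * t))"
        by (intro isCont_tendsto_compose[of _ G]) auto
      moreover have "\<delta> \<longlonglongrightarrow> 0" unfolding \<delta>_def by real_asymp
      ultimately have "(\<lambda>n. k n t) \<longlonglongrightarrow> max (norm (G (cis (2 * pi * t)))) 0"
        unfolding k_def by (intro tendsto_intros)
      then have lim: "(\<lambda>n. k n t) \<longlonglongrightarrow> norm (G (cis (2 * pi * t)))" by simp
      have nn: "eventually (\<lambda>n. 0 \<le> k n t) sequentially"
        by (simp add: k_def le_max_iff_disj)
      have "(\<lambda>n. k n t powr s) \<longlonglongrightarrow> norm (G (cis (2 * pi * t))) powr s" if "0 < s" for s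
        by (rule tendsto_powr2[OF lim tendsto_const nn that])
      then show ?case using pos lim nn unfolding J_def by (auto intro!: tendsto_intros)
    qed
  qed
  then have "(\<lambda>n. a powr ((1 - \<theta>) * r / p) * b powr (\<theta> * r / q) * (\<integral>t. J (k n) t \<partial>unit_interval))
    \<longlonglongrightarrow> a powr ((1 - \<theta>) * r / p) * b powr (\<theta> * r / q) * (\<integral>t. J (\<lambda>t. norm (G (cis (2 * pi * t)))) t \<partial>unit_interval)"
    by (intro tendsto_intros)
  then show ?thesis
    using main unfolding J_def by (intro LIMSEQ_le_const) auto
qed

lemma ennreal_integral_le_nn_integral:
  fixes f :: "'a \<Rightarrow> real"
  assumes "f \<in> borel_measurable M" "\<And>x. x \<in> space M \<Longrightarrow> 0 \<le> f x"
  shows "ennreal (\<integral>x. f x \<partial>M) \<le> (\<integral>\<^sup>+x. ennreal (f x) \<partial>M)"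
proof -
  have "(\<integral>x. f x \<partial>M) = enn2real (\<integral>\<^sup>+x. ennreal (f x) \<partial>M)"
    using assms by (intro integral_eq_nn_integral) auto
  then show ?thesis by (simp add: ennreal_enn2real_if)
qed

text \<open>The pointwise bound is used with constants that depend on \<open>x\<close> through the weights. Thereby the
  integrals over the two arcs become the endpoint norms after an exchange of the integrals over \<open>t\<close>
  and \<open>x\<close>, and the remaining constants multiply to the asserted bound.\<close>

lemma strip_interpolation:
  fixes g :: "'k \<Rightarrow> 'b \<Rightarrow> complex" and B :: "'k \<Rightarrow> real"
  assumes N: "sigma_finite_measure N" and I: "finite I"
    and g[measurable]: "\<And>k. k \<in> I \<Longrightarrow> g k \<in> borel_measurable N"
    and [measurable]: "w0 \<in> borel_measurable N" "v0 \<in> borel_measurable N" "u0 \<in> borel_measurable N"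
    and wts: "AE x in N. 0 < w0 x \<and> 0 < v0 x \<and> u0 x = w0 x powr (1 - \<theta>) * v0 x powr \<theta>"
    and \<theta>: "0 < \<theta>" "\<theta> < 1" and pos: "0 < p" "0 < q" "0 < r" "0 < A0" "0 < A1"
    and r: "1 / r = (1 - \<theta>) / p + \<theta> / q"
    and b0: "\<And>z. Re z = 0 \<Longrightarrow> Lpow N p w0 (\<lambda>x. \<Sum>k\<in>I. exp (of_real (B k) * (z - of_real \<theta>)) * g k x) \<le> ennreal A0"
    and b1: "\<And>z. Re z = 1 \<Longrightarrow> Lpow N q v0 (\<lambda>x. \<Sum>k\<in>I. exp (of_real (B k) * (z - of_real \<theta>)) * g k x) \<le> ennreal A1"
  shows "Lpow N r u0 (\<lambda>x. \<Sum>k\<in>I. g k x) \<le> ennreal (A0 powr ((1 - \<theta>) * r / p) * A1 powr (\<theta> * r / q))"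
proof -
  interpret D: prob_space unit_interval by (rule prob_space_unit_interval)
  interpret N: sigma_finite_measure N by (rule N)
  interpret P: pair_sigma_finite unit_interval N
    by (intro pair_sigma_finite.intro N) (rule prob_space_imp_sigma_finite[OF prob_space_unit_interval])
  note measurable_ident_unit_interval [measurable]
  define H where "H t x = (\<Sum>k\<in>I. exp (of_real (B k) * (strip_map \<theta> (cis (2 * pi * t)) - of_real \<theta>)) * g k x)" for t x
  define K where "K = A0 powr ((1 - \<theta>) * r / p) * A1 powr (\<theta> * r / q)"
  define J where "J t x = (if t < \<theta> then r / q * (norm (H t x * of_real (v0 x)) powr q / A1)
     else r / p * (norm (H t x * of_real (w0 x)) powr p / A0))" for t x
  have [measurable]: "(\<lambda>t. strip_map \<theta> (cis (2 * pi * t))) \<in> borel_measurable unit_interval"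
    by (rule measurable_unit_interval) measurable
  have Jm[measurable]: "(\<lambda>(t, x). J t x) \<in> borel_measurable (unit_interval \<Otimes>\<^sub>M N)"
    unfolding J_def H_def by measurable
  have Jnn: "0 \<le> J t x" for t x using pos by (auto simp: J_def)
  have ptwise: "AE x in N. ennreal (norm ((\<Sum>k\<in>I. g k x) * of_real (u0 x)) powr r) \<le>
      ennreal K * (\<integral>\<^sup>+t. ennreal (J t x) \<partial>unit_interval)"
    using wts AE_space
  proof eventually_elim
    case (elim x)
    \<comment> \<open>The product of the powers of \<open>a\<close> and \<open>b\<close> with \<open>u0 x powr r\<close> is the constant \<open>K\<close>.\<close>
    define a where "a = A0 / w0 x powr p"
    define b where "b = A1 / v0 x powr q"
    have ab: "0 < a" "0 < b" using elim pos by (auto simp: a_def b_def)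
    define S where "S = (\<integral>t. J t x \<partial>unit_interval)"
    have Jeq: "(if t < \<theta> then r / q * (norm (H t x) powr q / b) else r / p * (norm (H t x) powr p / a)) = J t x" for t
      using elim by (simp add: J_def a_def b_def norm_mult powr_mult)
    have Heq: "(\<Sum>k\<in>I. g k x * exp (of_real (B k) * (strip_map \<theta> (cis (2 * pi * t)) - of_real \<theta>))) = H t x" for t
      by (simp add: H_def mult.commute)
    have "norm (\<Sum>k\<in>I. g k x) powr r \<le> a powr ((1 - \<theta>) * r / p) * b powr (\<theta> * r / q) * S"
      using strip_function_bound[OF \<theta> pos(1-3) ab r I, of "\<lambda>k. g k x" B]
      unfolding Heq Jeq S_def[symmetric] .
    then have "norm (\<Sum>k\<in>I. g k x) powr r * u0 x powr r \<le> a powr ((1 - \<theta>) * r / p) * b powr (\<theta> * r / q) * S * u0 x powr r"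
      by (rule mult_right_mono) simp
    moreover have "a powr ((1 - \<theta>) * r / p) * b powr (\<theta> * r / q) * u0 x powr r = K"
      using elim pos by (simp add: a_def b_def K_def powr_divide powr_mult powr_powr)
    moreover have "norm ((\<Sum>k\<in>I. g k x) * of_real (u0 x)) powr r = norm (\<Sum>k\<in>I. g k x) powr r * u0 x powr r"
      using elim by (simp add: norm_mult powr_mult)
    ultimately have "norm ((\<Sum>k\<in>I. g k x) * of_real (u0 x)) powr r \<le> K * S"
      by (metis mult.assoc mult.commute)
    then have "ennreal (norm ((\<Sum>k\<in>I. g k x) * of_real (u0 x)) powr r) \<le> ennreal K * ennreal S"
      by (subst ennreal_mult[symmetric]) (auto simp: K_def S_def Jnn intro!: ennreal_leI integral_nonneg_AE)
    also have "ennreal S \<le> (\<integral>\<^sup>+t. ennreal (J t x) \<partial>unit_interval)"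
      unfolding S_def using elim(2) Jnn by (intro ennreal_integral_le_nn_integral) measurable
    finally show ?case by (simp add: mult_left_mono)
  qed
  define c where "c t = (if t < \<theta> then r / q else r / p)" for t
  have inner: "(\<integral>\<^sup>+x. ennreal (J t x) \<partial>N) \<le> ennreal (c t)" if t: "0 < t" "t < 1" "t \<noteq> \<theta>" for t
  proof (cases "t < \<theta>")
    case True
    have "(\<integral>\<^sup>+x. ennreal (J t x) \<partial>N) = (\<integral>\<^sup>+x. ennreal (r / q / A1) * ennreal (norm (H t x * of_real (v0 x)) powr q) \<partial>N)"
      using True pos by (intro nn_integral_cong) (simp add: J_def flip: ennreal_mult)
    also have "\<dots> = ennreal (r / q / A1) * Lpow N q v0 (H t)"
      unfolding Lpow_def H_def by (rule nn_integral_cmult) measurable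
    also have "\<dots> \<le> ennreal (r / q / A1) * ennreal A1"
      using b1[OF Re_strip_map_boundary(1)[OF \<theta> t(1) True]] unfolding H_def by (intro mult_left_mono) auto
    also have "\<dots> = ennreal (c t)" using True pos by (simp add: c_def flip: ennreal_mult)
    finally show ?thesis .
  next
    case False
    have "(\<integral>\<^sup>+x. ennreal (J t x) \<partial>N) = (\<integral>\<^sup>+x. ennreal (r / p / A0) * ennreal (norm (H t x * of_real (w0 x)) powr p) \<partial>N)"
      using False pos by (intro nn_integral_cong) (simp add: J_def flip: ennreal_mult)
    also have "\<dots> = ennreal (r / p / A0) * Lpow N p w0 (H t)"
      unfolding Lpow_def H_def by (rule nn_integral_cmult) measurable
    also have "\<dots> \<le> ennreal (r / p / A0) * ennreal A0"
      using b0[OF Re_strip_map_boundary(2)[OF \<theta> _ t(2)]] False t unfolding H_def by (intro mult_left_mono) auto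
    also have "\<dots> = ennreal (c t)" using False pos by (simp add: c_def flip: ennreal_mult)
    finally show ?thesis .
  qed
  have "Lpow N r u0 (\<lambda>x. \<Sum>k\<in>I. g k x) \<le> (\<integral>\<^sup>+x. ennreal K * (\<integral>\<^sup>+t. ennreal (J t x) \<partial>unit_interval) \<partial>N)"
    unfolding Lpow_def by (rule nn_integral_mono_AE[OF ptwise])
  also have "\<dots> = ennreal K * (\<integral>\<^sup>+x. (\<integral>\<^sup>+t. ennreal (J t x) \<partial>unit_interval) \<partial>N)"
    by (rule nn_integral_cmult) measurable
  also have "(\<integral>\<^sup>+x. (\<integral>\<^sup>+t. ennreal (J t x) \<partial>unit_interval) \<partial>N) = (\<integral>\<^sup>+t. (\<integral>\<^sup>+x. ennreal (J t x) \<partial>N) \<partial>unit_interval)"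
    by (rule P.Fubini') measurable
  also have "\<dots> \<le> (\<integral>\<^sup>+t. ennreal (c t) \<partial>unit_interval)"
  proof (rule nn_integral_mono_AE, use AE_unit_interval_interior[of \<theta>] in eventually_elim)
    case (elim t)
    then show ?case by (intro inner) auto
  qed
  also have "\<dots> = ennreal (\<integral>t. c t \<partial>unit_interval)"
    unfolding c_def using pos by (intro nn_integral_eq_integral integral_unit_interval_split \<theta>) auto
  also have "(\<integral>t. c t \<partial>unit_interval) = 1"
    using r pos unfolding c_def by (subst integral_unit_interval_split(1)[OF \<theta>]) (simp add: field_simps)
  finally show ?thesis by (simp add: K_def mult_left_mono)
qed

section \<open>Weighted norms with exponents between 1 and infinity\<close>

lemma ennreal_ge_1_cases:
  fixes p :: ennreal
  assumes "1 \<le> p"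
  obtains "p = \<infinity>" | P where "p = ennreal P" "1 \<le> P"
proof (cases p)
  case (real P)
  have "ennreal 1 \<le> ennreal P" using assms real by simp
  then have "1 \<le> P" using real by (subst (asm) ennreal_le_iff) auto
  with real show thesis using that by blast
qed (use that in \<open>simp add: infinity_ennreal_def\<close>)

lemma wLnorm_cong_AE:
  assumes "1 \<le> p" and [measurable]: "w \<in> borel_measurable M" "f \<in> borel_measurable M" "g \<in> borel_measurable M"
    and "AE x in M. f x = g x"
  shows "wLnorm M p w f = wLnorm M p w g"
proof (cases rule: ennreal_ge_1_cases[OF assms(1)])
  case 1
  then show ?thesis using assms(5)
    by (auto simp: wLnorm_def Lnorm_def intro!: esssup_AE_cong elim!: eventually_mono)
next
  case (2 P)
  then have "Lpow M P w f = Lpow M P w g" using assms by (intro Lpow_cong_AE) auto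
  with 2 show ?thesis by (simp add: wLnorm_eq_Lpow)
qed

lemma wLnorm_mono_AE:
  assumes "1 \<le> p" and [measurable]: "w \<in> borel_measurable M" "f \<in> borel_measurable M" "g \<in> borel_measurable M"
    and "AE x in M. norm (f x * of_real (w x)) \<le> norm (g x * of_real (w x))"
    and "wLnorm M p w g \<le> ennreal c" "0 \<le> c"
  shows "wLnorm M p w f \<le> ennreal c"
proof (cases rule: ennreal_ge_1_cases[OF assms(1)])
  case 1
  then have "AE x in M. norm (g x * of_real (w x)) \<le> c"
    using assms by (subst wLnorm_top_le_iff[symmetric]) auto
  with assms(5) have "AE x in M. norm (f x * of_real (w x)) \<le> c"
    by eventually_elim simp
  then show ?thesis using 1 assms by (subst 1, subst wLnorm_top_le_iff) auto
next
  case (2 P)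
  have "Lpow M P w f \<le> Lpow M P w g" using 2 assms by (intro Lpow_mono_AE) auto
  also have "\<dots> \<le> ennreal (c powr P)" using 2 assms by (simp add: wLnorm_le_iff_Lpow)
  finally show ?thesis using 2 assms by (simp add: wLnorm_le_iff_Lpow)
qed

lemma wLnorm_scale_le:
  assumes "1 \<le> p" and [measurable]: "w \<in> borel_measurable M" "f \<in> borel_measurable M"
    and "wLnorm M p w f \<le> ennreal a" "0 \<le> a"
  shows "wLnorm M p w (\<lambda>x. c * f x) \<le> ennreal (norm c * a)"
proof (cases rule: ennreal_ge_1_cases[OF assms(1)])
  case 1
  then have "AE x in M. norm (f x * of_real (w x)) \<le> a"
    using assms by (subst wLnorm_top_le_iff[symmetric]) auto
  then have "AE x in M. norm (c * f x * of_real (w x)) \<le> norm c * a"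
    by eventually_elim (simp add: norm_mult mult.assoc mult_left_mono)
  then show ?thesis using assms by (subst 1, subst wLnorm_top_le_iff) auto
next
  case (2 P)
  have "Lpow M P w (\<lambda>x. c * f x) = ennreal (norm c powr P) * Lpow M P w f"
    using 2 by (intro Lpow_scale) auto
  also have "\<dots> \<le> ennreal (norm c powr P) * ennreal (a powr P)"
    using 2 assms by (intro mult_left_mono) (auto simp: wLnorm_le_iff_Lpow)
  also have "\<dots> = ennreal ((norm c * a) powr P)" by (simp add: powr_mult flip: ennreal_mult)
  finally show ?thesis using 2 assms by (simp add: wLnorm_le_iff_Lpow)
qed

text \<open>The constant 4 is crude, but it is the same for all exponents, including \<open>\<infinity>\<close>.\<close>

lemma wLnorm_add_le:
  assumes "1 \<le> p" and [measurable]: "w \<in> borel_measurable M" "f \<in> borel_measurable M" "g \<in> borel_measurable M"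
    and f: "wLnorm M p w f \<le> ennreal a" and g: "wLnorm M p w g \<le> ennreal a" and "0 \<le> a"
  shows "wLnorm M p w (\<lambda>x. f x + g x) \<le> ennreal (4 * a)"
proof (cases rule: ennreal_ge_1_cases[OF assms(1)])
  case 1
  then have "AE x in M. norm (f x * of_real (w x)) \<le> a" "AE x in M. norm (g x * of_real (w x)) \<le> a"
    using assms by (subst wLnorm_top_le_iff[symmetric], auto)+
  then have "AE x in M. norm ((f x + g x) * of_real (w x)) \<le> 4 * a"
  proof eventually_elim
    case (elim x)
    have "norm ((f x + g x) * of_real (w x)) \<le> norm (f x * of_real (w x)) + norm (g x * of_real (w x))"
      unfolding distrib_right by (rule norm_triangle_ineq)
    with elim \<open>0 \<le> a\<close> show ?case by linarith
  qed
  then show ?thesis using \<open>0 \<le> a\<close> by (subst 1, subst wLnorm_top_le_iff) auto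
next
  case (2 P)
  have "Lpow M P w (\<lambda>x. f x + g x) \<le> ennreal (2 powr P) * (Lpow M P w f + Lpow M P w g)"
    using 2 by (intro Lpow_add) auto
  also have "\<dots> \<le> ennreal (2 powr P) * (ennreal (a powr P) + ennreal (a powr P))"
    using 2 assms by (intro mult_left_mono add_mono) (auto simp: wLnorm_le_iff_Lpow)
  also have "\<dots> = ennreal (2 powr P * (2 * a powr P))"
    by (simp flip: ennreal_mult ennreal_plus)
  also have "\<dots> \<le> ennreal ((4 * a) powr P)"
  proof -
    have "(2::real) powr 1 \<le> 2 powr P" using 2 by (intro powr_mono) auto
    then have "2 powr P * (2 * a powr P) \<le> 2 powr P * (2 powr P * a powr P)"
      by (intro mult_left_mono mult_right_mono) auto
    also have "\<dots> = (4 * a) powr P" by (simp add: powr_mult flip: powr_mult[of 2 2, simplified])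
    finally show ?thesis by (rule ennreal_leI)
  qed
  finally show ?thesis using 2 assms by (simp add: wLnorm_le_iff_Lpow)
qed

lemma wLnorm_eq_0_AE:
  assumes "1 \<le> p" and [measurable]: "w \<in> borel_measurable M" "f \<in> borel_measurable M"
    and "AE x in M. f x = 0" "0 \<le> c"
  shows "wLnorm M p w f \<le> ennreal c"
proof -
  have "wLnorm M p w (\<lambda>x. 0 * f x) \<le> ennreal c"
  proof (cases rule: ennreal_ge_1_cases[OF assms(1)])
    case 1
    then show ?thesis using assms by (subst 1, subst wLnorm_top_le_iff) auto
  next
    case (2 P)
    then show ?thesis using assms by (simp add: wLnorm_le_iff_Lpow Lpow_def)
  qed
  then show ?thesis
    using assms by (subst wLnorm_cong_AE[of p w M f "\<lambda>x. 0 * f x"]) auto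
qed

lemma wLnorm_finite_bound:
  assumes "wLnorm M p w f < \<infinity>"
  obtains a :: real where "0 < a" "wLnorm M p w f \<le> ennreal a"
proof (rule that[of "enn2real (wLnorm M p w f) + 1"])
  show "wLnorm M p w f \<le> ennreal (enn2real (wLnorm M p w f) + 1)"
    using assms by (subst ennreal_plus) (auto simp: ennreal_enn2real_if)
qed (simp add: add_nonneg_pos)

text \<open>Dominated convergence.\<close>

lemma Lpow_vanishing:
  assumes s: "0 < s" and [measurable]: "w \<in> borel_measurable M" "f \<in> borel_measurable M" "\<And>n. A n \<in> sets M"
    and fin: "Lpow M s w f < \<infinity>"
    and ev: "AE x in M. eventually (\<lambda>n. x \<notin> A n) sequentially" and \<epsilon>: "0 < \<epsilon>"
  shows "eventually (\<lambda>n. Lpow M s w (\<lambda>x. f x * indicator (A n) x) < ennreal \<epsilon>) sequentially"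
proof -
  have "(\<lambda>n. Lpow M s w (\<lambda>x. f x * indicator (A n) x)) \<longlonglongrightarrow> (\<integral>\<^sup>+x. 0 \<partial>M)"
    unfolding Lpow_def
  proof (rule nn_integral_dominated_convergence[where w = "\<lambda>x. ennreal (norm (f x * of_real (w x)) powr s)"])
    show "(\<integral>\<^sup>+x. ennreal (norm (f x * of_real (w x)) powr s) \<partial>M) < \<infinity>"
      using fin by (simp add: Lpow_def)
    show "AE x in M. ennreal (norm (f x * indicator (A n) x * of_real (w x)) powr s) \<le> ennreal (norm (f x * of_real (w x)) powr s)" for n
      by (auto simp: indicator_def)
    show "AE x in M. (\<lambda>n. ennreal (norm (f x * indicator (A n) x * of_real (w x)) powr s)) \<longlonglongrightarrow> 0"
      using ev
    proof eventually_elim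
      case (elim x)
      then have "eventually (\<lambda>n. ennreal (norm (f x * indicator (A n) x * of_real (w x)) powr s) = 0) sequentially"
        by eventually_elim (use s in simp)
      then show ?case by (rule tendsto_eventually)
    qed
  qed measurable
  then show ?thesis using \<epsilon> by (intro order_tendstoD) auto
qed

lemma wLnorm_vanishing:
  assumes P: "1 \<le> P" and [measurable]: "w \<in> borel_measurable M" "f \<in> borel_measurable M" "\<And>n. A n \<in> sets M"
    and fin: "wLnorm M (ennreal P) w f < \<infinity>"
    and ev: "AE x in M. eventually (\<lambda>n. x \<notin> A n) sequentially" and \<epsilon>: "0 < \<epsilon>"
  shows "\<exists>n0::nat. \<forall>n\<ge>n0. wLnorm M (ennreal P) w (\<lambda>x. f x * indicator (A n) x) \<le> ennreal \<epsilon>"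
proof -
  have "Lpow M P w f < \<infinity>" using fin P by (simp only: wLnorm_eq_Lpow ennpowr_finite_iff)
  then have "eventually (\<lambda>n. Lpow M P w (\<lambda>x. f x * indicator (A n) x) < ennreal (\<epsilon> powr P)) sequentially"
    using P \<epsilon> ev by (intro Lpow_vanishing) auto
  then obtain n0 where "\<And>n. n \<ge> n0 \<Longrightarrow> Lpow M P w (\<lambda>x. f x * indicator (A n) x) < ennreal (\<epsilon> powr P)"
    by (auto simp: eventually_sequentially)
  then show ?thesis using P \<epsilon> by (intro exI[of _ n0]) (auto simp: wLnorm_le_iff_Lpow intro: less_imp_le)
qed

section \<open>Simple functions and multilinear operators\<close>

text \<open>The level sets of a function with finitely many values represent it as a linear combination of
  indicators.\<close>

lemma simple_functions_iff:
  "f \<in> simple_functions M \<longleftrightarrow> finite (range f) \<and> f \<in> borel_measurable M \<and> {x. f x \<noteq> 0} \<in> fmeasurable M"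
proof
  assume "f \<in> simple_functions M"
  then obtain k :: nat and c A where A: "\<And>i. i < k \<Longrightarrow> A i \<in> fmeasurable M"
    and f: "f = (\<lambda>x. \<Sum>i<k. c i * indicator (A i) x)" unfolding simple_functions_def by auto
  have "range f \<subseteq> (\<lambda>B. \<Sum>i\<in>B. c i) ` Pow {..<k}"
  proof (rule image_subsetI)
    fix x
    have "f x = (\<Sum>i\<in>{i. i < k \<and> x \<in> A i}. c i)"
      unfolding f by (auto simp: indicator_def intro!: sum.mono_neutral_cong_right)
    then show "f x \<in> (\<lambda>B. \<Sum>i\<in>B. c i) ` Pow {..<k}" by auto
  qed
  then have 1: "finite (range f)" by (rule finite_subset) simp
  have 2: "f \<in> borel_measurable M"
    unfolding f by (intro borel_measurable_sum borel_measurable_times borel_measurable_const borel_measurable_indicator)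
      (use A in \<open>auto dest: fmeasurableD\<close>)
  have sub: "{x. f x \<noteq> 0} \<subseteq> (\<Union>i<k. A i)"
  proof (rule subsetI, rule ccontr)
    fix x assume "x \<in> {x. f x \<noteq> 0}" "x \<notin> (\<Union>i<k. A i)"
    moreover have "f x = 0" unfolding f
      by (rule sum.neutral) (use \<open>x \<notin> (\<Union>i<k. A i)\<close> in auto)
    ultimately show False by simp
  qed
  also have "\<dots> \<subseteq> space M" using A sets.sets_into_space by (fastforce dest: fmeasurableD)
  finally have "{x. f x \<noteq> 0} = {x\<in>space M. f x \<noteq> 0}" by auto
  also have "\<dots> \<in> sets M" using 2 by measurable
  finally have supp: "{x. f x \<noteq> 0} \<in> sets M" .
  have "(\<Union>i<k. A i) \<in> fmeasurable M" using A by (intro fmeasurable.finite_UN) auto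
  then have "{x. f x \<noteq> 0} \<in> fmeasurable M" using sub supp by (rule fmeasurableI2)
  with 1 2 show "finite (range f) \<and> f \<in> borel_measurable M \<and> {x. f x \<noteq> 0} \<in> fmeasurable M" by blast
next
  assume *: "finite (range f) \<and> f \<in> borel_measurable M \<and> {x. f x \<noteq> 0} \<in> fmeasurable M"
  then obtain k and h :: "nat \<Rightarrow> complex" where h: "bij_betw h {..<k} (range f - {0})"
    using ex_bij_betw_nat_finite[of "range f - {0}"] by (auto simp: atLeast0LessThan)
  define A where "A i = {x. f x = h i} \<inter> {x. f x \<noteq> 0}" for i
  have "A i \<in> fmeasurable M" for i
  proof -
    have "A i = {x. f x \<noteq> 0} \<inter> (f -` {h i} \<inter> space M)"
      using * sets.sets_into_space[of "{x. f x \<noteq> 0}" M] by (auto simp: A_def dest: fmeasurableD)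
    also have "\<dots> \<in> fmeasurable M"
      using * by (intro fmeasurable_Int_fmeasurable measurable_sets[of f M borel]) auto
    finally show ?thesis .
  qed
  moreover have "f = (\<lambda>x. \<Sum>i<k. h i * indicator (A i) x)"
  proof
    fix x
    show "f x = (\<Sum>i<k. h i * indicator (A i) x)"
    proof (cases "f x = 0")
      case True
      then show ?thesis by (simp add: A_def)
    next
      case False
      then have "f x \<in> h ` {..<k}" using h by (auto simp: bij_betw_def)
      then obtain i0 where i0: "i0 < k" "f x = h i0" by auto
      have "(\<Sum>i<k. h i * indicator (A i) x) = (\<Sum>i<k. if i = i0 then h i0 else 0)"
        using h i0 False by (intro sum.cong) (auto simp: A_def bij_betw_def inj_on_def indicator_def)
      then show ?thesis using i0 by simp
    qed
  qed
  ultimately show "f \<in> simple_functions M" unfolding simple_functions_def by blast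
qed

lemma simple_functions_lin:
  assumes f: "f \<in> simple_functions M" and g: "g \<in> simple_functions M"
  shows "(\<lambda>x. a * f x + b * g x) \<in> simple_functions M"
proof -
  have [measurable]: "f \<in> borel_measurable M" "g \<in> borel_measurable M" using assms by (auto simp: simple_functions_iff)
  have "range (\<lambda>x. a * f x + b * g x) \<subseteq> (\<lambda>(y, z). a * y + b * z) ` (range f \<times> range g)" by auto
  then have 1: "finite (range (\<lambda>x. a * f x + b * g x))"
    by (rule finite_subset) (use assms in \<open>auto simp: simple_functions_iff\<close>)
  have un: "{x. f x \<noteq> 0} \<union> {x. g x \<noteq> 0} \<in> fmeasurable M" using assms by (auto simp: simple_functions_iff)
  have sub: "{x. a * f x + b * g x \<noteq> 0} \<subseteq> {x. f x \<noteq> 0} \<union> {x. g x \<noteq> 0}" by auto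
  then have "{x. a * f x + b * g x \<noteq> 0} = {x\<in>space M. a * f x + b * g x \<noteq> 0}"
    using un sets.sets_into_space[OF fmeasurableD[OF un]] by blast
  also have "\<dots> \<in> sets M" by measurable
  finally have "{x. a * f x + b * g x \<noteq> 0} \<in> fmeasurable M" by (rule fmeasurableI2[OF un sub])
  with 1 show ?thesis by (simp add: simple_functions_iff)
qed

lemma simple_functions_restrict:
  assumes f: "f \<in> simple_functions M" and fin: "finite (h ` {x. f x \<noteq> 0})"
    and h [measurable]: "h \<in> borel_measurable M"
  shows "(\<lambda>x. f x * h x) \<in> simple_functions M"
proof -
  have fm: "f \<in> borel_measurable M" "{x. f x \<noteq> 0} \<in> fmeasurable M" "finite (range f)" using f by (auto simp: simple_functions_iff)
  note fm(1)[measurable]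
  have "range (\<lambda>x. f x * h x) \<subseteq> insert 0 ((\<lambda>(y, z). y * z) ` (range f \<times> h ` {x. f x \<noteq> 0}))"
  proof (rule image_subsetI)
    fix x
    show "f x * h x \<in> insert 0 ((\<lambda>(y, z). y * z) ` (range f \<times> h ` {x. f x \<noteq> 0}))"
      by (cases "f x = 0") auto
  qed
  then have 1: "finite (range (\<lambda>x. f x * h x))"
    by (rule finite_subset) (use fm fin in auto)
  have sub: "{x. f x * h x \<noteq> 0} \<subseteq> {x. f x \<noteq> 0}" by auto
  then have "{x. f x * h x \<noteq> 0} = {x\<in>space M. f x * h x \<noteq> 0}"
    using sets.sets_into_space[OF fmeasurableD[OF fm(2)]] by blast
  also have "\<dots> \<in> sets M" by measurable
  finally have "{x. f x * h x \<noteq> 0} \<in> fmeasurable M" by (rule fmeasurableI2[OF fm(2) sub])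
  with 1 show ?thesis by (simp add: simple_functions_iff)
qed

lemma simple_functions_indicator:
  assumes f: "f \<in> simple_functions M" and "A \<in> sets M"
  shows "(\<lambda>x. f x * indicator A x) \<in> simple_functions M"
proof (rule simple_functions_restrict[OF f])
  have "(indicator A ` {x. f x \<noteq> 0} :: complex set) \<subseteq> {0, 1}" by (auto simp: indicator_def)
  then show "finite (indicator A ` {x. f x \<noteq> 0} :: complex set)" by (rule finite_subset) simp
qed (use assms in simp)

locale simple_multilinear =
  fixes M :: "'m::finite \<Rightarrow> 'a measure" and N :: "'b measure"
    and S :: "('m \<Rightarrow> 'a \<Rightarrow> complex) \<Rightarrow> 'b \<Rightarrow> complex"
  assumes multilinear: "multilinear_op (\<lambda>j. simple_functions (M j)) N (borel_measurable N) S"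
begin

lemma S_meas: "(\<And>j. f j \<in> simple_functions (M j)) \<Longrightarrow> S f \<in> borel_measurable N"
  using multilinear unfolding multilinear_op_def by blast

lemma S_lin:
  assumes "\<And>j. f j \<in> simple_functions (M j)" "g \<in> simple_functions (M j)" "h \<in> simple_functions (M j)"
  shows "AE x in N. S (f(j := (\<lambda>y. a * g y + b * h y))) x = a * S (f(j := g)) x + b * S (f(j := h)) x"
  using multilinear assms unfolding multilinear_op_def by blast

lemma S_sum:
  assumes f: "\<And>j. f j \<in> simple_functions (M j)" and I: "finite I"
    and g: "\<And>i. i \<in> I \<Longrightarrow> g i \<in> simple_functions (M j)"
  shows "(\<lambda>y. \<Sum>i\<in>I. c i * g i y) \<in> simple_functions (M j) \<and>
    (AE x in N. S (f(j := (\<lambda>y. \<Sum>i\<in>I. c i * g i y))) x = (\<Sum>i\<in>I. c i * S (f(j := g i)) x))"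
  using I g
proof (induction I rule: finite_induct)
  case empty
  have "AE x in N. S (f(j := (\<lambda>y. 0 * f j y + 0 * f j y))) x = 0 * S (f(j := f j)) x + 0 * S (f(j := f j)) x"
    by (rule S_lin[OF f f f])
  then show ?case using simple_functions_lin[OF f f, of 0 j 0] by (simp add: fun_upd_def)
next
  case (insert i I)
  have IH: "(\<lambda>y. \<Sum>i\<in>I. c i * g i y) \<in> simple_functions (M j)"
    "AE x in N. S (f(j := (\<lambda>y. \<Sum>i\<in>I. c i * g i y))) x = (\<Sum>i\<in>I. c i * S (f(j := g i)) x)"
    using insert.IH[OF insert.prems[OF insertI2]] by blast+
  have gi: "g i \<in> simple_functions (M j)" using insert by simp
  have eq: "(\<lambda>y. \<Sum>i\<in>insert i I. c i * g i y) = (\<lambda>y. c i * g i y + 1 * (\<Sum>i\<in>I. c i * g i y))"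
    using insert.hyps by simp
  have "AE x in N. S (f(j := (\<lambda>y. c i * g i y + 1 * (\<Sum>i\<in>I. c i * g i y)))) x =
      c i * S (f(j := g i)) x + 1 * S (f(j := (\<lambda>y. \<Sum>i\<in>I. c i * g i y))) x"
    by (rule S_lin[OF f gi IH(1)])
  then have "AE x in N. S (f(j := (\<lambda>y. \<Sum>i\<in>insert i I. c i * g i y))) x = (\<Sum>i\<in>insert i I. c i * S (f(j := g i)) x)"
    using IH(2) unfolding eq
  proof eventually_elim
    case (elim x)
    note elim(1)
    also have "c i * S (f(j := g i)) x + 1 * S (f(j := (\<lambda>y. \<Sum>i\<in>I. c i * g i y))) x
        = (\<Sum>i\<in>insert i I. c i * S (f(j := g i)) x)"
      by (simp only: elim(2) sum.insert[OF insert.hyps] mult_1_left)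
    finally show ?case .
  qed
  moreover have "(\<lambda>y. \<Sum>i\<in>insert i I. c i * g i y) \<in> simple_functions (M j)"
    unfolding eq by (rule simple_functions_lin[OF gi IH(1)])
  ultimately show ?case by blast
qed

text \<open>Induction over the set \<open>J\<close> of coordinates that have been expanded already.\<close>

lemma S_expand_aux:
  assumes f: "\<And>j. f j \<in> simple_functions (M j)" and I: "\<And>j. finite (I j)"
    and e: "\<And>j i. i \<in> I j \<Longrightarrow> e j i \<in> simple_functions (M j)"
  shows "AE x in N. S (\<lambda>j. if j \<in> J then (\<lambda>y. \<Sum>i\<in>I j. c j i * e j i y) else f j) x =
    (\<Sum>\<kappa>\<in>PiE J I. (\<Prod>j\<in>J. c j (\<kappa> j)) * S (\<lambda>j. if j \<in> J then e j (\<kappa> j) else f j) x)"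
  using finite[of J] f
proof (induction J arbitrary: f rule: finite_induct)
  case empty
  then show ?case by simp
next
  case (insert a J)
  define s where "s = (\<lambda>y. \<Sum>i\<in>I a. c a i * e a i y)"
  have s: "s \<in> simple_functions (M a)"
    unfolding s_def using S_sum[of f "I a" "e a" a "c a"] insert.prems I e by blast
  have eqL: "(\<lambda>j. if j \<in> insert a J then (\<lambda>y. \<Sum>i\<in>I j. c j i * e j i y) else f j)
      = (\<lambda>j. if j \<in> J then (\<lambda>y. \<Sum>i\<in>I j. c j i * e j i y) else (f(a := s)) j)"
    using insert.hyps by (auto simp: s_def fun_eq_iff)
  have IH: "AE x in N. S (\<lambda>j. if j \<in> J then (\<lambda>y. \<Sum>i\<in>I j. c j i * e j i y) else (f(a := s)) j) x =
    (\<Sum>\<kappa>\<in>PiE J I. (\<Prod>j\<in>J. c j (\<kappa> j)) * S (\<lambda>j. if j \<in> J then e j (\<kappa> j) else (f(a := s)) j) x)"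
    by (rule insert.IH) (use insert.prems s in auto)
  have "AE x in N. \<forall>\<kappa>\<in>PiE J I. S (\<lambda>j. if j \<in> J then e j (\<kappa> j) else (f(a := s)) j) x =
      (\<Sum>i\<in>I a. c a i * S (\<lambda>j. if j \<in> insert a J then e j ((\<kappa>(a := i)) j) else f j) x)"
  proof (rule AE_finite_allI)
    show "finite (PiE J I)" using insert.hyps I by (intro finite_PiE) auto
    fix \<kappa> assume \<kappa>: "\<kappa> \<in> PiE J I"
    define F where "F = (\<lambda>j. if j \<in> J then e j (\<kappa> j) else f j)"
    have F: "F j \<in> simple_functions (M j)" for j
      using \<kappa> insert.prems e by (auto simp: F_def)
    have "(\<lambda>j. if j \<in> J then e j (\<kappa> j) else (f(a := s)) j) = F(a := s)"
      using insert.hyps by (auto simp: F_def fun_eq_iff)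
    moreover have "(\<lambda>j. if j \<in> insert a J then e j ((\<kappa>(a := i)) j) else f j) = F(a := e a i)" for i
      using insert.hyps by (auto simp: F_def fun_eq_iff)
    ultimately show "AE x in N. S (\<lambda>j. if j \<in> J then e j (\<kappa> j) else (f(a := s)) j) x =
      (\<Sum>i\<in>I a. c a i * S (\<lambda>j. if j \<in> insert a J then e j ((\<kappa>(a := i)) j) else f j) x)"
      using S_sum[OF F I e, where c = "c a"] unfolding s_def by simp
  qed
  with IH show ?case unfolding eqL
  proof eventually_elim
    case (elim x)
    define Z where "Z \<kappa> = S (\<lambda>j. if j \<in> insert a J then e j (\<kappa> j) else f j) x" for \<kappa>
    have inj: "inj_on (\<lambda>(i, \<kappa>). \<kappa>(a := i)) (I a \<times> PiE J I)"
      using inj_combinator[of a J I] insert.hyps by simp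
    have "(\<Sum>\<kappa>\<in>PiE (insert a J) I. (\<Prod>j\<in>insert a J. c j (\<kappa> j)) * Z \<kappa>) =
        (\<Sum>(i, \<kappa>)\<in>I a \<times> PiE J I. (\<Prod>j\<in>insert a J. c j ((\<kappa>(a := i)) j)) * Z (\<kappa>(a := i)))"
      unfolding PiE_insert_eq by (subst sum.reindex[OF inj]) (simp add: case_prod_beta)
    also have "\<dots> = (\<Sum>(i, \<kappa>)\<in>I a \<times> PiE J I. (\<Prod>j\<in>J. c j (\<kappa> j)) * (c a i * Z (\<kappa>(a := i))))"
    proof (rule sum.cong, simp, clarify)
      fix i \<kappa>
      have "(\<Prod>j\<in>J. c j ((\<kappa>(a := i)) j)) = (\<Prod>j\<in>J. c j (\<kappa> j))"
        using insert.hyps by (intro prod.cong) auto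
      then show "(\<Prod>j\<in>insert a J. c j ((\<kappa>(a := i)) j)) * Z (\<kappa>(a := i)) = (\<Prod>j\<in>J. c j (\<kappa> j)) * (c a i * Z (\<kappa>(a := i)))"
        using insert.hyps by simp
    qed
    also have "\<dots> = (\<Sum>\<kappa>\<in>PiE J I. (\<Prod>j\<in>J. c j (\<kappa> j)) * (\<Sum>i\<in>I a. c a i * Z (\<kappa>(a := i))))"
      by (subst sum.cartesian_product[symmetric], subst sum.swap) (simp add: sum_distrib_left)
    finally show ?case using elim unfolding Z_def by simp
  qed
qed

lemma S_expand:
  assumes I: "\<And>j. finite (I j)" and e: "\<And>j i. i \<in> I j \<Longrightarrow> e j i \<in> simple_functions (M j)"
  shows "AE x in N. S (\<lambda>j y. \<Sum>i\<in>I j. c j i * e j i y) x =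
    (\<Sum>\<kappa>\<in>PiE UNIV I. (\<Prod>j\<in>UNIV. c j (\<kappa> j)) * S (\<lambda>j. e j (\<kappa> j)) x)"
  using S_expand_aux[OF _ I e, where f = "\<lambda>_ _. 0" and J = UNIV and c = c]
  by (simp add: simple_functions_iff)

lemma S_scale:
  assumes f: "\<And>j. f j \<in> simple_functions (M j)"
  shows "AE x in N. S (\<lambda>j y. c j * f j y) x = (\<Prod>j\<in>UNIV. c j) * S f x"
  using S_expand[of "\<lambda>_. {()}" "\<lambda>j _. f j" "\<lambda>j _. c j"] f
  by (simp add: PiE_singleton PiE_UNIV_domain)

end

text \<open>Boundedness is recorded on unit balls. This form passes to the auxiliary operators without
  products of norms, and homogeneity recovers the multilinear bound.\<close>

definition ball_bounded where
  "ball_bounded M p w N s w0 S A \<longleftrightarrow> (\<forall>f. (\<forall>j. f j \<in> simple_functions (M j) \<and> wLnorm (M j) (p j) (w j) (f j) \<le> ennreal 1)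
     \<longrightarrow> Lpow N s w0 (S f) \<le> ennreal A)"

lemma ball_boundedI:
  assumes "\<And>f. (\<And>j. f j \<in> simple_functions (M j)) \<Longrightarrow> (\<And>j. wLnorm (M j) (p j) (w j) (f j) \<le> ennreal 1)
     \<Longrightarrow> Lpow N s w0 (S f) \<le> ennreal A"
  shows "ball_bounded M p w N s w0 S A"
  using assms by (auto simp: ball_bounded_def)

lemma ball_boundedD:
  assumes "ball_bounded M p w N s w0 S A" "\<And>j. f j \<in> simple_functions (M j)"
    "\<And>j. wLnorm (M j) (p j) (w j) (f j) \<le> ennreal 1"
  shows "Lpow N s w0 (S f) \<le> ennreal A"
  using assms by (auto simp: ball_bounded_def)

section \<open>Analytic families of simple functions\<close>

text \<open>Scaling each coordinate to norm \<open>\<tau>\<close>. The class \<open>D j\<close> of functions is arbitrary, since the bound is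
  used both for all simple functions and for the admissible ones.\<close>

lemma (in simple_multilinear) homogeneous_bound:
  fixes w :: "'m \<Rightarrow> 'a \<Rightarrow> real" and c :: "'m \<Rightarrow> real"
  assumes p: "\<And>j. 1 \<le> p j" and w: "\<And>j. w j \<in> borel_measurable (M j)"
    and w0: "w0 \<in> borel_measurable N" and s: "0 < s" and \<tau>: "0 < \<tau>" and A: "0 \<le> A"
    and D: "\<And>j f. f \<in> D j \<Longrightarrow> f \<in> simple_functions (M j)" "\<And>j f c. f \<in> D j \<Longrightarrow> (\<lambda>x. of_real c * f x) \<in> D j"
    and unit: "\<And>f. (\<And>j. f j \<in> D j) \<Longrightarrow> (\<And>j. wLnorm (M j) (p j) (w j) (f j) \<le> ennreal \<tau>)
        \<Longrightarrow> Lpow N s w0 (S f) \<le> ennreal A"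
    and f: "\<And>j. f j \<in> D j" and le: "\<And>j. wLnorm (M j) (p j) (w j) (f j) \<le> ennreal (c j)" and c: "\<And>j. 0 < c j"
  shows "Lpow N s w0 (S f) \<le> ennreal ((\<Prod>j\<in>UNIV. c j / \<tau>) powr s * A)"
proof -
  define g where "g j x = of_real (\<tau> / c j) * f j x" for j x
  have g: "g j \<in> D j" for j unfolding g_def by (rule D(2)[OF f])
  have gle: "wLnorm (M j) (p j) (w j) (g j) \<le> ennreal \<tau>" for j
  proof -
    have "wLnorm (M j) (p j) (w j) (g j) \<le> ennreal (norm (of_real (\<tau> / c j) :: complex) * c j)"
      unfolding g_def
      by (rule wLnorm_scale_le[OF p w _ le less_imp_le[OF c]]) (use D(1)[OF f] in \<open>auto simp: simple_functions_iff\<close>)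
    then show ?thesis using c[of j] \<tau> by (simp add: norm_divide)
  qed
  have "f = (\<lambda>j y. of_real (c j / \<tau>) * g j y)"
    using c[THEN less_imp_neq] \<tau> by (fastforce simp: g_def fun_eq_iff)
  moreover have "AE x in N. S (\<lambda>j y. of_real (c j / \<tau>) * g j y) x = (\<Prod>j\<in>UNIV. of_real (c j / \<tau>)) * S g x"
    by (rule S_scale) (rule D(1)[OF g])
  ultimately have "Lpow N s w0 (S f) = Lpow N s w0 (\<lambda>x. (\<Prod>j\<in>UNIV. of_real (c j / \<tau>)) * S g x)"
    by (intro Lpow_cong_AE[OF w0 s]) auto
  also have "\<dots> = ennreal (norm (\<Prod>j\<in>UNIV. of_real (c j / \<tau>) :: complex) powr s) * Lpow N s w0 (S g)"
    by (rule Lpow_scale[OF w0 s]) (rule S_meas[OF D(1)[OF g]])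
  also have "\<dots> \<le> ennreal (norm (\<Prod>j\<in>UNIV. of_real (c j / \<tau>) :: complex) powr s) * ennreal A"
    using unit[OF g gle] by (rule mult_left_mono) simp
  also have "norm (\<Prod>j\<in>UNIV. of_real (c j / \<tau>) :: complex) = (\<Prod>j\<in>UNIV. c j / \<tau>)"
  proof -
    have "0 \<le> (\<Prod>j\<in>UNIV. c j / \<tau>)" using c \<tau> by (intro prod_nonneg) (auto intro: less_imp_le)
    then show ?thesis by (simp only: of_real_prod[symmetric] norm_of_real abs_of_nonneg)
  qed
  finally show ?thesis using A by (simp flip: ennreal_mult)
qed

text \<open>The reciprocal of an extended exponent as a real number, with value 0 at \<open>\<infinity>\<close>.\<close>

definition einv :: "ennreal \<Rightarrow> real" where
  "einv p = enn2real (inverse p)"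

lemma einv_real: "0 < P \<Longrightarrow> einv (ennreal P) = 1 / P"
  by (simp add: einv_def inverse_ennreal inverse_eq_divide)

lemma einv_top: "einv top = 0"
  by (simp add: einv_def)

lemma inverse_eq_einv:
  assumes "1 \<le> p" shows "inverse p = ennreal (einv p)"
  using assms by (cases rule: ennreal_ge_1_cases) (auto simp: einv_real einv_top inverse_ennreal inverse_eq_divide)

lemma einv_bounds:
  assumes "1 \<le> p" shows "0 \<le> einv p" "einv p \<le> 1"
  by (cases rule: ennreal_ge_1_cases[OF assms]; simp add: einv_real einv_top)+

text \<open>The exponent \<open>r / p\<close>. If \<open>r = \<infinity>\<close> then \<open>p = \<infinity>\<close> as well, and the value 1 keeps the relation
  \<open>rexp_sum\<close> valid.\<close>

definition rexp :: "ennreal \<Rightarrow> ennreal \<Rightarrow> real" where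
  "rexp r p = (if r = \<infinity> then 1 else enn2real r * einv p)"

locale endpoint_pair =
  fixes M :: "'a measure" and p q r :: ennreal and w v u :: "'a \<Rightarrow> real" and \<theta> :: real
  assumes p: "1 \<le> p" and q: "1 \<le> q" and \<theta>: "0 < \<theta>" "\<theta> < 1"
    and r: "1 / r = ennreal (1 - \<theta>) / p + ennreal \<theta> / q"
    and w: "weight M w" and v: "weight M v"
    and u: "\<And>x. x \<in> space M \<Longrightarrow> u x = w x powr (1 - \<theta>) * v x powr \<theta>"
begin

text \<open>The two endpoints play symmetric roles, so that statements about one edge of the strip yield
  those about the other.\<close>

lemma swap: "endpoint_pair M q p r v w u (1 - \<theta>)"
  using p q \<theta> r w v u by unfold_locales (auto simp: add.commute mult.commute)

lemma w_meas[measurable]: "w \<in> borel_measurable M" and w_pos: "AE x in M. 0 < w x"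
  and v_meas[measurable]: "v \<in> borel_measurable M" and v_pos: "AE x in M. 0 < v x"
  using w v by (auto simp: weight_def)

lemma u_meas[measurable]: "u \<in> borel_measurable M"
proof -
  have "(\<lambda>x. w x powr (1 - \<theta>) * v x powr \<theta>) \<in> borel_measurable M" by measurable
  then show ?thesis by (subst measurable_cong[OF u])
qed

lemma inverse_r: "inverse r = ennreal ((1 - \<theta>) * einv p + \<theta> * einv q)"
proof -
  have "inverse r = ennreal (1 - \<theta>) * inverse p + ennreal \<theta> * inverse q"
    using r by (simp add: divide_ennreal_def)
  also have "\<dots> = ennreal ((1 - \<theta>) * einv p + \<theta> * einv q)"
    using \<theta> einv_bounds[OF p] einv_bounds[OF q]
    by (simp add: inverse_eq_einv[OF p] inverse_eq_einv[OF q] flip: ennreal_mult ennreal_plus)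
  finally show ?thesis .
qed

lemma r_cases:
  obtains "r = \<infinity>" "p = \<infinity>" "q = \<infinity>"
  | R where "r = ennreal R" "1 \<le> R" "1 / R = (1 - \<theta>) * einv p + \<theta> * einv q"
proof -
  define s where "s = (1 - \<theta>) * einv p + \<theta> * einv q"
  have s: "0 \<le> s" "s \<le> 1"
  proof -
    have "(1 - \<theta>) * einv p + \<theta> * einv q \<le> (1 - \<theta>) * 1 + \<theta> * 1"
      using \<theta> einv_bounds[OF p] einv_bounds[OF q] by (intro add_mono mult_left_mono) auto
    then show "s \<le> 1" by (simp add: s_def)
    show "0 \<le> s" using \<theta> einv_bounds[OF p] einv_bounds[OF q] by (simp add: s_def)
  qed
  show thesis
  proof (cases r)
    case (real R)
    have "R \<noteq> 0" using inverse_r real by auto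
    then have R: "0 < R" using real by simp
    then have "1 / R = s" using inverse_r real s by (simp add: inverse_ennreal s_def inverse_eq_divide)
    moreover from this have "1 \<le> R" using mult_left_le[of s R] s R by (simp add: field_simps)
    ultimately show thesis using that(2)[of R] real by (simp add: s_def)
  next
    case top
    then have "s = 0" using inverse_r s by (simp add: s_def ennreal_eq_0_iff)
    then have "(1 - \<theta>) * einv p = 0" "\<theta> * einv q = 0"
      using \<theta> einv_bounds[OF p] einv_bounds[OF q] unfolding s_def
      by (smt (verit) mult_nonneg_nonneg)+
    then have "einv p = 0" "einv q = 0" using \<theta> by auto
    then have "inverse p = 0" "inverse q = 0" using inverse_eq_einv[OF p] inverse_eq_einv[OF q] by auto
    then have "p = \<infinity>" "q = \<infinity>" by (auto simp: ennreal_inverse_eq_0_iff)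
    then show thesis using that(1) top by simp
  qed
qed

lemma r_ge_1: "1 \<le> r"
  by (cases rule: r_cases) (auto simp flip: ennreal_1)

lemma rexp_sum: "(1 - \<theta>) * rexp r p + \<theta> * rexp r q = 1"
  using \<theta> by (cases rule: r_cases)
    (auto simp: rexp_def field_simps)

lemma rexp_nonneg: "0 \<le> rexp r p"
  using einv_bounds[OF p] by (auto simp: rexp_def)

text \<open>If \<open>\<bar>F w\<bar> \<le> \<bar>f u\<bar>\<^bsup>r/p\<^esup>\<close> then the \<open>p\<close>-th power of the left side is at most the \<open>r\<close>-th power of
  \<open>\<bar>f u\<bar>\<close>. For \<open>p = \<infinity> > r\<close> the exponent is 0 and the right side is at most 1.\<close>

lemma transfer:
  assumes [measurable]: "f \<in> borel_measurable M" "F \<in> borel_measurable M"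
    and F: "AE x in M. norm (F x * of_real (w x)) \<le> (if f x = 0 then 0 else norm (f x * of_real (u x)) powr rexp r p)"
    and f: "wLnorm M r u f \<le> ennreal 1"
  shows "wLnorm M p w F \<le> ennreal 1"
proof (cases rule: ennreal_ge_1_cases[OF p])
  case 1
  have "AE x in M. norm (F x * of_real (w x)) \<le> 1"
  proof (cases rule: r_cases)
    case 1
    then have "AE x in M. norm (f x * of_real (u x)) \<le> 1"
      using f by (subst wLnorm_top_le_iff[symmetric]) auto
    with F show ?thesis
      by eventually_elim (auto simp: rexp_def 1 split: if_splits)
  next
    case (2 R)
    from F show ?thesis
      by eventually_elim (use 1 2 in \<open>auto simp: rexp_def einv_top powr_def split: if_splits\<close>)
  qed
  then show ?thesis using 1 by (subst 1, subst wLnorm_top_le_iff) auto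
next
  case (2 P)
  then obtain R where R: "r = ennreal R" "1 \<le> R" by (cases rule: r_cases) auto
  have rP: "rexp r p * P = R" using 2 R by (simp add: rexp_def einv_real)
  have "Lpow M P w F \<le> Lpow M R u f"
    unfolding Lpow_def
  proof (rule nn_integral_mono_AE, use F in eventually_elim)
    case (elim x)
    have "norm (F x * of_real (w x)) powr P \<le> norm (f x * of_real (u x)) powr R"
    proof (cases "f x = 0")
      case False
      then have "norm (F x * of_real (w x)) powr P \<le> (norm (f x * of_real (u x)) powr rexp r p) powr P"
        using elim 2 by (intro powr_mono2) auto
      then show ?thesis by (simp add: powr_powr rP)
    qed (use elim in simp)
    then show ?case by (rule ennreal_leI)
  qed
  also have "\<dots> \<le> ennreal 1" using f R wLnorm_le_iff_Lpow[of R 1 M u f] by simp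
  finally show ?thesis using 2 wLnorm_le_iff_Lpow[of P 1 M w F] by simp
qed

text \<open>The analytic family \<open>f exp (b (z - \<theta>))\<close> should have modulus \<open>\<bar>f u\<bar>\<^bsup>r/p\<^esup> / w\<close> on the edge \<open>Re z = 0\<close> and
  \<open>\<bar>f u\<bar>\<^bsup>r/q\<^esup> / v\<close> on the edge \<open>Re z = 1\<close>. The difference of the logarithms of these moduli is \<open>b\<close>.
  Here it is taken with \<open>f\<close> replaced by \<open>2 f\<close> and the weights by the powers \<open>2\<^sup>m\<close> and \<open>2\<^sup>n\<close> below them,
  so that \<open>b\<close> has finitely many values on a set where the weights are bounded above and below.\<close>

definition slope :: "complex \<Rightarrow> int \<Rightarrow> int \<Rightarrow> real" where
  "slope c m n = (rexp r q - rexp r p) * (ln (2 * norm c) + ((1 - \<theta>) * m + \<theta> * n) * ln 2) + (m - n) * ln 2"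

lemma slope_swap: "endpoint_pair.slope q p r (1 - \<theta>) c n m = - slope c m n"
  by (simp add: slope_def endpoint_pair.slope_def[OF swap] algebra_simps)

abbreviation "branch f x \<equiv> slope (f x) \<lfloor>log 2 (w x)\<rfloor> \<lfloor>log 2 (v x)\<rfloor>"

lemma branch_meas[measurable]:
  assumes [measurable]: "f \<in> borel_measurable M"
  shows "(\<lambda>x. branch f x) \<in> borel_measurable M"
  unfolding slope_def by measurable

text \<open>Rounding the weights costs at most a factor 2, which the norm bound \<open>1 / 2\<close> compensates.\<close>

lemma branch_endpoint:
  assumes f: "f \<in> borel_measurable M" and z: "Re z = 0"
    and le: "wLnorm M r u f \<le> ennreal (1 / 2)"
  shows "wLnorm M p w (\<lambda>x. f x * exp (of_real (branch f x) * (z - of_real \<theta>))) \<le> ennreal 1"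
proof (rule transfer[of "\<lambda>x. 2 * f x"])
  note f[measurable]
  show "(\<lambda>x. f x * exp (of_real (branch f x) * (z - of_real \<theta>))) \<in> borel_measurable M" by measurable
  have "wLnorm M r u (\<lambda>x. 2 * f x) \<le> ennreal (norm (2::complex) * (1/2))"
    by (rule wLnorm_scale_le[OF r_ge_1 _ _ le]) auto
  then show "wLnorm M r u (\<lambda>x. 2 * f x) \<le> ennreal 1" by simp
  show "AE x in M. norm (f x * exp (of_real (branch f x) * (z - of_real \<theta>)) * of_real (w x))
      \<le> (if 2 * f x = 0 then 0 else norm (2 * f x * of_real (u x)) powr rexp r p)"
    using w_pos v_pos AE_space
  proof eventually_elim
    case (elim x)
    define m where "m = \<lfloor>log 2 (w x)\<rfloor>"
    define n where "n = \<lfloor>log 2 (v x)\<rfloor>"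
    define L where "L = ln (2 * norm (f x)) + ((1 - \<theta>) * m + \<theta> * n) * ln 2"
    show ?case
    proof (cases "f x = 0")
      case False
      have lnw: "ln (w x) = log 2 (w x) * ln 2" "ln (v x) = log 2 (v x) * ln 2" by (auto simp: log_def)
      have u0: "0 < u x" using elim u by simp
      have "ln (w x) \<le> (m + 1) * ln 2"
        unfolding lnw m_def by (rule mult_right_mono, linarith, simp)
      have "((1 - \<theta>) * m + \<theta> * n) * ln 2 \<le> ((1 - \<theta>) * log 2 (w x) + \<theta> * log 2 (v x)) * ln 2"
        unfolding m_def n_def using \<theta> by (intro mult_right_mono add_mono mult_left_mono) auto
      also have "\<dots> = ln (u x)"
        using elim by (simp add: u ln_mult ln_powr lnw algebra_simps)
      finally have "L \<le> ln (2 * norm (f x) * u x)"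
        using False u0 by (simp add: L_def ln_mult)
      then have "rexp r p * L \<le> rexp r p * ln (2 * norm (f x) * u x)" using rexp_nonneg by (rule mult_left_mono)
      moreover have "ln (norm (f x)) - \<theta> * slope (f x) m n + (m + 1) * ln 2 = rexp r p * L"
      proof -
        have "rexp r p * L + \<theta> * slope (f x) m n = ((1 - \<theta>) * rexp r p + \<theta> * rexp r q) * L + \<theta> * (m - n) * ln 2"
          by (simp add: slope_def L_def algebra_simps)
        also have "\<dots> = ln (norm (f x)) + (m + 1) * ln 2"
          unfolding rexp_sum using False by (simp add: L_def ln_mult algebra_simps)
        finally show ?thesis by simp
      qed
      ultimately have "ln (norm (f x)) - \<theta> * slope (f x) m n + ln (w x) \<le> rexp r p * ln (2 * norm (f x) * u x)"
        using \<open>ln (w x) \<le> (m + 1) * ln 2\<close> by linarith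
      then have "exp (ln (norm (f x)) - \<theta> * slope (f x) m n + ln (w x)) \<le> exp (rexp r p * ln (2 * norm (f x) * u x))"
        by simp
      moreover have "exp (ln (norm (f x)) - \<theta> * slope (f x) m n + ln (w x)) =
          norm (f x * exp (of_real (branch f x) * (z - of_real \<theta>)) * of_real (w x))"
      proof -
        have "norm (exp (of_real (branch f x) * (z - of_real \<theta>))) = exp (- (\<theta> * slope (f x) m n))"
          using z by (simp add: m_def n_def mult.commute)
        then have "norm (f x * exp (of_real (branch f x) * (z - of_real \<theta>)) * of_real (w x)) =
            norm (f x) * exp (- (\<theta> * slope (f x) m n)) * w x"
          using elim by (simp only: norm_mult norm_of_real abs_of_pos)
        also have "\<dots> = exp (ln (norm (f x)) - \<theta> * slope (f x) m n + ln (w x))"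
          using False elim by (simp add: exp_add exp_diff exp_minus field_simps)
        finally show ?thesis by (rule sym)
      qed
      moreover have "exp (rexp r p * ln (2 * norm (f x) * u x)) = norm (2 * f x * of_real (u x)) powr rexp r p"
        using False u0 by (simp add: norm_mult powr_def)
      ultimately show ?thesis using False by simp
    qed simp
  qed
qed (use f in measurable)

lemma branch_endpoint1:
  assumes f: "f \<in> borel_measurable M" and z: "Re z = 1"
    and le: "wLnorm M r u f \<le> ennreal (1 / 2)"
  shows "wLnorm M q v (\<lambda>x. f x * exp (of_real (branch f x) * (z - of_real \<theta>))) \<le> ennreal 1"
proof -
  have "of_real (- branch f x) * ((1 - z) - of_real (1 - \<theta>)) = of_real (branch f x) * (z - of_real \<theta>)" for x
    by (simp add: algebra_simps)
  then show ?thesis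
    using endpoint_pair.branch_endpoint[OF swap f _ le, of "1 - z"] z
    unfolding slope_swap by simp
qed

definition banded :: "('a \<Rightarrow> complex) \<Rightarrow> bool" where
  "banded f \<longleftrightarrow> f \<in> simple_functions M \<and>
     (\<exists>k>0. \<forall>x. f x \<noteq> 0 \<longrightarrow> 1 / k \<le> w x \<and> w x \<le> k \<and> 1 / k \<le> v x \<and> v x \<le> k)"

text \<open>Only finitely many powers of 2 lie between \<open>1 / k\<close> and \<open>k\<close>.\<close>

lemma finite_branch:
  assumes "banded f"
  shows "finite ((\<lambda>x. branch f x) ` {x. f x \<noteq> 0})"
proof -
  from assms obtain k where k: "k > 0"
    "\<And>x. f x \<noteq> 0 \<Longrightarrow> 1 / k \<le> w x \<and> w x \<le> k \<and> 1 / k \<le> v x \<and> v x \<le> k" unfolding banded_def by blast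
  have *: "\<lfloor>log 2 y\<rfloor> \<in> {\<lfloor>log 2 (1 / k)\<rfloor>..\<lfloor>log 2 k\<rfloor>}" if "1 / k \<le> y" "y \<le> k" for y
  proof -
    have "0 < 1 / k" using k by simp
    then have "0 < y" using that by linarith
    then show ?thesis using that k by (auto intro!: floor_mono)
  qed
  have "(\<lambda>x. branch f x) ` {x. f x \<noteq> 0} \<subseteq> (\<lambda>(c, m, n). slope c m n) `
      (range f \<times> {\<lfloor>log 2 (1 / k)\<rfloor>..\<lfloor>log 2 k\<rfloor>} \<times> {\<lfloor>log 2 (1 / k)\<rfloor>..\<lfloor>log 2 k\<rfloor>})"
  proof (rule image_subsetI)
    fix x assume "x \<in> {x. f x \<noteq> 0}"
    then have "(f x, \<lfloor>log 2 (w x)\<rfloor>, \<lfloor>log 2 (v x)\<rfloor>) \<in>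
        range f \<times> {\<lfloor>log 2 (1 / k)\<rfloor>..\<lfloor>log 2 k\<rfloor>} \<times> {\<lfloor>log 2 (1 / k)\<rfloor>..\<lfloor>log 2 k\<rfloor>}"
      using k(2)[of x] * by blast
    then show "branch f x \<in> (\<lambda>(c, m, n). slope c m n) `
      (range f \<times> {\<lfloor>log 2 (1 / k)\<rfloor>..\<lfloor>log 2 k\<rfloor>} \<times> {\<lfloor>log 2 (1 / k)\<rfloor>..\<lfloor>log 2 k\<rfloor>})"
      by (rule rev_image_eqI) simp
  qed
  then show ?thesis
    by (rule finite_subset) (use assms in \<open>auto simp: banded_def simple_functions_iff\<close>)
qed

end

lemma wLnorm_lin_finite:
  assumes p: "1 \<le> p" and w: "w \<in> borel_measurable M" and fg: "f \<in> borel_measurable M" "g \<in> borel_measurable M"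
    and fin: "wLnorm M p w f < \<infinity>" "wLnorm M p w g < \<infinity>"
  shows "wLnorm M p w (\<lambda>x. a * f x + b * g x) < \<infinity>"
proof -
  obtain c d where cd: "0 < c" "wLnorm M p w f \<le> ennreal c" "0 < d" "wLnorm M p w g \<le> ennreal d"
    using fin by (meson wLnorm_finite_bound)
  define e where "e = max (norm a * c) (norm b * d)"
  have 1: "wLnorm M p w (\<lambda>x. a * f x) \<le> ennreal (norm a * c)"
    using cd by (intro wLnorm_scale_le p w fg) auto
  have 2: "wLnorm M p w (\<lambda>x. b * g x) \<le> ennreal (norm b * d)"
    using cd by (intro wLnorm_scale_le p w fg) auto
  have "wLnorm M p w (\<lambda>x. a * f x + b * g x) \<le> ennreal (4 * e)"
  proof (rule wLnorm_add_le[OF p w])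
    show "wLnorm M p w (\<lambda>x. a * f x) \<le> ennreal e" by (rule order_trans[OF 1]) (auto simp: e_def intro!: ennreal_leI)
    show "wLnorm M p w (\<lambda>x. b * g x) \<le> ennreal e" by (rule order_trans[OF 2]) (auto simp: e_def intro!: ennreal_leI)
    show "0 \<le> e" using cd by (auto simp: e_def le_max_iff_disj)
  qed (use fg in measurable)
  then show ?thesis by (rule le_less_trans) simp
qed

lemma wLnorm_indicator_le:
  assumes "1 \<le> p'" "w' \<in> borel_measurable M" "f \<in> borel_measurable M" "A \<in> sets M"
    and "wLnorm M p' w' f \<le> ennreal c" "0 \<le> c"
  shows "wLnorm M p' w' (\<lambda>x. f x * indicator A x) \<le> ennreal c"
  using assms(4) by (intro wLnorm_mono_AE[OF assms(1-2) _ assms(3) _ assms(5-6)])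
    (auto simp: indicator_def intro!: borel_measurable_times borel_measurable_indicator assms)

lemma wLnorm_indicator_finite:
  assumes "1 \<le> p'" "w' \<in> borel_measurable M" "f \<in> borel_measurable M" "A \<in> sets M" "wLnorm M p' w' f < \<infinity>"
  shows "wLnorm M p' w' (\<lambda>x. f x * indicator A x) < \<infinity>"
proof -
  obtain c where "0 < c" "wLnorm M p' w' f \<le> ennreal c" using wLnorm_finite_bound[OF assms(5)] .
  then have "wLnorm M p' w' (\<lambda>x. f x * indicator A x) \<le> ennreal c" using assms by (intro wLnorm_indicator_le) auto
  then show ?thesis by (rule le_less_trans) simp
qed

definition off_band :: "'a measure \<Rightarrow> ('a \<Rightarrow> real) \<Rightarrow> nat \<Rightarrow> 'a set" where
  "off_band M w n = {x \<in> space M. \<not> (1 / real (Suc n) \<le> w x \<and> w x \<le> real (Suc n))}"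

lemma off_band_sets[measurable]:
  assumes [measurable]: "w \<in> borel_measurable M"
  shows "off_band M w n \<in> sets M"
  unfolding off_band_def by measurable

lemma off_band_vanish:
  assumes "AE x in M. 0 < w x"
  shows "AE x in M. eventually (\<lambda>n. x \<notin> off_band M w n) sequentially"
  using assms
proof eventually_elim
  case (elim x)
  obtain n1 where n1: "1 / w x \<le> real n1" using real_arch_simple by blast
  obtain n2 where n2: "w x \<le> real n2" using real_arch_simple by blast
  have "x \<notin> off_band M w n" if "n \<ge> max n1 n2" for n
  proof -
    have "1 / w x \<le> real (Suc n)" "w x \<le> real (Suc n)" using n1 n2 that by linarith+
    then show ?thesis using elim by (auto simp: off_band_def field_simps)
  qed
  then show ?case unfolding eventually_sequentially by blast
qed

text \<open>For finite \<open>p\<close> this is dominated convergence. For \<open>p = \<infinity>\<close> it depends on \<open>f\<close> being simple: as \<open>\<bar>f\<bar>\<close> is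
  bounded below where it does not vanish, a finite norm bounds \<open>w\<close> from above there; so the truncation
  removes only points where \<open>w\<close>, and with it \<open>f w\<close>, is small.\<close>

lemma truncation_small:
  assumes p: "1 \<le> p" and w[measurable]: "w \<in> borel_measurable M" and w_pos: "AE x in M. 0 < w x"
    and f: "f \<in> simple_functions M" "wLnorm M p w f < \<infinity>" and \<epsilon>: "0 < \<epsilon>"
  shows "\<exists>n0. \<forall>n\<ge>n0. wLnorm M p w (\<lambda>x. f x * indicator (off_band M w n) x) \<le> ennreal \<epsilon>"
proof -
  have [measurable]: "f \<in> borel_measurable M" using f by (simp add: simple_functions_iff)
  show ?thesis
  proof (cases rule: ennreal_ge_1_cases[OF p])
    case (2 P)
    then show ?thesis using wLnorm_vanishing[of P w M f "off_band M w" \<epsilon>] f \<epsilon> off_band_vanish[OF w_pos] by simp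
  next
    case 1
    obtain C where C: "0 < C" "wLnorm M p w f \<le> ennreal C" using wLnorm_finite_bound[OF f(2)] .
    then have ae: "AE x in M. norm (f x * of_real (w x)) \<le> C"
      using 1 by (subst wLnorm_top_le_iff[symmetric]) auto
    have fin: "finite (range f)" using f by (simp add: simple_functions_iff)
    define a where "a = Min (insert 1 (norm ` (range f - {0})))"
    define b where "b = Max (insert 1 (norm ` range f))"
    have a: "0 < a" unfolding a_def using fin by (subst Min_gr_iff) auto
    have af: "a \<le> norm (f x)" if "f x \<noteq> 0" for x
      unfolding a_def using fin that by (intro Min_le) auto
    have bf: "norm (f x) \<le> b" for x unfolding b_def using fin by (intro Max_ge) auto
    have b: "0 < b" unfolding b_def using fin by (subst Max_gr_iff) auto
    obtain n1 where n1: "C / a \<le> real n1" using real_arch_simple by blast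
    obtain n2 where n2: "b / \<epsilon> \<le> real n2" using real_arch_simple by blast
    have "wLnorm M p w (\<lambda>x. f x * indicator (off_band M w n) x) \<le> ennreal \<epsilon>" if n: "n \<ge> max n1 n2" for n
    proof -
      have "AE x in M. norm (f x * indicator (off_band M w n) x * of_real (w x)) \<le> \<epsilon>"
        using ae w_pos AE_space
      proof eventually_elim
        case (elim x)
        show ?case
        proof (cases "x \<in> off_band M w n \<and> f x \<noteq> 0")
          case True
          have "a * w x \<le> C"
          proof -
            have "a * w x \<le> norm (f x) * w x" using af[of x] True elim by (intro mult_right_mono) auto
            also have "\<dots> \<le> C" using elim by (simp add: norm_mult)
            finally show ?thesis .
          qed
          then have "w x \<le> C / a" using a by (simp add: field_simps)
          then have "w x \<le> real (Suc n)" using n1 n by linarith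
          then have wx: "w x \<le> 1 / real (Suc n)" using True by (auto simp: off_band_def)
          have "b / \<epsilon> \<le> real (Suc n)" using n2 n by linarith
          then have bs: "b / real (Suc n) \<le> \<epsilon>" using \<epsilon> by (simp add: field_simps)
          have "norm (f x * indicator (off_band M w n) x * of_real (w x)) = norm (f x) * w x"
            using True elim by (simp add: norm_mult)
          also have "\<dots> \<le> b * (1 / real (Suc n))" using bf wx elim b by (intro mult_mono) auto
          finally show ?thesis using bs by simp
        qed (use \<epsilon> in auto)
      qed
      then show ?thesis using \<epsilon> 1 by (subst 1, subst wLnorm_top_le_iff) auto
    qed
    then show ?thesis by blast
  qed
qed

context endpoint_pair begin

text \<open>The extended operator has to agree with the given one on these functions.\<close>

definition admissible :: "('a \<Rightarrow> complex) set" where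
  "admissible = {f \<in> simple_functions M. wLnorm M p w f < \<infinity> \<and> wLnorm M q v f < \<infinity>}"

lemma admissible_simple: "f \<in> admissible \<Longrightarrow> f \<in> simple_functions M"
  by (simp add: admissible_def)

lemma admissible_meas: "f \<in> admissible \<Longrightarrow> f \<in> borel_measurable M"
  by (simp add: admissible_def simple_functions_iff)

lemma admissible_lin:
  assumes "f \<in> admissible" "g \<in> admissible"
  shows "(\<lambda>x. a * f x + b * g x) \<in> admissible"
  using assms simple_functions_lin[of f M g a b]
    wLnorm_lin_finite[OF p w_meas admissible_meas[OF assms(1)] admissible_meas[OF assms(2)], of a b]
    wLnorm_lin_finite[OF q v_meas admissible_meas[OF assms(1)] admissible_meas[OF assms(2)], of a b]
  by (simp add: admissible_def)

lemma admissible_scale: "f \<in> admissible \<Longrightarrow> (\<lambda>x. c * f x) \<in> admissible"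
  using admissible_lin[of f f c 0] by simp

lemma admissible_indicator:
  assumes "f \<in> admissible" "A \<in> sets M"
  shows "(\<lambda>x. f x * indicator A x) \<in> admissible"
  using assms admissible_meas[OF assms(1)] unfolding admissible_def
  by (auto simp flip: infinity_ennreal_def intro!: simple_functions_indicator wLnorm_indicator_finite p q)

end

section \<open>Interpolation of bounds\<close>

locale target_pair = sigma_finite_measure N
  for N :: "'b measure" and p0 q0 r0 :: real and w0 v0 u0 :: "'b \<Rightarrow> real" and \<theta> :: real +
  assumes p0: "0 < p0" and q0: "0 < q0" and \<theta>: "0 < \<theta>" "\<theta> < 1"
    and r0: "1 / r0 = (1 - \<theta>) / p0 + \<theta> / q0"
    and w0: "weight N w0" and v0: "weight N v0" and u0_meas: "u0 \<in> borel_measurable N"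
    and u0: "AE x in N. u0 x = w0 x powr (1 - \<theta>) * v0 x powr \<theta>"
begin

lemma r0_pos: "0 < r0"
proof -
  have "0 < 1 / r0" unfolding r0 using p0 q0 \<theta> by (intro add_pos_pos divide_pos_pos) auto
  then show ?thesis by (simp add: zero_less_divide_iff)
qed

lemma w0_meas: "w0 \<in> borel_measurable N" and v0_meas: "v0 \<in> borel_measurable N"
  and w0_pos: "AE x in N. 0 < w0 x" and v0_pos: "AE x in N. 0 < v0 x"
  using w0 v0 by (auto simp: weight_def)

lemma u0_pos: "AE x in N. 0 < u0 x"
  using w0_pos v0_pos u0 by eventually_elim auto

lemma u0_weight: "weight N u0"
  using u0_pos u0_meas by (simp add: weight_def)

end

locale interpolation_scale =
  fixes M :: "'m::finite \<Rightarrow> 'a measure" and p q r :: "'m \<Rightarrow> ennreal"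
    and w v u :: "'m \<Rightarrow> 'a \<Rightarrow> real" and \<theta> :: real
  assumes endpoint: "\<And>j. endpoint_pair (M j) (p j) (q j) (r j) (w j) (v j) (u j) \<theta>"
begin

sublocale E: endpoint_pair "M j" "p j" "q j" "r j" "w j" "v j" "u j" \<theta> for j
  by (rule endpoint)

abbreviation "adm j \<equiv> endpoint_pair.admissible (M j) (p j) (q j) (w j) (v j)"
abbreviation "ban j \<equiv> endpoint_pair.banded (M j) (w j) (v j)"

text \<open>The analytic family has finitely many exponents in each coordinate, so \<open>S_expand\<close> writes the value of
  the operator as an exponential sum, to which \<open>strip_interpolation\<close> applies.\<close>

lemma banded_interpolation:
  assumes N: "target_pair N p0 q0 r0 w0 v0 u0 \<theta>" and S: "simple_multilinear M N S"
    and A: "0 < A0" "0 < A1"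
    and b0: "ball_bounded M p w N p0 w0 S A0"
    and b1: "ball_bounded M q v N q0 v0 S A1"
    and f: "\<And>j. ban j (f j)" and le: "\<And>j. wLnorm (M j) (r j) (u j) (f j) \<le> ennreal (1 / 2)"
  shows "Lpow N r0 u0 (S f) \<le> ennreal (A0 powr ((1 - \<theta>) * r0 / p0) * A1 powr (\<theta> * r0 / q0))"
proof -
  interpret N: target_pair N p0 q0 r0 w0 v0 u0 \<theta> by (rule N)
  interpret S: simple_multilinear M N S by (rule S)
  have fs: "f j \<in> simple_functions (M j)" for j using f E.banded_def by blast
  then have fm: "f j \<in> borel_measurable (M j)" for j by (auto simp: simple_functions_iff)
  define b where "b j x = endpoint_pair.slope (p j) (q j) (r j) \<theta> (f j x) \<lfloor>log 2 (w j x)\<rfloor> \<lfloor>log 2 (v j x)\<rfloor>" for j x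
  have bm: "b j \<in> borel_measurable (M j)" for j
    unfolding b_def by (rule E.branch_meas[OF fm])
  define I where "I j = b j ` {x. f j x \<noteq> 0}" for j
  have I: "finite (I j)" for j
    unfolding I_def b_def using E.finite_branch[OF f] .
  \<comment> \<open>The level sets of \<open>b j\<close> split \<open>f j\<close> into pieces on which the family is a single exponential in \<open>z\<close>.\<close>
  define e where "e j i x = f j x * indicator {x \<in> space (M j). b j x = i} x" for j i x
  have es: "e j i \<in> simple_functions (M j)" for j i
    unfolding e_def
  proof (rule simple_functions_indicator[OF fs])
    note bm[of j, measurable]
    show "{x \<in> space (M j). b j x = i} \<in> sets (M j)" by measurable
  qed
  define F where "F z j x = f j x * exp (of_real (b j x) * (z - of_real \<theta>))" for z j x
  have supp: "x \<in> space (M j)" if "f j x \<noteq> 0" for j x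
    using fs[of j] that sets.sets_into_space[of "{x. f j x \<noteq> 0}" "M j"]
    by (auto simp: simple_functions_iff dest!: fmeasurableD)
  have Fs: "F z j \<in> simple_functions (M j)" for z j
    unfolding F_def
  proof (rule simple_functions_restrict[OF fs])
    have "(\<lambda>x. exp (of_real (b j x) * (z - of_real \<theta>))) ` {x. f j x \<noteq> 0} = (\<lambda>i. exp (of_real i * (z - of_real \<theta>))) ` I j"
      by (auto simp: I_def)
    then show "finite ((\<lambda>x. exp (of_real (b j x) * (z - of_real \<theta>))) ` {x. f j x \<noteq> 0})" using I by simp
    note bm[of j, measurable]
    show "(\<lambda>x. exp (of_real (b j x) * (z - of_real \<theta>))) \<in> borel_measurable (M j)" by measurable
  qed
  have Fe: "F z j x = (\<Sum>i\<in>I j. exp (of_real i * (z - of_real \<theta>)) * e j i x)" for z j x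
  proof (cases "f j x = 0")
    case True
    then show ?thesis by (simp add: F_def e_def)
  next
    case False
    then have "(\<Sum>i\<in>I j. exp (of_real i * (z - of_real \<theta>)) * e j i x) =
        (\<Sum>i\<in>I j. if i = b j x then exp (of_real i * (z - of_real \<theta>)) * f j x else 0)"
      using supp by (intro sum.cong) (auto simp: e_def)
    also have "\<dots> = F z j x" using False I by (simp add: F_def) (auto simp: I_def)
    finally show ?thesis ..
  qed
  define K where "K = PiE UNIV I"
  have K: "finite K" unfolding K_def using I by (intro finite_PiE) auto
  define g where "g \<kappa> = S (\<lambda>j. e j (\<kappa> j))" for \<kappa>
  have expand: "AE x in N. S (F z) x = (\<Sum>\<kappa>\<in>K. exp (of_real (\<Sum>j\<in>UNIV. \<kappa> j) * (z - of_real \<theta>)) * g \<kappa> x)" for z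
  proof -
    have "F z = (\<lambda>j x. \<Sum>i\<in>I j. exp (of_real i * (z - of_real \<theta>)) * e j i x)"
      by (intro ext) (rule Fe)
    moreover have "(\<Prod>j\<in>UNIV. exp (of_real (\<kappa> j) * (z - of_real \<theta>))) = exp (of_real (\<Sum>j\<in>UNIV. \<kappa> j) * (z - of_real \<theta>))" for \<kappa> :: "'m \<Rightarrow> real"
      by (simp add: exp_sum sum_distrib_right)
    ultimately show ?thesis
      using S.S_expand[of I e "\<lambda>j i. exp (of_real i * (z - of_real \<theta>))"] I es
      by (simp add: K_def g_def)
  qed
  have at\<theta>: "F (of_real \<theta>) = f" by (simp add: F_def fun_eq_iff)
  have "Lpow N r0 u0 (S f) = Lpow N r0 u0 (\<lambda>x. \<Sum>\<kappa>\<in>K. g \<kappa> x)"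
    using expand[of "of_real \<theta>"] unfolding at\<theta> by (intro Lpow_cong_AE N.u0_meas N.r0_pos) simp
  also have "\<dots> \<le> ennreal (A0 powr ((1 - \<theta>) * r0 / p0) * A1 powr (\<theta> * r0 / q0))"
  proof (rule strip_interpolation[OF N.sigma_finite_measure_axioms K _ N.w0_meas N.v0_meas N.u0_meas _ N.\<theta> N.p0 N.q0 N.r0_pos A N.r0])
    show "g \<kappa> \<in> borel_measurable N" for \<kappa> unfolding g_def by (rule S.S_meas[OF es])
    show "AE x in N. 0 < w0 x \<and> 0 < v0 x \<and> u0 x = w0 x powr (1 - \<theta>) * v0 x powr \<theta>"
      using N.w0_pos N.v0_pos N.u0 by eventually_elim simp
    fix z :: complex
    show "Lpow N p0 w0 (\<lambda>x. \<Sum>\<kappa>\<in>K. exp (of_real (\<Sum>j\<in>UNIV. \<kappa> j) * (z - of_real \<theta>)) * g \<kappa> x) \<le> ennreal A0" if "Re z = 0"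
    proof -
      have "wLnorm (M j) (p j) (w j) (F z j) \<le> ennreal 1" for j
        unfolding F_def b_def by (rule E.branch_endpoint[OF fm that le])
      then have "Lpow N p0 w0 (S (F z)) \<le> ennreal A0" by (intro ball_boundedD[OF b0] Fs)
      then show ?thesis using Lpow_cong_AE[OF N.w0_meas N.p0 expand[of z]] by simp
    qed
    show "Lpow N q0 v0 (\<lambda>x. \<Sum>\<kappa>\<in>K. exp (of_real (\<Sum>j\<in>UNIV. \<kappa> j) * (z - of_real \<theta>)) * g \<kappa> x) \<le> ennreal A1" if "Re z = 1"
    proof -
      have "wLnorm (M j) (q j) (v j) (F z j) \<le> ennreal 1" for j
        unfolding F_def b_def by (rule E.branch_endpoint1[OF fm that le])
      then have "Lpow N q0 v0 (S (F z)) \<le> ennreal A1" by (intro ball_boundedD[OF b1] Fs)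
      then show ?thesis using Lpow_cong_AE[OF N.v0_meas N.q0 expand[of z]] by simp
    qed
  qed
  finally show ?thesis .
qed

end

text \<open>By homogeneity, \<open>\<epsilon> n\<close> can be chosen so small that the powers of the norms of \<open>S (f(i := h n))\<close> are
  summable. The choice does not depend on \<open>h\<close>.\<close>

lemma (in simple_multilinear) AE_null_along_coordinate:
  fixes w :: "'m \<Rightarrow> 'a \<Rightarrow> real"
  assumes p: "\<And>j. 1 \<le> p j" and w: "\<And>j. w j \<in> borel_measurable (M j)"
    and w0: "w0 \<in> borel_measurable N" "AE x in N. 0 < w0 x" and s: "0 < s" and A: "0 < A"
    and unit: "ball_bounded M p w N s w0 S A"
    and f: "\<And>j. f j \<in> simple_functions (M j)" "\<And>j. wLnorm (M j) (p j) (w j) (f j) < \<infinity>"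
  obtains \<epsilon> :: "nat \<Rightarrow> real" where "\<And>n. 0 < \<epsilon> n"
    "\<And>h. (\<And>n. h n \<in> simple_functions (M i)) \<Longrightarrow> (\<And>n. wLnorm (M i) (p i) (w i) (h n) \<le> ennreal (\<epsilon> n))
      \<Longrightarrow> AE x in N. (\<lambda>n. S (f(i := h n)) x) \<longlonglongrightarrow> 0"
proof -
  have "\<forall>j. \<exists>c>0. wLnorm (M j) (p j) (w j) (f j) \<le> ennreal c"
    using wLnorm_finite_bound[OF f(2)] by metis
  then obtain c where c: "\<And>j. 0 < c j" "\<And>j. wLnorm (M j) (p j) (w j) (f j) \<le> ennreal (c j)" by metis
  define C where "C = (\<Prod>j\<in>UNIV-{i}. c j)"
  have C: "0 < C" unfolding C_def using c by (intro prod_pos) auto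
  \<comment> \<open>Chosen such that \<open>(\<epsilon> n * C) powr s * A\<close> is \<open>(1/2)^n\<close>.\<close>
  define \<epsilon> where "\<epsilon> n = ((1/2)^n / A) powr (1 / s) / C" for n :: nat
  have \<epsilon>: "0 < \<epsilon> n" for n using A C by (simp add: \<epsilon>_def)
  show thesis
  proof (rule that[OF \<epsilon>])
    fix h assume h: "\<And>n. h n \<in> simple_functions (M i)" "\<And>n. wLnorm (M i) (p i) (w i) (h n) \<le> ennreal (\<epsilon> n)"
    have fh: "(f(i := h n)) j \<in> simple_functions (M j)" for n j using f h by simp
    have "Lpow N s w0 (S (f(i := h n))) \<le> ennreal ((1/2)^n)" for n
    proof -
      have "Lpow N s w0 (S (f(i := h n))) \<le> ennreal ((\<Prod>j\<in>UNIV. (c(i := \<epsilon> n)) j / 1) powr s * A)"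
      proof (rule homogeneous_bound[OF p w w0(1) s zero_less_one less_imp_le[OF A] _ _ ball_boundedD[OF unit], where D = "\<lambda>j. simple_functions (M j)"])
        show "(\<lambda>x. of_real c * f x) \<in> simple_functions (M j)" if "f \<in> simple_functions (M j)" for j f c
          using simple_functions_lin[OF that that, of "of_real c" 0] by simp
        show "wLnorm (M j) (p j) (w j) ((f(i := h n)) j) \<le> ennreal ((c(i := \<epsilon> n)) j)" for j
          using c h by simp
        show "0 < (c(i := \<epsilon> n)) j" for j using c \<epsilon> by simp
      qed (use fh in auto)
      also have "(\<Prod>j\<in>UNIV. (c(i := \<epsilon> n)) j / 1) = \<epsilon> n * C"
        unfolding C_def by (subst prod.remove[of UNIV i]) auto
      also have "(\<epsilon> n * C) powr s * A = (1/2)^n"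
        using C A s by (simp add: \<epsilon>_def powr_powr)
      finally show ?thesis .
    qed
    then have "(\<Sum>n. Lpow N s w0 (S (f(i := h n)))) \<le> (\<Sum>n. ennreal ((1/2)^n))" by (intro suminf_le) auto
    also have "\<dots> < \<infinity>" by (subst suminf_ennreal2) (auto simp: summable_geometric)
    finally have "AE x in N. (\<lambda>n. S (f(i := h n)) x * of_real (w0 x)) \<longlonglongrightarrow> 0"
      by (intro Lpow_suminf_AE_null[OF w0(1) s] S_meas fh)
    with w0(2) show "AE x in N. (\<lambda>n. S (f(i := h n)) x) \<longlonglongrightarrow> 0"
    proof eventually_elim
      case (elim x)
      then have "(\<lambda>n. S (f(i := h n)) x * of_real (w0 x) * of_real (1 / w0 x)) \<longlonglongrightarrow> 0 * of_real (1 / w0 x)"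
        by (intro tendsto_intros)
      moreover have "S (f(i := h n)) x * of_real (w0 x) * of_real (1 / w0 x) = S (f(i := h n)) x" for n
        using elim by (simp add: field_simps)
      ultimately show ?case by simp
    qed
  qed
qed

context interpolation_scale begin

text \<open>Coordinate by coordinate, \<open>f i\<close> is cut down to the set where both weights lie in \<open>[1 / k, k]\<close>. The part
  cut off where \<open>w\<close> leaves this interval is small in the \<open>p\<close>-norm, and the part cut off where \<open>v\<close> does is
  small in the \<open>q\<close>-norm. Either kind of smallness makes the corresponding values of \<open>S\<close> vanish in the
  limit a.e., and Fatou's lemma carries the bound over.\<close>

theorem admissible_interpolation:
  assumes N: "target_pair N p0 q0 r0 w0 v0 u0 \<theta>" and S: "simple_multilinear M N S"
    and A: "0 < A0" "0 < A1"
    and b0: "ball_bounded M p w N p0 w0 S A0"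
    and b1: "ball_bounded M q v N q0 v0 S A1"
    and f: "\<And>j. f j \<in> adm j" and le: "\<And>j. wLnorm (M j) (r j) (u j) (f j) \<le> ennreal (1 / 2)"
  shows "Lpow N r0 u0 (S f) \<le> ennreal (A0 powr ((1 - \<theta>) * r0 / p0) * A1 powr (\<theta> * r0 / q0))"
proof -
  interpret N: target_pair N p0 q0 r0 w0 v0 u0 \<theta> by (rule N)
  interpret S: simple_multilinear M N S by (rule S)
  have "Lpow N r0 u0 (S f) \<le> ennreal (A0 powr ((1 - \<theta>) * r0 / p0) * A1 powr (\<theta> * r0 / q0))"
    if "finite J" "\<And>j. f j \<in> adm j" "\<And>j. wLnorm (M j) (r j) (u j) (f j) \<le> ennreal (1 / 2)"
      "\<And>j. j \<notin> J \<Longrightarrow> ban j (f j)" for J f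
    using that
  proof (induction J arbitrary: f rule: finite_induct)
    case empty
    then show ?case using banded_interpolation[OF N S A b0 b1, of f] by simp
  next
    case (insert i J)
    note fa = insert.prems(1)
    have fs: "f j \<in> simple_functions (M j)" and fw: "wLnorm (M j) (p j) (w j) (f j) < \<infinity>"
      and fv: "wLnorm (M j) (q j) (v j) (f j) < \<infinity>" for j
      using fa[of j] by (auto simp: E.admissible_def)
    have fm[measurable]: "f j \<in> borel_measurable (M j)" for j using fs by (auto simp: simple_functions_iff)
    obtain \<epsilon> where \<epsilon>: "\<And>n. 0 < \<epsilon> n"
      and null_w: "\<And>h. (\<And>n. h n \<in> simple_functions (M i)) \<Longrightarrow> (\<And>n. wLnorm (M i) (p i) (w i) (h n) \<le> ennreal (\<epsilon> n))
      \<Longrightarrow> AE x in N. (\<lambda>n::nat. S (f(i := h n)) x) \<longlonglongrightarrow> 0"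
      using S.AE_null_along_coordinate[OF E.p E.w_meas N.w0_meas N.w0_pos N.p0 A(1) b0 fs fw, of i] by blast
    obtain \<delta> where \<delta>: "\<And>n. 0 < \<delta> n"
      and null_v: "\<And>h. (\<And>n. h n \<in> simple_functions (M i)) \<Longrightarrow> (\<And>n. wLnorm (M i) (q i) (v i) (h n) \<le> ennreal (\<delta> n))
      \<Longrightarrow> AE x in N. (\<lambda>n::nat. S (f(i := h n)) x) \<longlonglongrightarrow> 0"
      using S.AE_null_along_coordinate[OF E.q E.v_meas N.v0_meas N.v0_pos N.q0 A(2) b1 fs fv, of i] by blast
    have "\<exists>k. wLnorm (M i) (p i) (w i) (\<lambda>x. f i x * indicator (off_band (M i) (w i) k) x) \<le> ennreal (\<epsilon> n) \<and>
        wLnorm (M i) (q i) (v i) (\<lambda>x. f i x * indicator (off_band (M i) (v i) k) x) \<le> ennreal (\<delta> n)" for n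
    proof -
      obtain k1 where k1: "\<And>k. k \<ge> k1 \<Longrightarrow> wLnorm (M i) (p i) (w i) (\<lambda>x. f i x * indicator (off_band (M i) (w i) k) x) \<le> ennreal (\<epsilon> n)"
        using truncation_small[OF E.p E.w_meas E.w_pos fs fw \<epsilon>] by blast
      obtain k2 where k2: "\<And>k. k \<ge> k2 \<Longrightarrow> wLnorm (M i) (q i) (v i) (\<lambda>x. f i x * indicator (off_band (M i) (v i) k) x) \<le> ennreal (\<delta> n)"
        using truncation_small[OF E.q E.v_meas E.v_pos fs fv \<delta>] by blast
      show ?thesis using k1[of "max k1 k2"] k2[of "max k1 k2"] by auto
    qed
    then obtain k where kw: "\<And>n. wLnorm (M i) (p i) (w i) (\<lambda>x. f i x * indicator (off_band (M i) (w i) (k n)) x) \<le> ennreal (\<epsilon> n)"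
      and kv: "\<And>n. wLnorm (M i) (q i) (v i) (\<lambda>x. f i x * indicator (off_band (M i) (v i) (k n)) x) \<le> ennreal (\<delta> n)" by metis
    \<comment> \<open>\<open>a\<close> is small in the \<open>p\<close>-norm, \<open>b\<close> is small in the \<open>q\<close>-norm, and \<open>c\<close> is banded.\<close>
    define a where "a n x = f i x * indicator (off_band (M i) (w i) (k n)) x" for n x
    define b where "b n x = f i x * indicator (off_band (M i) (v i) (k n) - off_band (M i) (w i) (k n)) x" for n x
    define c where "c n x = f i x * indicator (space (M i) - off_band (M i) (v i) (k n) - off_band (M i) (w i) (k n)) x" for n x
    have sets: "off_band (M i) (w i) m \<in> sets (M i)" "off_band (M i) (v i) m \<in> sets (M i)" for m
      using off_band_sets E.w_meas E.v_meas by auto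
    have as: "a n \<in> simple_functions (M i)" and bs: "b n \<in> simple_functions (M i)" and cs: "c n \<in> simple_functions (M i)" for n
      unfolding a_def b_def c_def using sets by (auto intro!: simple_functions_indicator fs)
    have nb: "wLnorm (M i) (q i) (v i) (b n) \<le> ennreal (\<delta> n)" for n
    proof (rule wLnorm_mono_AE[OF E.q E.v_meas _ _ _ kv[of n] less_imp_le[OF \<delta>]])
      show "b n \<in> borel_measurable (M i)" using bs by (auto simp: simple_functions_iff)
    qed (use sets in \<open>auto simp: b_def indicator_def\<close>)
    have split: "AE x in N. S f x = S (f(i := a n)) x + S (f(i := b n)) x + S (f(i := c n)) x" for n
    proof -
      have supp: "x \<in> space (M i)" if "f i x \<noteq> 0" for x
        using fs[of i] that sets.sets_into_space[of "{x. f i x \<noteq> 0}" "M i"]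
        by (auto simp: simple_functions_iff dest!: fmeasurableD)
      have "f i = (\<lambda>x. 1 * a n x + 1 * (1 * b n x + 1 * c n x))"
        using supp by (auto simp: a_def b_def c_def indicator_def fun_eq_iff)
      then have "f = f(i := (\<lambda>x. 1 * a n x + 1 * (1 * b n x + 1 * c n x)))" by (metis fun_upd_triv)
      moreover have "AE x in N. S (f(i := (\<lambda>x. 1 * a n x + 1 * (1 * b n x + 1 * c n x)))) x
          = 1 * S (f(i := a n)) x + 1 * S (f(i := (\<lambda>x. 1 * b n x + 1 * c n x))) x"
        by (rule S.S_lin[OF fs as simple_functions_lin[OF bs cs]])
      ultimately have 1: "AE x in N. S f x = 1 * S (f(i := a n)) x + 1 * S (f(i := (\<lambda>x. 1 * b n x + 1 * c n x))) x"
        by (simp only:)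
      have "AE x in N. S (f(i := (\<lambda>x. 1 * b n x + 1 * c n x))) x = 1 * S (f(i := b n)) x + 1 * S (f(i := c n)) x"
        by (rule S.S_lin[OF fs bs cs])
      with 1 show ?thesis by eventually_elim (simp only: mult_1_left add.assoc)
    qed
    have ae: "AE x in N. \<forall>n. S f x = S (f(i := a n)) x + S (f(i := b n)) x + S (f(i := c n)) x"
      using split by (simp add: AE_all_countable)
    have na: "AE x in N. (\<lambda>n. S (f(i := a n)) x) \<longlonglongrightarrow> 0"
      by (rule null_w[OF as]) (use kw in \<open>simp add: a_def[abs_def]\<close>)
    have nb: "AE x in N. (\<lambda>n. S (f(i := b n)) x) \<longlonglongrightarrow> 0"
      by (rule null_v[OF bs nb])
    have lim: "AE x in N. (\<lambda>n. S (f(i := c n)) x) \<longlonglongrightarrow> S f x"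
      using ae na nb
    proof eventually_elim
      case (elim x)
      have "(\<lambda>n. S f x - S (f(i := a n)) x - S (f(i := b n)) x) \<longlonglongrightarrow> S f x - 0 - 0"
        using elim by (intro tendsto_intros)
      moreover have "S f x - S (f(i := a n)) x - S (f(i := b n)) x = S (f(i := c n)) x" for n
        using elim(1)[rule_format, of n] by simp
      ultimately show ?case by simp
    qed
    have "Lpow N r0 u0 (S (f(i := c n))) \<le> ennreal (A0 powr ((1 - \<theta>) * r0 / p0) * A1 powr (\<theta> * r0 / q0))" for n
    proof (rule insert.IH)
      have cadm: "c n \<in> adm i"
        unfolding c_def using sets by (intro E.admissible_indicator fa) auto
      show "(f(i := c n)) j \<in> adm j" for j using cadm fa by simp
      have "wLnorm (M i) (r i) (u i) (c n) \<le> ennreal (1 / 2)"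
        unfolding c_def using sets
        by (intro wLnorm_indicator_le E.r_ge_1 E.u_meas fm insert.prems) auto
      then show "wLnorm (M j) (r j) (u j) ((f(i := c n)) j) \<le> ennreal (1 / 2)" for j
        using insert.prems by simp
      have "ban i (c n)"
        unfolding E.banded_def
      proof (intro conjI exI[of _ "real (Suc (k n))"] allI impI cs)
        fix x assume "c n x \<noteq> 0"
        then have "x \<in> space (M i)" "x \<notin> off_band (M i) (v i) (k n)" "x \<notin> off_band (M i) (w i) (k n)"
          by (auto simp: c_def indicator_def split: if_splits)
        then show "1 / real (Suc (k n)) \<le> w i x" "w i x \<le> real (Suc (k n))"
          "1 / real (Suc (k n)) \<le> v i x" "v i x \<le> real (Suc (k n))" by (auto simp: off_band_def)
      qed simp
      then show "ban j ((f(i := c n)) j)" if "j \<notin> J" for j using insert.prems that by simp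
    qed
    then show ?case
      using lim fs cs by (intro Lpow_Fatou[OF N.u0_meas N.r0_pos _ lim] S.S_meas) auto
  qed
  from this[of UNIV f] show ?thesis using f le by simp
qed

end

section \<open>Cells, step functions and oscillation\<close>

text \<open>Rounding to the lattice of mesh \<open>1 / (k + 1)\<close>; it provides measurable approximations with finitely many
  values on bounded sets.\<close>

definition grid :: "nat \<Rightarrow> complex \<Rightarrow> complex" where
  "grid k z = Complex (of_int \<lfloor>real (Suc k) * Re z\<rfloor> / real (Suc k)) (of_int \<lfloor>real (Suc k) * Im z\<rfloor> / real (Suc k))"

lemma grid_dist: "norm (z - grid k z) \<le> 2 / real (Suc k)"
proof -
  have *: "\<bar>t - of_int \<lfloor>real (Suc k) * t\<rfloor> / real (Suc k)\<bar> \<le> 1 / real (Suc k)" for t :: real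
  proof -
    have "\<bar>real (Suc k) * t - of_int \<lfloor>real (Suc k) * t\<rfloor>\<bar> \<le> 1" by linarith
    moreover have "t - of_int \<lfloor>real (Suc k) * t\<rfloor> / real (Suc k) = (real (Suc k) * t - of_int \<lfloor>real (Suc k) * t\<rfloor>) / real (Suc k)"
      by (simp add: field_simps del: of_nat_Suc)
    ultimately show ?thesis by (simp add: abs_divide divide_right_mono del: of_nat_Suc)
  qed
  have "norm (z - grid k z) \<le> \<bar>Re (z - grid k z)\<bar> + \<bar>Im (z - grid k z)\<bar>" by (rule cmod_le)
  also have "\<dots> \<le> 1 / real (Suc k) + 1 / real (Suc k)"
    using *[of "Re z"] *[of "Im z"] by (intro add_mono) (auto simp: grid_def)
  finally show ?thesis by simp
qed

lemma finite_grid_image: "finite (grid k ` {z. norm z \<le> C})"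
proof -
  let ?R = "{\<lfloor>real (Suc k) * - C\<rfloor>..\<lfloor>real (Suc k) * C\<rfloor>}"
  have *: "\<lfloor>real (Suc k) * t\<rfloor> \<in> ?R" if "\<bar>t\<bar> \<le> C" for t
  proof -
    have "- C \<le> t" "t \<le> C" using that by auto
    then have "real (Suc k) * - C \<le> real (Suc k) * t" "real (Suc k) * t \<le> real (Suc k) * C"
      by (simp_all only: mult_left_mono of_nat_0_le_iff)
    then show ?thesis by (simp only: atLeastAtMost_iff floor_mono)
  qed
  have "grid k ` {z. norm z \<le> C} \<subseteq> (\<lambda>(a, b). Complex (of_int a / real (Suc k)) (of_int b / real (Suc k))) ` (?R \<times> ?R)"
  proof (rule image_subsetI)
    fix z :: complex assume "z \<in> {z. norm z \<le> C}"
    then have "\<bar>Re z\<bar> \<le> C" "\<bar>Im z\<bar> \<le> C" using abs_Re_le_cmod[of z] abs_Im_le_cmod[of z] by auto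
    then have "(\<lfloor>real (Suc k) * Re z\<rfloor>, \<lfloor>real (Suc k) * Im z\<rfloor>) \<in> ?R \<times> ?R" using * by blast
    then show "grid k z \<in> (\<lambda>(a, b). Complex (of_int a / real (Suc k)) (of_int b / real (Suc k))) ` (?R \<times> ?R)"
      by (rule rev_image_eqI) (simp add: grid_def)
  qed
  then show ?thesis by (rule finite_subset) simp
qed

lemma grid_meas[measurable]: "grid k \<in> borel_measurable borel"
proof -
  have "grid k = (\<lambda>z. of_real (of_int \<lfloor>real (Suc k) * Re z\<rfloor> / real (Suc k)) + \<i> * of_real (of_int \<lfloor>real (Suc k) * Im z\<rfloor> / real (Suc k)))"
    by (simp add: grid_def fun_eq_iff complex_eq_iff)
  also have "\<dots> \<in> borel_measurable borel" by measurable
  finally show ?thesis .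
qed

lemma bounded_approx_simple:
  assumes [measurable]: "f \<in> borel_measurable M" and A: "A \<in> fmeasurable M" and b: "\<And>x. x \<in> A \<Longrightarrow> norm (f x) \<le> C" and e: "0 < e"
  obtains g where "g \<in> simple_functions M" "\<And>x. x \<notin> A \<Longrightarrow> g x = 0" "\<And>x. x \<in> A \<Longrightarrow> norm (f x - g x) \<le> e"
proof -
  have [measurable]: "A \<in> sets M" using A by auto
  obtain k where k: "2 / e \<le> real k" using real_arch_simple by blast
  then have "2 / e \<le> real (Suc k)" by simp
  then have k': "2 / real (Suc k) \<le> e" using e by (simp add: field_simps)
  define g where "g x = (if x \<in> A then grid k (f x) else 0)" for x
  have sub: "A \<subseteq> space M" using A by (auto dest!: fmeasurableD sets.sets_into_space)
  have "range g \<subseteq> insert 0 (grid k ` {z. norm z \<le> C})" using b by (auto simp: g_def)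
  then have 1: "finite (range g)" by (rule finite_subset) (simp add: finite_grid_image)
  have 2[measurable]: "g \<in> borel_measurable M" unfolding g_def by measurable
  have "{x. g x \<noteq> 0} = {x\<in>space M. g x \<noteq> 0}" using sub by (auto simp: g_def)
  also have "\<dots> \<in> sets M" by measurable
  finally have "{x. g x \<noteq> 0} \<in> fmeasurable M"
    by (rule fmeasurableI2[OF A, rotated]) (auto simp: g_def split: if_splits)
  with 1 2 have "g \<in> simple_functions M" by (simp add: simple_functions_iff)
  moreover have "norm (f x - g x) \<le> e" if "x \<in> A" for x
    using grid_dist[of "f x" k] k' that by (simp add: g_def)
  ultimately show thesis by (intro that[of g]) (auto simp: g_def)
qed

lemma Lpow_bounded_on:
  assumes s: "0 < s" and [measurable]: "A \<in> sets M" and "measure M A = a" "A \<in> fmeasurable M"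
    and h: "\<And>x. x \<in> space M \<Longrightarrow> norm (h x * of_real (w x)) \<le> c * indicator A x" and c: "0 \<le> c"
  shows "Lpow M s w h \<le> ennreal (c powr s * a)"
proof -
  have "Lpow M s w h \<le> (\<integral>\<^sup>+x. ennreal (c powr s) * indicator A x \<partial>M)"
    unfolding Lpow_def
  proof (rule nn_integral_mono)
    fix x assume x: "x \<in> space M"
    show "ennreal (norm (h x * of_real (w x)) powr s) \<le> ennreal (c powr s) * indicator A x"
    proof (cases "x \<in> A")
      case True
      then have "norm (h x * of_real (w x)) powr s \<le> c powr s" using h[OF x] s by (intro powr_mono2) auto
      then show ?thesis using True by (simp add: ennreal_leI)
    next
      case False
      then show ?thesis using h[OF x] by simp
    qed
  qed
  also have "\<dots> = ennreal (c powr s) * emeasure M A" by (rule nn_integral_cmult_indicator) simp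
  also have "\<dots> = ennreal (c powr s * a)"
    using assms measure_nonneg[of M A] by (simp add: emeasure_eq_measure2 ennreal_mult)
  finally show ?thesis .
qed

locale cell_family = sigma_finite_measure N
  for N :: "'b measure" +
  fixes I :: "'i set" and Q :: "'i \<Rightarrow> 'b set"
  assumes finI: "finite I" and Qf: "\<And>i. i \<in> I \<Longrightarrow> Q i \<in> fmeasurable N"
    and Qpos: "\<And>i. i \<in> I \<Longrightarrow> 0 < measure N (Q i)" and disj: "disjoint_family_on Q I"
begin

lemma Q_sets[measurable]: "i \<in> I \<Longrightarrow> Q i \<in> sets N"
  using Qf by auto

definition kern :: "'b \<times> 'b \<Rightarrow> real" where
  "kern z = (\<Sum>i\<in>I. indicator (Q i) (fst z) * indicator (Q i) (snd z) / measure N (Q i))"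

lemma kern_meas[measurable]: "kern \<in> borel_measurable (N \<Otimes>\<^sub>M N)"
  unfolding kern_def by measurable

lemma kern_nonneg: "0 \<le> kern z"
  unfolding kern_def by (intro sum_nonneg) auto

text \<open>On \<open>Q i \<times> Q i\<close> this is the product measure divided by the measure of \<open>Q i\<close>. With this normalization
  both marginals are the restriction of \<open>N\<close> to the union of the cells.\<close>

definition cell_pairs :: "('b \<times> 'b) measure" where
  "cell_pairs = density (N \<Otimes>\<^sub>M N) (\<lambda>z. ennreal (kern z))"

lemma sets_cell_pairs[measurable_cong]: "sets cell_pairs = sets (N \<Otimes>\<^sub>M N)"
  by (simp add: cell_pairs_def)

lemma nn_integral_cell_pairs:
  assumes [measurable]: "\<phi> \<in> borel_measurable (N \<Otimes>\<^sub>M N)"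
  shows "(\<integral>\<^sup>+z. \<phi> z \<partial>cell_pairs) =
    (\<Sum>i\<in>I. ennreal (1 / measure N (Q i)) * (\<integral>\<^sup>+x. \<integral>\<^sup>+y. \<phi> (x, y) * indicator (Q i) x * indicator (Q i) y \<partial>N \<partial>N))"
proof -
  have "(\<integral>\<^sup>+z. \<phi> z \<partial>cell_pairs) = (\<integral>\<^sup>+z. ennreal (kern z) * \<phi> z \<partial>(N \<Otimes>\<^sub>M N))"
    unfolding cell_pairs_def by (rule nn_integral_density) measurable
  also have "\<dots> = (\<integral>\<^sup>+z. (\<Sum>i\<in>I. ennreal (1 / measure N (Q i)) * (\<phi> z * indicator (Q i) (fst z) * indicator (Q i) (snd z))) \<partial>(N \<Otimes>\<^sub>M N))"
  proof (rule nn_integral_cong)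
    fix z
    have "ennreal (kern z) = (\<Sum>i\<in>I. ennreal (indicator (Q i) (fst z) * indicator (Q i) (snd z) / measure N (Q i)))"
      unfolding kern_def by (rule sum_ennreal[symmetric]) auto
    also have "\<dots> * \<phi> z = (\<Sum>i\<in>I. ennreal (1 / measure N (Q i)) * (\<phi> z * indicator (Q i) (fst z) * indicator (Q i) (snd z)))"
      unfolding sum_distrib_right
      by (rule sum.cong) (auto simp: indicator_def)
    finally show "ennreal (kern z) * \<phi> z = (\<Sum>i\<in>I. ennreal (1 / measure N (Q i)) * (\<phi> z * indicator (Q i) (fst z) * indicator (Q i) (snd z)))" .
  qed
  also have "\<dots> = (\<Sum>i\<in>I. (\<integral>\<^sup>+z. ennreal (1 / measure N (Q i)) * (\<phi> z * indicator (Q i) (fst z) * indicator (Q i) (snd z)) \<partial>(N \<Otimes>\<^sub>M N)))"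
    by (rule nn_integral_sum) measurable
  also have "\<dots> = (\<Sum>i\<in>I. ennreal (1 / measure N (Q i)) * (\<integral>\<^sup>+x. \<integral>\<^sup>+y. \<phi> (x, y) * indicator (Q i) x * indicator (Q i) y \<partial>N \<partial>N))"
  proof (rule sum.cong[OF refl])
    fix i assume "i \<in> I"
    then have [measurable]: "Q i \<in> sets N" by simp
    have "(\<integral>\<^sup>+z. ennreal (1 / measure N (Q i)) * (\<phi> z * indicator (Q i) (fst z) * indicator (Q i) (snd z)) \<partial>(N \<Otimes>\<^sub>M N))
      = ennreal (1 / measure N (Q i)) * (\<integral>\<^sup>+z. \<phi> z * indicator (Q i) (fst z) * indicator (Q i) (snd z) \<partial>(N \<Otimes>\<^sub>M N))"
      by (rule nn_integral_cmult) measurable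
    also have "(\<integral>\<^sup>+z. \<phi> z * indicator (Q i) (fst z) * indicator (Q i) (snd z) \<partial>(N \<Otimes>\<^sub>M N)) =
      (\<integral>\<^sup>+x. \<integral>\<^sup>+y. \<phi> (x, y) * indicator (Q i) x * indicator (Q i) y \<partial>N \<partial>N)"
      by (subst nn_integral_fst[symmetric]) simp_all
    finally show "(\<integral>\<^sup>+z. ennreal (1 / measure N (Q i)) * (\<phi> z * indicator (Q i) (fst z) * indicator (Q i) (snd z)) \<partial>(N \<Otimes>\<^sub>M N))
      = ennreal (1 / measure N (Q i)) * (\<integral>\<^sup>+x. \<integral>\<^sup>+y. \<phi> (x, y) * indicator (Q i) x * indicator (Q i) y \<partial>N \<partial>N)" .
  qed
  finally show ?thesis .
qed

lemma sum_cells_le: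
  assumes [measurable]: "\<phi> \<in> borel_measurable N"
  shows "(\<Sum>i\<in>I. \<integral>\<^sup>+x. \<phi> x * indicator (Q i) x \<partial>N) \<le> (\<integral>\<^sup>+x. \<phi> x \<partial>N)"
proof -
  have "(\<Sum>i\<in>I. \<integral>\<^sup>+x. \<phi> x * indicator (Q i) x \<partial>N) = (\<integral>\<^sup>+x. (\<Sum>i\<in>I. \<phi> x * indicator (Q i) x) \<partial>N)"
    by (rule nn_integral_sum[symmetric]) measurable
  also have "\<dots> \<le> (\<integral>\<^sup>+x. \<phi> x \<partial>N)"
  proof (rule nn_integral_mono)
    fix x
    have "(\<Sum>i\<in>I. \<phi> x * indicator (Q i) x) = \<phi> x * indicator (\<Union>i\<in>I. Q i) x"
      by (simp add: sum_distrib_left[symmetric] indicator_UN_disjoint[OF finI disj])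
    also have "\<dots> \<le> \<phi> x * 1" by (intro mult_left_mono) (auto simp: indicator_def)
    finally show "(\<Sum>i\<in>I. \<phi> x * indicator (Q i) x) \<le> \<phi> x" by simp
  qed
  finally show ?thesis .
qed

lemma cell_ratio: "i \<in> I \<Longrightarrow> ennreal (1 / measure N (Q i)) * emeasure N (Q i) = 1"
  using Qpos[of i] Qf[of i] by (simp add: emeasure_eq_measure2 flip: ennreal_mult)

lemma marginal_fst:
  assumes [measurable]: "\<phi> \<in> borel_measurable N"
  shows "(\<integral>\<^sup>+z. \<phi> (fst z) \<partial>cell_pairs) \<le> (\<integral>\<^sup>+x. \<phi> x \<partial>N)"
proof -
  have "(\<integral>\<^sup>+z. \<phi> (fst z) \<partial>cell_pairs) = (\<Sum>i\<in>I. \<integral>\<^sup>+x. \<phi> x * indicator (Q i) x \<partial>N)"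
  proof (subst nn_integral_cell_pairs, measurable, rule sum.cong[OF refl])
    fix i assume i: "i \<in> I"
    then have [measurable]: "Q i \<in> sets N" by simp
    have eq: "(\<integral>\<^sup>+y. \<phi> (fst (x, y)) * indicator (Q i) x * indicator (Q i) y \<partial>N) =
        emeasure N (Q i) * (\<phi> x * indicator (Q i) x)" for x
      using nn_integral_cmult_indicator[of "Q i" N "\<phi> x * indicator (Q i) x"]
      by (simp only: fst_conv mult.commute[of "emeasure N (Q i)"]) simp
    have "(\<integral>\<^sup>+x. \<integral>\<^sup>+y. \<phi> (fst (x, y)) * indicator (Q i) x * indicator (Q i) y \<partial>N \<partial>N) =
        (\<integral>\<^sup>+x. emeasure N (Q i) * (\<phi> x * indicator (Q i) x) \<partial>N)"
      unfolding eq ..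
    also have "\<dots> = emeasure N (Q i) * (\<integral>\<^sup>+x. \<phi> x * indicator (Q i) x \<partial>N)" by (rule nn_integral_cmult) measurable
    finally show "ennreal (1 / measure N (Q i)) * (\<integral>\<^sup>+x. \<integral>\<^sup>+y. \<phi> (fst (x, y)) * indicator (Q i) x * indicator (Q i) y \<partial>N \<partial>N)
        = (\<integral>\<^sup>+x. \<phi> x * indicator (Q i) x \<partial>N)" by (simp add: mult.assoc[symmetric] cell_ratio i)
  qed
  also have "\<dots> \<le> (\<integral>\<^sup>+x. \<phi> x \<partial>N)" by (rule sum_cells_le) measurable
  finally show ?thesis .
qed

lemma marginal_snd:
  assumes [measurable]: "\<phi> \<in> borel_measurable N"
  shows "(\<integral>\<^sup>+z. \<phi> (snd z) \<partial>cell_pairs) \<le> (\<integral>\<^sup>+x. \<phi> x \<partial>N)"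
proof -
  have "(\<integral>\<^sup>+z. \<phi> (snd z) \<partial>cell_pairs) = (\<Sum>i\<in>I. \<integral>\<^sup>+x. \<phi> x * indicator (Q i) x \<partial>N)"
  proof (subst nn_integral_cell_pairs, measurable, rule sum.cong[OF refl])
    fix i assume i: "i \<in> I"
    then have [measurable]: "Q i \<in> sets N" by simp
    have "(\<integral>\<^sup>+x. \<integral>\<^sup>+y. \<phi> (snd (x, y)) * indicator (Q i) x * indicator (Q i) y \<partial>N \<partial>N) =
        (\<integral>\<^sup>+x. (\<integral>\<^sup>+y. \<phi> y * indicator (Q i) y \<partial>N) * indicator (Q i) x \<partial>N)"
      by (intro nn_integral_cong) (auto simp: indicator_def)
    also have "\<dots> = (\<integral>\<^sup>+y. \<phi> y * indicator (Q i) y \<partial>N) * emeasure N (Q i)"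
      by (rule nn_integral_cmult_indicator) measurable
    finally have "ennreal (1 / measure N (Q i)) * (\<integral>\<^sup>+x. \<integral>\<^sup>+y. \<phi> (snd (x, y)) * indicator (Q i) x * indicator (Q i) y \<partial>N \<partial>N)
        = (\<integral>\<^sup>+x. \<phi> x * indicator (Q i) x \<partial>N) * (ennreal (1 / measure N (Q i)) * emeasure N (Q i))"
      by (simp only: mult_ac)
    then show "ennreal (1 / measure N (Q i)) * (\<integral>\<^sup>+x. \<integral>\<^sup>+y. \<phi> (snd (x, y)) * indicator (Q i) x * indicator (Q i) y \<partial>N \<partial>N)
        = (\<integral>\<^sup>+x. \<phi> x * indicator (Q i) x \<partial>N)"
      by (simp only: cell_ratio[OF i] mult_1_right)
  qed
  also have "\<dots> \<le> (\<integral>\<^sup>+x. \<phi> x \<partial>N)" by (rule sum_cells_le) measurable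
  finally show ?thesis .
qed

lemma sigma_finite_cell_pairs: "sigma_finite_measure cell_pairs"
proof -
  interpret P: pair_sigma_finite N N by unfold_locales
  show ?thesis unfolding cell_pairs_def
    by (subst P.P.sigma_finite_iff_density_finite) auto
qed

lemma AE_cell_pairs:
  assumes "AE x in N. P x"
  shows "AE z in cell_pairs. P (fst z) \<and> P (snd z)"
proof -
  interpret P: pair_sigma_finite N N by unfold_locales
  obtain Z where Z: "{x\<in>space N. \<not> P x} \<subseteq> Z" "Z \<in> null_sets N" using assms by (auto simp: eventually_ae_filter)
  have "Z \<times> space N \<in> null_sets (N \<Otimes>\<^sub>M N)" "space N \<times> Z \<in> null_sets (N \<Otimes>\<^sub>M N)"
    using Z by (auto intro: times_in_null_sets1 times_in_null_sets2)
  then have "Z \<times> space N \<union> space N \<times> Z \<in> null_sets (N \<Otimes>\<^sub>M N)" by (rule null_sets.Un)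
  then have "AE z in N \<Otimes>\<^sub>M N. P (fst z) \<and> P (snd z)"
    by (rule AE_I') (use Z in \<open>auto simp: space_pair_measure\<close>)
  then show ?thesis unfolding cell_pairs_def by (subst AE_density) auto
qed

lemma cell_pairs_same_cell: "AE z in cell_pairs. \<exists>i\<in>I. fst z \<in> Q i \<and> snd z \<in> Q i"
proof -
  have "kern z = 0" if "\<not> (\<exists>i\<in>I. fst z \<in> Q i \<and> snd z \<in> Q i)" for z
    unfolding kern_def by (rule sum.neutral) (use that in \<open>auto simp: indicator_def\<close>)
  then have "0 < ennreal (kern z) \<longrightarrow> (\<exists>i\<in>I. fst z \<in> Q i \<and> snd z \<in> Q i)" for z
    by (cases "\<exists>i\<in>I. fst z \<in> Q i \<and> snd z \<in> Q i") auto
  then show ?thesis unfolding cell_pairs_def by (subst AE_density) auto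
qed

text \<open>The oscillation of \<open>g\<close> within the cells. As the norm of a function that depends linearly on \<open>g\<close>, it can
  be interpolated like any other bound.\<close>

definition osc :: "real \<Rightarrow> ('b \<Rightarrow> real) \<Rightarrow> ('b \<Rightarrow> complex) \<Rightarrow> ennreal" where
  "osc s w g = Lpow cell_pairs s (\<lambda>z. w (fst z)) (\<lambda>z. g (fst z) - g (snd z))"

text \<open>Split the difference and pass to the marginals. Replacing \<open>w x\<close> by \<open>w y\<close> in the second term costs a
  factor 2 on pairs in a common cell.\<close>

lemma osc_le_Lpow:
  assumes s: "0 < s" and [measurable]: "w \<in> borel_measurable N" "g \<in> borel_measurable N"
    and flat: "\<And>i x y. i \<in> I \<Longrightarrow> x \<in> Q i \<Longrightarrow> y \<in> Q i \<Longrightarrow> 0 < w x \<and> w x \<le> 2 * w y"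
  shows "osc s w g \<le> ennreal (2 powr s * (1 + 2 powr s)) * Lpow N s w g"
proof -
  have "osc s w g = Lpow cell_pairs s (\<lambda>z. w (fst z)) (\<lambda>z. g (fst z) + (- g (snd z)))"
    by (simp add: osc_def)
  also have "\<dots> \<le> ennreal (2 powr s) * (Lpow cell_pairs s (\<lambda>z. w (fst z)) (\<lambda>z. g (fst z))
      + Lpow cell_pairs s (\<lambda>z. w (fst z)) (\<lambda>z. - g (snd z)))"
    using s by (intro Lpow_add) measurable
  also have "\<dots> \<le> ennreal (2 powr s) * (Lpow N s w g + ennreal (2 powr s) * Lpow N s w g)"
  proof (intro mult_left_mono add_mono)
  show "Lpow cell_pairs s (\<lambda>z. w (fst z)) (\<lambda>z. g (fst z)) \<le> Lpow N s w g"
    unfolding Lpow_def by (rule marginal_fst[of "\<lambda>x. ennreal (norm (g x * of_real (w x)) powr s)"]) measurable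
  show "Lpow cell_pairs s (\<lambda>z. w (fst z)) (\<lambda>z. - g (snd z)) \<le> ennreal (2 powr s) * Lpow N s w g"
  proof -
    have "Lpow cell_pairs s (\<lambda>z. w (fst z)) (\<lambda>z. - g (snd z)) \<le>
        (\<integral>\<^sup>+z. ennreal (2 powr s) * ennreal (norm (g (snd z) * of_real (w (snd z))) powr s) \<partial>cell_pairs)"
      unfolding Lpow_def
    proof (rule nn_integral_mono_AE, use cell_pairs_same_cell in eventually_elim)
      case (elim z)
      then obtain i where i: "i \<in> I" "fst z \<in> Q i" "snd z \<in> Q i" by blast
      have w: "0 < w (fst z)" "w (fst z) \<le> 2 * w (snd z)" "0 < w (snd z)" using flat[of i] i by auto
      have "norm (- g (snd z) * of_real (w (fst z))) \<le> 2 * norm (g (snd z) * of_real (w (snd z)))"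
        using w mult_left_mono[OF w(2), of "norm (g (snd z))"] by (simp add: norm_mult)
      then have "norm (- g (snd z) * of_real (w (fst z))) powr s \<le> (2 * norm (g (snd z) * of_real (w (snd z)))) powr s"
        using s by (intro powr_mono2) auto
      also have "\<dots> = 2 powr s * norm (g (snd z) * of_real (w (snd z))) powr s" by (rule powr_mult)
      finally show ?case by (simp add: ennreal_leI flip: ennreal_mult)
    qed
    also have "\<dots> = ennreal (2 powr s) * (\<integral>\<^sup>+z. ennreal (norm (g (snd z) * of_real (w (snd z))) powr s) \<partial>cell_pairs)"
      by (rule nn_integral_cmult) measurable
    also have "\<dots> \<le> ennreal (2 powr s) * Lpow N s w g"
      unfolding Lpow_def
      by (intro mult_left_mono marginal_snd[of "\<lambda>x. ennreal (norm (g x * of_real (w x)) powr s)"]) measurable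
    finally show ?thesis .
  qed
  qed simp
  also have "\<dots> = ennreal (2 powr s * (1 + 2 powr s)) * Lpow N s w g"
    by (simp add: ennreal_mult ennreal_plus distrib_left distrib_right mult.assoc)
  finally show ?thesis .
qed

end

lemma nn_integral_exists_le_average:
  assumes [measurable]: "\<Psi> \<in> borel_measurable N" and Q: "Q \<in> fmeasurable N" "0 < measure N Q"
    and le: "ennreal (1 / measure N Q) * (\<integral>\<^sup>+y. \<Psi> y * indicator Q y \<partial>N) = a"
  obtains y where "y \<in> Q" "\<Psi> y \<le> a"
proof -
  have "\<exists>y\<in>Q. \<Psi> y \<le> a"
  proof (rule ccontr)
    assume "\<not> ?thesis"
    then have gt: "\<And>y. y \<in> Q \<Longrightarrow> a < \<Psi> y" by (auto simp: not_le)
    have [measurable]: "Q \<in> sets N" using Q by auto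
    have int: "(\<integral>\<^sup>+y. \<Psi> y * indicator Q y \<partial>N) = a * ennreal (measure N Q)"
    proof -
      have "a * ennreal (measure N Q) = (ennreal (1 / measure N Q) * ennreal (measure N Q)) * (\<integral>\<^sup>+y. \<Psi> y * indicator Q y \<partial>N)"
        by (simp only: le[symmetric] mult_ac)
      also have "ennreal (1 / measure N Q) * ennreal (measure N Q) = 1" using Q by (simp flip: ennreal_mult)
      finally show ?thesis by simp
    qed
    have em: "emeasure N Q = ennreal (measure N Q)" using Q by (simp add: emeasure_eq_measure2)
    obtain y where "y \<in> Q" using Q(2) by fastforce
    then have a: "a \<noteq> \<infinity>" using gt[of y] by (auto simp: top_unique)
    have ia: "(\<integral>\<^sup>+y. a * indicator Q y \<partial>N) = a * ennreal (measure N Q)"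
      by (simp add: nn_integral_cmult_indicator em)
    have "(\<integral>\<^sup>+y. a * indicator Q y \<partial>N) < (\<integral>\<^sup>+y. \<Psi> y * indicator Q y \<partial>N)"
    proof (rule nn_integral_less)
      show "(\<integral>\<^sup>+y. a * indicator Q y \<partial>N) \<noteq> \<infinity>"
        unfolding ia using a by (simp add: ennreal_mult_eq_top_iff)
      show "AE x in N. a * indicator Q x \<le> \<Psi> x * indicator Q x"
        by (rule AE_I2) (use gt in \<open>auto simp: indicator_def intro: less_imp_le\<close>)
      show "\<not> (AE x in N. \<Psi> x * indicator Q x \<le> a * indicator Q x)"
      proof
        assume "AE x in N. \<Psi> x * indicator Q x \<le> a * indicator Q x"
        then have "AE x in N. x \<notin> Q"
          by eventually_elim (use gt in \<open>force simp: indicator_def not_le[symmetric] split: if_splits\<close>)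
        then have "Q \<in> null_sets N" by (subst AE_iff_null_sets) auto
        then show False using Q(2) by (auto simp: measure_def)
      qed
    qed measurable
    then show False unfolding int ia by simp
  qed
  then show thesis using that by blast
qed

context cell_family begin

definition step :: "('i \<Rightarrow> complex) \<Rightarrow> 'b \<Rightarrow> complex" where
  "step c x = (\<Sum>i\<in>I. c i * indicator (Q i) x)"

abbreviation "A \<equiv> \<Union>i\<in>I. Q i"

lemma A_sets[measurable]: "A \<in> sets N"
  using finI by auto

lemma step_meas[measurable]: "step c \<in> borel_measurable N"
  unfolding step_def by measurable

lemma step_on:
  assumes "i \<in> I" "x \<in> Q i" shows "step c x = c i"
proof -
  have "x \<notin> Q k" if "k \<in> I" "k \<noteq> i" for k
    using disj assms that by (auto simp: disjoint_family_on_def)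
  then have "step c x = (\<Sum>k\<in>I. if k = i then c i else 0)"
    unfolding step_def using assms by (intro sum.cong) (auto simp: indicator_def)
  then show ?thesis using finI assms by simp
qed

lemma step_off: "x \<notin> A \<Longrightarrow> step c x = 0"
  unfolding step_def by (intro sum.neutral) auto

lemma Lpow_split_cells:
  assumes "0 < s" and [measurable]: "w \<in> borel_measurable N" "h \<in> borel_measurable N"
  shows "Lpow N s w h = Lpow N s w (\<lambda>x. h x * indicator (- A) x) + (\<Sum>i\<in>I. \<integral>\<^sup>+x. ennreal (norm (h x * of_real (w x)) powr s) * indicator (Q i) x \<partial>N)"
proof -
  let ?\<phi> = "\<lambda>x. ennreal (norm (h x * of_real (w x)) powr s)"
  have "Lpow N s w h = (\<integral>\<^sup>+x. ennreal (norm (h x * indicator (- A) x * of_real (w x)) powr s) + (\<Sum>i\<in>I. ?\<phi> x * indicator (Q i) x) \<partial>N)"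
    unfolding Lpow_def
  proof (rule nn_integral_cong)
    fix x
    have "(\<Sum>i\<in>I. ?\<phi> x * indicator (Q i) x) = ?\<phi> x * indicator A x"
      by (simp add: sum_distrib_left[symmetric] indicator_UN_disjoint[OF finI disj])
    then show "?\<phi> x = ennreal (norm (h x * indicator (- A) x * of_real (w x)) powr s) + (\<Sum>i\<in>I. ?\<phi> x * indicator (Q i) x)"
      using assms(1) by (cases "x \<in> A") (auto simp: indicator_def)
  qed
  also have "\<dots> = Lpow N s w (\<lambda>x. h x * indicator (- A) x) + (\<integral>\<^sup>+x. (\<Sum>i\<in>I. ?\<phi> x * indicator (Q i) x) \<partial>N)"
  proof -
    have "(\<lambda>x. h x * indicator (- A) x) \<in> borel_measurable N"
    proof -
      have "(\<lambda>x. h x * (1 - indicator A x)) \<in> borel_measurable N" by measurable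
      moreover have "(\<lambda>x. h x * (1 - indicator A x)) = (\<lambda>x. h x * indicator (- A) x)" by (auto simp: indicator_def)
      ultimately show ?thesis by simp
    qed
    note this[measurable]
    show ?thesis unfolding Lpow_def by (rule nn_integral_add) measurable
  qed
  also have "(\<integral>\<^sup>+x. (\<Sum>i\<in>I. ?\<phi> x * indicator (Q i) x) \<partial>N) = (\<Sum>i\<in>I. \<integral>\<^sup>+x. ?\<phi> x * indicator (Q i) x \<partial>N)"
    by (rule nn_integral_sum) measurable
  finally show ?thesis .
qed

text \<open>In each cell, averaging over \<open>y\<close> yields a point \<open>y\<close> for which the deviation of \<open>g\<close> from the constant
  \<open>g y\<close> is at most its mean; the means add up to the oscillation.\<close>

lemma step_approx:
  assumes s: "0 < s" and [measurable]: "w \<in> borel_measurable N" "g \<in> borel_measurable N"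
  obtains c where "Lpow N s w (\<lambda>x. g x - step c x) \<le> Lpow N s w (\<lambda>x. g x * indicator (- A) x) + osc s w g"
proof -
  define \<Psi> where "\<Psi> i y = (\<integral>\<^sup>+x. ennreal (norm ((g x - g y) * of_real (w x)) powr s) * indicator (Q i) x \<partial>N)" for i y
  have \<Psi>m: "\<Psi> i \<in> borel_measurable N" if "i \<in> I" for i
  proof -
    have [measurable]: "Q i \<in> sets N" using that by simp
    show ?thesis unfolding \<Psi>_def by measurable
  qed
  define a where "a i = ennreal (1 / measure N (Q i)) * (\<integral>\<^sup>+y. \<Psi> i y * indicator (Q i) y \<partial>N)" for i
  have "\<forall>i\<in>I. \<exists>y\<in>Q i. \<Psi> i y \<le> a i"
  proof
    fix i assume i: "i \<in> I"
    from nn_integral_exists_le_average[OF \<Psi>m[OF i] Qf[OF i] Qpos[OF i] a_def[of i, symmetric]]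
    show "\<exists>y\<in>Q i. \<Psi> i y \<le> a i" by blast
  qed
  then obtain y where y: "\<And>i. i \<in> I \<Longrightarrow> y i \<in> Q i" "\<And>i. i \<in> I \<Longrightarrow> \<Psi> i (y i) \<le> a i" by metis
  \<comment> \<open>The constant on a cell is the value of \<open>g\<close> at a good sample point.\<close>
  define c where "c i = g (y i)" for i
  have osc: "osc s w g = (\<Sum>i\<in>I. a i)"
  proof -
    interpret P: pair_sigma_finite N N by unfold_locales
    have "osc s w g = (\<Sum>i\<in>I. ennreal (1 / measure N (Q i)) * (\<integral>\<^sup>+x. \<integral>\<^sup>+y. ennreal (norm ((g (fst (x, y)) - g (snd (x, y))) * of_real (w (fst (x, y)))) powr s) * indicator (Q i) x * indicator (Q i) y \<partial>N \<partial>N))"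
      unfolding osc_def Lpow_def by (rule nn_integral_cell_pairs) measurable
    also have "\<dots> = (\<Sum>i\<in>I. a i)"
    proof (rule sum.cong[OF refl])
      fix i assume "i \<in> I"
      then have [measurable]: "Q i \<in> sets N" by simp
      have "(\<integral>\<^sup>+x. \<integral>\<^sup>+y. ennreal (norm ((g (fst (x, y)) - g (snd (x, y))) * of_real (w (fst (x, y)))) powr s) * indicator (Q i) x * indicator (Q i) y \<partial>N \<partial>N)
        = (\<integral>\<^sup>+y. \<integral>\<^sup>+x. ennreal (norm ((g x - g y) * of_real (w x)) powr s) * indicator (Q i) x * indicator (Q i) y \<partial>N \<partial>N)"
        unfolding fst_conv snd_conv by (rule P.Fubini') measurable
      also have "\<dots> = (\<integral>\<^sup>+y. \<Psi> i y * indicator (Q i) y \<partial>N)"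
        unfolding \<Psi>_def by (intro nn_integral_cong nn_integral_multc) measurable
      finally show "ennreal (1 / measure N (Q i)) * (\<integral>\<^sup>+x. \<integral>\<^sup>+y. ennreal (norm ((g (fst (x, y)) - g (snd (x, y))) * of_real (w (fst (x, y)))) powr s) * indicator (Q i) x * indicator (Q i) y \<partial>N \<partial>N) = a i"
        by (simp only: a_def)
    qed
    finally show ?thesis .
  qed
  have "Lpow N s w (\<lambda>x. g x - step c x) = Lpow N s w (\<lambda>x. (g x - step c x) * indicator (- A) x)
      + (\<Sum>i\<in>I. \<integral>\<^sup>+x. ennreal (norm ((g x - step c x) * of_real (w x)) powr s) * indicator (Q i) x \<partial>N)"
    using s by (intro Lpow_split_cells) measurable
  also have "(\<lambda>x. (g x - step c x) * indicator (- A) x) = (\<lambda>x. g x * indicator (- A) x)"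
  proof
    fix x show "(g x - step c x) * indicator (- A) x = g x * indicator (- A) x"
      using step_off[of x c] by (cases "x \<in> A") (auto simp: indicator_def)
  qed
  also have "(\<Sum>i\<in>I. \<integral>\<^sup>+x. ennreal (norm ((g x - step c x) * of_real (w x)) powr s) * indicator (Q i) x \<partial>N) = (\<Sum>i\<in>I. \<Psi> i (y i))"
  proof (rule sum.cong[OF refl])
    fix i assume i: "i \<in> I"
    show "(\<integral>\<^sup>+x. ennreal (norm ((g x - step c x) * of_real (w x)) powr s) * indicator (Q i) x \<partial>N) = \<Psi> i (y i)"
      unfolding \<Psi>_def by (intro nn_integral_cong) (auto simp: indicator_def step_on[OF i] c_def)
  qed
  also have "\<dots> \<le> osc s w g" unfolding osc by (rule sum_mono) (rule y(2))
  finally show thesis by (intro that[of c]) (simp add: add_left_mono)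
qed

end

text \<open>For a given accuracy, the members of \<open>G\<close> are close to step functions on one and the same family of
  cells. The coefficients of these step functions are bounded, since each cell has positive norm; rounding
  them to a lattice leaves finitely many step functions.\<close>

lemma (in weighted_Lspace) totbdd_by_cells:
  assumes sf: "sigma_finite_measure N" and G: "G \<subseteq> L" and B: "\<And>g. g \<in> G \<Longrightarrow> Lpow N s w g \<le> ennreal B"
    and cells: "\<And>\<epsilon>. 0 < \<epsilon> \<Longrightarrow> \<exists>(I::'i set) Q. cell_family N I Q \<and> Lpow N s w (indicator (\<Union>i\<in>I. Q i)) < \<infinity> \<and>
       (\<forall>g\<in>G. Lpow N s w (\<lambda>x. g x * indicator (- (\<Union>i\<in>I. Q i)) x) \<le> ennreal \<epsilon> \<and> cell_family.osc N I Q s w g \<le> ennreal \<epsilon>)"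
  shows "totbdd G"
  unfolding totbdd_def
proof (intro conjI allI impI G)
  fix \<epsilon> :: real assume "0 < \<epsilon>"
  define \<eta> where "\<eta> = \<epsilon> / (4 * 2 powr s)"
  have \<eta>: "0 < \<eta>" using \<open>0 < \<epsilon>\<close> by (simp add: \<eta>_def)
  obtain I :: "'i set" and Q where IQ: "cell_family N I Q" "Lpow N s w (indicator (\<Union>i\<in>I. Q i)) < \<infinity>"
    and small: "\<And>g. g \<in> G \<Longrightarrow> Lpow N s w (\<lambda>x. g x * indicator (- (\<Union>i\<in>I. Q i)) x) \<le> ennreal \<eta>"
      "\<And>g. g \<in> G \<Longrightarrow> cell_family.osc N I Q s w g \<le> ennreal \<eta>"
    using cells[OF \<eta>] by blast
  interpret C: cell_family N I Q by (rule IQ)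
  define \<Lambda> where "\<Lambda> = enn2real (Lpow N s w (indicator C.A))"
  have \<Lambda>: "Lpow N s w (indicator C.A) = ennreal \<Lambda>" "0 \<le> \<Lambda>"
    using IQ(2) by (auto simp: \<Lambda>_def)
  define m where "m i = Lpow N s w (indicator (Q i))" for i
  have m: "0 < m i" "m i < \<infinity>" if "i \<in> I" for i
  proof -
    have "m i \<le> Lpow N s w (indicator C.A)"
      unfolding m_def using that s by (intro Lpow_mono_AE[OF w_meas s] AE_I2) (auto simp: indicator_def)
    then show "m i < \<infinity>" using IQ(2) by (rule le_less_trans)
    have "m i \<noteq> 0"
    proof
      assume "m i = 0"
      then have "AE x in N. indicator (Q i) x * complex_of_real (w x) = 0"
        unfolding m_def using that by (subst (asm) Lpow_eq_0_iff[OF w_meas s]) auto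
      with w_pos have "AE x in N. x \<notin> Q i" by eventually_elim (auto simp: indicator_def)
      then have "Q i \<in> null_sets N" using that by (subst AE_iff_null_sets) auto
      then show False using C.Qpos[OF that] by (auto simp: measure_def)
    qed
    then show "0 < m i" by (simp add: zero_less_iff_neq_zero)
  qed
  define R where "R = 2 powr s * (2 * \<eta> + max 0 B)"
  \<comment> \<open>A bound for the \<open>i\<close>-th coefficient of any step function with \<open>Lpow\<close> at most \<open>R\<close>.\<close>
  define b where "b i = (R / enn2real (m i)) powr (1 / s)" for i
  define Cb where "Cb = (\<Sum>i\<in>I. b i)"
  \<comment> \<open>Changing all coefficients by at most \<open>\<delta>\<close> moves the step function by at most \<open>\<eta>\<close>, as measured by \<open>Lpow\<close>.\<close>
  define \<delta> where "\<delta> = (\<eta> / (\<Lambda> + 1)) powr (1 / s)"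
  have \<delta>: "0 < \<delta>" using \<eta> \<Lambda> by (simp add: \<delta>_def)
  obtain k where "2 / \<delta> \<le> real k" using real_arch_simple by blast
  then have "2 / \<delta> \<le> real (Suc k)" by simp
  then have k: "2 / real (Suc k) \<le> \<delta>" using \<delta> by (simp add: field_simps)
  define F where "F = C.step ` PiE I (\<lambda>_. grid k ` {z. norm z \<le> Cb})"
  have stepL: "C.step c \<in> L" for c
  proof -
    define M where "M = (\<Sum>i\<in>I. norm (c i))"
    have "Lpow N s w (C.step c) \<le> Lpow N s w (\<lambda>x. of_real M * indicator C.A x)"
    proof (intro Lpow_mono_AE[OF w_meas s] AE_I2)
      fix x
      show "norm (C.step c x * of_real (w x)) \<le> norm (of_real M * indicator C.A x * of_real (w x) :: complex)"
      proof (cases "x \<in> C.A")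
        case True
        then obtain i where i: "i \<in> I" "x \<in> Q i" by blast
        have "norm (c i) \<le> M" unfolding M_def using i C.finI by (intro member_le_sum) auto
        then show ?thesis using C.step_on[OF i] True
          by (simp add: norm_mult mult_right_mono)
      next
        case False
        then show ?thesis using C.step_off[of x c] by simp
      qed
    qed
    also have "\<dots> = ennreal (norm (of_real M :: complex) powr s) * Lpow N s w (indicator C.A)"
      by (rule Lpow_scale[OF w_meas s]) measurable
    also have "\<dots> < \<infinity>" using \<Lambda> by (simp add: ennreal_mult_less_top)
    finally show ?thesis by (simp add: L_iff)
  qed
  have "\<exists>f\<in>F. Ldist N s w g f < \<epsilon>" if g: "g \<in> G" for g
  proof -
    have gL: "g \<in> L" using g G by blast
    have [measurable]: "g \<in> borel_measurable N" using gL by (rule L_meas)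
    obtain c where c: "Lpow N s w (\<lambda>x. g x - C.step c x) \<le> Lpow N s w (\<lambda>x. g x * indicator (- C.A) x) + C.osc s w g"
      using C.step_approx[OF s w_meas] by (metis \<open>g \<in> borel_measurable N\<close>)
    also have "\<dots> \<le> ennreal \<eta> + ennreal \<eta>" using small[OF g] by (rule add_mono)
    also have "\<dots> = ennreal (2 * \<eta>)" using \<eta> by (simp flip: ennreal_plus)
    finally have gc: "Lpow N s w (\<lambda>x. g x - C.step c x) \<le> ennreal (2 * \<eta>)" .
    have sc: "Lpow N s w (C.step c) \<le> ennreal R"
    proof -
      have "Lpow N s w (\<lambda>x. (C.step c x - g x) + g x) \<le> ennreal (2 powr s) * (Lpow N s w (\<lambda>x. C.step c x - g x) + Lpow N s w g)"
        by (intro Lpow_add[OF w_meas s]) measurable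
      also have "\<dots> \<le> ennreal (2 powr s) * (ennreal (2 * \<eta>) + ennreal (max 0 B))"
        using gc B[OF g] by (intro mult_left_mono add_mono)
          (auto simp: Lpow_minus_commute[OF w_meas s, of "C.step c"] max_def ennreal_neg)
      also have "\<dots> = ennreal R" using \<eta> by (simp add: R_def flip: ennreal_plus ennreal_mult)
      finally show ?thesis by simp
    qed
    have R0: "0 \<le> R" using \<eta> by (simp add: R_def)
    have cle: "norm (c i) \<le> Cb" if i: "i \<in> I" for i
    proof -
      obtain mi where mi: "m i = ennreal mi" "0 < mi" using m[OF i] by (cases "m i") auto
      have "ennreal (norm (c i) powr s * mi) = Lpow N s w (\<lambda>x. c i * indicator (Q i) x)"
        using i mi by (subst Lpow_scale[OF w_meas s]) (auto simp: m_def ennreal_mult)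
      also have "\<dots> \<le> Lpow N s w (C.step c)"
        by (intro Lpow_mono_AE[OF w_meas s] AE_I2) (auto simp: indicator_def C.step_on[OF i])
      also note sc
      finally have "norm (c i) powr s * mi \<le> R" using R0 by (subst (asm) ennreal_le_iff) auto
      then have "norm (c i) powr s \<le> R / mi" using mi by (simp add: field_simps)
      then have "(norm (c i) powr s) powr (1 / s) \<le> (R / mi) powr (1 / s)" using s by (intro powr_mono2) auto
      then have "norm (c i) \<le> b i" using s mi by (simp add: powr_powr b_def)
      also have "\<dots> \<le> Cb" unfolding Cb_def using i C.finI by (intro member_le_sum) (auto simp: b_def)
      finally show ?thesis .
    qed
    define z where "z = restrict (\<lambda>i. grid k (c i)) I"
    have zF: "C.step z \<in> F" unfolding F_def z_def using cle by (intro imageI restrict_PiE_iff[THEN iffD2]) auto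
    have "Lpow N s w (\<lambda>x. C.step c x - C.step z x) \<le> Lpow N s w (\<lambda>x. of_real \<delta> * indicator C.A x)"
    proof (intro Lpow_mono_AE[OF w_meas s] AE_I2)
      fix x
      show "norm ((C.step c x - C.step z x) * of_real (w x)) \<le> norm (of_real \<delta> * indicator C.A x * of_real (w x) :: complex)"
      proof (cases "x \<in> C.A")
        case True
        then obtain i where i: "i \<in> I" "x \<in> Q i" by blast
        have "norm (c i - grid k (c i)) \<le> \<delta>" using grid_dist[of "c i" k] k by linarith
        then show ?thesis using C.step_on[OF i] True i \<delta>
          by (simp add: norm_mult mult_right_mono z_def)
      next
        case False
        then show ?thesis using C.step_off[of x c] C.step_off[of x z] by simp
      qed
    qed
    also have "\<dots> = ennreal (norm (of_real \<delta> :: complex) powr s) * Lpow N s w (indicator C.A)"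
      by (rule Lpow_scale[OF w_meas s]) measurable
    also have "\<dots> = ennreal (\<eta> / (\<Lambda> + 1) * \<Lambda>)"
    proof -
      have "\<delta> powr s = \<eta> / (\<Lambda> + 1)" using s \<eta> \<Lambda> by (simp add: \<delta>_def powr_powr)
      then show ?thesis using \<Lambda> \<delta> \<eta> by (simp add: ennreal_mult[of "\<eta> / (\<Lambda> + 1)" \<Lambda>] del: times_divide_eq_left)
    qed
    also have "\<dots> \<le> ennreal \<eta>" using \<Lambda> \<eta> by (intro ennreal_leI) (simp add: field_simps)
    finally have cz: "Lpow N s w (\<lambda>x. C.step c x - C.step z x) \<le> ennreal \<eta>" .
    have "Lpow N s w (\<lambda>x. (g x - C.step c x) + (C.step c x - C.step z x)) \<le>
        ennreal (2 powr s) * (Lpow N s w (\<lambda>x. g x - C.step c x) + Lpow N s w (\<lambda>x. C.step c x - C.step z x))"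
      by (intro Lpow_add[OF w_meas s]) measurable
    also have "\<dots> \<le> ennreal (2 powr s) * (ennreal (2 * \<eta>) + ennreal \<eta>)"
      using gc cz by (intro mult_left_mono add_mono) auto
    also have "\<dots> = ennreal (2 powr s * (3 * \<eta>))" using \<eta> by (simp flip: ennreal_plus ennreal_mult)
    also have "\<dots> < ennreal \<epsilon>" using \<open>0 < \<epsilon>\<close> by (intro ennreal_lessI) (auto simp: \<eta>_def)
    finally have "Lpow N s w (\<lambda>x. g x - C.step z x) < ennreal \<epsilon>" by simp
    then have "Ldist N s w g (C.step z) < \<epsilon>" by (simp add: Lpow_less_iff_Ldist gL stepL)
    with zF show ?thesis by blast
  qed
  moreover have "finite F" unfolding F_def using C.finI by (intro finite_imageI finite_PiE finite_grid_image)
  moreover have "F \<subseteq> L" unfolding F_def using stepL by auto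
  ultimately show "\<exists>F. finite F \<and> F \<subseteq> L \<and> (\<forall>g\<in>G. \<exists>f\<in>F. Ldist N s w g f < \<epsilon>)" by blast
qed

context target_pair begin

lemma off_band_meas[measurable]: "off_band N w0 n \<in> sets N" "off_band N v0 n \<in> sets N"
  by (rule off_band_sets w0_meas v0_meas)+

text \<open>The approximation is supported where both weights are bounded above and below, and it exists for all
  large \<open>n\<close>, so that one \<open>n\<close> serves any finite number of functions.\<close>

lemma dense_simple:
  assumes C: "\<And>n. C n \<in> sets N" "(\<Union>n. C n) = space N" "\<And>n. emeasure N (C n) \<noteq> \<infinity>" "incseq C"
    and f: "f \<in> wLspace N (ennreal q0) v0" and \<epsilon>: "0 < \<epsilon>"
  shows "eventually (\<lambda>n. \<exists>g\<in>simple_functions N. (\<forall>x. g x \<noteq> 0 \<longrightarrow> x \<in> C n - off_band N w0 n - off_band N v0 n) \<and>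
     Lpow N q0 v0 (\<lambda>x. f x - g x) \<le> ennreal \<epsilon>) sequentially"
proof -
  interpret L: weighted_Lspace N q0 v0 using v0 q0 by unfold_locales
  note C(1)[measurable] v0_meas[measurable]
  have f': "Lpow N q0 v0 f < \<infinity>" and [measurable]: "f \<in> borel_measurable N" using f by (auto simp: L.L_iff)
  define \<eta> where "\<eta> = \<epsilon> / (2 * 2 powr q0)"
  have \<eta>: "0 < \<eta>" using \<epsilon> by (simp add: \<eta>_def)
  define X where "X n = (C n - off_band N w0 n - off_band N v0 n) \<inter> {x\<in>space N. norm (f x) \<le> real n}" for n
  have [measurable]: "X n \<in> sets N" for n unfolding X_def by measurable
  have "AE x in N. eventually (\<lambda>n. x \<notin> space N - X n) sequentially"
    using off_band_vanish[OF w0_pos] off_band_vanish[OF v0_pos] AE_space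
  proof eventually_elim
    case (elim x)
    obtain n1 where n1: "x \<in> C n1" using elim C(2) by blast
    have 1: "eventually (\<lambda>n. x \<in> C n) sequentially"
      using n1 incseqD[OF C(4)] by (intro eventually_sequentiallyI[of n1]) blast
    obtain n2 where n2: "norm (f x) \<le> real n2" using real_arch_simple by blast
    have 2: "eventually (\<lambda>n. norm (f x) \<le> real n) sequentially"
      by (rule eventually_sequentiallyI[of n2]) (use n2 in linarith)
    show ?case using elim(1,2) 1 2 by eventually_elim (use elim(3) in \<open>auto simp: X_def\<close>)
  qed
  then have "eventually (\<lambda>n. Lpow N q0 v0 (\<lambda>x. f x * indicator (space N - X n) x) < ennreal \<eta>) sequentially"
    by (intro Lpow_vanishing q0 f' \<eta>) measurable
  then show ?thesis
  proof eventually_elim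
    case (elim n)
    have XC: "X n \<subseteq> C n" by (auto simp: X_def)
    have Xf: "X n \<in> fmeasurable N"
      using emeasure_mono[OF XC, of N] C(3)[of n] by (intro fmeasurableI) (auto simp: top.not_eq_extremum intro: le_less_trans)
    define a where "a = measure N (X n)"
    have a: "0 \<le> a" by (simp add: a_def)
    \<comment> \<open>An error \<open>e\<close> on \<open>X n\<close>, where \<open>v0\<close> is at most \<open>n + 1\<close>, contributes at most \<open>\<eta>\<close> to \<open>Lpow\<close>.\<close>
    define e where "e = (\<eta> / (a + 1)) powr (1 / q0) / real (Suc n)"
    have e: "0 < e" using \<eta> a by (simp add: e_def)
    obtain g where g: "g \<in> simple_functions N" "\<And>x. x \<notin> X n \<Longrightarrow> g x = 0" "\<And>x. x \<in> X n \<Longrightarrow> norm (f x - g x) \<le> e"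
      by (rule bounded_approx_simple[of f N "X n" "real n" e]) (use Xf e in \<open>auto simp: X_def\<close>)
    have [measurable]: "g \<in> borel_measurable N" using g by (simp add: simple_functions_iff)
    have "Lpow N q0 v0 (\<lambda>x. (f x - g x) * indicator (X n) x) \<le> ennreal ((e * real (Suc n)) powr q0 * a)"
    proof (rule Lpow_bounded_on[OF q0, of "X n"])
      fix x assume x: "x \<in> space N"
      show "norm ((f x - g x) * indicator (X n) x * of_real (v0 x)) \<le> e * real (Suc n) * indicator (X n) x"
      proof (cases "x \<in> X n")
        case True
        then have "x \<notin> off_band N v0 n" by (auto simp: X_def)
        then have "\<bar>v0 x\<bar> \<le> real (Suc n)"
          using x order_trans[of 0 "1 / real (Suc n)" "v0 x"] by (auto simp: off_band_def)
        then show ?thesis using True g(3)[OF True] e by (simp add: norm_mult mult_mono del: of_nat_Suc)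
      qed simp
    qed (use Xf e in \<open>auto simp: a_def\<close>)
    also have "(e * real (Suc n)) powr q0 * a = \<eta> / (a + 1) * a"
      using \<eta> a q0 by (simp add: e_def powr_powr del: of_nat_Suc)
    also have "ennreal (\<eta> / (a + 1) * a) \<le> ennreal \<eta>" using \<eta> a by (intro ennreal_leI) (simp add: field_simps)
    finally have 2: "Lpow N q0 v0 (\<lambda>x. (f x - g x) * indicator (X n) x) \<le> ennreal \<eta>" .
    have "Lpow N q0 v0 (\<lambda>x. f x - g x) = Lpow N q0 v0 (\<lambda>x. f x * indicator (space N - X n) x + (f x - g x) * indicator (X n) x)"
      by (intro Lpow_cong_AE[OF v0_meas q0] AE_I2) (use g(2) in \<open>auto simp: indicator_def\<close>)
    also have "\<dots> \<le> ennreal (2 powr q0) * (Lpow N q0 v0 (\<lambda>x. f x * indicator (space N - X n) x) + Lpow N q0 v0 (\<lambda>x. (f x - g x) * indicator (X n) x))"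
      by (intro Lpow_add[OF v0_meas q0]) measurable
    also have "\<dots> \<le> ennreal (2 powr q0) * (ennreal \<eta> + ennreal \<eta>)"
      using elim 2 by (intro mult_left_mono add_mono) auto
    also have "\<dots> = ennreal \<epsilon>" using \<eta> \<epsilon> by (simp add: \<eta>_def flip: ennreal_plus ennreal_mult)
    finally have "Lpow N q0 v0 (\<lambda>x. f x - g x) \<le> ennreal \<epsilon>" .
    moreover have "x \<in> C n - off_band N w0 n - off_band N v0 n" if "g x \<noteq> 0" for x
      using g(2)[of x] that by (auto simp: X_def)
    ultimately show ?case using g(1) by blast
  qed
qed

text \<open>The cells are the joint level sets of finitely many simple functions, which approximate a finite net of
  \<open>G\<close>, and of the weights rounded to powers of 2. The label of a cell consists of these values, which is
  why the simple functions become step functions on the cells.\<close>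

lemma cells_exist:
  assumes G: "quasi_metric.totbdd (wLspace N (ennreal q0) v0) (Ldist N q0 v0) G" and \<epsilon>: "0 < \<epsilon>"
  obtains I :: "((('b \<Rightarrow> complex) \<Rightarrow> complex) \<times> int \<times> int) set" and Q k where "cell_family N I Q"
    "\<And>i x y. i \<in> I \<Longrightarrow> x \<in> Q i \<Longrightarrow> y \<in> Q i \<Longrightarrow> 0 < w0 x \<and> w0 x \<le> 2 * w0 y"
    "\<And>i x y. i \<in> I \<Longrightarrow> x \<in> Q i \<Longrightarrow> y \<in> Q i \<Longrightarrow> 0 < v0 x \<and> v0 x \<le> 2 * v0 y"
    "\<And>x. x \<in> (\<Union>i\<in>I. Q i) \<Longrightarrow> w0 x \<le> k \<and> v0 x \<le> k"
    "\<And>g. g \<in> G \<Longrightarrow> \<exists>c. Lpow N q0 v0 (\<lambda>x. g x - cell_family.step I Q c x) \<le> ennreal \<epsilon>"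
proof -
  interpret L: weighted_Lspace N q0 v0 using v0 q0 by unfold_locales
  note v0_meas[measurable] w0_meas[measurable]
  define \<eta> where "\<eta> = \<epsilon> / (2 * 2 powr q0)"
  have \<eta>: "0 < \<eta>" using \<epsilon> by (simp add: \<eta>_def)
  obtain F where F: "finite F" "F \<subseteq> L.L" "\<And>g. g \<in> G \<Longrightarrow> \<exists>l\<in>F. Ldist N q0 v0 g l < \<eta>"
    using G \<eta> unfolding L.totbdd_def by metis
  have GL: "G \<subseteq> L.L" using G unfolding L.totbdd_def by blast
  obtain C :: "nat \<Rightarrow> 'b set" where C: "range C \<subseteq> sets N" "(\<Union>n. C n) = space N" "\<And>n. emeasure N (C n) \<noteq> \<infinity>" "incseq C"
    using sigma_finite_incseq by blast
  have Cs[measurable]: "C n \<in> sets N" for n using C(1) by blast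
  have "eventually (\<lambda>n. \<forall>l\<in>F. \<exists>g\<in>simple_functions N. (\<forall>x. g x \<noteq> 0 \<longrightarrow> x \<in> C n - off_band N w0 n - off_band N v0 n) \<and>
     Lpow N q0 v0 (\<lambda>x. l x - g x) \<le> ennreal \<eta>) sequentially"
    using F(2) by (intro eventually_ball_finite F(1) ballI dense_simple[OF Cs C(2-4) _ \<eta>]) blast
  then obtain n where "\<forall>l\<in>F. \<exists>g\<in>simple_functions N. (\<forall>x. g x \<noteq> 0 \<longrightarrow> x \<in> C n - off_band N w0 n - off_band N v0 n) \<and>
     Lpow N q0 v0 (\<lambda>x. l x - g x) \<le> ennreal \<eta>"
    by (auto simp: eventually_sequentially)
  then obtain s where s: "\<And>l. l \<in> F \<Longrightarrow> s l \<in> simple_functions N"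
     "\<And>l x. l \<in> F \<Longrightarrow> s l x \<noteq> 0 \<Longrightarrow> x \<in> C n - off_band N w0 n - off_band N v0 n"
     "\<And>l. l \<in> F \<Longrightarrow> Lpow N q0 v0 (\<lambda>x. l x - s l x) \<le> ennreal \<eta>" by metis
  have sm: "s l \<in> borel_measurable N" if "l \<in> F" for l using s(1)[OF that] by (simp add: simple_functions_iff)
  define B where "B = C n - off_band N w0 n - off_band N v0 n"
  have [measurable]: "B \<in> sets N" unfolding B_def by measurable
  have BC: "B \<subseteq> C n" by (auto simp: B_def)
  have Bf: "B \<in> fmeasurable N"
    using emeasure_mono[OF BC, of N] C(3)[of n] by (intro fmeasurableI) (auto simp: top.not_eq_extremum intro: le_less_trans)
  have Bsp: "B \<subseteq> space N" using sets.sets_into_space[OF \<open>B \<in> sets N\<close>] .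
  have band: "1 / real (Suc n) \<le> w0 x" "w0 x \<le> real (Suc n)" "1 / real (Suc n) \<le> v0 x" "v0 x \<le> real (Suc n)" if "x \<in> B" for x
    using that Bsp by (auto simp: B_def off_band_def)
  have pos: "0 < w0 x" "0 < v0 x" if "x \<in> B" for x
    using band[OF that] by (meson less_le_trans of_nat_0_less_iff zero_less_Suc zero_less_divide_1_iff)+
  \<comment> \<open>The label of the cell of \<open>x\<close>.\<close>
  define \<kappa> where "\<kappa> x = (restrict (\<lambda>l. s l x) F, \<lfloor>log 2 (w0 x)\<rfloor>, \<lfloor>log 2 (v0 x)\<rfloor>)" for x
  define Q where "Q i = {x\<in>B. \<kappa> x = i}" for i
  have \<kappa>_eq: "\<kappa> x = i \<longleftrightarrow> fst i \<in> extensional F \<and> (\<forall>l\<in>F. s l x = fst i l) \<and> \<lfloor>log 2 (w0 x)\<rfloor> = fst (snd i) \<and> \<lfloor>log 2 (v0 x)\<rfloor> = snd (snd i)" for x i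
    unfolding \<kappa>_def by (cases i) (auto simp: fun_eq_iff extensional_def)
  have Qs: "Q i \<in> sets N" for i
  proof -
    have "{x\<in>space N. (\<forall>l\<in>F. s l x = fst i l)} \<in> sets N"
    proof (rule sets.sets_Collect_finite_All[OF _ F(1)])
      fix l assume "l \<in> F"
      note sm[OF this, measurable]
      show "{x\<in>space N. s l x = fst i l} \<in> sets N" by measurable
    qed
    then have "B \<inter> {x\<in>space N. (\<forall>l\<in>F. s l x = fst i l)} \<inter> {x\<in>space N. \<lfloor>log 2 (w0 x)\<rfloor> = fst (snd i)} \<inter> {x\<in>space N. \<lfloor>log 2 (v0 x)\<rfloor> = snd (snd i)} \<in> sets N"
      by measurable
    moreover have "Q i = (if fst i \<in> extensional F then B \<inter> {x\<in>space N. (\<forall>l\<in>F. s l x = fst i l)} \<inter> {x\<in>space N. \<lfloor>log 2 (w0 x)\<rfloor> = fst (snd i)} \<inter> {x\<in>space N. \<lfloor>log 2 (v0 x)\<rfloor> = snd (snd i)} else {})"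
      using Bsp by (auto simp: Q_def \<kappa>_eq)
    ultimately show ?thesis by auto
  qed
  have Qf: "Q i \<in> fmeasurable N" for i by (rule fmeasurableI2[OF Bf _ Qs]) (auto simp: Q_def)
  define I0 where "I0 = \<kappa> ` B"
  have "finite I0"
  proof -
    let ?R = "{\<lfloor>log 2 (1 / real (Suc n))\<rfloor>..\<lfloor>log 2 (real (Suc n))\<rfloor>}"
    have fl: "\<lfloor>log 2 y\<rfloor> \<in> ?R" if "1 / real (Suc n) \<le> y" "y \<le> real (Suc n)" for y
    proof -
      have "0 < 1 / real (Suc n)" by simp
      then have "0 < y" using that by linarith
      then show ?thesis using that by (auto intro!: floor_mono simp del: of_nat_Suc)
    qed
    have "I0 \<subseteq> PiE F (\<lambda>l. range (s l)) \<times> ?R \<times> ?R"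
      unfolding I0_def
    proof (rule image_subsetI)
      fix x assume x: "x \<in> B"
      show "\<kappa> x \<in> PiE F (\<lambda>l. range (s l)) \<times> ?R \<times> ?R"
        unfolding \<kappa>_def using fl[OF band(1,2)[OF x]] fl[OF band(3,4)[OF x]] by auto
    qed
    moreover have "finite (PiE F (\<lambda>l. range (s l)) \<times> ?R \<times> ?R)"
      using F(1) s(1) by (intro finite_cartesian_product finite_PiE) (auto simp: simple_functions_iff)
    ultimately show ?thesis by (rule finite_subset)
  qed
  define I where "I = {i\<in>I0. 0 < measure N (Q i)}"
  have cf: "cell_family N I Q"
  proof
    show "finite I" using \<open>finite I0\<close> by (simp add: I_def)
    show "disjoint_family_on Q I" by (auto simp: disjoint_family_on_def Q_def)
  qed (use Qf in \<open>auto simp: I_def\<close>)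
  interpret C: cell_family N I Q by (rule cf)
  have flat: "w x \<le> 2 * w y" if "\<lfloor>log 2 (w x)\<rfloor> = \<lfloor>log 2 (w y)\<rfloor>" "0 < w x" "0 < w y" for w :: "'b \<Rightarrow> real" and x y
  proof -
    have "log 2 (w x) \<le> log 2 (w y) + 1" using that(1) by linarith
    also have "\<dots> = log 2 (2 * w y)" using that by (simp add: log_mult)
    finally show ?thesis using that by (subst (asm) log_le_cancel_iff) auto
  qed
  \<comment> \<open>Only null sets are lost by discarding the cells of measure zero.\<close>
  have null: "AE x in N. x \<in> B \<longrightarrow> x \<in> C.A"
  proof -
    have "AE x in N. \<forall>i\<in>I0. 0 < measure N (Q i) \<or> x \<notin> Q i"
    proof (rule AE_finite_allI[OF \<open>finite I0\<close>])
      fix i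
      show "AE x in N. 0 < measure N (Q i) \<or> x \<notin> Q i"
      proof (cases "0 < measure N (Q i)")
        case False
        then have "measure N (Q i) = 0" using measure_nonneg[of N "Q i"] by linarith
        then have "Q i \<in> null_sets N" using Qf[of i] Qs[of i] by (auto simp: emeasure_eq_measure2)
        then have "AE x in N. x \<notin> Q i" by (subst (asm) AE_iff_null_sets[OF Qs])
        then show ?thesis by eventually_elim simp
      qed simp
    qed
    then show ?thesis by eventually_elim (auto simp: I_def I0_def Q_def)
  qed
  show thesis
  proof (rule that[OF cf])
    show "0 < w0 x \<and> w0 x \<le> 2 * w0 y" "0 < v0 x \<and> v0 x \<le> 2 * v0 y" if "i \<in> I" "x \<in> Q i" "y \<in> Q i" for i x y
      using that pos flat[of w0 x y] flat[of v0 x y] by (auto simp: Q_def \<kappa>_eq)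
    show "w0 x \<le> real (Suc n) \<and> v0 x \<le> real (Suc n)" if "x \<in> C.A" for x
      using that band by (auto simp: Q_def)
    fix g assume g: "g \<in> G"
    then obtain l where l: "l \<in> F" "Ldist N q0 v0 g l < \<eta>" using F(3) by blast
    have gL: "g \<in> L.L" and lL: "l \<in> L.L" using g GL l F(2) by auto
    have [measurable]: "g \<in> borel_measurable N" "l \<in> borel_measurable N" "s l \<in> borel_measurable N"
      using L.L_meas gL lL sm l by auto
    define c where "c i = fst i l" for i :: "(('b \<Rightarrow> complex) \<Rightarrow> complex) \<times> int \<times> int"
    have eq: "AE x in N. C.step c x = s l x"
      using null
    proof eventually_elim
      case (elim x)
      show ?case
      proof (cases "x \<in> C.A")
        case True
        then obtain i where i: "i \<in> I" "x \<in> Q i" by blast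
        then show ?thesis using C.step_on[OF i] l(1) by (auto simp: c_def Q_def \<kappa>_eq)
      next
        case False
        then show ?thesis using elim C.step_off[OF False] s(2)[OF l(1), of x] by (auto simp: B_def)
      qed
    qed
    have "Lpow N q0 v0 (\<lambda>x. g x - C.step c x) = Lpow N q0 v0 (\<lambda>x. (g x - l x) + (l x - s l x))"
      using eq by (intro Lpow_cong_AE[OF v0_meas q0]) (auto elim!: eventually_mono)
    also have "\<dots> \<le> ennreal (2 powr q0) * (Lpow N q0 v0 (\<lambda>x. g x - l x) + Lpow N q0 v0 (\<lambda>x. l x - s l x))"
      by (intro Lpow_add[OF v0_meas q0]) measurable
    also have "\<dots> \<le> ennreal (2 powr q0) * (ennreal \<eta> + ennreal \<eta>)"
      using l(2) s(3)[OF l(1)] \<eta> gL lL by (intro mult_left_mono add_mono) (auto simp: L.Lpow_le_iff_Ldist)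
    also have "\<dots> = ennreal \<epsilon>" using \<eta> \<epsilon> by (simp add: \<eta>_def flip: ennreal_plus ennreal_mult)
    finally show "\<exists>c. Lpow N q0 v0 (\<lambda>x. g x - C.step c x) \<le> ennreal \<epsilon>" by blast
  qed
qed

end

section \<open>Interpolation of compactness\<close>

lemma (in weighted_Lspace) totbdd_bounded:
  assumes "totbdd G"
  obtains B where "0 < B" "\<And>g. g \<in> G \<Longrightarrow> Lpow N s w g \<le> ennreal B"
proof -
  obtain F where F: "finite F" "F \<subseteq> L" "\<And>g. g \<in> G \<Longrightarrow> \<exists>y\<in>F. Ldist N s w g y < 1"
    using assms zero_less_one unfolding totbdd_def by metis
  have GL: "G \<subseteq> L" using assms by (simp add: totbdd_def)
  define B where "B = 2 powr s * (1 + (\<Sum>y\<in>F. enn2real (Lpow N s w y)))"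
  have B: "0 < B" by (simp add: B_def add_pos_nonneg sum_nonneg)
  show thesis
  proof (rule that[OF B])
    fix g assume g: "g \<in> G"
    then obtain y where y: "y \<in> F" "Ldist N s w g y < 1" using F(3) by blast
    have gL: "g \<in> L" "y \<in> L" using g GL y F(2) by auto
    have "Lpow N s w (\<lambda>x. (g x - y x) + y x) \<le> ennreal (2 powr s) * (Lpow N s w (\<lambda>x. g x - y x) + Lpow N s w y)"
      using gL by (intro Lpow_add[OF w_meas s] borel_measurable_diff L_meas)
    also have "\<dots> \<le> ennreal (2 powr s) * (ennreal 1 + ennreal (\<Sum>y\<in>F. enn2real (Lpow N s w y)))"
    proof (intro mult_left_mono add_mono)
      show "Lpow N s w (\<lambda>x. g x - y x) \<le> ennreal 1" using y gL by (subst Lpow_le_iff_Ldist) auto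
      have "Lpow N s w y = ennreal (enn2real (Lpow N s w y))" using gL by (simp add: L_iff)
      also have "\<dots> \<le> ennreal (\<Sum>y\<in>F. enn2real (Lpow N s w y))"
        using y F(1) by (intro ennreal_leI member_le_sum) auto
      finally show "Lpow N s w y \<le> ennreal (\<Sum>y\<in>F. enn2real (Lpow N s w y))" .
    qed simp
    also have "\<dots> = ennreal B"
    proof -
      have "0 \<le> (\<Sum>y\<in>F. enn2real (Lpow N s w y))" by (intro sum_nonneg) simp
      then show ?thesis by (simp add: B_def ennreal_mult)
    qed
    finally show "Lpow N s w g \<le> ennreal B" by simp
  qed
qed

context cell_family begin

lemma indicator_off_meas[measurable]: "(\<lambda>x. indicator (- A) x :: complex) \<in> borel_measurable N"
proof -
  have "(\<lambda>x. 1 - indicator A x :: complex) \<in> borel_measurable N" by measurable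
  moreover have "(\<lambda>x. 1 - indicator A x :: complex) = (\<lambda>x. indicator (- A) x)" by (auto simp: indicator_def)
  ultimately show ?thesis by simp
qed

lemma multilinear_off:
  assumes "simple_multilinear M N T"
  shows "simple_multilinear M N (\<lambda>f x. T f x * indicator (- A) x)"
proof -
  interpret T: simple_multilinear M N T by (rule assms)
  show ?thesis
  proof (unfold_locales, unfold multilinear_op_def, intro conjI allI impI)
    show "(\<lambda>x. T f x * indicator (- A) x) \<in> borel_measurable N" if "\<forall>j. f j \<in> simple_functions (M j)" for f
    proof -
      have [measurable]: "T f \<in> borel_measurable N" using that by (intro T.S_meas) auto
      show ?thesis by measurable
    qed
    fix f j g h a b
    assume *: "(\<forall>i. f i \<in> simple_functions (M i)) \<and> g \<in> simple_functions (M j) \<and> h \<in> simple_functions (M j)"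
    have "AE x in N. T (f(j := (\<lambda>y. a * g y + b * h y))) x = a * T (f(j := g)) x + b * T (f(j := h)) x"
      by (rule T.S_lin) (use * in auto)
    then show "AE x in N. T (f(j := (\<lambda>y. a * g y + b * h y))) x * indicator (- A) x =
        a * (T (f(j := g)) x * indicator (- A) x) + b * (T (f(j := h)) x * indicator (- A) x)"
      by eventually_elim (simp add: algebra_simps)
  qed
qed

text \<open>Linearity in each variable holds a.e. in \<open>x\<close>, hence a.e. at both components of a pair.\<close>

lemma multilinear_difference:
  assumes "simple_multilinear M N T"
  shows "simple_multilinear M cell_pairs (\<lambda>f z. T f (fst z) - T f (snd z))"
proof -
  interpret T: simple_multilinear M N T by (rule assms)
  show ?thesis
  proof (unfold_locales, unfold multilinear_op_def, intro conjI allI impI)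
    show "(\<lambda>z. T f (fst z) - T f (snd z)) \<in> borel_measurable cell_pairs" if "\<forall>j. f j \<in> simple_functions (M j)" for f
    proof -
      have [measurable]: "T f \<in> borel_measurable N" using that by (intro T.S_meas) auto
      show ?thesis by measurable
    qed
    fix f j g h a b
    assume *: "(\<forall>i. f i \<in> simple_functions (M i)) \<and> g \<in> simple_functions (M j) \<and> h \<in> simple_functions (M j)"
    have "AE x in N. T (f(j := (\<lambda>y. a * g y + b * h y))) x = a * T (f(j := g)) x + b * T (f(j := h)) x"
      by (rule T.S_lin) (use * in auto)
    from AE_cell_pairs[OF this]
    show "AE z in cell_pairs. T (f(j := (\<lambda>y. a * g y + b * h y))) (fst z) - T (f(j := (\<lambda>y. a * g y + b * h y))) (snd z) =
        a * (T (f(j := g)) (fst z) - T (f(j := g)) (snd z)) + b * (T (f(j := h)) (fst z) - T (f(j := h)) (snd z))"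
      by eventually_elim (simp add: algebra_simps)
  qed
qed

lemma target_pair_cell_pairs:
  assumes "target_pair N p0 q0 r0 w0 v0 u0 \<theta>"
  shows "target_pair cell_pairs p0 q0 r0 (\<lambda>z. w0 (fst z)) (\<lambda>z. v0 (fst z)) (\<lambda>z. u0 (fst z)) \<theta>"
proof -
  interpret T: target_pair N p0 q0 r0 w0 v0 u0 \<theta> by (rule assms)
  note T.w0_meas[measurable] T.v0_meas[measurable] T.u0_meas[measurable]
  show ?thesis
    unfolding target_pair_def target_pair_axioms_def
  proof (intro conjI sigma_finite_cell_pairs T.p0 T.q0 T.\<theta> T.r0)
    show "weight cell_pairs (\<lambda>z. w0 (fst z))" "weight cell_pairs (\<lambda>z. v0 (fst z))"
      using AE_cell_pairs[OF T.w0_pos] AE_cell_pairs[OF T.v0_pos] by (auto simp: weight_def)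
    show "(\<lambda>z. u0 (fst z)) \<in> borel_measurable cell_pairs" by measurable
    show "AE z in cell_pairs. u0 (fst z) = w0 (fst z) powr (1 - \<theta>) * v0 (fst z) powr \<theta>"
      using AE_cell_pairs[OF T.u0] by eventually_elim simp
  qed
qed

text \<open>Step functions have no oscillation within the cells.\<close>

lemma osc_minus_step: "osc s w (\<lambda>x. g x - step c x) = osc s w g"
proof -
  have "AE z in cell_pairs. (g (fst z) - step c (fst z)) - (g (snd z) - step c (snd z)) = g (fst z) - g (snd z)"
    using cell_pairs_same_cell by eventually_elim (auto simp: step_on)
  then show ?thesis unfolding osc_def Lpow_def
    by (intro nn_integral_cong_AE) (auto elim!: eventually_mono)
qed

end

context interpolation_scale begin

text \<open>Cells are chosen for the image of the unit ball at the \<open>q\<close>-endpoint. Both \<open>T f\<close> off the cells and its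
  differences within the cells are then as small as desired at that endpoint and bounded at the other, with
  a bound that does not depend on the cells. By \<open>admissible_interpolation\<close> they are small in
  between, which is the criterion \<open>totbdd_by_cells\<close>.\<close>

theorem compact_interpolation:
  assumes N: "target_pair N p0 q0 r0 w0 v0 u0 \<theta>" and T: "simple_multilinear M N T"
    and A0: "0 < A0"
    and b0: "ball_bounded M p w N p0 w0 T A0"
    and K: "quasi_metric.totbdd (wLspace N (ennreal q0) v0) (Ldist N q0 v0)
        {T f | f. \<forall>j. f j \<in> simple_functions (M j) \<and> wLnorm (M j) (q j) (v j) (f j) \<le> ennreal 1}"
  shows "quasi_metric.totbdd (wLspace N (ennreal r0) u0) (Ldist N r0 u0)
        {T f | f. \<forall>j. f j \<in> adm j \<and> wLnorm (M j) (r j) (u j) (f j) \<le> ennreal (1 / 2)}"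
proof -
  interpret N: target_pair N p0 q0 r0 w0 v0 u0 \<theta> by (rule N)
  interpret T: simple_multilinear M N T by (rule T)
  interpret LQ: weighted_Lspace N q0 v0 using N.v0 N.q0 by unfold_locales
  interpret LR: weighted_Lspace N r0 u0 using N.u0_weight N.r0_pos by unfold_locales
  note N.w0_meas[measurable] N.v0_meas[measurable] N.u0_meas[measurable]
  let ?G = "{T f | f. \<forall>j. f j \<in> simple_functions (M j) \<and> wLnorm (M j) (q j) (v j) (f j) \<le> ennreal 1}"
  let ?R = "{T f | f. \<forall>j. f j \<in> adm j \<and> wLnorm (M j) (r j) (u j) (f j) \<le> ennreal (1 / 2)}"
  obtain A1 where A1: "0 < A1" "\<And>g. g \<in> ?G \<Longrightarrow> Lpow N q0 v0 g \<le> ennreal A1"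
    using LQ.totbdd_bounded[OF K] by blast
  have adm_meas: "T f \<in> borel_measurable N" if "\<And>j. f j \<in> adm j" for f
    using that E.admissible_simple by (intro T.S_meas) blast
  define B where "B = A0 powr ((1 - \<theta>) * r0 / p0) * A1 powr (\<theta> * r0 / q0)"
  have bd: "Lpow N r0 u0 (T f) \<le> ennreal B" if f: "\<And>j. f j \<in> adm j" "\<And>j. wLnorm (M j) (r j) (u j) (f j) \<le> ennreal (1 / 2)" for f
    unfolding B_def by (rule admissible_interpolation[OF N T A0 A1(1) b0 ball_boundedI[OF A1(2)] f]) auto
  show ?thesis
  proof (rule LR.totbdd_by_cells[OF N.sigma_finite_measure_axioms, where 'i = "(('b \<Rightarrow> complex) \<Rightarrow> complex) \<times> int \<times> int"])
    show "Lpow N r0 u0 g \<le> ennreal B" if "g \<in> ?R" for g using that bd by blast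
    show "?R \<subseteq> LR.L"
      using bd adm_meas by (auto simp: LR.L_iff intro!: le_less_trans[OF bd])
    fix \<epsilon> :: real assume \<epsilon>: "0 < \<epsilon>"
    define Cp where "Cp = 2 powr p0 * (1 + 2 powr p0)"
    define Cq where "Cq = 2 powr q0 * (1 + 2 powr q0)"
    have Cp: "1 \<le> Cp" and Cq: "1 \<le> Cq"
      unfolding Cp_def Cq_def using N.p0 N.q0
      by (auto intro!: mult_ge1_I[of "2 powr _" "1 + 2 powr _"] ge_one_powr_ge_zero)
    define \<mu> where "\<mu> = \<theta> * r0 / q0"
    have \<mu>: "0 < \<mu>" using N.\<theta> N.q0 N.r0_pos by (simp add: \<mu>_def)
    define Z where "Z = (Cp * A0) powr ((1 - \<theta>) * r0 / p0)"
    have Z: "0 < Z" using Cp A0 by (simp add: Z_def)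
    \<comment> \<open>The accuracy at the \<open>q\<close>-endpoint for which the interpolated bound equals \<open>\<epsilon>\<close>.\<close>
    define \<eta> where "\<eta> = (\<epsilon> / Z) powr (1 / \<mu>)"
    have \<eta>: "0 < \<eta>" using \<epsilon> Z by (simp add: \<eta>_def)
    have Z\<eta>: "Z * \<eta> powr \<mu> = \<epsilon>" using \<mu> \<epsilon> Z by (simp add: \<eta>_def powr_powr)
    have \<eta>Cq: "0 < \<eta> / Cq" using \<eta> Cq by simp
    obtain I :: "((('b \<Rightarrow> complex) \<Rightarrow> complex) \<times> int \<times> int) set" and Q k where cf: "cell_family N I Q"
      and flat_w: "\<And>i x y. i \<in> I \<Longrightarrow> x \<in> Q i \<Longrightarrow> y \<in> Q i \<Longrightarrow> 0 < w0 x \<and> w0 x \<le> 2 * w0 y"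
      and flat_v: "\<And>i x y. i \<in> I \<Longrightarrow> x \<in> Q i \<Longrightarrow> y \<in> Q i \<Longrightarrow> 0 < v0 x \<and> v0 x \<le> 2 * v0 y"
      and wk: "\<And>x. x \<in> (\<Union>i\<in>I. Q i) \<Longrightarrow> w0 x \<le> k \<and> v0 x \<le> k"
      and near: "\<And>g. g \<in> ?G \<Longrightarrow> \<exists>c. Lpow N q0 v0 (\<lambda>x. g x - cell_family.step I Q c x) \<le> ennreal (\<eta> / Cq)"
      by (rule N.cells_exist[OF K \<eta>Cq], rule that; blast)
    interpret C: cell_family N I Q by (rule cf)
    have Af: "C.A \<in> fmeasurable N" using C.finI C.Qf by (intro fmeasurable.finite_UN) auto
    have "Lpow N r0 u0 (indicator C.A) < \<infinity>"
    proof -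
      \<comment> \<open>The formula for \<open>u0\<close> holds only a.e.; \<open>h\<close> vanishes where it fails.\<close>
      define h where "h x = indicator C.A x * (if u0 x = w0 x powr (1 - \<theta>) * v0 x powr \<theta> then 1 else 0 :: complex)" for x
      define c where "c = k powr (1 - \<theta>) * k powr \<theta>"
      have "AE x in N. indicator C.A x = h x" using N.u0 by eventually_elim (simp add: h_def)
      then have "Lpow N r0 u0 (indicator C.A) = Lpow N r0 u0 h" by (rule Lpow_cong_AE[OF N.u0_meas N.r0_pos])
      also have "\<dots> \<le> ennreal (c powr r0 * measure N C.A)"
      proof (rule Lpow_bounded_on[OF N.r0_pos _ refl Af])
        fix x
        show "norm (h x * of_real (u0 x)) \<le> c * indicator C.A x"
        proof (cases "x \<in> C.A \<and> u0 x = w0 x powr (1 - \<theta>) * v0 x powr \<theta>")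
          case True
          then have "0 < w0 x" "0 < v0 x" "w0 x \<le> k" "v0 x \<le> k" using wk[of x] flat_w flat_v by auto
          then have "w0 x powr (1 - \<theta>) * v0 x powr \<theta> \<le> c"
            unfolding c_def using N.\<theta> by (intro mult_mono powr_mono2) auto
          then show ?thesis using True by (simp add: h_def norm_mult)
        qed (auto simp: h_def c_def)
      qed (auto simp: c_def)
      finally show ?thesis by (rule le_less_trans) simp
    qed
    moreover have "Lpow N r0 u0 (\<lambda>x. g x * indicator (- C.A) x) \<le> ennreal \<epsilon> \<and> C.osc r0 u0 g \<le> ennreal \<epsilon>" if gR: "g \<in> ?R" for g
    proof -
      obtain f where g: "g = T f" and f: "\<And>j. f j \<in> adm j" "\<And>j. wLnorm (M j) (r j) (u j) (f j) \<le> ennreal (1 / 2)"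
        using gR by blast
      have CA0: "0 < Cp * A0" "A0 \<le> Cp * A0" using Cp A0 by auto
      have Cq\<eta>: "\<eta> / Cq \<le> \<eta>" using \<eta> Cq by (simp add: field_simps)
      have "Lpow N r0 u0 (\<lambda>x. T f x * indicator (- C.A) x) \<le> ennreal ((Cp * A0) powr ((1 - \<theta>) * r0 / p0) * \<eta> powr (\<theta> * r0 / q0))"
      proof (rule admissible_interpolation[OF N C.multilinear_off[OF T] CA0(1) \<eta> ball_boundedI ball_boundedI f])
        fix f assume f: "\<And>j. f j \<in> simple_functions (M j)" and le: "\<And>j. wLnorm (M j) (p j) (w j) (f j) \<le> ennreal 1"
        have "Lpow N p0 w0 (\<lambda>x. T f x * indicator (- C.A) x) \<le> Lpow N p0 w0 (T f)"
          by (intro Lpow_mono_AE[OF N.w0_meas N.p0] AE_I2) (auto simp: indicator_def)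
        also have "\<dots> \<le> ennreal A0" by (rule ball_boundedD[OF b0 f le])
        also have "\<dots> \<le> ennreal (Cp * A0)" using CA0 by (intro ennreal_leI)
        finally show "Lpow N p0 w0 (\<lambda>x. T f x * indicator (- C.A) x) \<le> ennreal (Cp * A0)" .
      next
        fix f assume f: "\<And>j. f j \<in> simple_functions (M j)" and le: "\<And>j. wLnorm (M j) (q j) (v j) (f j) \<le> ennreal 1"
        then have "T f \<in> ?G" by blast
        then obtain c where c: "Lpow N q0 v0 (\<lambda>x. T f x - C.step c x) \<le> ennreal (\<eta> / Cq)" using near by blast
        have "Lpow N q0 v0 (\<lambda>x. T f x * indicator (- C.A) x) \<le> Lpow N q0 v0 (\<lambda>x. T f x - C.step c x)"
          by (intro Lpow_mono_AE[OF N.v0_meas N.q0] AE_I2) (auto simp: indicator_def C.step_off)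
        also note c
        also have "ennreal (\<eta> / Cq) \<le> ennreal \<eta>" using Cq\<eta> by (rule ennreal_leI)
        finally show "Lpow N q0 v0 (\<lambda>x. T f x * indicator (- C.A) x) \<le> ennreal \<eta>" .
      qed
      moreover have "Lpow C.cell_pairs r0 (\<lambda>z. u0 (fst z)) (\<lambda>z. T f (fst z) - T f (snd z)) \<le> ennreal ((Cp * A0) powr ((1 - \<theta>) * r0 / p0) * \<eta> powr (\<theta> * r0 / q0))"
      proof (rule admissible_interpolation[OF C.target_pair_cell_pairs[OF N] C.multilinear_difference[OF T] CA0(1) \<eta> ball_boundedI ball_boundedI f])
        fix f assume f: "\<And>j. f j \<in> simple_functions (M j)" and le: "\<And>j. wLnorm (M j) (p j) (w j) (f j) \<le> ennreal 1"
        have [measurable]: "T f \<in> borel_measurable N" by (rule T.S_meas[OF f])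
        have "C.osc p0 w0 (T f) \<le> ennreal Cp * Lpow N p0 w0 (T f)"
          unfolding Cp_def by (rule C.osc_le_Lpow[OF N.p0 _ _ flat_w]) measurable
        also have "\<dots> \<le> ennreal Cp * ennreal A0" using ball_boundedD[OF b0 f le] by (rule mult_left_mono) simp
        finally show "Lpow C.cell_pairs p0 (\<lambda>z. w0 (fst z)) (\<lambda>z. T f (fst z) - T f (snd z)) \<le> ennreal (Cp * A0)"
          using Cp A0 by (simp add: C.osc_def ennreal_mult)
      next
        fix f assume f: "\<And>j. f j \<in> simple_functions (M j)" and le: "\<And>j. wLnorm (M j) (q j) (v j) (f j) \<le> ennreal 1"
        have [measurable]: "T f \<in> borel_measurable N" by (rule T.S_meas[OF f])
        have "T f \<in> ?G" using f le by blast
        then obtain c where c: "Lpow N q0 v0 (\<lambda>x. T f x - C.step c x) \<le> ennreal (\<eta> / Cq)" using near by blast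
        have "C.osc q0 v0 (T f) = C.osc q0 v0 (\<lambda>x. T f x - C.step c x)" by (rule C.osc_minus_step[symmetric])
        also have "\<dots> \<le> ennreal Cq * Lpow N q0 v0 (\<lambda>x. T f x - C.step c x)"
          unfolding Cq_def by (rule C.osc_le_Lpow[OF N.q0 _ _ flat_v]) measurable
        also have "\<dots> \<le> ennreal Cq * ennreal (\<eta> / Cq)" using c by (rule mult_left_mono) simp
        also have "\<dots> = ennreal \<eta>" using Cq \<eta> by (simp flip: ennreal_mult)
        finally show "Lpow C.cell_pairs q0 (\<lambda>z. v0 (fst z)) (\<lambda>z. T f (fst z) - T f (snd z)) \<le> ennreal \<eta>"
          by (simp add: C.osc_def)
      qed
      ultimately show ?thesis unfolding g C.osc_def using Z\<eta> by (simp add: Z_def \<mu>_def)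
    qed
    ultimately show "\<exists>(I::((('b \<Rightarrow> complex) \<Rightarrow> complex) \<times> int \<times> int) set) Q. cell_family N I Q \<and> Lpow N r0 u0 (indicator (\<Union>i\<in>I. Q i)) < \<infinity> \<and>
       (\<forall>g\<in>?R. Lpow N r0 u0 (\<lambda>x. g x * indicator (- (\<Union>i\<in>I. Q i)) x) \<le> ennreal \<epsilon> \<and> cell_family.osc N I Q r0 u0 g \<le> ennreal \<epsilon>)"
      using cf by blast
  qed
qed

end

section \<open>Approximation by admissible simple functions\<close>

context endpoint_pair begin

text \<open>Young's inequality for \<open>\<bar>f u\<bar> = \<bar>f w\<bar>\<^bsup>1-\<theta>\<^esup> \<bar>f v\<bar>\<^sup>\<theta>\<close>, raised to the power \<open>r\<close>. An endpoint with exponent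
  \<open>\<infinity>\<close> contributes a factor at most 1.\<close>

lemma norm_interpolation_unit:
  assumes [measurable]: "f \<in> borel_measurable M"
    and a: "wLnorm M p w f \<le> ennreal 1" and b: "wLnorm M q v f \<le> ennreal 1"
  shows "wLnorm M r u f \<le> ennreal 1"
proof -
  have fu: "AE x in M. 0 < w x \<and> 0 < v x \<and> norm (f x * of_real (u x)) = norm (f x * of_real (w x)) powr (1 - \<theta>) * norm (f x * of_real (v x)) powr \<theta>"
    using w_pos v_pos AE_space
  proof eventually_elim
    case (elim x)
    have "norm (f x) = norm (f x) powr (1 - \<theta>) * norm (f x) powr \<theta>"
      by (cases "f x = 0") (simp_all flip: powr_add)
    then show ?case using elim by (simp add: u norm_mult powr_mult)
  qed
  have top_p: "AE x in M. norm (f x * of_real (w x)) \<le> 1" if "p = \<infinity>"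
    using a that by (subst wLnorm_top_le_iff[symmetric]) auto
  have top_q: "AE x in M. norm (f x * of_real (v x)) \<le> 1" if "q = \<infinity>"
    using b that by (subst wLnorm_top_le_iff[symmetric]) auto
  show ?thesis
  proof (cases rule: r_cases)
    case 1
    have "AE x in M. norm (f x * of_real (u x)) \<le> 1"
      using fu top_p[OF 1(2)] top_q[OF 1(3)]
    proof eventually_elim
      case (elim x)
      have "norm (f x * of_real (w x)) powr (1 - \<theta>) \<le> 1" "norm (f x * of_real (v x)) powr \<theta> \<le> 1"
        using elim \<theta> by (intro powr_le1; simp)+
      then have "norm (f x * of_real (w x)) powr (1 - \<theta>) * norm (f x * of_real (v x)) powr \<theta> \<le> 1 * 1"
        by (intro mult_mono) auto
      then show ?case using elim by simp
    qed
    then show ?thesis using 1 by (subst 1, subst wLnorm_top_le_iff) auto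
  next
    case (2 R)
    define \<gamma> where "\<gamma> = R * (1 - \<theta>) * einv p"
    define \<mu> where "\<mu> = R * \<theta> * einv q"
    have sum: "\<gamma> + \<mu> = 1" using 2 by (simp add: \<gamma>_def \<mu>_def field_simps)
    have nn: "0 \<le> \<gamma>" "0 \<le> \<mu>" using 2 \<theta> einv_bounds[OF p] einv_bounds[OF q] by (auto simp: \<gamma>_def \<mu>_def)
    define X where "X x = norm (f x * of_real (w x))" for x
    define Y where "Y x = norm (f x * of_real (v x))" for x
    define XP where "XP x = (if p = \<infinity> then 1 else X x powr enn2real p)" for x
    define YQ where "YQ x = (if q = \<infinity> then 1 else Y x powr enn2real q)" for x
    have [measurable]: "X \<in> borel_measurable M" "Y \<in> borel_measurable M"
      unfolding X_def Y_def by measurable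
    have Xle: "X x powr (R * (1 - \<theta>)) \<le> XP x powr \<gamma>" if "p = \<infinity> \<longrightarrow> X x \<le> 1" "X x \<noteq> 0" for x
    proof (cases rule: ennreal_ge_1_cases[OF p])
      case 1
      have "X x powr (R * (1 - \<theta>)) \<le> 1" using that 1 2 \<theta> by (intro powr_le1) (auto simp: X_def)
      then show ?thesis using 1 by (simp add: XP_def)
    next
      case P: (2 P)
      then have "P * \<gamma> = R * (1 - \<theta>)" by (simp add: \<gamma>_def einv_real)
      then show ?thesis using P by (simp add: XP_def powr_powr)
    qed
    have Yle: "Y x powr (R * \<theta>) \<le> YQ x powr \<mu>" if "q = \<infinity> \<longrightarrow> Y x \<le> 1" "Y x \<noteq> 0" for x
    proof (cases rule: ennreal_ge_1_cases[OF q])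
      case 1
      have "Y x powr (R * \<theta>) \<le> 1" using that 1 2 \<theta> by (intro powr_le1) (auto simp: Y_def)
      then show ?thesis using 1 by (simp add: YQ_def)
    next
      case P: (2 P)
      then have "P * \<mu> = R * \<theta>" by (simp add: \<mu>_def einv_real)
      then show ?thesis using P by (simp add: YQ_def powr_powr)
    qed
    have pw: "norm (f x * of_real (u x)) powr R \<le> \<gamma> * XP x + \<mu> * YQ x"
      if "0 < w x \<and> 0 < v x \<and> norm (f x * of_real (u x)) = norm (f x * of_real (w x)) powr (1 - \<theta>) * norm (f x * of_real (v x)) powr \<theta>"
        "p = \<infinity> \<longrightarrow> X x \<le> 1" "q = \<infinity> \<longrightarrow> Y x \<le> 1" for x
    proof (cases "f x = 0")
      case True
      then show ?thesis using nn 2 by (auto simp: XP_def YQ_def)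
    next
      case False
      then have ne: "X x \<noteq> 0" "Y x \<noteq> 0" using that by (auto simp: X_def Y_def)
      then have pos: "0 < XP x" "0 < YQ x" by (auto simp: XP_def YQ_def)
      have "norm (f x * of_real (u x)) powr R = X x powr (R * (1 - \<theta>)) * Y x powr (R * \<theta>)"
        using that(1) by (simp add: X_def Y_def powr_mult powr_powr mult.commute)
      also have "\<dots> \<le> XP x powr \<gamma> * YQ x powr \<mu>"
        using Xle[OF that(2) ne(1)] Yle[OF that(3) ne(2)] by (intro mult_mono) auto
      also have "\<dots> \<le> \<gamma> * XP x + \<mu> * YQ x"
        using nn sum pos by (intro Youngs_inequality_0) auto
      finally show ?thesis .
    qed
    have XPi: "ennreal \<gamma> * (\<integral>\<^sup>+x. ennreal (XP x) \<partial>M) \<le> ennreal \<gamma>"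
    proof (cases rule: ennreal_ge_1_cases[OF p])
      case 1
      then have "\<gamma> = 0" by (simp add: \<gamma>_def einv_top)
      then show ?thesis by simp
    next
      case P: (2 P)
      then have "(\<integral>\<^sup>+x. ennreal (XP x) \<partial>M) \<le> ennreal 1"
        using a wLnorm_le_iff_Lpow[of P 1 M w f] by (simp add: XP_def X_def Lpow_def)
      then have "ennreal \<gamma> * (\<integral>\<^sup>+x. ennreal (XP x) \<partial>M) \<le> ennreal \<gamma> * ennreal 1" by (rule mult_left_mono) simp
      then show ?thesis by simp
    qed
    have YQi: "ennreal \<mu> * (\<integral>\<^sup>+x. ennreal (YQ x) \<partial>M) \<le> ennreal \<mu>"
    proof (cases rule: ennreal_ge_1_cases[OF q])
      case 1
      then have "\<mu> = 0" by (simp add: \<mu>_def einv_top)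
      then show ?thesis by simp
    next
      case P: (2 P)
      then have "(\<integral>\<^sup>+x. ennreal (YQ x) \<partial>M) \<le> ennreal 1"
        using b wLnorm_le_iff_Lpow[of P 1 M v f] by (simp add: YQ_def Y_def Lpow_def)
      then have "ennreal \<mu> * (\<integral>\<^sup>+x. ennreal (YQ x) \<partial>M) \<le> ennreal \<mu> * ennreal 1" by (rule mult_left_mono) simp
      then show ?thesis by simp
    qed
    have [measurable]: "XP \<in> borel_measurable M" "YQ \<in> borel_measurable M"
      unfolding XP_def YQ_def by measurable
    have ae: "AE x in M. p = \<infinity> \<longrightarrow> X x \<le> 1" "AE x in M. q = \<infinity> \<longrightarrow> Y x \<le> 1"
      using top_p top_q by (auto simp: X_def Y_def)
    have "Lpow M R u f \<le> (\<integral>\<^sup>+x. ennreal \<gamma> * ennreal (XP x) + ennreal \<mu> * ennreal (YQ x) \<partial>M)"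
      unfolding Lpow_def
    proof (rule nn_integral_mono_AE, use fu ae in eventually_elim)
      case (elim x)
      have "0 \<le> XP x" "0 \<le> YQ x" by (auto simp: XP_def YQ_def)
      then show ?case using ennreal_leI[OF pw[OF elim]] nn by (simp add: ennreal_mult)
    qed
    also have "\<dots> = ennreal \<gamma> * (\<integral>\<^sup>+x. ennreal (XP x) \<partial>M) + ennreal \<mu> * (\<integral>\<^sup>+x. ennreal (YQ x) \<partial>M)"
      by (simp add: nn_integral_add nn_integral_cmult)
    also have "\<dots> \<le> ennreal \<gamma> + ennreal \<mu>" using XPi YQi by (rule add_mono)
    also have "\<dots> = ennreal 1" using nn sum by (simp flip: ennreal_plus)
    finally show ?thesis using 2 wLnorm_le_iff_Lpow[of R 1 M u f] by simp
  qed
qed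

lemma norm_interpolation:
  assumes f[measurable]: "f \<in> borel_measurable M"
    and a: "wLnorm M p w f \<le> ennreal a" "0 < a" and b: "wLnorm M q v f \<le> ennreal b" "0 < b"
  shows "wLnorm M r u f \<le> ennreal (a powr (1 - \<theta>) * b powr \<theta>)"
proof -
  define c where "c = a powr (1 - \<theta>) * b powr \<theta>"
  have c: "0 < c" using a b by (simp add: c_def)
  have scale: "wLnorm M s (\<lambda>x. z x / d) f = wLnorm M s z (\<lambda>x. of_real (1 / d) * f x)" for s z d
    unfolding wLnorm_def by (intro arg_cong[where f = "Lnorm M s"] ext) simp
  have "endpoint_pair M p q r (\<lambda>x. w x / a) (\<lambda>x. v x / b) (\<lambda>x. u x / c) \<theta>"
  proof (unfold_locales; (fact p q \<theta> r)?)
    show "weight M (\<lambda>x. w x / a)" "weight M (\<lambda>x. v x / b)"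
      using w_pos v_pos a b by (auto simp: weight_def)
    fix x assume "x \<in> space M"
    then show "u x / c = (w x / a) powr (1 - \<theta>) * (v x / b) powr \<theta>"
      using a b by (simp add: u c_def powr_divide)
  qed
  then have "wLnorm M r (\<lambda>x. u x / c) f \<le> ennreal 1"
  proof (rule endpoint_pair.norm_interpolation_unit[OF _ f])
    have "wLnorm M p w (\<lambda>x. of_real (1 / a) * f x) \<le> ennreal (norm (of_real (1 / a) :: complex) * a)"
      using a by (intro wLnorm_scale_le p) auto
    then show "wLnorm M p (\<lambda>x. w x / a) f \<le> ennreal 1" unfolding scale using a by (simp add: norm_divide)
    have "wLnorm M q v (\<lambda>x. of_real (1 / b) * f x) \<le> ennreal (norm (of_real (1 / b) :: complex) * b)"
      using b by (intro wLnorm_scale_le q) auto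
    then show "wLnorm M q (\<lambda>x. v x / b) f \<le> ennreal 1" unfolding scale using b by (simp add: norm_divide)
  qed
  then have "wLnorm M r u (\<lambda>x. of_real (1 / c) * f x) \<le> ennreal 1" unfolding scale .
  then have "wLnorm M r u (\<lambda>x. of_real c * (of_real (1 / c) * f x)) \<le> ennreal (norm (of_real c :: complex) * 1)"
    using r_ge_1 by (intro wLnorm_scale_le) auto
  then show ?thesis using c by (simp add: c_def[symmetric])
qed

lemma admissible_finite:
  assumes "f \<in> admissible" shows "wLnorm M r u f < \<infinity>"
proof -
  obtain a b where "0 < a" "wLnorm M p w f \<le> ennreal a" "0 < b" "wLnorm M q v f \<le> ennreal b"
    using assms wLnorm_finite_bound unfolding admissible_def by (smt (verit) mem_Collect_eq)
  then have "wLnorm M r u f \<le> ennreal (a powr (1 - \<theta>) * b powr \<theta>)"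
    using admissible_meas[OF assms] by (intro norm_interpolation)
  then show ?thesis by (rule le_less_trans) simp
qed

text \<open>The sets from which the domain is exhausted. They are closed under finite unions, and on each of them all
  norms in question are comparable to unweighted ones.\<close>

definition core :: "'a set \<Rightarrow> bool" where
  "core A \<longleftrightarrow> A \<in> fmeasurable M \<and> (\<exists>k>0. \<forall>x\<in>A. 1 / k \<le> w x \<and> w x \<le> k \<and> 1 / k \<le> v x \<and> v x \<le> k)"

lemma core_sets: "core A \<Longrightarrow> A \<in> sets M"
  by (auto simp: core_def)

lemma core_empty: "core {}"
  by (auto simp: core_def intro!: exI[of _ 1])

lemma core_Un:
  assumes "core A" "core B" shows "core (A \<union> B)"
proof -
  obtain k l where k: "0 < k" "\<forall>x\<in>A. 1 / k \<le> w x \<and> w x \<le> k \<and> 1 / k \<le> v x \<and> v x \<le> k"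
    and l: "0 < l" "\<forall>x\<in>B. 1 / l \<le> w x \<and> w x \<le> l \<and> 1 / l \<le> v x \<and> v x \<le> l"
    using assms by (auto simp: core_def)
  define m where "m = max k l"
  have "1 / m \<le> 1 / k" "1 / m \<le> 1 / l" "k \<le> m" "l \<le> m" using k l by (auto simp: m_def frac_le)
  then have "\<forall>x\<in>A \<union> B. 1 / m \<le> w x \<and> w x \<le> m \<and> 1 / m \<le> v x \<and> v x \<le> m"
    using k l by (meson UnE order_trans)
  moreover have "0 < m" using k by (simp add: m_def less_max_iff_disj)
  ultimately show ?thesis using assms by (auto simp: core_def)
qed

lemma wLnorm_bounded_on:
  assumes p': "1 \<le> p'" and z[measurable]: "z \<in> borel_measurable M" and A: "A \<in> fmeasurable M"
    and f[measurable]: "f \<in> borel_measurable M"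
    and h: "\<And>x. x \<in> space M \<Longrightarrow> norm (f x * of_real (z x)) \<le> c * indicator A x" and c: "0 \<le> c"
  shows "wLnorm M p' z f \<le> ennreal (c * (1 + measure M A))"
proof (cases rule: ennreal_ge_1_cases[OF p'])
  case 1
  have "norm (f x * of_real (z x)) \<le> c * (1 + measure M A)" if "x \<in> space M" for x
  proof -
    have "norm (f x * of_real (z x)) \<le> c * 1" using h[OF that] c by (cases "x \<in> A") auto
    also have "\<dots> \<le> c * (1 + measure M A)" using c by (intro mult_left_mono) auto
    finally show ?thesis .
  qed
  then show ?thesis using 1 c by (subst 1, subst wLnorm_top_le_iff) auto
next
  case (2 P)
  have "Lpow M P z f \<le> ennreal (c powr P * measure M A)"
    using 2 by (intro Lpow_bounded_on[OF _ _ refl A h c]) (use A in auto)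
  also have "\<dots> \<le> ennreal ((c * (1 + measure M A)) powr P)"
  proof (rule ennreal_leI)
    have "measure M A \<le> (1 + measure M A) powr 1" by simp
    also have "\<dots> \<le> (1 + measure M A) powr P" using 2 by (intro powr_mono) auto
    finally show "c powr P * measure M A \<le> (c * (1 + measure M A)) powr P"
      by (simp add: powr_mult mult_left_mono)
  qed
  finally show ?thesis using 2 c by (simp add: wLnorm_le_iff_Lpow)
qed

lemma core_simple_admissible:
  assumes A: "core A" and g: "g \<in> simple_functions M" "\<And>x. x \<notin> A \<Longrightarrow> g x = 0"
  shows "g \<in> admissible"
proof -
  obtain k where k: "0 < k" "\<And>x. x \<in> A \<Longrightarrow> 1 / k \<le> w x \<and> w x \<le> k \<and> 1 / k \<le> v x \<and> v x \<le> k"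
    using A by (auto simp: core_def)
  have pos: "0 < w x" "0 < v x" if "x \<in> A" for x
    using k(2)[OF that] k(1) by (meson less_le_trans zero_less_divide_1_iff)+
  have fin: "finite (range g)" and gm: "g \<in> borel_measurable M" using g by (auto simp: simple_functions_iff)
  define C where "C = Max (norm ` range g)"
  have C: "norm (g x) \<le> C" for x unfolding C_def using fin by (intro Max_ge) auto
  have C0: "0 \<le> C" using C[of undefined] norm_ge_zero order_trans by blast
  have Af: "A \<in> fmeasurable M" using A by (simp add: core_def)
  have "wLnorm M p w g \<le> ennreal (C * k * (1 + measure M A))"
  proof (rule wLnorm_bounded_on[OF p w_meas Af gm])
    fix x show "norm (g x * of_real (w x)) \<le> C * k * indicator A x"
      using g(2)[of x] k(2)[of x] pos(1)[of x] C[of x] C0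
      by (cases "x \<in> A") (auto simp: norm_mult intro!: mult_mono)
  qed (use C0 k in auto)
  moreover have "wLnorm M q v g \<le> ennreal (C * k * (1 + measure M A))"
  proof (rule wLnorm_bounded_on[OF q v_meas Af gm])
    fix x show "norm (g x * of_real (v x)) \<le> C * k * indicator A x"
      using g(2)[of x] k(2)[of x] pos(2)[of x] C[of x] C0
      by (cases "x \<in> A") (auto simp: norm_mult intro!: mult_mono)
  qed (use C0 k in auto)
  ultimately show ?thesis using g(1) by (auto simp: admissible_def intro: le_less_trans)
qed

lemma u_on_core:
  assumes A: "core A"
  obtains K where "0 < K" "\<And>x. x \<in> A \<Longrightarrow> 0 < u x \<and> 1 / K \<le> u x \<and> u x \<le> K"
proof -
  obtain k where k: "0 < k" "\<And>x. x \<in> A \<Longrightarrow> 1 / k \<le> w x \<and> w x \<le> k \<and> 1 / k \<le> v x \<and> v x \<le> k"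
    using A by (auto simp: core_def)
  have Asp: "A \<subseteq> space M" using core_sets[OF A] sets.sets_into_space by blast
  have "0 < u x \<and> 1 / k \<le> u x \<and> u x \<le> k" if x: "x \<in> A" for x
  proof -
    have pos: "0 < w x" "0 < v x" using k(2)[OF x] k(1) by (meson less_le_trans zero_less_divide_1_iff)+
    have ux: "u x = w x powr (1 - \<theta>) * v x powr \<theta>" using u x Asp by blast
    have "u x \<le> k powr (1 - \<theta>) * k powr \<theta>"
      unfolding ux using k(2)[OF x] pos \<theta> by (intro mult_mono powr_mono2) auto
    moreover have "(1 / k) powr (1 - \<theta>) * (1 / k) powr \<theta> \<le> u x"
      unfolding ux using k pos k(2)[OF x] \<theta> by (intro mult_mono powr_mono2) auto
    ultimately show ?thesis using k(1) pos by (simp add: ux flip: powr_add)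
  qed
  then show thesis using that k(1) by blast
qed

text \<open>Also for \<open>r = \<infinity>\<close>: on a core set a function of finite norm is bounded after removal of a part of small norm, and a bounded
  function on a set of finite measure is a uniform limit of simple functions.\<close>

lemma approximant:
  assumes f: "f \<in> wLspace M r u" and A: "core A" and \<epsilon>: "0 < \<epsilon>"
  shows "\<exists>g\<in>admissible. wLnorm M r u (\<lambda>x. g x - f x * indicator A x) \<le> ennreal \<epsilon>"
proof -
  have fm[measurable]: "f \<in> borel_measurable M" and fin: "wLnorm M r u f < \<infinity>" using f by (auto simp: wLspace_def)
  have Am[measurable]: "A \<in> sets M" using A by (rule core_sets)
  have Asp: "A \<subseteq> space M" using Am sets.sets_into_space by blast
  obtain K where K: "0 < K" "\<And>x. x \<in> A \<Longrightarrow> 0 < u x \<and> 1 / K \<le> u x \<and> u x \<le> K" using u_on_core[OF A] by blast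
  \<comment> \<open>The large part of \<open>f\<close>; for \<open>r = \<infinity>\<close> it is eventually empty up to a null set, because \<open>u\<close> is bounded below on \<open>A\<close>.\<close>
  define X where "X n = {x\<in>A. real n < norm (f x)}" for n :: nat
  have [measurable]: "X n \<in> sets M" for n
  proof -
    have "X n = A \<inter> {x\<in>space M. real n < norm (f x)}" using Asp by (auto simp: X_def)
    then show ?thesis by simp
  qed
  have "\<exists>n. wLnorm M r u (\<lambda>x. f x * indicator (X n) x) \<le> ennreal (\<epsilon> / 4)"
  proof (cases rule: ennreal_ge_1_cases[OF r_ge_1])
    case 1
    obtain c where c: "0 < c" "wLnorm M r u f \<le> ennreal c" using wLnorm_finite_bound[OF fin] .
    then have ae: "AE x in M. norm (f x * of_real (u x)) \<le> c"
      using 1 by (subst wLnorm_top_le_iff[symmetric]) auto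
    obtain n where n: "c * K \<le> real n" using real_arch_simple by blast
    have "AE x in M. f x * indicator (X n) x = 0"
      using ae
    proof eventually_elim
      case (elim x)
      show ?case
      proof (cases "x \<in> X n")
        case True
        then have xA: "x \<in> A" and big: "real n < norm (f x)" by (auto simp: X_def)
        have "norm (f x) * (1 / K) \<le> norm (f x) * u x" using K(2)[OF xA] by (intro mult_left_mono) auto
        also have "\<dots> \<le> c" using elim K(2)[OF xA] by (simp add: norm_mult)
        finally have "norm (f x) \<le> c * K" using K(1) by (simp add: field_simps)
        then show ?thesis using n big by linarith
      qed simp
    qed
    then show ?thesis using \<epsilon> by (intro exI[of _ n] wLnorm_eq_0_AE r_ge_1 u_meas) auto
  next
    case (2 R)
    have "AE x in M. eventually (\<lambda>n. x \<notin> X n) sequentially"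
    proof (rule AE_I2)
      fix x
      obtain n0 where n0: "norm (f x) \<le> real n0" using real_arch_simple by blast
      show "eventually (\<lambda>n. x \<notin> X n) sequentially"
        by (rule eventually_sequentiallyI[of n0]) (use n0 in \<open>auto simp: X_def\<close>)
    qed
    from wLnorm_vanishing[OF _ u_meas fm _ _ this, of R "\<epsilon> / 4"] show ?thesis
      using 2 fin \<epsilon> by auto
  qed
  then obtain n where n: "wLnorm M r u (\<lambda>x. f x * indicator (X n) x) \<le> ennreal (\<epsilon> / 4)" by blast
  define Z where "Z = A - X n"
  have Zf: "Z \<in> fmeasurable M"
  proof (rule fmeasurableI2)
    show "A \<in> fmeasurable M" using A by (simp add: core_def)
  qed (auto simp: Z_def)
  then have Zm[measurable]: "Z \<in> sets M" by auto
  define e where "e = \<epsilon> / (4 * K * (1 + measure M Z))"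
  have mZ: "0 < 1 + measure M Z" by (simp add: add_pos_nonneg)
  have e: "0 < e" using \<epsilon> K mZ by (simp add: e_def)
  have Zb: "norm (f x) \<le> real n" if "x \<in> Z" for x using that by (auto simp: Z_def X_def)
  obtain g where g: "g \<in> simple_functions M" "\<And>x. x \<notin> Z \<Longrightarrow> g x = 0" "\<And>x. x \<in> Z \<Longrightarrow> norm (f x - g x) \<le> e"
    using bounded_approx_simple[OF fm Zf Zb e] by blast
  have gm[measurable]: "g \<in> borel_measurable M" using g by (simp add: simple_functions_iff)
  have 1: "wLnorm M r u (\<lambda>x. (g x - f x) * indicator Z x) \<le> ennreal (\<epsilon> / 4)"
  proof -
    have "wLnorm M r u (\<lambda>x. (g x - f x) * indicator Z x) \<le> ennreal (e * K * (1 + measure M Z))"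
    proof (rule wLnorm_bounded_on[OF r_ge_1 u_meas Zf])
      fix x
      show "norm ((g x - f x) * indicator Z x * of_real (u x)) \<le> e * K * indicator Z x"
      proof (cases "x \<in> Z")
        case True
        then have "0 < u x" "u x \<le> K" using K(2)[of x] by (auto simp: Z_def)
        moreover have "norm (g x - f x) \<le> e" using g(3)[OF True] by (simp add: norm_minus_commute)
        ultimately show ?thesis using True e by (auto simp: norm_mult intro!: mult_mono)
      qed simp
    qed (use e K in auto)
    also have "e * K * (1 + measure M Z) = \<epsilon> / 4"
    proof -
      have "\<epsilon> / (4 * K * t) * K * t = \<epsilon> / 4" if "0 < t" for t using K(1) that by simp
      from this[OF mZ] show ?thesis by (simp only: e_def)
    qed
    finally show ?thesis .
  qed
  have 2: "wLnorm M r u (\<lambda>x. - 1 * (f x * indicator (X n) x)) \<le> ennreal (norm (- 1 :: complex) * (\<epsilon> / 4))"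
    using n \<epsilon> by (intro wLnorm_scale_le r_ge_1 u_meas) auto
  have "wLnorm M r u (\<lambda>x. (g x - f x) * indicator Z x + - 1 * (f x * indicator (X n) x)) \<le> ennreal (4 * (\<epsilon> / 4))"
    using 1 2 \<epsilon> by (intro wLnorm_add_le r_ge_1 u_meas) auto
  moreover have "(\<lambda>x. (g x - f x) * indicator Z x + - 1 * (f x * indicator (X n) x)) = (\<lambda>x. g x - f x * indicator A x)"
    using g(2) by (auto simp: Z_def X_def indicator_def fun_eq_iff)
  ultimately have "wLnorm M r u (\<lambda>x. g x - f x * indicator A x) \<le> ennreal \<epsilon>" by simp
  moreover have "g \<in> admissible"
    by (rule core_simple_admissible[OF A g(1)]) (use g(2) in \<open>auto simp: Z_def\<close>)
  ultimately show ?thesis by blast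
qed

text \<open>What is cut off is small in one endpoint norm and bounded in the other, hence small at the
  intermediate exponent by \<open>norm_interpolation\<close>. This convergence in norm, which for \<open>r = \<infinity>\<close>
  fails for general members of the space, makes the extension agree with the original operator.\<close>

lemma core_exhausts:
  assumes f: "f \<in> admissible" and \<epsilon>: "0 < \<epsilon>"
  obtains A where "core A" "\<And>B. A \<subseteq> B \<Longrightarrow> B \<in> sets M \<Longrightarrow> wLnorm M r u (\<lambda>x. f x * indicator B x - f x) \<le> ennreal \<epsilon>"
proof -
  have fs: "f \<in> simple_functions M" and fw: "wLnorm M p w f < \<infinity>" and fv: "wLnorm M q v f < \<infinity>"
    using f by (auto simp: admissible_def)
  have fm[measurable]: "f \<in> borel_measurable M" using f by (rule admissible_meas)
  obtain a b where a: "0 < a" "wLnorm M p w f \<le> ennreal a" and b: "0 < b" "wLnorm M q v f \<le> ennreal b"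
    using wLnorm_finite_bound[OF fw] wLnorm_finite_bound[OF fv] by metis
  \<comment> \<open>Chosen such that the interpolated norms are \<open>\<epsilon> / 4\<close>; the 4 is the constant of \<open>wLnorm_add_le\<close>.\<close>
  define \<alpha> where "\<alpha> = (\<epsilon> / 4 / b powr \<theta>) powr (1 / (1 - \<theta>))"
  define \<beta> where "\<beta> = (\<epsilon> / 4 / a powr (1 - \<theta>)) powr (1 / \<theta>)"
  have \<alpha>: "0 < \<alpha>" "\<alpha> powr (1 - \<theta>) * b powr \<theta> = \<epsilon> / 4" using \<epsilon> b \<theta> by (auto simp: \<alpha>_def powr_powr)
  have \<beta>: "0 < \<beta>" "a powr (1 - \<theta>) * \<beta> powr \<theta> = \<epsilon> / 4" using \<epsilon> a \<theta> by (auto simp: \<beta>_def powr_powr)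
  obtain n1 where n1: "\<And>n. n \<ge> n1 \<Longrightarrow> wLnorm M p w (\<lambda>x. f x * indicator (off_band M w n) x) \<le> ennreal \<alpha>"
    using truncation_small[OF p w_meas w_pos fs fw \<alpha>(1)] by blast
  obtain n2 where n2: "\<And>n. n \<ge> n2 \<Longrightarrow> wLnorm M q v (\<lambda>x. f x * indicator (off_band M v n) x) \<le> ennreal \<beta>"
    using truncation_small[OF q v_meas v_pos fs fv \<beta>(1)] by blast
  define n where "n = max n1 n2"
  have [measurable]: "off_band M w n \<in> sets M" "off_band M v n \<in> sets M" by (rule off_band_sets w_meas v_meas)+
  have 1: "wLnorm M r u (\<lambda>x. f x * indicator (off_band M w n) x) \<le> ennreal (\<epsilon> / 4)"
    unfolding \<alpha>(2)[symmetric]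
  proof (rule norm_interpolation[OF _ n1 \<alpha>(1) _ b(1)])
    show "wLnorm M q v (\<lambda>x. f x * indicator (off_band M w n) x) \<le> ennreal b"
      using b by (intro wLnorm_indicator_le[OF q v_meas fm]) auto
  qed (auto simp: n_def)
  have 2: "wLnorm M r u (\<lambda>x. f x * indicator (off_band M v n) x) \<le> ennreal (\<epsilon> / 4)"
    unfolding \<beta>(2)[symmetric]
  proof (rule norm_interpolation[OF _ _ a(1) n2 \<beta>(1)])
    show "wLnorm M p w (\<lambda>x. f x * indicator (off_band M v n) x) \<le> ennreal a"
      using a by (intro wLnorm_indicator_le[OF p w_meas fm]) auto
  qed (auto simp: n_def)
  define A where "A = {x. f x \<noteq> 0} - off_band M w n - off_band M v n"
  have sf: "{x. f x \<noteq> 0} \<in> fmeasurable M" using fs by (simp add: simple_functions_iff)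
  then have supp: "{x. f x \<noteq> 0} \<in> sets M" "{x. f x \<noteq> 0} \<subseteq> space M" using sets.sets_into_space by (auto dest: fmeasurableD)
  have cA: "core A"
    unfolding core_def
  proof (intro conjI exI[of _ "real (Suc n)"] ballI)
    show "A \<in> fmeasurable M"
      by (rule fmeasurableI2[OF sf]) (use supp in \<open>auto simp: A_def\<close>)
    fix x assume "x \<in> A"
    then have "x \<in> space M" "x \<notin> off_band M w n" "x \<notin> off_band M v n" using supp by (auto simp: A_def)
    then show "1 / real (Suc n) \<le> w x" "w x \<le> real (Suc n)" "1 / real (Suc n) \<le> v x" "v x \<le> real (Suc n)"
      by (auto simp: off_band_def)
  qed simp
  show thesis
  proof (rule that[OF cA])
    fix B assume AB: "A \<subseteq> B" and [measurable]: "B \<in> sets M"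
    have "wLnorm M r u (\<lambda>x. f x * indicator (off_band M w n) x + f x * indicator (off_band M v n - off_band M w n) x) \<le> ennreal (4 * (\<epsilon> / 4))"
    proof (rule wLnorm_add_le[OF r_ge_1 u_meas _ _ 1])
      show "wLnorm M r u (\<lambda>x. f x * indicator (off_band M v n - off_band M w n) x) \<le> ennreal (\<epsilon> / 4)"
        by (rule wLnorm_mono_AE[OF r_ge_1 u_meas _ _ _ 2]) (use \<epsilon> in \<open>auto simp: indicator_def\<close>)
    qed (use \<epsilon> in auto)
    then have "wLnorm M r u (\<lambda>x. f x * indicator B x - f x) \<le> ennreal (4 * (\<epsilon> / 4))"
    proof (rule wLnorm_mono_AE[OF r_ge_1 u_meas, rotated 3])
      show "AE x in M. norm ((f x * indicator B x - f x) * of_real (u x)) \<le>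
        norm ((f x * indicator (off_band M w n) x + f x * indicator (off_band M v n - off_band M w n) x) * of_real (u x))"
        using AB by (intro AE_I2) (auto simp: A_def indicator_def)
    qed (use \<epsilon> in auto)
    then show "wLnorm M r u (\<lambda>x. f x * indicator B x - f x) \<le> ennreal \<epsilon>" by simp
  qed
qed

end

section \<open>Extension along an ultrafilter\<close>

context weighted_Lspace begin

definition limit_along :: "'i filter \<Rightarrow> ('i \<Rightarrow> 'a \<Rightarrow> complex) \<Rightarrow> ('a \<Rightarrow> complex) \<Rightarrow> bool" where
  "limit_along U h y \<longleftrightarrow> y \<in> L \<and>
     (\<forall>\<epsilon>>0. eventually (\<lambda>i. h i \<in> L \<and> Lpow N s w (\<lambda>x. h i x - y x) \<le> ennreal \<epsilon>) U)"

lemma Lpow_lin: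
  assumes f: "f \<in> borel_measurable N" "g \<in> borel_measurable N"
    and "Lpow N s w f \<le> ennreal \<epsilon>" "Lpow N s w g \<le> ennreal \<epsilon>" "0 \<le> \<epsilon>"
  shows "Lpow N s w (\<lambda>x. a * f x + b * g x) \<le> ennreal (2 powr s * (norm a powr s + norm b powr s) * \<epsilon>)"
proof -
  have "Lpow N s w (\<lambda>x. a * f x + b * g x) \<le> ennreal (2 powr s) * (Lpow N s w (\<lambda>x. a * f x) + Lpow N s w (\<lambda>x. b * g x))"
    using f by (intro Lpow_add[OF w_meas s]) auto
  also have "\<dots> = ennreal (2 powr s) * (ennreal (norm a powr s) * Lpow N s w f + ennreal (norm b powr s) * Lpow N s w g)"
    using f by (simp add: Lpow_scale[OF w_meas s])
  also have "\<dots> \<le> ennreal (2 powr s) * (ennreal (norm a powr s) * ennreal \<epsilon> + ennreal (norm b powr s) * ennreal \<epsilon>)"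
    using assms by (intro mult_left_mono add_mono) auto
  also have "\<dots> = ennreal (2 powr s * (norm a powr s + norm b powr s) * \<epsilon>)"
    using assms by (simp add: algebra_simps flip: ennreal_mult ennreal_plus)
  finally show ?thesis .
qed

lemma limit_along_lin:
  assumes h: "limit_along U h y" and k: "limit_along U k z"
  shows "limit_along U (\<lambda>i x. a * h i x + b * k i x) (\<lambda>x. a * y x + b * z x)"
  unfolding limit_along_def
proof (intro conjI allI impI)
  have L: "y \<in> L" "z \<in> L" using h k by (auto simp: limit_along_def)
  have lin: "(\<lambda>x. a * f x + b * g x) \<in> L" if "f \<in> L" "g \<in> L" for f g
    using that by (intro L_add L_scale)
  show "(\<lambda>x. a * y x + b * z x) \<in> L" using L by (rule lin)
  fix \<epsilon> :: real assume \<epsilon>: "0 < \<epsilon>"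
  define C where "C = 2 powr s * (norm a powr s + norm b powr s) + 1"
  have C: "0 < C" by (simp add: C_def add_nonneg_pos)
  have "0 < \<epsilon> / C" using \<epsilon> C by simp
  then have "eventually (\<lambda>i. h i \<in> L \<and> Lpow N s w (\<lambda>x. h i x - y x) \<le> ennreal (\<epsilon> / C)) U"
    "eventually (\<lambda>i. k i \<in> L \<and> Lpow N s w (\<lambda>x. k i x - z x) \<le> ennreal (\<epsilon> / C)) U"
    using h k by (auto simp: limit_along_def)
  then show "eventually (\<lambda>i. (\<lambda>x. a * h i x + b * k i x) \<in> L \<and>
      Lpow N s w (\<lambda>x. (a * h i x + b * k i x) - (a * y x + b * z x)) \<le> ennreal \<epsilon>) U"
  proof eventually_elim
    case (elim i)
    have "Lpow N s w (\<lambda>x. a * (h i x - y x) + b * (k i x - z x)) \<le> ennreal (2 powr s * (norm a powr s + norm b powr s) * (\<epsilon> / C))"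
      using elim L \<epsilon> C by (intro Lpow_lin borel_measurable_diff L_meas) auto
    also have "\<dots> \<le> ennreal (C * (\<epsilon> / C))"
      using \<epsilon> C by (intro ennreal_leI mult_right_mono) (auto simp: C_def)
    finally have "Lpow N s w (\<lambda>x. a * (h i x - y x) + b * (k i x - z x)) \<le> ennreal \<epsilon>" using C by simp
    moreover have "(\<lambda>x. (a * h i x + b * k i x) - (a * y x + b * z x)) = (\<lambda>x. a * (h i x - y x) + b * (k i x - z x))"
      by (simp add: algebra_simps)
    ultimately show ?case using elim lin by simp
  qed
qed

text \<open>The case \<open>h = k\<close> gives uniqueness. The general form shows that the limit depends only on the asymptotic
  behaviour along \<open>U\<close>, which is how the identities of the extended operator are obtained.\<close>

lemma limit_along_unique:
  assumes U: "U \<noteq> bot" and h: "limit_along U h y" and k: "limit_along U k z"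
    and close: "\<And>\<epsilon>. 0 < \<epsilon> \<Longrightarrow> eventually (\<lambda>i. Lpow N s w (\<lambda>x. h i x - k i x) \<le> ennreal \<epsilon>) U"
  shows "AE x in N. y x = z x"
proof -
  have L: "y \<in> L" "z \<in> L" using h k by (auto simp: limit_along_def)
  have le: "Lpow N s w (\<lambda>x. y x - z x) \<le> 0 + ennreal \<epsilon>" if \<epsilon>: "0 < \<epsilon>" for \<epsilon>
  proof -
    define C where "C = 2 powr s * 2 * (2 powr s * 2 + 1)"
    have C: "0 < C" by (simp add: C_def add_nonneg_pos)
    define \<eta> where "\<eta> = \<epsilon> / C"
    have \<eta>: "0 < \<eta>" using \<epsilon> C by (simp add: \<eta>_def)
    have "eventually (\<lambda>i. h i \<in> L \<and> Lpow N s w (\<lambda>x. h i x - y x) \<le> ennreal \<eta>) U"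
      "eventually (\<lambda>i. k i \<in> L \<and> Lpow N s w (\<lambda>x. k i x - z x) \<le> ennreal \<eta>) U"
      using h k \<eta> by (auto simp: limit_along_def)
    with close[OF \<eta>] have "eventually (\<lambda>i. (h i \<in> L \<and> Lpow N s w (\<lambda>x. h i x - y x) \<le> ennreal \<eta>) \<and> (k i \<in> L \<and> Lpow N s w (\<lambda>x. k i x - z x) \<le> ennreal \<eta>)
        \<and> Lpow N s w (\<lambda>x. h i x - k i x) \<le> ennreal \<eta>) U"
      by eventually_elim auto
    from eventually_happens'[OF U this] obtain i where i: "h i \<in> L" "Lpow N s w (\<lambda>x. h i x - y x) \<le> ennreal \<eta>"
      "k i \<in> L" "Lpow N s w (\<lambda>x. k i x - z x) \<le> ennreal \<eta>" "Lpow N s w (\<lambda>x. h i x - k i x) \<le> ennreal \<eta>" by blast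
    note m = L_meas[OF i(1)] L_meas[OF i(3)] L_meas[OF L(1)] L_meas[OF L(2)]
    have 1: "Lpow N s w (\<lambda>x. - 1 * (h i x - y x) + 1 * (k i x - z x)) \<le> ennreal (2 powr s * 2 * \<eta>)"
      using Lpow_lin[of "\<lambda>x. h i x - y x" "\<lambda>x. k i x - z x" \<eta> "- 1" 1] i m \<eta> by simp
    have 2: "Lpow N s w (\<lambda>x. 1 * (- 1 * (h i x - y x) + 1 * (k i x - z x)) + 1 * (h i x - k i x)) \<le>
        ennreal (2 powr s * (norm (1::complex) powr s + norm (1::complex) powr s) * ((2 powr s * 2 + 1) * \<eta>))"
    proof (rule Lpow_lin)
      show "Lpow N s w (\<lambda>x. - 1 * (h i x - y x) + 1 * (k i x - z x)) \<le> ennreal ((2 powr s * 2 + 1) * \<eta>)"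
        using 1 by (rule order_trans) (use \<eta> in \<open>auto intro!: ennreal_leI simp: algebra_simps\<close>)
      show "Lpow N s w (\<lambda>x. h i x - k i x) \<le> ennreal ((2 powr s * 2 + 1) * \<eta>)"
        using i(5) by (rule order_trans) (use \<eta> in \<open>auto intro!: ennreal_leI simp: algebra_simps\<close>)
      note m[measurable]
      show "(\<lambda>x. - 1 * (h i x - y x) + 1 * (k i x - z x)) \<in> borel_measurable N"
        "(\<lambda>x. h i x - k i x) \<in> borel_measurable N" by measurable
      show "0 \<le> (2 powr s * 2 + 1) * \<eta>" using \<eta> by (intro mult_nonneg_nonneg add_nonneg_nonneg) auto
    qed
    have "(\<lambda>x. 1 * (- 1 * (h i x - y x) + 1 * (k i x - z x)) + 1 * (h i x - k i x)) = (\<lambda>x. y x - z x)" by auto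
    then have "Lpow N s w (\<lambda>x. y x - z x) \<le> ennreal (C * \<eta>)" using 2 by (simp add: C_def mult_ac)
    then show ?thesis using C by (simp add: \<eta>_def)
  qed
  have "Lpow N s w (\<lambda>x. y x - z x) \<le> 0" by (rule ennreal_le_epsilon) (rule le)
  then have "Lpow N s w (\<lambda>x. y x - z x) = 0" by simp
  then have "AE x in N. (y x - z x) * of_real (w x) = 0"
    using L_meas[OF L(1)] L_meas[OF L(2)] by (subst (asm) Lpow_eq_0_iff[OF w_meas s]) auto
  with w_pos show ?thesis by eventually_elim auto
qed

lemma limit_along_exists:
  assumes S: "totbdd S" and U: "U \<noteq> bot" "\<And>P. eventually P U \<or> eventually (\<lambda>i. \<not> P i) U"
    and h: "eventually (\<lambda>i. h i \<in> S) U"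
  obtains y where "limit_along U h y"
proof -
  have SL: "S \<subseteq> L" using S by (simp add: totbdd_def)
  obtain y where y: "y \<in> L" "\<And>\<epsilon>. 0 < \<epsilon> \<Longrightarrow> eventually (\<lambda>i. Ldist N s w (h i) y < \<epsilon>) U"
    using ultrafilter_limit[OF complete_L S U h] by blast
  have "limit_along U h y"
    unfolding limit_along_def
  proof (intro conjI allI impI y(1))
    fix \<epsilon> :: real assume "0 < \<epsilon>"
    from y(2)[OF this] h show "eventually (\<lambda>i. h i \<in> L \<and> Lpow N s w (\<lambda>x. h i x - y x) \<le> ennreal \<epsilon>) U"
      by eventually_elim (use SL y(1) \<open>0 < \<epsilon>\<close> in \<open>auto simp: Lpow_le_iff_Ldist subset_iff\<close>)
  qed
  then show thesis by (rule that)
qed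

end

text \<open>The multiples are formed up to equality a.e., as \<open>T\<close> is homogeneous only in that sense.\<close>

lemma (in weighted_Lspace) totbdd_scale:
  assumes S: "totbdd S" shows "totbdd {y \<in> L. \<exists>h\<in>S. AE x in N. y x = c * h x}"
  unfolding totbdd_def
proof (intro conjI allI impI)
  fix \<epsilon> :: real assume \<epsilon>: "0 < \<epsilon>"
  define C where "C = norm c powr s + 1"
  have C: "0 < C" by (simp add: C_def add_nonneg_pos)
  have SL: "S \<subseteq> L" using S by (simp add: totbdd_def)
  have "0 < \<epsilon> / C" using \<epsilon> C by simp
  then obtain F where F: "finite F" "F \<subseteq> L" "\<And>h. h \<in> S \<Longrightarrow> \<exists>y\<in>F. Ldist N s w h y < \<epsilon> / C"
    using S unfolding totbdd_def by metis
  define F' where "F' = (\<lambda>y x. c * y x) ` F"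
  have "\<exists>z\<in>F'. Ldist N s w y z < \<epsilon>" if y: "y \<in> L" "h \<in> S" "AE x in N. y x = c * h x" for y h
  proof -
    obtain z where z: "z \<in> F" "Ldist N s w h z < \<epsilon> / C" using F(3) y by blast
    have zL: "z \<in> L" "h \<in> L" using z F SL y by auto
    have "Lpow N s w (\<lambda>x. y x - c * z x) = Lpow N s w (\<lambda>x. c * (h x - z x))"
      using y(3) by (intro Lpow_cong_AE[OF w_meas s]) (auto elim!: eventually_mono simp: algebra_simps)
    also have "\<dots> = ennreal (norm c powr s) * Lpow N s w (\<lambda>x. h x - z x)"
      using zL by (intro Lpow_scale[OF w_meas s] borel_measurable_diff L_meas)
    also have "\<dots> \<le> ennreal (norm c powr s) * ennreal (\<epsilon> / C)"
      using z zL \<epsilon> C by (intro mult_left_mono) (auto simp: Lpow_le_iff_Ldist)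
    also have "\<dots> = ennreal (norm c powr s * (\<epsilon> / C))" using \<epsilon> C by (simp add: ennreal_mult del: times_divide_eq_right)
    also have "\<dots> < ennreal \<epsilon>"
    proof (rule ennreal_lessI[OF \<epsilon>])
      have "norm c powr s * (\<epsilon> / C) < C * (\<epsilon> / C)" using \<epsilon> C by (intro mult_strict_right_mono) (auto simp: C_def)
      then show "norm c powr s * (\<epsilon> / C) < \<epsilon>" using C by simp
    qed
    finally have "Ldist N s w y (\<lambda>x. c * z x) < \<epsilon>"
      using y zL by (subst Lpow_less_iff_Ldist[symmetric]) (auto intro: L_scale)
    then show ?thesis using z by (auto simp: F'_def)
  qed
  moreover have "finite F'" "F' \<subseteq> L" using F L_scale by (auto simp: F'_def)
  ultimately show "\<exists>F. finite F \<and> F \<subseteq> L \<and> (\<forall>y\<in>{y \<in> L. \<exists>h\<in>S. AE x in N. y x = c * h x}. \<exists>z\<in>F. Ldist N s w y z < \<epsilon>)"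
    by (intro exI[of _ F']) blast
qed blast

lemma wLnorm_diff_le:
  assumes "1 \<le> p" "w \<in> borel_measurable M" "f \<in> borel_measurable M" "g \<in> borel_measurable M"
    and "wLnorm M p w f \<le> ennreal a" "wLnorm M p w g \<le> ennreal a" "0 \<le> a"
  shows "wLnorm M p w (\<lambda>x. f x - g x) \<le> ennreal (4 * a)"
proof -
  have "wLnorm M p w (\<lambda>x. - 1 * g x) \<le> ennreal (norm (- 1 :: complex) * a)"
    using assms by (intro wLnorm_scale_le)
  then have "wLnorm M p w (\<lambda>x. f x + - 1 * g x) \<le> ennreal (4 * a)"
    using assms by (intro wLnorm_add_le) auto
  then show ?thesis by simp
qed

locale compact_on_admissible = interpolation_scale M p q r w v u \<theta> + T: simple_multilinear M N T
  + LR: weighted_Lspace N r0 u0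
  for M :: "'m::finite \<Rightarrow> 'a measure" and p q r :: "'m \<Rightarrow> ennreal"
    and w v u :: "'m \<Rightarrow> 'a \<Rightarrow> real" and \<theta> :: real
    and N :: "'b measure" and T and r0 :: real and u0 :: "'b \<Rightarrow> real" +
  assumes K: "LR.totbdd {T f | f. \<forall>j. f j \<in> adm j \<and> wLnorm (M j) (r j) (u j) (f j) \<le> ennreal (1 / 2)}"
begin

abbreviation "nrm j \<equiv> wLnorm (M j) (r j) (u j)"
abbreviation "Dom j \<equiv> wLspace (M j) (r j) (u j)"

lemma adm_dom: "f \<in> adm j \<Longrightarrow> f \<in> Dom j"
  using E.admissible_finite E.admissible_meas by (auto simp: wLspace_def)

lemma dom_meas: "f \<in> Dom j \<Longrightarrow> f \<in> borel_measurable (M j)"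
  by (simp add: wLspace_def)

lemma T_meas: "(\<And>j. f j \<in> adm j) \<Longrightarrow> T f \<in> borel_measurable N"
  by (rule T.S_meas) (rule E.admissible_simple)

lemma T_L: assumes f: "\<And>j. f j \<in> adm j" shows "T f \<in> LR.L"
proof -
  have "\<forall>j. \<exists>c>0. nrm j (f j) \<le> ennreal c"
    using wLnorm_finite_bound[OF E.admissible_finite[OF f]] by metis
  then obtain c where c: "\<And>j. 0 < c j" "\<And>j. nrm j (f j) \<le> ennreal (c j)" by metis
  obtain B where B: "0 < B" "\<And>g. g \<in> {T f | f. \<forall>j. f j \<in> adm j \<and> nrm j (f j) \<le> ennreal (1 / 2)} \<Longrightarrow> Lpow N r0 u0 g \<le> ennreal B"
    using LR.totbdd_bounded[OF K] by blast
  have "Lpow N r0 u0 (T f) \<le> ennreal ((\<Prod>j\<in>UNIV. c j / (1 / 2)) powr r0 * B)"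
  proof (rule T.homogeneous_bound[where D = adm])
    show "Lpow N r0 u0 (T f) \<le> ennreal B" if "\<And>j. f j \<in> adm j" "\<And>j. nrm j (f j) \<le> ennreal (1 / 2)" for f
      using that by (intro B(2)) blast
  qed (use B c f LR.s LR.w_meas E.r_ge_1 E.u_meas E.admissible_simple E.admissible_scale in auto)
  then show ?thesis using T_meas[OF f] by (auto simp: LR.L_iff intro: le_less_trans)
qed

text \<open>Totally bounded sets are bounded, so that homogeneity applies.\<close>

lemma T_small:
  assumes "0 < c" "0 < \<epsilon>"
  obtains \<delta> where "0 < \<delta>" "\<And>f i h. (\<And>j. f j \<in> adm j) \<Longrightarrow> (\<And>j. nrm j (f j) \<le> ennreal c) \<Longrightarrow> h \<in> adm i \<Longrightarrow> nrm i h \<le> ennreal \<delta>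
     \<Longrightarrow> Lpow N r0 u0 (T (f(i := h))) \<le> ennreal \<epsilon>"
proof -
  obtain B where B: "0 < B" "\<And>g. g \<in> {T f | f. \<forall>j. f j \<in> adm j \<and> nrm j (f j) \<le> ennreal (1 / 2)} \<Longrightarrow> Lpow N r0 u0 g \<le> ennreal B"
    using LR.totbdd_bounded[OF K] by blast
  define C where "C = (2 * c) ^ (CARD('m) - 1)"
  have C: "0 < C" using assms by (simp add: C_def)
  define \<delta> where "\<delta> = (\<epsilon> / B) powr (1 / r0) / (2 * C)"
  have \<delta>: "0 < \<delta>" using assms B C by (simp add: \<delta>_def)
  show thesis
  proof (rule that[OF \<delta>])
    fix f i h assume f: "\<And>j. f j \<in> adm j" "\<And>j. nrm j (f j) \<le> ennreal c" and h: "h \<in> adm i" "nrm i h \<le> ennreal \<delta>"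
    have "Lpow N r0 u0 (T (f(i := h))) \<le> ennreal ((\<Prod>j\<in>UNIV. ((\<lambda>_. c)(i := \<delta>)) j / (1 / 2)) powr r0 * B)"
    proof (rule T.homogeneous_bound[where D = adm])
      show "Lpow N r0 u0 (T f) \<le> ennreal B" if "\<And>j. f j \<in> adm j" "\<And>j. nrm j (f j) \<le> ennreal (1 / 2)" for f
        using that by (intro B(2)) blast
      show "(f(i := h)) j \<in> adm j" "nrm j ((f(i := h)) j) \<le> ennreal (((\<lambda>_. c)(i := \<delta>)) j)" "0 < ((\<lambda>_. c)(i := \<delta>)) j" for j
        using f h \<delta> assms by auto
    qed (use B LR.s LR.w_meas E.r_ge_1 E.u_meas E.admissible_simple E.admissible_scale in auto)
    also have "(\<Prod>j\<in>UNIV. ((\<lambda>_. c)(i := \<delta>)) j / (1 / 2)) = 2 * \<delta> * C"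
      by (subst prod.remove[of UNIV i]) (auto simp: C_def mult.commute card_Diff_singleton)
    also have "(2 * \<delta> * C) powr r0 * B = \<epsilon>"
      using assms B C LR.s by (simp add: \<delta>_def powr_powr)
    finally show "Lpow N r0 u0 (T (f(i := h))) \<le> ennreal \<epsilon>" .
  qed
qed

text \<open>Passing from \<open>f\<close> to \<open>g\<close> one coordinate at a time; each step is a value of \<open>T\<close> with one small argument.\<close>

lemma T_uniformly_continuous:
  assumes c: "0 < c" and "0 < \<epsilon>"
  obtains \<delta> where "0 < \<delta>" "\<And>f g. (\<And>j. f j \<in> adm j) \<Longrightarrow> (\<And>j. nrm j (f j) \<le> ennreal c) \<Longrightarrow> (\<And>j. g j \<in> adm j)
     \<Longrightarrow> (\<And>j. nrm j (g j) \<le> ennreal c) \<Longrightarrow> (\<And>j. nrm j (\<lambda>x. f j x - g j x) \<le> ennreal \<delta>)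
     \<Longrightarrow> Lpow N r0 u0 (\<lambda>x. T f x - T g x) \<le> ennreal \<epsilon>"
proof -
  have "\<exists>\<delta>>0. \<forall>f g. (\<forall>j. f j \<in> adm j \<and> nrm j (f j) \<le> ennreal c \<and> g j \<in> adm j \<and> nrm j (g j) \<le> ennreal c
      \<and> nrm j (\<lambda>x. f j x - g j x) \<le> ennreal \<delta>) \<longrightarrow> Lpow N r0 u0 (\<lambda>x. T f x - T (\<lambda>j. if j \<in> J then g j else f j) x) \<le> ennreal \<epsilon>"
    if "0 < \<epsilon>" "finite J" for J \<epsilon>
    using that(2,1)
  proof (induction J arbitrary: \<epsilon> rule: finite_induct)
    case empty
    have "Lpow N r0 u0 (\<lambda>x. 0) = 0" using LR.s by (simp add: Lpow_def)
    then show ?case by (intro exI[of _ 1]) simp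
  next
    case (insert i J)
    define \<eta> where "\<eta> = \<epsilon> / (2 powr r0 * 2)"
    have \<eta>: "0 < \<eta>" using insert.prems by (simp add: \<eta>_def)
    obtain \<delta>1 where \<delta>1: "0 < \<delta>1" "\<And>f g. (\<forall>j. f j \<in> adm j \<and> nrm j (f j) \<le> ennreal c \<and> g j \<in> adm j \<and> nrm j (g j) \<le> ennreal c
      \<and> nrm j (\<lambda>x. f j x - g j x) \<le> ennreal \<delta>1) \<Longrightarrow> Lpow N r0 u0 (\<lambda>x. T f x - T (\<lambda>j. if j \<in> J then g j else f j) x) \<le> ennreal \<eta>"
      using insert.IH[OF \<eta>] by blast
    obtain \<delta>2 where \<delta>2: "0 < \<delta>2" "\<And>f i h. (\<And>j. f j \<in> adm j) \<Longrightarrow> (\<And>j. nrm j (f j) \<le> ennreal c) \<Longrightarrow> h \<in> adm i \<Longrightarrow> nrm i h \<le> ennreal \<delta>2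
     \<Longrightarrow> Lpow N r0 u0 (T (f(i := h))) \<le> ennreal \<eta>"
      using T_small[OF c \<eta>] by metis
    show ?case
    proof (intro exI[of _ "min \<delta>1 \<delta>2"] conjI allI impI)
      show "0 < min \<delta>1 \<delta>2" using \<delta>1 \<delta>2 by simp
      fix f g assume fg: "\<forall>j. f j \<in> adm j \<and> nrm j (f j) \<le> ennreal c \<and> g j \<in> adm j \<and> nrm j (g j) \<le> ennreal c
        \<and> nrm j (\<lambda>x. f j x - g j x) \<le> ennreal (min \<delta>1 \<delta>2)"
      have d12: "nrm j (\<lambda>x. f j x - g j x) \<le> ennreal \<delta>1" "nrm j (\<lambda>x. f j x - g j x) \<le> ennreal \<delta>2" for j
      proof -
        have d: "nrm j (\<lambda>x. f j x - g j x) \<le> ennreal (min \<delta>1 \<delta>2)" using fg by blast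
        show "nrm j (\<lambda>x. f j x - g j x) \<le> ennreal \<delta>1" by (rule order_trans[OF d]) (simp add: ennreal_leI)
        show "nrm j (\<lambda>x. f j x - g j x) \<le> ennreal \<delta>2" by (rule order_trans[OF d]) (simp add: ennreal_leI)
      qed
      define h where "h = (\<lambda>j. if j \<in> J then g j else f j)"
      define h' where "h' = (\<lambda>j. if j \<in> insert i J then g j else f j)"
      have hadm: "h j \<in> adm j" "nrm j (h j) \<le> ennreal c" "h' j \<in> adm j" for j using fg by (auto simp: h_def h'_def)
      have 1: "Lpow N r0 u0 (\<lambda>x. T f x - T h x) \<le> ennreal \<eta>"
        unfolding h_def using fg d12 by (intro \<delta>1(2)) blast
      have dadm: "(\<lambda>x. 1 * f i x + - 1 * g i x) \<in> adm i" using fg by (intro E.admissible_lin) auto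
      have hi: "h = h(i := f i)" "h' = h(i := g i)" using insert.hyps by (auto simp: h_def h'_def fun_eq_iff)
      have "AE x in N. T (h(i := (\<lambda>x. 1 * f i x + - 1 * g i x))) x = 1 * T (h(i := f i)) x + - 1 * T (h(i := g i)) x"
        using fg hadm by (intro T.S_lin E.admissible_simple) auto
      then have "AE x in N. T h x - T h' x = T (h(i := (\<lambda>x. 1 * f i x + - 1 * g i x))) x"
        unfolding hi(1)[symmetric] hi(2)[symmetric] by eventually_elim simp
      then have "Lpow N r0 u0 (\<lambda>x. T h x - T h' x) = Lpow N r0 u0 (T (h(i := (\<lambda>x. 1 * f i x + - 1 * g i x))))"
        by (rule Lpow_cong_AE[OF LR.w_meas LR.s])
      also have "\<dots> \<le> ennreal \<eta>" using hadm dadm d12 by (intro \<delta>2(2)) auto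
      finally have 2: "Lpow N r0 u0 (\<lambda>x. T h x - T h' x) \<le> ennreal \<eta>" .
      have m: "T f \<in> borel_measurable N" "T h \<in> borel_measurable N" "T h' \<in> borel_measurable N"
        using fg hadm by (auto intro: T_meas)
      have "Lpow N r0 u0 (\<lambda>x. 1 * (T f x - T h x) + 1 * (T h x - T h' x)) \<le> ennreal (2 powr r0 * (norm (1::complex) powr r0 + norm (1::complex) powr r0) * \<eta>)"
        using 1 2 m \<eta> by (intro LR.Lpow_lin) auto
      then have "Lpow N r0 u0 (\<lambda>x. T f x - T h' x) \<le> ennreal \<epsilon>" by (simp add: \<eta>_def)
      then show "Lpow N r0 u0 (\<lambda>x. T f x - T (\<lambda>j. if j \<in> insert i J then g j else f j) x) \<le> ennreal \<epsilon>"
        unfolding h'_def .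
    qed
  qed
  from this[OF \<open>0 < \<epsilon>\<close> finite[of UNIV]] show thesis using that by auto
qed

lemma totbdd_balls:
  assumes c: "0 < c"
  shows "LR.totbdd {T f | f. \<forall>j. f j \<in> adm j \<and> nrm j (f j) \<le> ennreal c}"
proof -
  let ?S = "{T f | f. \<forall>j. f j \<in> adm j \<and> nrm j (f j) \<le> ennreal (1 / 2)}"
  define \<kappa> :: complex where "\<kappa> = (\<Prod>j\<in>(UNIV::'m set). of_real (2 * c))"
  have "{T f | f. \<forall>j. f j \<in> adm j \<and> nrm j (f j) \<le> ennreal c} \<subseteq> {y \<in> LR.L. \<exists>h\<in>?S. AE x in N. y x = \<kappa> * h x}"
  proof (intro subsetI, elim CollectE exE conjE)
    fix y f assume y: "y = T f" and "\<forall>j. f j \<in> adm j \<and> nrm j (f j) \<le> ennreal c"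
    then have f: "f j \<in> adm j" "nrm j (f j) \<le> ennreal c" for j by auto
    define g where "g j x = of_real (1 / (2 * c)) * f j x" for j x
    have g: "g j \<in> adm j" for j unfolding g_def using f by (intro E.admissible_scale)
    have "nrm j (g j) \<le> ennreal (1 / 2)" for j
    proof -
      have "nrm j (g j) \<le> ennreal (norm (of_real (1 / (2 * c)) :: complex) * c)"
        unfolding g_def using f c E.admissible_meas by (intro wLnorm_scale_le E.r_ge_1 E.u_meas) auto
      then show ?thesis using c by (simp add: norm_divide)
    qed
    then have "T g \<in> ?S" using g by blast
    moreover have "f = (\<lambda>j x. of_real (2 * c) * g j x)" using c by (simp add: g_def fun_eq_iff)
    then have "AE x in N. T f x = \<kappa> * T g x"
      using T.S_scale[of g "\<lambda>_. of_real (2 * c)"] g E.admissible_simple unfolding \<kappa>_def by metis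
    ultimately show "y \<in> {y \<in> LR.L. \<exists>h\<in>?S. AE x in N. y x = \<kappa> * h x}"
      using y T_L[of f] f by blast
  qed
  moreover have "LR.totbdd {y \<in> LR.L. \<exists>h\<in>?S. AE x in N. y x = \<kappa> * h x}" by (rule LR.totbdd_scale[OF K])
  ultimately show ?thesis unfolding LR.totbdd_def by (meson order_trans subsetD)
qed

end

context compact_on_admissible begin

abbreviation "is_core j \<equiv> endpoint_pair.core (M j) (w j) (v j)"

text \<open>The index of the ultrafilter is a tuple of core sets together with an accuracy, ordered by inclusion
  and by increasing accuracy; \<open>H f i\<close> is the value of \<open>T\<close> on approximations chosen at index \<open>i\<close>. These
  approximations are chosen without regard to linearity, so they are additive only up to an error that
  vanishes along the ultrafilter, and \<open>limit_along_unique\<close> absorbs this error. The image of the unit ball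
  lies in the closure of the image of a larger ball of admissible functions, hence is totally bounded.\<close>

theorem compact_extension:
  shows "\<exists>T'. multilinear_op (\<lambda>j. Dom j) N LR.L T' \<and> respects_AE M (\<lambda>j. Dom j) N T' \<and>
     LR.totbdd {T' f | f. \<forall>j. f j \<in> Dom j \<and> nrm j (f j) \<le> 1} \<and>
     (\<forall>f. (\<forall>j. f j \<in> adm j) \<longrightarrow> (AE x in N. T' f x = T f x))"
proof -
  \<comment> \<open>\<open>F\<close> is the filter of tails of the directed set \<open>Ix\<close>.\<close>
  define Ix where "Ix = {(A, n::nat). \<forall>j. is_core j (A j)}"
  define above where "above i = {(B, k). (\<forall>j. fst i j \<subseteq> B j \<and> is_core j (B j)) \<and> snd i \<le> k}" for i :: "('m \<Rightarrow> 'a set) \<times> nat"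
  define F where "F = (INF i\<in>Ix. principal (above i))"
  have "F \<noteq> bot"
    unfolding F_def
  proof (rule INF_filter_not_bot)
    fix X assume X: "X \<subseteq> Ix" "finite X"
    have "\<exists>i. (\<forall>j. is_core j (fst i j)) \<and> i \<in> (\<Inter>k\<in>X. above k)"
      using X(2,1)
    proof (induction X rule: finite_induct)
      case empty
      then show ?case using E.core_empty by (intro exI[of _ "(\<lambda>_. {}, 0)"]) auto
    next
      case (insert k X)
      then obtain i where i: "\<And>j. is_core j (fst i j)" "i \<in> (\<Inter>k\<in>X. above k)" by blast
      have k: "is_core j (fst k j)" for j using insert.prems by (auto simp: Ix_def)
      show ?case
      proof (intro exI[of _ "(\<lambda>j. fst i j \<union> fst k j, max (snd i) (snd k))"] conjI allI)
        show c: "is_core j (fst (\<lambda>j. fst i j \<union> fst k j, max (snd i) (snd k)) j)" for j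
          using E.core_Un i k by simp
        show "(\<lambda>j. fst i j \<union> fst k j, max (snd i) (snd k)) \<in> (\<Inter>k\<in>insert k X. above k)"
          using i(2) c by (fastforce simp: above_def)
      qed
    qed
    then have "(\<Inter>k\<in>X. above k) \<noteq> {}" by blast
    moreover have "(INF i\<in>X. principal (above i)) = principal (\<Inter>k\<in>X. above k)"
      using X(2) by (rule INF_principal_finite)
    ultimately show "(INF i\<in>X. principal (above i)) \<noteq> bot" by (metis principal_eq_bot_iff)
  qed
  then obtain U where UF: "U \<le> F" and U: "U \<noteq> bot" "\<And>P. eventually P U \<or> eventually (\<lambda>i. \<not> P i) U"
    by (rule ultrafilter_extension) blast
  have evI: "eventually P U" if "i \<in> Ix" "\<And>B k. (\<And>j. fst i j \<subseteq> B j) \<Longrightarrow> (\<And>j. is_core j (B j)) \<Longrightarrow> snd i \<le> k \<Longrightarrow> P (B, k)" for P i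
  proof -
    have "U \<le> principal (above i)" using UF that(1) unfolding F_def by (meson INF_lower order_trans)
    then have "eventually (\<lambda>x. x \<in> above i) U" by (simp add: le_principal)
    then show ?thesis by (rule eventually_mono) (use that(2) in \<open>auto simp: above_def\<close>)
  qed
  have small: "\<exists>n0. \<forall>k\<ge>n0. 1 / real (Suc k) \<le> \<delta>" if "0 < \<delta>" for \<delta>
  proof -
    obtain n0 where n0: "1 / real (Suc n0) < \<delta>" using reals_Archimedean[OF \<open>0 < \<delta>\<close>] by (auto simp: inverse_eq_divide)
    have "1 / real (Suc k) \<le> \<delta>" if "k \<ge> n0" for k
    proof -
      have "1 / real (Suc k) \<le> 1 / real (Suc n0)" using that by (simp add: frac_le)
      then show ?thesis using n0 by linarith
    qed
    then show ?thesis by blast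
  qed
  have ev_core: "eventually (\<lambda>i. (\<forall>j. is_core j (fst i j)) \<and> 1 / real (Suc (snd i)) \<le> \<delta>) U" if "0 < \<delta>" for \<delta>
  proof -
    obtain n0 where "\<And>k. k \<ge> n0 \<Longrightarrow> 1 / real (Suc k) \<le> \<delta>" using small[OF \<open>0 < \<delta>\<close>] by blast
    then show ?thesis using E.core_empty by (intro evI[of "(\<lambda>_. {}, n0)"]) (auto simp: Ix_def)
  qed
  \<comment> \<open>An arbitrary choice of approximations, with no relation between those of different functions.\<close>
  define appr where "appr j B k f = (SOME g. g \<in> adm j \<and> nrm j (\<lambda>x. g x - f x * indicator B x) \<le> ennreal (1 / real (Suc k)))" for j B and k :: nat and f
  have ap: "appr j B k f \<in> adm j" "nrm j (\<lambda>x. appr j B k f x - f x * indicator B x) \<le> ennreal (1 / real (Suc k))"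
    if "f \<in> Dom j" "is_core j B" for j B k f
  proof -
    have "\<exists>g. g \<in> adm j \<and> nrm j (\<lambda>x. g x - f x * indicator B x) \<le> ennreal (1 / real (Suc k))"
      using E.approximant[OF that, of "1 / real (Suc k)"] by auto
    from someI_ex[OF this] show "appr j B k f \<in> adm j" "nrm j (\<lambda>x. appr j B k f x - f x * indicator B x) \<le> ennreal (1 / real (Suc k))"
      unfolding appr_def by blast+
  qed
  have ap_meas: "(\<lambda>x. appr j B k f x - f x * indicator B x) \<in> borel_measurable (M j)" if "f \<in> Dom j" "is_core j B" for j B k f
    using E.admissible_meas[OF ap(1)[OF that]] dom_meas[OF that(1)] E.core_sets[OF that(2)] by measurable
  have res_meas: "(\<lambda>x. f x * indicator B x) \<in> borel_measurable (M j)" if "f \<in> Dom j" "is_core j B" for j B f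
    using dom_meas[OF that(1)] E.core_sets[OF that(2)] by measurable
  have ap_bound: "nrm j (appr j B k f) \<le> ennreal (4 * c)"
    if "f \<in> Dom j" "is_core j B" "nrm j f \<le> ennreal c" "1 \<le> c" for j B k f c
  proof -
    have "nrm j (\<lambda>x. (appr j B k f x - f x * indicator B x) + f x * indicator B x) \<le> ennreal (4 * c)"
    proof (rule wLnorm_add_le[OF E.r_ge_1 E.u_meas ap_meas[OF that(1,2)] res_meas[OF that(1,2)]])
      have "1 / real (Suc k) \<le> 1" by (simp add: field_simps)
      then have "1 / real (Suc k) \<le> c" using that(4) by linarith
      then show "nrm j (\<lambda>x. appr j B k f x - f x * indicator B x) \<le> ennreal c"
        using ap(2)[OF that(1,2), of k] by (meson ennreal_leI order_trans)
      show "nrm j (\<lambda>x. f x * indicator B x) \<le> ennreal c"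
        using that by (intro wLnorm_indicator_le E.r_ge_1 E.u_meas dom_meas E.core_sets) auto
    qed (use that in auto)
    then show ?thesis by simp
  qed
  define H where "H f i = T (\<lambda>j. appr j (fst i j) (snd i) (f j))" for f i
  have unif: "\<exists>c\<ge>1. \<forall>j. nrm j (f j) \<le> ennreal c" if "\<And>j. f j \<in> Dom j" for f
  proof -
    have "\<forall>j. \<exists>c>0. nrm j (f j) \<le> ennreal c"
    proof
      fix j
      have "nrm j (f j) < \<infinity>" using that[of j] by (auto simp: wLspace_def)
      from wLnorm_finite_bound[OF this] show "\<exists>c>0. nrm j (f j) \<le> ennreal c" by metis
    qed
    then obtain c where c: "\<And>j. 0 < c j" "\<And>j. nrm j (f j) \<le> ennreal (c j)" by metis
    have "nrm j (f j) \<le> ennreal (1 + (\<Sum>j\<in>UNIV. c j))" for j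
    proof -
      have "c j \<le> (\<Sum>j\<in>UNIV. c j)" using c(1) by (intro member_le_sum) (auto intro: less_imp_le)
      then have "ennreal (c j) \<le> ennreal (1 + (\<Sum>j\<in>UNIV. c j))" by (intro ennreal_leI) simp
      with c(2)[of j] show ?thesis by (rule order_trans)
    qed
    moreover have "1 \<le> 1 + (\<Sum>j\<in>UNIV. c j)" using c(1) by (simp add: sum_nonneg less_imp_le)
    ultimately show ?thesis by blast
  qed
  have in_ball: "eventually (\<lambda>i. H f i \<in> {T f | f. \<forall>j. f j \<in> adm j \<and> nrm j (f j) \<le> ennreal (4 * c)}) U"
    if "\<And>j. f j \<in> Dom j" "\<And>j. nrm j (f j) \<le> ennreal c" "1 \<le> c" for f c
    using ev_core[of 1, simplified]
  proof eventually_elim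
    case (elim i)
    then show ?case unfolding H_def using ap(1)[OF that(1)] ap_bound[OF that(1) _ that(2,3)] by blast
  qed
  have "\<exists>y. LR.limit_along U (H f) y" if f: "\<And>j. f j \<in> Dom j" for f
  proof -
    obtain c where c: "1 \<le> c" "\<And>j. nrm j (f j) \<le> ennreal c" using unif[of f, OF f] by blast
    then have "0 < 4 * c" by simp
    from LR.limit_along_exists[OF totbdd_balls[OF this] U in_ball[OF f c(2,1)]] show ?thesis by blast
  qed
  define T' where "T' f = (SOME y. LR.limit_along U (H f) y)" for f
  have T': "LR.limit_along U (H f) (T' f)" if "\<And>j. f j \<in> Dom j" for f
    unfolding T'_def using \<open>\<And>f. (\<And>j. f j \<in> Dom j) \<Longrightarrow> \<exists>y. LR.limit_along U (H f) y\<close>[OF that] by (rule someI_ex)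
  have T'_L: "T' f \<in> LR.L" if "\<And>j. f j \<in> Dom j" for f
    using T'[OF that] by (simp add: LR.limit_along_def)
  have dom_lin: "(\<lambda>y. a * g y + b * h y) \<in> Dom j" if "g \<in> Dom j" "h \<in> Dom j" for g h a b j
    using that wLnorm_lin_finite[OF E.r_ge_1 E.u_meas dom_meas[OF that(1)] dom_meas[OF that(2)]]
    by (auto simp: wLspace_def)
  have lin: "AE x in N. T' (f(j := (\<lambda>y. a * g y + b * h y))) x = a * T' (f(j := g)) x + b * T' (f(j := h)) x"
    if f: "\<And>i. f i \<in> Dom i" and g: "g \<in> Dom j" and h: "h \<in> Dom j" for f j g h a b
  proof -
    define k where "k = (\<lambda>y. a * g y + b * h y)"
    have k: "k \<in> Dom j" unfolding k_def by (rule dom_lin[OF g h])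
    have upd: "(f(j := z)) i \<in> Dom i" if "z \<in> Dom j" for z i using f that by simp
    show ?thesis
      unfolding k_def[symmetric]
    proof (rule LR.limit_along_unique[OF U(1) T'[OF upd[OF k]] LR.limit_along_lin[OF T'[OF upd[OF g]] T'[OF upd[OF h]]]])
      fix \<epsilon> :: real assume \<epsilon>: "0 < \<epsilon>"
      obtain c where c: "1 \<le> c" "\<And>j. nrm j (f j) \<le> ennreal c" using unif[of f, OF f] by blast
      then have "0 < 4 * c" by simp
      then obtain \<delta> where \<delta>: "0 < \<delta>" "\<And>f i h. (\<And>j. f j \<in> adm j) \<Longrightarrow> (\<And>j. nrm j (f j) \<le> ennreal (4 * c)) \<Longrightarrow> h \<in> adm i \<Longrightarrow> nrm i h \<le> ennreal \<delta>
         \<Longrightarrow> Lpow N r0 u0 (T (f(i := h))) \<le> ennreal \<epsilon>"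
        using T_small[OF _ \<epsilon>] by metis
      \<comment> \<open>The factor 16 comes from two applications of \<open>wLnorm_add_le\<close>.\<close>
      define D where "D = 16 * (1 + norm a + norm b)"
      have D: "0 < D" by (simp add: D_def add_pos_nonneg)
      have "0 < \<delta> / D" using \<delta> D by simp
      from ev_core[OF this]
      show "eventually (\<lambda>i. Lpow N r0 u0 (\<lambda>x. H (f(j := k)) i x - (a * H (f(j := g)) i x + b * H (f(j := h)) i x)) \<le> ennreal \<epsilon>) U"
      proof eventually_elim
        case (elim i)
        define B where "B = fst i j"
        define n where "n = snd i"
        have cB: "is_core j B" using elim by (simp add: B_def)
        define t where "t = 1 / real (Suc n)"
        have t: "0 < t" "t \<le> \<delta> / D" using elim by (auto simp: t_def n_def)
        define G where "G = (\<lambda>l. appr l (fst i l) (snd i) (f l))"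
        have G: "G l \<in> adm l" "nrm l (G l) \<le> ennreal (4 * c)" for l
          unfolding G_def using ap(1)[OF f] ap_bound[OF f _ c(2,1)] elim by auto
        have Hu: "H (f(j := z)) i = T (G(j := appr j B n z))" for z
          unfolding H_def G_def B_def n_def by (rule arg_cong[where f = T]) auto
        define e where "e = (\<lambda>x. 1 * appr j B n k x + - 1 * (a * appr j B n g x + b * appr j B n h x))"
        have lin_adm: "(\<lambda>x. a * appr j B n g x + b * appr j B n h x) \<in> adm j"
          by (intro E.admissible_lin ap(1) g h cB)
        have e: "e \<in> adm j" unfolding e_def by (rule E.admissible_lin[OF ap(1)[OF k cB] lin_adm])
        have split: "e = (\<lambda>x. (appr j B n k x - k x * indicator B x) +
            ((- a) * (appr j B n g x - g x * indicator B x) + (- b) * (appr j B n h x - h x * indicator B x)))"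
          by (simp add: e_def k_def algebra_simps fun_eq_iff)
        define m where "m = t * (1 + norm a + norm b)"
        have m0: "0 \<le> m" using t by (simp add: m_def)
        have 1: "nrm j (\<lambda>x. (- a) * (appr j B n g x - g x * indicator B x)) \<le> ennreal m"
        proof (rule order_trans[OF wLnorm_scale_le[OF E.r_ge_1 E.u_meas ap_meas[OF g cB] ap(2)[OF g cB]]])
          show "ennreal (norm (- a) * (1 / real (Suc n))) \<le> ennreal m"
            using t(1) by (intro ennreal_leI) (simp only: t_def[symmetric] m_def, simp add: algebra_simps)
        qed simp
        have 2: "nrm j (\<lambda>x. (- b) * (appr j B n h x - h x * indicator B x)) \<le> ennreal m"
        proof (rule order_trans[OF wLnorm_scale_le[OF E.r_ge_1 E.u_meas ap_meas[OF h cB] ap(2)[OF h cB]]])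
          show "ennreal (norm (- b) * (1 / real (Suc n))) \<le> ennreal m"
            using t(1) by (intro ennreal_leI) (simp only: t_def[symmetric] m_def, simp add: algebra_simps)
        qed simp
        have 3: "nrm j (\<lambda>x. (- a) * (appr j B n g x - g x * indicator B x) + (- b) * (appr j B n h x - h x * indicator B x)) \<le> ennreal (4 * m)"
          by (rule wLnorm_add_le[OF E.r_ge_1 E.u_meas _ _ 1 2 m0])
            (use ap_meas[OF g cB] ap_meas[OF h cB] in measurable)
        have 4: "nrm j (\<lambda>x. appr j B n k x - k x * indicator B x) \<le> ennreal (4 * m)"
        proof (rule order_trans[OF ap(2)[OF k cB]])
          have "t \<le> m" unfolding m_def using t by (simp add: algebra_simps)
          then show "ennreal (1 / real (Suc n)) \<le> ennreal (4 * m)"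
            using m0 unfolding t_def[symmetric] by (intro ennreal_leI) linarith
        qed
        have "nrm j e \<le> ennreal (4 * (4 * m))"
          unfolding split
          by (rule wLnorm_add_le[OF E.r_ge_1 E.u_meas _ _ 4 3])
            (use ap_meas[OF g cB] ap_meas[OF h cB] ap_meas[OF k cB] m0 in auto)
        also have "4 * (4 * m) = D * t" by (simp add: m_def D_def)
        also have "ennreal (D * t) \<le> ennreal \<delta>" using t D by (intro ennreal_leI) (simp add: field_simps)
        finally have e\<delta>: "nrm j e \<le> ennreal \<delta>" .
        have Gs: "G l \<in> simple_functions (M l)" for l using G(1) by (rule E.admissible_simple)
        have "AE x in N. T (G(j := e)) x = 1 * T (G(j := appr j B n k)) x + - 1 * T (G(j := (\<lambda>x. a * appr j B n g x + b * appr j B n h x))) x"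
          unfolding e_def by (rule T.S_lin[OF Gs E.admissible_simple[OF ap(1)[OF k cB]] E.admissible_simple[OF lin_adm]])
        moreover have "AE x in N. T (G(j := (\<lambda>x. a * appr j B n g x + b * appr j B n h x))) x = a * T (G(j := appr j B n g)) x + b * T (G(j := appr j B n h)) x"
          by (rule T.S_lin[OF Gs E.admissible_simple[OF ap(1)[OF g cB]] E.admissible_simple[OF ap(1)[OF h cB]]])
        ultimately have "AE x in N. H (f(j := k)) i x - (a * H (f(j := g)) i x + b * H (f(j := h)) i x) = T (G(j := e)) x"
          unfolding Hu by eventually_elim simp
        then have "Lpow N r0 u0 (\<lambda>x. H (f(j := k)) i x - (a * H (f(j := g)) i x + b * H (f(j := h)) i x)) = Lpow N r0 u0 (T (G(j := e)))"
          by (rule Lpow_cong_AE[OF LR.w_meas LR.s])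
        also have "\<dots> \<le> ennreal \<epsilon>" by (rule \<delta>(2)[OF G e e\<delta>])
        finally show ?case .
      qed
    qed
  qed
  have respects: "AE x in N. T' f x = T' g x"
    if f: "\<And>j. f j \<in> Dom j" and g: "\<And>j. g j \<in> Dom j" and fg: "\<And>j. AE x in M j. f j x = g j x" for f g
  proof (rule LR.limit_along_unique[OF U(1) T'[OF f] T'[OF g]])
    fix \<epsilon> :: real assume \<epsilon>: "0 < \<epsilon>"
    obtain c1 where c1: "1 \<le> c1" "\<And>j. nrm j (f j) \<le> ennreal c1" using unif[of f, OF f] by blast
    obtain c2 where c2: "1 \<le> c2" "\<And>j. nrm j (g j) \<le> ennreal c2" using unif[of g, OF g] by blast
    define c where "c = max c1 c2"
    have c: "1 \<le> c" "\<And>j. nrm j (f j) \<le> ennreal c" "\<And>j. nrm j (g j) \<le> ennreal c"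
    proof -
      show "1 \<le> c" using c1(1) by (simp add: c_def)
      show "nrm j (f j) \<le> ennreal c" for j by (rule order_trans[OF c1(2)]) (simp add: c_def ennreal_leI)
      show "nrm j (g j) \<le> ennreal c" for j by (rule order_trans[OF c2(2)]) (simp add: c_def ennreal_leI)
    qed
    then have c4: "0 < 4 * c" by simp
    obtain \<delta> where \<delta>: "0 < \<delta>" "\<And>f g. (\<And>j. f j \<in> adm j) \<Longrightarrow> (\<And>j. nrm j (f j) \<le> ennreal (4 * c)) \<Longrightarrow> (\<And>j. g j \<in> adm j)
     \<Longrightarrow> (\<And>j. nrm j (g j) \<le> ennreal (4 * c)) \<Longrightarrow> (\<And>j. nrm j (\<lambda>x. f j x - g j x) \<le> ennreal \<delta>)
     \<Longrightarrow> Lpow N r0 u0 (\<lambda>x. T f x - T g x) \<le> ennreal \<epsilon>"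
      by (rule T_uniformly_continuous[OF c4 \<epsilon>]) blast
    have "0 < \<delta> / 4" using \<delta> by simp
    from ev_core[OF this] show "eventually (\<lambda>i. Lpow N r0 u0 (\<lambda>x. H f i x - H g i x) \<le> ennreal \<epsilon>) U"
    proof eventually_elim
      case (elim i)
      show ?case unfolding H_def
      proof (rule \<delta>(2))
        fix j
        let ?B = "fst i j" and ?n = "snd i"
        have B: "is_core j ?B" using elim by blast
        show "appr j ?B ?n (f j) \<in> adm j" "appr j ?B ?n (g j) \<in> adm j" using ap(1) f g B by auto
        show "nrm j (appr j ?B ?n (f j)) \<le> ennreal (4 * c)" "nrm j (appr j ?B ?n (g j)) \<le> ennreal (4 * c)"
          using ap_bound f g B c by auto
        have a: "nrm j (\<lambda>x. appr j ?B ?n (f j) x - f j x * indicator ?B x) \<le> ennreal (\<delta> / 4)"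
          "nrm j (\<lambda>x. appr j ?B ?n (g j) x - g j x * indicator ?B x) \<le> ennreal (\<delta> / 4)"
          using ap(2)[OF f B] ap(2)[OF g B] elim by (meson ennreal_leI order_trans)+
        have "nrm j (\<lambda>x. (appr j ?B ?n (f j) x - f j x * indicator ?B x) - (appr j ?B ?n (g j) x - g j x * indicator ?B x)) \<le> ennreal (4 * (\<delta> / 4))"
          using \<delta> by (intro wLnorm_diff_le[OF E.r_ge_1 E.u_meas ap_meas[OF f B] ap_meas[OF g B] a]) simp
        moreover have "nrm j (\<lambda>x. appr j ?B ?n (f j) x - appr j ?B ?n (g j) x) =
            nrm j (\<lambda>x. (appr j ?B ?n (f j) x - f j x * indicator ?B x) - (appr j ?B ?n (g j) x - g j x * indicator ?B x))"
        proof (rule wLnorm_cong_AE[OF E.r_ge_1 E.u_meas])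
          show "(\<lambda>x. appr j ?B ?n (f j) x - appr j ?B ?n (g j) x) \<in> borel_measurable (M j)"
            using E.admissible_meas[OF ap(1)[OF f B]] E.admissible_meas[OF ap(1)[OF g B]] by measurable
          show "(\<lambda>x. (appr j ?B ?n (f j) x - f j x * indicator ?B x) - (appr j ?B ?n (g j) x - g j x * indicator ?B x)) \<in> borel_measurable (M j)"
            using ap_meas[OF f B] ap_meas[OF g B] by measurable
          show "AE x in M j. appr j ?B ?n (f j) x - appr j ?B ?n (g j) x =
            (appr j ?B ?n (f j) x - f j x * indicator ?B x) - (appr j ?B ?n (g j) x - g j x * indicator ?B x)"
            using fg[of j] by eventually_elim simp
        qed
        ultimately show "nrm j (\<lambda>x. appr j ?B ?n (f j) x - appr j ?B ?n (g j) x) \<le> ennreal \<delta>" by simp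
      qed
    qed
  qed
  have extends: "AE x in N. T' f x = T f x" if f: "\<And>j. f j \<in> adm j" for f
  proof (rule LR.limit_along_unique[OF U(1) T'[OF adm_dom[OF f]]])
    show "LR.limit_along U (\<lambda>_. T f) (T f)"
      unfolding LR.limit_along_def using T_L[OF f] LR.s by (auto simp: Lpow_def)
    fix \<epsilon> :: real assume \<epsilon>: "0 < \<epsilon>"
    obtain c where c: "1 \<le> c" "\<And>j. nrm j (f j) \<le> ennreal c" using unif[of f, OF adm_dom[OF f]] by blast
    then have c4: "0 < 4 * c" by simp
    obtain \<delta> where \<delta>: "0 < \<delta>" "\<And>f g. (\<And>j. f j \<in> adm j) \<Longrightarrow> (\<And>j. nrm j (f j) \<le> ennreal (4 * c)) \<Longrightarrow> (\<And>j. g j \<in> adm j)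
     \<Longrightarrow> (\<And>j. nrm j (g j) \<le> ennreal (4 * c)) \<Longrightarrow> (\<And>j. nrm j (\<lambda>x. f j x - g j x) \<le> ennreal \<delta>)
     \<Longrightarrow> Lpow N r0 u0 (\<lambda>x. T f x - T g x) \<le> ennreal \<epsilon>"
      by (rule T_uniformly_continuous[OF c4 \<epsilon>]) blast
    have \<delta>4: "0 < \<delta> / 4" using \<delta> by simp
    have "\<forall>j. \<exists>A. is_core j A \<and> (\<forall>B. A \<subseteq> B \<longrightarrow> B \<in> sets (M j) \<longrightarrow> nrm j (\<lambda>x. f j x * indicator B x - f j x) \<le> ennreal (\<delta> / 4))"
      using E.core_exhausts[OF f \<delta>4] by metis
    then obtain A where A: "\<And>j. is_core j (A j)" "\<And>j B. A j \<subseteq> B \<Longrightarrow> B \<in> sets (M j) \<Longrightarrow> nrm j (\<lambda>x. f j x * indicator B x - f j x) \<le> ennreal (\<delta> / 4)"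
      by metis
    obtain n0 where n0: "\<And>k. k \<ge> n0 \<Longrightarrow> 1 / real (Suc k) \<le> \<delta> / 4" using small[OF \<delta>4] by blast
    show "eventually (\<lambda>i. Lpow N r0 u0 (\<lambda>x. H f i x - T f x) \<le> ennreal \<epsilon>) U"
    proof (rule evI[of "(A, n0)"])
      show "(A, n0) \<in> Ix" using A by (simp add: Ix_def)
      fix B k assume B: "\<And>j. fst (A, n0) j \<subseteq> B j" "\<And>j. is_core j (B j)" and k: "snd (A, n0) \<le> k"
      show "Lpow N r0 u0 (\<lambda>x. H f (B, k) x - T f x) \<le> ennreal \<epsilon>"
        unfolding H_def
      proof (rule \<delta>(2))
        fix j
        note fd = adm_dom[OF f, of j]
        have Bs: "B j \<in> sets (M j)" using B(2) by (rule E.core_sets)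
        show "appr j (fst (B, k) j) (snd (B, k)) (f j) \<in> adm j" using ap(1)[OF fd B(2)] by simp
        show "nrm j (appr j (fst (B, k) j) (snd (B, k)) (f j)) \<le> ennreal (4 * c)" using ap_bound[OF fd B(2) c(2,1)] by simp
        show "f j \<in> adm j" by (rule f)
        have "ennreal c \<le> ennreal (4 * c)" using c by (intro ennreal_leI) simp
        with c(2)[of j] show "nrm j (f j) \<le> ennreal (4 * c)" by (rule order_trans)
        have 1: "nrm j (\<lambda>x. appr j (B j) k (f j) x - f j x * indicator (B j) x) \<le> ennreal (\<delta> / 4)"
        proof (rule order_trans[OF ap(2)[OF fd B(2)]])
          show "ennreal (1 / real (Suc k)) \<le> ennreal (\<delta> / 4)" using n0[of k] k by (intro ennreal_leI) simp
        qed
        have 2: "nrm j (\<lambda>x. f j x * indicator (B j) x - f j x) \<le> ennreal (\<delta> / 4)"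
          using B(1)[of j] Bs by (intro A(2)) auto
        have "nrm j (\<lambda>x. (appr j (B j) k (f j) x - f j x * indicator (B j) x) + (f j x * indicator (B j) x - f j x)) \<le> ennreal (4 * (\<delta> / 4))"
          using \<delta>4 res_meas[OF fd B(2)] dom_meas[OF fd]
          by (intro wLnorm_add_le[OF E.r_ge_1 E.u_meas ap_meas[OF fd B(2)] _ 1 2]) auto
        then show "nrm j (\<lambda>x. appr j (fst (B, k) j) (snd (B, k)) (f j) x - f j x) \<le> ennreal \<delta>" by simp
      qed
    qed
  qed
  have "LR.totbdd {T' f | f. \<forall>j. f j \<in> Dom j \<and> nrm j (f j) \<le> 1}"
  proof (rule LR.totbdd_thicken[OF totbdd_balls[of "4 * 1"]])
    show "{T' f | f. \<forall>j. f j \<in> Dom j \<and> nrm j (f j) \<le> 1} \<subseteq> LR.L" using T'_L by blast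
    fix y and \<epsilon> :: real assume "y \<in> {T' f | f. \<forall>j. f j \<in> Dom j \<and> nrm j (f j) \<le> 1}" and \<epsilon>: "0 < \<epsilon>"
    then obtain f where y: "y = T' f" and f: "\<And>j. f j \<in> Dom j" "\<And>j. nrm j (f j) \<le> ennreal 1" by auto
    have "eventually (\<lambda>i. H f i \<in> LR.L \<and> Lpow N r0 u0 (\<lambda>x. H f i x - y x) \<le> ennreal (\<epsilon> / 2)) U"
      using T'[OF f(1)] \<epsilon> unfolding y LR.limit_along_def by simp
    with in_ball[OF f order_refl]
    have "eventually (\<lambda>i. H f i \<in> {T f | f. \<forall>j. f j \<in> adm j \<and> nrm j (f j) \<le> ennreal (4 * 1)} \<and>
       H f i \<in> LR.L \<and> Lpow N r0 u0 (\<lambda>x. H f i x - y x) \<le> ennreal (\<epsilon> / 2)) U"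
      by (rule eventually_conj)
    from eventually_happens'[OF U(1) this] obtain i where i: "H f i \<in> {T f | f. \<forall>j. f j \<in> adm j \<and> nrm j (f j) \<le> ennreal (4 * 1)}"
      "H f i \<in> LR.L" "Lpow N r0 u0 (\<lambda>x. H f i x - y x) \<le> ennreal (\<epsilon> / 2)" by blast
    have yL: "y \<in> LR.L" unfolding y by (rule T'_L[OF f(1)])
    have "Ldist N r0 u0 y (H f i) \<le> \<epsilon> / 2"
      using i(3) \<epsilon> LR.Lpow_le_iff_Ldist[OF _ i(2) yL, of "\<epsilon> / 2"] LR.d_sym[OF yL i(2)] by simp
    then have "Ldist N r0 u0 y (H f i) < \<epsilon>" using \<epsilon> by simp
    with i(1) show "\<exists>z\<in>{T f | f. \<forall>j. f j \<in> adm j \<and> nrm j (f j) \<le> ennreal (4 * 1)}. Ldist N r0 u0 y z < \<epsilon>" by blast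
  qed simp
  moreover have "multilinear_op (\<lambda>j. Dom j) N LR.L T'"
    unfolding multilinear_op_def using T'_L lin by blast
  moreover have "respects_AE M (\<lambda>j. Dom j) N T'"
    unfolding respects_AE_def using respects by blast
  ultimately show ?thesis using extends by blast
qed

end

section \<open>Interpolation of compact multilinear operators\<close>

lemma sigma_finite_lebesgue: "sigma_finite_measure (lebesgue :: 'a::euclidean_space measure)"
proof
  let ?A = "range (\<lambda>n::nat. cball 0 (real n)) :: 'a set set"
  have "\<exists>n::nat. norm x \<le> real n" for x :: 'a by (rule real_arch_simple)
  then have "\<Union>?A = space lebesgue" by auto
  moreover have "emeasure lebesgue (cball 0 (real n) :: 'a set) \<noteq> \<infinity>" for n
    using fmeasurableD2[OF lmeasurable_cball] by simp
  ultimately show "\<exists>A :: 'a set set. countable A \<and> A \<subseteq> sets lebesgue \<and> \<Union>A = space lebesgue \<and> (\<forall>a\<in>A. emeasure lebesgue a \<noteq> \<infinity>)"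
    by (intro exI[of _ ?A]) auto
qed

text \<open>Compactness and total boundedness agree in the complete target spaces, and the two intermediate results
  combine. The ball of radius \<open>1 / 2\<close>, which comes from the factor 2 lost in \<open>branch_endpoint\<close>, determines all
  other balls by homogeneity.\<close>

theorem theorem3p6:
  fixes M :: "'m::finite \<Rightarrow> 'a measure"
    and T :: "('m \<Rightarrow> 'a \<Rightarrow> complex) \<Rightarrow> real ^ 'n \<Rightarrow> complex"
    and p0 q0 r0 \<theta> :: real
    and p q r :: "'m \<Rightarrow> ennreal"
    and w0 v0 u0 :: "real ^ 'n \<Rightarrow> real"
    and w v u :: "'m \<Rightarrow> 'a \<Rightarrow> real"
  assumes T: "multilinear_op (\<lambda>j. simple_functions (M j)) lebesgue (borel_measurable lebesgue) T"
    and p0: "0 < p0" and q0: "0 < q0"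
    and p: "\<And>j. 1 \<le> p j" and q: "\<And>j. 1 \<le> q j"
    and w0: "weight lebesgue w0" "(\<lambda>x. w0 x powr p0) \<in> Muckenhoupt_infinity"
    and v0: "weight lebesgue v0" "(\<lambda>x. v0 x powr q0) \<in> Muckenhoupt_infinity"
    and w: "\<And>j. weight (M j) (w j)" and v: "\<And>j. weight (M j) (v j)"
    and bounded: "bounded_op (\<lambda>j. simple_functions (M j)) M p w lebesgue (ennreal p0) w0 T"
    and compact: "compact_op (\<lambda>j. simple_functions (M j)) M q v lebesgue (ennreal q0) v0 T"
    and \<theta>: "0 < \<theta>" "\<theta> < 1"
    and r0: "1 / r0 = (1 - \<theta>) / p0 + \<theta> / q0"
    and r: "\<And>j. 1 / r j = ennreal (1 - \<theta>) / p j + ennreal \<theta> / q j"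
    and u0: "\<And>x. u0 x = w0 x powr (1 - \<theta>) * v0 x powr \<theta>"
    and u: "\<And>j x. x \<in> space (M j) \<Longrightarrow> u j x = w j x powr (1 - \<theta>) * v j x powr \<theta>"
  shows "\<exists>T'. multilinear_op (\<lambda>j. wLspace (M j) (r j) (u j)) lebesgue
                (wLspace lebesgue (ennreal r0) u0) T' \<and>
              respects_AE M (\<lambda>j. wLspace (M j) (r j) (u j)) lebesgue T' \<and>
              compact_op (\<lambda>j. wLspace (M j) (r j) (u j)) M r u lebesgue (ennreal r0) u0 T' \<and>
              (\<forall>f. (\<forall>j. f j \<in> simple_functions (M j) \<and>
                        wLnorm (M j) (p j) (w j) (f j) < \<infinity> \<and>
                        wLnorm (M j) (q j) (v j) (f j) < \<infinity>) \<longrightarrow>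
                   (AE x in lebesgue. T' f x = T f x))"
proof -
  interpret IS: interpolation_scale M p q r w v u \<theta>
    using p q \<theta> r w v u by unfold_locales auto
  have N: "target_pair (lebesgue :: (real ^ 'n) measure) p0 q0 r0 w0 v0 u0 \<theta>"
    unfolding target_pair_def target_pair_axioms_def
  proof (intro conjI sigma_finite_lebesgue p0 q0 \<theta> r0 w0(1) v0(1))
    have "w0 \<in> borel_measurable lebesgue" "v0 \<in> borel_measurable lebesgue" using w0 v0 by (auto simp: weight_def)
    then have "(\<lambda>x. w0 x powr (1 - \<theta>) * v0 x powr \<theta>) \<in> borel_measurable lebesgue" by measurable
    moreover have "u0 = (\<lambda>x. w0 x powr (1 - \<theta>) * v0 x powr \<theta>)" using u0 by (intro ext)
    ultimately show "u0 \<in> borel_measurable lebesgue" by simp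
    show "AE x in lebesgue. u0 x = w0 x powr (1 - \<theta>) * v0 x powr \<theta>" using u0 by simp
  qed
  interpret N: target_pair "lebesgue :: (real ^ 'n) measure" p0 q0 r0 w0 v0 u0 \<theta> by (rule N)
  have S: "simple_multilinear M lebesgue T" using T by unfold_locales
  interpret LQ: weighted_Lspace "lebesgue :: (real ^ 'n) measure" q0 v0 using v0 q0 by unfold_locales
  interpret LR: weighted_Lspace "lebesgue :: (real ^ 'n) measure" r0 u0 using N.u0_weight N.r0_pos by unfold_locales
  obtain C where C: "\<And>f. (\<forall>j. f j \<in> simple_functions (M j) \<and> wLnorm (M j) (p j) (w j) (f j) < \<infinity>) \<Longrightarrow>
      wLnorm lebesgue (ennreal p0) w0 (T f) \<le> ennreal C * (\<Prod>j\<in>UNIV. wLnorm (M j) (p j) (w j) (f j))"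
    using bounded unfolding bounded_op_def by blast
  define A0 where "A0 = max C 1 powr p0"
  have A0: "0 < A0" by (simp add: A0_def)
  have b0: "ball_bounded M p w lebesgue p0 w0 T A0"
  proof (rule ball_boundedI)
    fix f assume f: "\<And>j. f j \<in> simple_functions (M j)" "\<And>j. wLnorm (M j) (p j) (w j) (f j) \<le> ennreal 1"
    have "wLnorm (M j) (p j) (w j) (f j) < \<infinity>" for j using f(2)[of j] by (rule le_less_trans) simp
    then have "wLnorm lebesgue (ennreal p0) w0 (T f) \<le> ennreal C * (\<Prod>j\<in>UNIV. wLnorm (M j) (p j) (w j) (f j))"
      using f(1) by (intro C) auto
    also have "\<dots> \<le> ennreal C * 1"
      using f(2) by (intro mult_left_mono prod_le_1) auto
    also have "\<dots> \<le> ennreal (max C 1)" by (simp add: ennreal_leI)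
    finally show "Lpow lebesgue p0 w0 (T f) \<le> ennreal A0"
      using p0 by (subst (asm) wLnorm_le_iff_Lpow) (auto simp: A0_def)
  qed
  have K: "LQ.totbdd {T f | f. \<forall>j. f j \<in> simple_functions (M j) \<and> wLnorm (M j) (q j) (v j) (f j) \<le> ennreal 1}"
    using compact unfolding compact_op_def LQ.relatively_compact_iff_totbdd by simp
  have KR: "LR.totbdd {T f | f. \<forall>j. f j \<in> IS.adm j \<and> wLnorm (M j) (r j) (u j) (f j) \<le> ennreal (1 / 2)}"
    by (rule IS.compact_interpolation[OF N S A0 b0 K])
  interpret CA: compact_on_admissible M p q r w v u \<theta> "lebesgue :: (real ^ 'n) measure" T r0 u0
    using S KR by (intro compact_on_admissible.intro compact_on_admissible_axioms.intro IS.interpolation_scale_axioms LR.weighted_Lspace_axioms)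
  from CA.compact_extension show ?thesis
    unfolding compact_op_def LR.relatively_compact_iff_totbdd IS.E.admissible_def
    by (elim ex_forward) auto
qed

end
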